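(* Let $H\in(0,1)$, let $\alpha>0$ with $\alpha>1-\frac1{2H}$, and let $b\in\mathscr C^\alpha(\mathbb R^d;\mathbb R^d)$. Then for any $x_0\in\mathbb R^d$ there exists a measurable set $\mathcal N_{b,x_0}\subseteq C([0,1];\mathbb R^d)$ which has zero measure with respect to the law of the $d$-dimensional fractional Brownian motion of Hurst index $H$ and such that for all $w\notin\mathcal N_{b,x_0}$ there exists a unique continuous solution $x\in C([0,1];\mathbb R^d)$ of $$x_t=x_0+\int_0^tb(x_s)\,ds+w_t,\qquad t\in[0,1].$$
   Context: $\mathscr C^\alpha=B^\alpha_{\infty,\infty}(\mathbb R^d;\mathbb R^d)$ is the Besov–Hölder space; for $\alpha>0$ its elements are bounded continuous functions (for non-integer $\alpha$: bounded functions with bounded derivatives up to order $\lfloor\alpha\rfloor$, those of order $\lfloor\alpha\rfloor$ being $(\alpha-\lfloor\alpha\rfloor)$-Hölder). Fractional Brownian motion of Hurst index $H\in(0,1)$ in $\mathbb R^d$: the centered continuous Gaussian process with i.i.d. components, each with covariance proportional (by a positive constant) to $t^{2H}+s^{2H}-|t-s|^{2H}$. Uniqueness is path-by-path: for the fixed $w$, in the class of all continuous paths. *)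

theory Defs
  imports "HOL-Probability.Probability"
begin

section \<open>The Besov--Hoelder space\<close>

text \<open>The space $B^\alpha_{\infty,\infty}$ is defined by Littlewood--Paley blocks. A smooth profile
  \<open>\<rho>\<close> on the real line gives the radial cutoff $\chi(\xi) = \rho(|\xi|)$ and the radial symbol
  $\varphi(\xi) = \rho(|\xi|/2) - \rho(|\xi|)$, so that \<open>\<chi>\<close> is supported in the ball of radius
  $4/3$, \<open>\<phi>\<close> is supported in the annulus $3/4 \le |\xi| \le 8/3$ and
  $\chi + \sum_{j\ge 0} \varphi(2^{-j}\cdot) = 1$. As \<open>\<rho>\<close> is constant near \<open>0\<close>, both are smooth.\<close>

definition lp_profile :: "(real \<Rightarrow> real) \<Rightarrow> bool" where
  "lp_profile \<rho> \<longleftrightarrow>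
     (\<forall>n x. (deriv ^^ n) \<rho> field_differentiable at x) \<and>
     (\<forall>r. 0 \<le> \<rho> r \<and> \<rho> r \<le> 1) \<and>
     (\<forall>r\<le>3/4. \<rho> r = 1) \<and>
     (\<forall>r\<ge>4/3. \<rho> r = 0)"

text \<open>The index is shifted by one: \<open>lp_symbol \<rho> 0\<close> is \<open>\<chi>\<close>, the symbol of the block usually
  numbered $-1$, and \<open>lp_symbol \<rho> (Suc j)\<close> is $\varphi(2^{-j}\cdot)$.\<close>

fun lp_symbol :: "(real \<Rightarrow> real) \<Rightarrow> nat \<Rightarrow> 'a::euclidean_space \<Rightarrow> real" where
  "lp_symbol \<rho> 0 \<xi> = \<rho> (norm \<xi>)"
| "lp_symbol \<rho> (Suc j) \<xi> = \<rho> (norm \<xi> / 2 ^ Suc j) - \<rho> (norm \<xi> / 2 ^ j)"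

lemma lp_symbol_partition:
  "(\<Sum>j\<le>N. lp_symbol \<rho> j \<xi>) = \<rho> (norm \<xi> / 2 ^ N)"
  by (induction N) simp_all

definition inverse_fourier :: "('a::euclidean_space \<Rightarrow> complex) \<Rightarrow> 'a \<Rightarrow> complex" where
  "inverse_fourier f x =
     (1 / (2 * pi) ^ DIM('a)) *\<^sub>R (LINT \<xi>|lborel. cis (x \<bullet> \<xi>) * f \<xi>)"

text \<open>The symbols are real and even, so the inverse transform below is real-valued and taking the
  real part loses nothing.\<close>

definition lp_kernel :: "(real \<Rightarrow> real) \<Rightarrow> nat \<Rightarrow> 'a::euclidean_space \<Rightarrow> real" where
  "lp_kernel \<rho> j x = Re (inverse_fourier (\<lambda>\<xi>. complex_of_real (lp_symbol \<rho> j \<xi>)) x)"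

definition lp_block ::
  "(real \<Rightarrow> real) \<Rightarrow> nat \<Rightarrow> ('a::euclidean_space \<Rightarrow> 'b::euclidean_space) \<Rightarrow> 'a \<Rightarrow> 'b" where
  "lp_block \<rho> j f x = (LINT y|lborel. lp_kernel \<rho> j (x - y) *\<^sub>R f y)"

text \<open>For positive \<open>\<alpha>\<close> every element of the space is represented by a unique bounded continuous
  function, and membership is stated for this representative. The exponent \<open>real j - 1\<close> undoes the
  index shift. Different profiles give the same space, with equivalent norms. The definition is
  meant for positive \<open>\<alpha>\<close> only.\<close>

definition besov_holder ::
  "real \<Rightarrow> ('a::euclidean_space \<Rightarrow> 'b::euclidean_space) set" where
  "besov_holder \<alpha> =
     {f. continuous_on UNIV f \<and> bounded (range f) \<and>
         (\<exists>\<rho>. lp_profile \<rho> \<and>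
           (\<exists>C. \<forall>j x. 2 powr (\<alpha> * (real j - 1)) * norm (lp_block \<rho> j f x) \<le> C))}"

section \<open>The path space\<close>

text \<open>Continuous paths on the unit interval with the uniform metric. A path is a function on
  \<open>real\<close> that is \<open>undefined\<close> outside \<open>{0..1}\<close>.\<close>

definition C01 :: "(real \<Rightarrow> 'a::euclidean_space) metric" where
  "C01 = cfunspace (top_of_set {0..1}) euclidean_metric"

lemma mspace_C01:
  "mspace (C01 :: (real \<Rightarrow> 'a::euclidean_space) metric) =
     {w. w \<in> extensional {0..1} \<and> continuous_on {0..1} w}"
proof -
  have "bounded (w ` {0..1})" if "continuous_on {0..1} w" for w :: "real \<Rightarrow> 'a"
    using that by (intro compact_imp_bounded compact_continuous_image) auto
  then show ?thesis
    by (auto simp: C01_def)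
qed

definition borel_C01 :: "(real \<Rightarrow> 'a::euclidean_space) measure" where
  "borel_C01 = sigma (mspace C01) {U. openin (mtopology_of C01) U}"

lemma space_borel_C01: "space borel_C01 = mspace C01"
  unfolding borel_C01_def
  by (rule space_measure_of) (metis PowI mem_Collect_eq openin_subset subsetI topspace_mtopology_of)

section \<open>Fractional Brownian motion\<close>

text \<open>Constants count as degenerate Gaussian variables; this is needed at time \<open>0\<close>, for instance.\<close>

definition gaussian_var :: "'w measure \<Rightarrow> ('w \<Rightarrow> real) \<Rightarrow> bool" where
  "gaussian_var M X \<longleftrightarrow> X \<in> borel_measurable M \<and>
     (\<exists>m. (AE \<omega> in M. X \<omega> = m) \<or>
          (\<exists>\<sigma>>0. distributed M lborel X (normal_density m \<sigma>)))"

definition gaussian_process :: "'w measure \<Rightarrow> 'i set \<Rightarrow> ('i \<Rightarrow> 'w \<Rightarrow> real) \<Rightarrow> bool" where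
  "gaussian_process M T X \<longleftrightarrow>
     (\<forall>J a. finite J \<and> J \<subseteq> T \<longrightarrow> gaussian_var M (\<lambda>\<omega>. \<Sum>t\<in>J. a t * X t \<omega>))"

text \<open>The components are independent as processes. They are identically distributed because they
  are centered Gaussian with the same covariance, that is, with the same constant \<open>c\<close>.\<close>

definition fractional_brownian_motion ::
  "'w measure \<Rightarrow> real \<Rightarrow> (real \<Rightarrow> 'w \<Rightarrow> real ^ 'n) \<Rightarrow> bool" where
  "fractional_brownian_motion M H W \<longleftrightarrow>
     prob_space M \<and>
     (\<forall>\<omega>\<in>space M. continuous_on {0..1} (\<lambda>t. W t \<omega>)) \<and>
     prob_space.indep_vars M (\<lambda>i. \<Pi>\<^sub>M t\<in>{0..1::real}. (borel :: real measure))
       (\<lambda>i \<omega>. \<lambda>t\<in>{0..1}. W t \<omega> $ i) UNIV \<and>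
     (\<forall>i. gaussian_process M {0..1} (\<lambda>t \<omega>. W t \<omega> $ i)) \<and>
     (\<forall>i. \<forall>t\<in>{0..1}. prob_space.expectation M (\<lambda>\<omega>. W t \<omega> $ i) = 0) \<and>
     (\<exists>c>0. \<forall>i. \<forall>s\<in>{0..1}. \<forall>t\<in>{0..1}.
        prob_space.expectation M (\<lambda>\<omega>. W s \<omega> $ i * W t \<omega> $ i) =
          c * (t powr (2 * H) + s powr (2 * H) - \<bar>t - s\<bar> powr (2 * H)))"

text \<open>A measure on the path space is the law of such a process iff the coordinate process has this
  property under it.\<close>

definition fbm_law :: "real \<Rightarrow> (real \<Rightarrow> real ^ 'n) measure \<Rightarrow> bool" where
  "fbm_law H \<mu> \<longleftrightarrow>
     space \<mu> = space borel_C01 \<and> sets \<mu> = sets borel_C01 \<and>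
     fractional_brownian_motion \<mu> H (\<lambda>t w. w t)"

end

theory Submission
 imports Defs "HOL-Complex_Analysis.Great_Picard"
begin

text \<open>Some Hoelder exponent \<open>a < \<alpha>\<close> of \<open>b\<close> satisfies \<open>H (1 - a) < 1/2\<close>. On the dyadic grid of
 mesh $2^{-m}$ the Cholesky innovations of the noise are independent standard normal. Local
 nondeterminism makes conditional expectations of second differences of \<open>b\<close> small, and summing
 along dyadic levels, with Azuma's inequality on each level, bounds second differences of the
 averages of $y \mapsto b(y + w_i)$ over all dyadic blocks with large probability.

 A Girsanov-type change of the innovations carries these bounds over from the noise to the Euler
 polygon, uniformly in \<open>m\<close>; the energy of the shift is controlled through the Mandelbrot--van Ness
 kernel and needs only moments of increments. Hence almost surely the polygon satisfies the bounds
 with one constant for infinitely many \<open>m\<close>, and by compactness a subsequence converges to a solution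
 \<open>x\<close>, which inherits them at all scales. A Zygmund-type argument turns them into Lipschitz bounds
 $|I|^\gamma$ with $\gamma > 1/2$ for $y \mapsto \int_I b(x_s + y)\,ds$, and a deterministic dyadic
 sewing argument shows that every other solution coincides with \<open>x\<close>.\<close>

text \<open>A competing solution is an arbitrary continuous path, not an adapted process, so no
  stochastic estimate applies to it. Randomness enters only through one solution \<open>x\<close>,
  and any other one is measured by averages of \<open>b\<close> along \<open>x\<close>. The sewing
  defect has two small factors, the Lipschitz constant of an average and an increment of the
  difference of the solutions, both of order |I|^\<gamma>; hence the threshold \<gamma> > 1/2.
  Smoothing by noise of size |I|^H pays for 1 + \<epsilon> powers of the spatial step with H (1 +
  \<epsilon> - a) powers of time, which leaves \<gamma> < 1 - H (1 + \<epsilon> - a). For small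
  \<epsilon> there is room above 1/2 because H (1 - a) < 1/2. The energy of the drift is controlled
  in expectation only, not in exponential moments. The change of innovations is therefore switched
  off at an energy level, and regularity of the polygon is known up to a small probability for each
  \<open>m\<close> separately. As these probabilities are uniform in \<open>m\<close>, they still
  force regularity for infinitely many \<open>m\<close>.\<close>

lemmas L_integrable_add = Bochner_Integration.integrable_add
 and L_integrable_bound = Bochner_Integration.integrable_bound
 and L_integrable_diff = Bochner_Integration.integrable_diff
 and L_integrable_sum = Bochner_Integration.integrable_sum
 and L_integral_add = Bochner_Integration.integral_add
 and L_integral_cong = Bochner_Integration.integral_cong
 and L_integral_diff = Bochner_Integration.integral_diff
 and L_integral_nonneg = Bochner_Integration.integral_nonneg
 and L_integral_sum = Bochner_Integration.integral_sum

section \<open>Besov--Hoelder functions are Hoelder continuous\<close>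

text \<open>Finite differences replace derivatives in the decay estimate: the difference along a vector \<open>v\<close>
 with \<open>cis (x \<bullet> v) = - 1\<close> multiplies the Fourier integral at \<open>x\<close> by \<open>- 2\<close>.\<close>

fun fd :: "nat => 'a::ab_group_add => ('a => 'b::ab_group_add) => 'a => 'b" where
 "fd 0 h u t = u t"
| "fd (Suc k) h u t = fd k h u (t + h) - fd k h u t"

lemma fd_has_real_derivative:
 assumes "!!s. (u has_real_derivative u' s) (at s)"
 shows "(fd k h u has_real_derivative fd k h u' t) (at t)"
proof (induction k arbitrary: t)
 case 0
 then show ?case using assms by simp
next
 case (Suc k)
 have "((%t. fd k h u (t + h)) has_real_derivative fd k h u' (t + h)) (at t)" using Suc[of "t + h"] by (simp add: DERIV_shift)
 then show ?case using DERIV_diff[OF _ Suc[of t]] by simp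
qed

text \<open>By the mean value theorem one difference is exchanged for one derivative and a factor
  \<open>h\<close>; iteration turns bounds on derivatives of order \<open>k\<close> into a factor
  \<open>h ^ k\<close>.\<close>

lemma fd_Suc_bound:
 assumes "!!s. (u has_real_derivative u' s) (at s)" "0 <= h" "!!s. \<bar>fd k h u' s\<bar> <= C"
 shows "\<bar>fd (Suc k) h u t\<bar> <= C * h"
proof (cases "h = 0")
 case False
 then have h: "t < t + h" using assms by simp
 obtain z where "fd k h u (t + h) - fd k h u t = (t + h - t) * fd k h u' z"
  using MVT2[OF h, of "fd k h u" "fd k h u'"] fd_has_real_derivative[OF assms(1)] by blast
 then have "\<bar>fd (Suc k) h u t\<bar> = h * \<bar>fd k h u' z\<bar>" using assms(2) by (simp add: abs_mult)
 also have "... <= h * C" using assms by (intro mult_left_mono) auto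
 finally show ?thesis by (simp add: mult.commute)
qed simp

text \<open>The three summands match the three terms of
  \<open>radial_term_derivative\<close>.\<close>

lemma fd_linear3:
 fixes a b c :: real and t :: "'a::ab_group_add"
 shows "fd k h (%s. a * u s + b * v s + c * w s) t = a * fd k h u t + b * fd k h v t + c * fd k h w t"
 by (induction k arbitrary: t) (simp_all add: algebra_simps)

section \<open>Finite differences of the radial cutoff\<close>

abbreviation profile_deriv :: "(real => real) => nat => real => real" where
 "profile_deriv \<rho> m \<equiv> (deriv ^^ m) \<rho>"

lemma profile_deriv_has_derivative:
 assumes profile: "lp_profile \<rho>"
 shows "(profile_deriv \<rho> m has_real_derivative profile_deriv \<rho> (Suc m) x) (at x)"
 using profile unfolding lp_profile_def by (simp add: DERIV_deriv_iff_field_differentiable)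

lemma profile_deriv_low:
 assumes profile: "lp_profile \<rho>" and "x < 3/4" shows "profile_deriv \<rho> m x = (if m = 0 then 1 else 0)" using assms(2)
proof (induction m arbitrary: x)
 case 0
 then show ?case using profile by (simp add: lp_profile_def)
next
 case (Suc m)
 have "(profile_deriv \<rho> m has_real_derivative 0) (at x)"
 proof (rule has_field_derivative_transform_within_open[of "%_. if m = 0 then 1 else 0" 0 x "{..<3/4}"])
  show "((%_. if m = 0 then 1 else 0) has_real_derivative 0) (at x)" by (rule DERIV_const)
 qed (use Suc in auto)
 then show ?case using profile_deriv_has_derivative[OF profile] DERIV_unique by fastforce
qed

lemma profile_deriv_high:
 assumes profile: "lp_profile \<rho>" and "4/3 < x" shows "profile_deriv \<rho> m x = 0" using assms(2)
proof (induction m arbitrary: x)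
 case 0
 then show ?case using profile by (simp add: lp_profile_def)
next
 case (Suc m)
 have "(profile_deriv \<rho> m has_real_derivative 0) (at x)"
  by (rule has_field_derivative_transform_within_open[of "%_. 0" 0 x "{4/3<..}"]) (use Suc in auto)
 then show ?case using profile_deriv_has_derivative[OF profile] DERIV_unique by blast
qed

lemma profile_deriv_bounded:
 assumes profile: "lp_profile \<rho>"
 shows "EX C>=0. ALL x. \<bar>profile_deriv \<rho> m x\<bar> <= C"
proof -
 have "continuous_on {3/4..4/3} (profile_deriv \<rho> m)"
  using profile_deriv_has_derivative[OF profile] by (intro continuous_at_imp_continuous_on ballI DERIV_isCont) blast
 then have "bounded (profile_deriv \<rho> m ` {3/4..4/3})" by (intro compact_imp_bounded compact_continuous_image) auto
 then obtain C where C: "\<bar>profile_deriv \<rho> m x\<bar> <= C" if "x : {3/4..4/3}" for x by (metis bounded_iff image_eqI real_norm_def)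
 have "\<bar>profile_deriv \<rho> m x\<bar> <= max 1 C" for x
 proof -
  consider "x < 3/4" | "x : {3/4..4/3}" | "4/3 < x" by force
  then show ?thesis using C profile_deriv_low[OF profile] profile_deriv_high[OF profile] by cases (auto simp: le_max_iff_disj)
 qed
 then show ?thesis by (intro exI[of _ "max 1 C"]) auto
qed

text \<open>Differentiating the profile along a line at squared distance \<open>a\<close> from the
  origin produces such products, since r = sqrt (a + t^2) has derivative t / r. The family is closed
  under further differentiation. For positive \<open>m\<close> the derivative of the profile
  vanishes for r < 3/4, so that the powers of 1 / r are harmless at the origin.\<close>

definition radial_term :: "(real => real) => nat => nat => nat => real => real => real" where
 "radial_term \<rho> m p q a t = t ^ p * profile_deriv \<rho> m (sqrt (a + t^2)) * (1 / sqrt (a + t^2)) ^ q"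

lemma sqrt_has_derivative_line:
 assumes "0 < a + t^2"
 shows "((%t. sqrt (a + t^2)) has_real_derivative t / sqrt (a + t^2)) (at t)" using assms by (auto intro!: derivative_eq_intros simp: field_simps)

lemma radial_term_derivative:
 assumes profile: "lp_profile \<rho>" and "0 <= a" "1 <= m"
 shows "(radial_term \<rho> m p q a has_real_derivative
  real p * radial_term \<rho> m (p - 1) q a t + 1 * radial_term \<rho> (Suc m) (Suc p) (Suc q) a t +
  (- real q) * radial_term \<rho> m (Suc p) (Suc (Suc q)) a t) (at t)"
proof (cases "a + t^2 = 0")
 case True
 then have at: "a = 0" "t = 0" using assms by (auto simp: add_nonneg_eq_0_iff)
 have "(radial_term \<rho> m p q a has_real_derivative 0) (at t)"
 proof (rule has_field_derivative_transform_within_open[of "%_. 0" 0 t "{-3/4<..<3/4}"])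
  fix s :: real assume "s : {-3/4<..<3/4}"
  then have "\<bar>s\<bar> < 3/4" by auto
  then show "0 = radial_term \<rho> m p q a s" using at assms profile_deriv_low[OF profile, of "\<bar>s\<bar>" m] by (simp add: radial_term_def)
 qed (use at in auto)
 moreover have "radial_term \<rho> m' p' q' a t = 0" if "1 <= m'" for m' p' q'
  using at that profile_deriv_low[OF profile, of 0 m'] by (simp add: radial_term_def)
 ultimately show ?thesis using assms by simp
next
 case False
 then have pos: "0 < a + t^2" using assms by (metis add_nonneg_nonneg less_eq_real_def zero_le_power2)
 let ?r = "%t. sqrt (a + t^2)"
 have r: "0 < ?r t" using pos by simp
 note dr = sqrt_has_derivative_line[OF pos]
 have d1: "((%t. profile_deriv \<rho> m (?r t)) has_real_derivative profile_deriv \<rho> (Suc m) (?r t) * (t / ?r t)) (at t)"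
  by (rule DERIV_chain2[OF profile_deriv_has_derivative[OF profile] dr])
 have d2: "((%t. (1 / ?r t) ^ q) has_real_derivative - real q * (t * (1 / ?r t) ^ Suc (Suc q))) (at t)"
 proof -
  have "((%t. 1 / ?r t) has_real_derivative - (t / ?r t) * (1 / ?r t)^2) (at t)"
   using DERIV_inverse_fun[OF dr] r by (simp add: inverse_eq_divide power2_eq_square)
  from DERIV_power[OF this, of q] have "((%t. (1 / ?r t) ^ q) has_real_derivative real q * (1 / ?r t) ^ (q - Suc 0) * (- (t / ?r t) * (1 / ?r t)^2)) (at t)"
   by (simp add: mult_ac)
  moreover have "real q * (1 / ?r t) ^ (q - Suc 0) * (- (t / ?r t) * (1 / ?r t)^2) = - real q * (t * (1 / ?r t) ^ Suc (Suc q))"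
   by (cases q) (simp_all only: power2_eq_square mult_ac power_Suc of_nat_0 mult_zero_left mult_zero_right diff_Suc_Suc diff_zero divide_inverse mult_1_left mult_1_right mult_minus_left mult_minus_right minus_zero)
  ultimately show ?thesis by (simp only:)
 qed
 have d0: "((%t. t ^ p) has_real_derivative real p * t ^ (p - 1)) (at t)" using DERIV_pow[of p t] by simp
 have "((%t. t ^ p * profile_deriv \<rho> m (?r t) * (1 / ?r t) ^ q) has_real_derivative
  (real p * t ^ (p - 1) * profile_deriv \<rho> m (?r t) + profile_deriv \<rho> (Suc m) (?r t) * (t / ?r t) * t ^ p) * (1 / ?r t) ^ q +
  - real q * (t * (1 / ?r t) ^ Suc (Suc q)) * (t ^ p * profile_deriv \<rho> m (?r t))) (at t)" by (rule DERIV_mult[OF DERIV_mult[OF d0 d1] d2])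
 moreover have "(real p * t ^ (p - 1) * profile_deriv \<rho> m (?r t) + profile_deriv \<rho> (Suc m) (?r t) * (t / ?r t) * t ^ p) * (1 / ?r t) ^ q +
  - real q * (t * (1 / ?r t) ^ Suc (Suc q)) * (t ^ p * profile_deriv \<rho> m (?r t)) =
  real p * radial_term \<rho> m (p - 1) q a t + 1 * radial_term \<rho> (Suc m) (Suc p) (Suc q) a t +
  (- real q) * radial_term \<rho> m (Suc p) (Suc (Suc q)) a t"
  unfolding radial_term_def power_Suc by (simp only: divide_inverse ring_distribs mult_ac mult_1_left mult_1_right mult_minus_left mult_minus_right)
 ultimately show ?thesis unfolding radial_term_def by simp
qed

text \<open>On the support 3/4 <= r <= 4/3 of the derivative both |t| <= r and 1 / r are at most
  4/3. The bound is uniform in \<open>a\<close>, since the lines that occur have all distances from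
  the origin.\<close>

lemma radial_term_bounded:
 assumes profile: "lp_profile \<rho>" and "1 <= m"
 shows "EX C>=0. ALL a>=0. ALL t. \<bar>radial_term \<rho> m p q a t\<bar> <= C"
proof -
 obtain C where C: "0 <= C" "!!x. \<bar>profile_deriv \<rho> m x\<bar> <= C" using profile_deriv_bounded[OF profile] by blast
 have "\<bar>radial_term \<rho> m p q a t\<bar> <= (4/3) ^ p * C * (4/3) ^ q" if "0 <= a" for a t
 proof (cases "3/4 <= sqrt (a + t^2) & sqrt (a + t^2) <= 4/3")
  case True
  have "\<bar>t\<bar> <= sqrt (a + t^2)" using that by (intro real_le_rsqrt) simp
  then have "\<bar>t ^ p\<bar> <= (4/3) ^ p" using True unfolding power_abs by (intro power_mono) auto
  moreover have "(1 / sqrt (a + t^2)) ^ q <= (4/3) ^ q" using True add_nonneg_nonneg[OF that zero_le_power2[of t]] by (intro power_mono) (auto simp: divide_simps)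
  ultimately show ?thesis unfolding radial_term_def abs_mult using C True by (intro mult_mono) (auto simp: power_abs)
 next
  case False
  then have "profile_deriv \<rho> m (sqrt (a + t^2)) = 0" using assms profile_deriv_low[OF profile] profile_deriv_high[OF profile] by (auto simp: not_le)
  then show ?thesis using C by (simp add: radial_term_def)
 qed
 then show ?thesis using C by (intro exI[of _ "(4/3) ^ p * C * (4/3) ^ q"]) auto
qed

lemma fd_radial_term_bound:
 assumes profile: "lp_profile \<rho>" and "1 <= m"
 shows "EX C>=0. ALL a>=0. ALL h>=0. ALL t. \<bar>fd k h (radial_term \<rho> m p q a) t\<bar> <= C * h ^ k" using assms(2)
proof (induction k arbitrary: m p q)
 case 0
 then show ?case using radial_term_bounded[OF profile, of m p q] by fastforce
next
 case (Suc k)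
 obtain C1 where C1: "C1 >= 0" "!!a h t. a >= 0 ==> h >= 0 ==> \<bar>fd k h (radial_term \<rho> m (p - 1) q a) t\<bar> <= C1 * h ^ k"
  using Suc.IH[OF Suc.prems, of "p - 1" q] by auto
 obtain C2 where C2: "C2 >= 0" "!!a h t. a >= 0 ==> h >= 0 ==> \<bar>fd k h (radial_term \<rho> (Suc m) (Suc p) (Suc q) a) t\<bar> <= C2 * h ^ k"
  using Suc.IH[of "Suc m" "Suc p" "Suc q"] by auto
 obtain C3 where C3: "C3 >= 0" "!!a h t. a >= 0 ==> h >= 0 ==> \<bar>fd k h (radial_term \<rho> m (Suc p) (Suc (Suc q)) a) t\<bar> <= C3 * h ^ k"
  using Suc.IH[OF Suc.prems, of "Suc p" "Suc (Suc q)"] by auto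
 let ?C = "real p * C1 + 1 * C2 + real q * C3"
 have "\<bar>fd (Suc k) h (radial_term \<rho> m p q a) t\<bar> <= ?C * h ^ k * h" if ah: "0 <= a" "0 <= h" for a h t
 proof (rule fd_Suc_bound[OF radial_term_derivative[OF profile ah(1) Suc.prems] ah(2)])
  fix s
  have "\<bar>fd k h (%s. real p * radial_term \<rho> m (p - 1) q a s + 1 * radial_term \<rho> (Suc m) (Suc p) (Suc q) a s +
   (- real q) * radial_term \<rho> m (Suc p) (Suc (Suc q)) a s) s\<bar> <=
   real p * \<bar>fd k h (radial_term \<rho> m (p - 1) q a) s\<bar> + 1 * \<bar>fd k h (radial_term \<rho> (Suc m) (Suc p) (Suc q) a) s\<bar> +
   real q * \<bar>fd k h (radial_term \<rho> m (Suc p) (Suc (Suc q)) a) s\<bar>" unfolding fd_linear3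
   by (rule order_trans[OF abs_triangle_ineq], rule add_mono, rule order_trans[OF abs_triangle_ineq]) (simp_all add: abs_mult)
  also have "... <= real p * (C1 * h ^ k) + 1 * (C2 * h ^ k) + real q * (C3 * h ^ k)"
   using C1(2)[OF ah] C2(2)[OF ah] C3(2)[OF ah] by (intro add_mono mult_left_mono) auto
  finally show "\<bar>fd k h (%s. real p * radial_term \<rho> m (p - 1) q a s + 1 * radial_term \<rho> (Suc m) (Suc p) (Suc q) a s +
   (- real q) * radial_term \<rho> m (Suc p) (Suc (Suc q)) a s) s\<bar> <= ?C * h ^ k" by (simp add: algebra_simps)
 qed
 then show ?case using C1(1) C2(1) C3(1) by (intro exI[of _ ?C]) (auto simp: mult_ac)
qed

text \<open>The first difference produces the derivative t \<rho>'(r) / r, which is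
  \<open>radial_term \<rho> 1 1 1 a\<close>; from then on the order of differentiation is
  positive.\<close>

lemma fd_profile_bound:
 assumes profile: "lp_profile \<rho>"
 shows "EX C>=0. ALL a>=0. ALL h>=0. ALL t. \<bar>fd k h (%s. \<rho> (sqrt (a + s^2))) t\<bar> <= C * h ^ k"
proof (cases k)
 case 0
 then show ?thesis using profile_deriv_bounded[OF profile, of 0] by fastforce
next
 case (Suc k)
 obtain C where C: "C >= 0" "!!a h t. a >= 0 ==> h >= 0 ==> \<bar>fd k h (radial_term \<rho> 1 1 1 a) t\<bar> <= C * h ^ k"
  using fd_radial_term_bound[OF profile, of 1 k 1 1] by auto
 have d: "((%s. \<rho> (sqrt (a + s^2))) has_real_derivative radial_term \<rho> 1 1 1 a t) (at t)" if "0 <= a" for a t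
 proof (cases "a + t^2 = 0")
  case True
  then have at: "a = 0" "t = 0" using that by (auto simp: add_nonneg_eq_0_iff)
  have "((%s. \<rho> (sqrt (a + s^2))) has_real_derivative 0) (at t)"
  proof (rule has_field_derivative_transform_within_open[of "%_. 1" 0 t "{-3/4<..<3/4}"])
   fix s :: real assume "s : {-3/4<..<3/4}"
   then have "\<bar>s\<bar> < 3/4" by auto
   then show "1 = \<rho> (sqrt (a + s^2))" using at profile_deriv_low[OF profile, of "\<bar>s\<bar>" 0] by simp
  qed (use at in auto)
  then show ?thesis using at by (simp add: radial_term_def)
 next
  case False
  then have pos: "0 < a + t^2" using that by (metis add_nonneg_nonneg less_eq_real_def zero_le_power2)
  show ?thesis using DERIV_chain2[OF profile_deriv_has_derivative[OF profile, of 0] sqrt_has_derivative_line[OF pos]]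
   by (simp add: radial_term_def mult_ac)
 qed
 show ?thesis unfolding Suc using fd_Suc_bound[OF d _ C(2)] C(1) by (intro exI[of _ C]) (simp add: mult_ac)
qed

section \<open>Affine changes of variables and decay of Fourier integrals\<close>

lemma lborel_integral_affine:
 fixes f :: "'a::euclidean_space => 'b::{banach, second_countable_topology}"
 assumes f: "f : borel_measurable borel" and c: "c ~= 0"
 shows "(LBINT x. f x) = \<bar>c\<bar> ^ DIM('a) *\<^sub>R (LBINT x. f (t + c *\<^sub>R x))"
proof -
 have "(LBINT x. f x) = (LINT x|density (distr lborel borel (%x. t + c *\<^sub>R x)) (%_. \<bar>c\<bar> ^ DIM('a)). f x)"
  using lborel_affine[OF c, of t] by simp
 also have "... = (LINT x|distr lborel borel (%x. t + c *\<^sub>R x). \<bar>c\<bar> ^ DIM('a) *\<^sub>R f x)"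
  by (rule integral_density) (use f in auto)
 also have "... = (LBINT x. \<bar>c\<bar> ^ DIM('a) *\<^sub>R f (t + c *\<^sub>R x))" by (rule integral_distr) (use f in auto)
 finally show ?thesis by simp
qed

lemma lborel_integrable_affine:
 fixes f :: "'a::euclidean_space => 'b::{banach, second_countable_topology}"
 assumes f: "integrable lborel f" and c: "c ~= 0"
 shows "integrable lborel (%x. f (t + c *\<^sub>R x))"
proof -
 have m: "f : borel_measurable borel" using borel_measurable_integrable[OF f] by simp
 have "integrable (density (distr lborel borel (%x. t + c *\<^sub>R x)) (%_. \<bar>c\<bar> ^ DIM('a))) f" using lborel_affine[OF c, of t] f by simp
 then have "integrable (distr lborel borel (%x. t + c *\<^sub>R x)) (%x. \<bar>c\<bar> ^ DIM('a) *\<^sub>R f x)"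
  by (subst (asm) integrable_density) (use m in auto)
 then have "integrable lborel (%x. \<bar>c\<bar> ^ DIM('a) *\<^sub>R f (t + c *\<^sub>R x))" by (subst (asm) integrable_distr_eq) (use m in auto)
 then have "integrable lborel (%x. (1 / \<bar>c\<bar> ^ DIM('a)) *\<^sub>R (\<bar>c\<bar> ^ DIM('a) *\<^sub>R f (t + c *\<^sub>R x)))"
  by (rule integrable_scaleR_right)
 then show ?thesis using c by simp
qed

lemma lborel_integral_shift:
 fixes f :: "'a::euclidean_space => 'b::{banach, second_countable_topology}"
 assumes "f : borel_measurable borel"
 shows "(LBINT x. f (x + c)) = (LBINT x. f x)" using lborel_integral_affine[OF assms, of 1 c] by (simp add: add.commute)

lemma lborel_integrable_shift:
 fixes f :: "'a::euclidean_space => 'b::{banach, second_countable_topology}"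
 assumes "integrable lborel f"
 shows "integrable lborel (%x. f (x + c))" using lborel_integrable_affine[OF assms, of 1 c] by (simp add: add.commute)

definition fourier_int :: "('a::euclidean_space => real) => 'a => complex" where
 "fourier_int g x = (LBINT \<xi>. cis (x \<bullet> \<xi>) * complex_of_real (g \<xi>))"

lemma cis_inner_measurable [measurable]:
 fixes x :: "'a::euclidean_space"
 shows "(%\<xi>. cis (x \<bullet> \<xi>)) : borel_measurable borel" by (intro borel_measurable_continuous_onI continuous_intros)

lemma fourier_integrable:
 fixes g :: "'a::euclidean_space => real"
 assumes "integrable lborel g"
 shows "integrable lborel (%\<xi>. cis (x \<bullet> \<xi>) * complex_of_real (g \<xi>))"
proof (rule L_integrable_bound[OF assms])
 have [measurable]: "g : borel_measurable borel" using borel_measurable_integrable[OF assms] by simp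
 show "(%\<xi>. cis (x \<bullet> \<xi>) * complex_of_real (g \<xi>)) : borel_measurable lborel" by measurable
qed (auto simp: norm_mult)

lemma fourier_int_fd:
 fixes g :: "'a::euclidean_space => real"
 assumes "integrable lborel g" and v: "cis (x \<bullet> v) = - 1"
 shows "integrable lborel (fd k v g) & fourier_int (fd k v g) x = (- 2) ^ k * fourier_int g x"
proof (induction k)
 case 0
 then show ?case using assms by simp
next
 case (Suc k)
 let ?G = "fd k v g"
 have G: "integrable lborel ?G" using Suc by simp
 have [measurable]: "?G : borel_measurable borel" using borel_measurable_integrable[OF G] by simp
 note G' = lborel_integrable_shift[OF G, of v]
 have cv: "cis (- (x \<bullet> v)) = - 1"
 proof -
  have "cis (- (x \<bullet> v)) * cis (x \<bullet> v) = 1" by (simp add: cis_mult)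
  then show ?thesis using v by (simp add: minus_equation_iff)
 qed
 have "(LBINT \<xi>. cis (x \<bullet> \<xi>) * complex_of_real (?G (\<xi> + v))) =
  (LBINT \<xi>. (%\<xi>. - (cis (x \<bullet> \<xi>) * complex_of_real (?G \<xi>))) (\<xi> + v))"
 proof (rule L_integral_cong[OF refl])
  fix \<xi>
  have "cis (x \<bullet> \<xi>) = cis (x \<bullet> (\<xi> + v)) * cis (- (x \<bullet> v))" by (simp add: cis_mult inner_add_right)
  then show "cis (x \<bullet> \<xi>) * complex_of_real (?G (\<xi> + v)) = (%\<xi>. - (cis (x \<bullet> \<xi>) * complex_of_real (?G \<xi>))) (\<xi> + v)"
   unfolding cv by simp
 qed
 also have "... = (LBINT \<xi>. - (cis (x \<bullet> \<xi>) * complex_of_real (?G \<xi>)))" by (rule lborel_integral_shift) measurable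
 also have "... = - fourier_int ?G x" by (simp add: fourier_int_def)
 finally have 1: "(LBINT \<xi>. cis (x \<bullet> \<xi>) * complex_of_real (?G (\<xi> + v))) = - fourier_int ?G x" .
 have "fourier_int (fd (Suc k) v g) x = (LBINT \<xi>. cis (x \<bullet> \<xi>) * complex_of_real (?G (\<xi> + v)) - cis (x \<bullet> \<xi>) * complex_of_real (?G \<xi>))"
  unfolding fourier_int_def by (simp add: right_diff_distrib)
 also have "... = - fourier_int ?G x - fourier_int ?G x" using L_integral_diff[OF fourier_integrable[OF G', of x] fourier_integrable[OF G, of x]]
  unfolding 1 by (simp add: fourier_int_def)
 also have "... = (- 2) ^ Suc k * fourier_int g x" using Suc by simp
 finally have "fourier_int (fd (Suc k) v g) x = (- 2) ^ Suc k * fourier_int g x" .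
 moreover have "integrable lborel (%\<xi>. ?G (\<xi> + v) - ?G \<xi>)" by (rule L_integrable_diff[OF G' G])
 ultimately show ?case by (simp del: fd.simps add: fd.simps(2)[abs_def])
qed

lemma norm_fourier_int_le:
 fixes g :: "'a::euclidean_space => real"
 shows "norm (fourier_int g x) <= (LBINT \<xi>. \<bar>g \<xi>\<bar>)"
proof -
 have "norm (fourier_int g x) <= (LBINT \<xi>. norm (cis (x \<bullet> \<xi>) * complex_of_real (g \<xi>)))"
  unfolding fourier_int_def by (rule integral_norm_bound)
 then show ?thesis by (simp add: norm_mult)
qed

lemma fd_support:
 fixes g :: "'a::real_normed_vector => real"
 assumes "!!\<xi>. R < norm \<xi> ==> g \<xi> = 0" "R + real k * norm v < norm \<xi>"
 shows "fd k v g \<xi> = 0" using assms(2)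
proof (induction k arbitrary: \<xi>)
 case 0
 then show ?case using assms(1) by simp
next
 case (Suc k)
 have "norm \<xi> <= norm (\<xi> + v) + norm v" by norm
 then have "R + real k * norm v < norm (\<xi> + v)" "R + real k * norm v < norm \<xi>"
  using Suc.prems norm_ge_zero[of v] unfolding of_nat_Suc distrib_right by linarith+
 then show ?case using Suc.IH by simp
qed

text \<open>On a line in direction \<open>e\<close> the squared norm is a constant plus the square
  of the coordinate. A difference along \<open>e\<close> is thus a one-dimensional one, and
  \<open>fd_profile_bound\<close> applies with this constant as \<open>a\<close>.\<close>

lemma fd_radial:
 fixes \<xi> e :: "'a::real_inner"
 assumes "norm e = 1"
 shows "fd k (h *\<^sub>R e) (%\<xi>. \<rho> (norm \<xi>)) \<xi> = fd k h (%s. \<rho> (sqrt ((norm \<xi>)^2 - (\<xi> \<bullet> e)\<^sup>2 + s^2))) (\<xi> \<bullet> e)"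
proof (induction k arbitrary: \<xi>)
 case (Suc k)
 have e: "e \<bullet> e = 1" using assms by (simp add: dot_square_norm)
 let ?A = "\<xi> + h *\<^sub>R e"
 have a: "(norm ?A)^2 - (?A \<bullet> e)\<^sup>2 = (norm \<xi>)^2 - (\<xi> \<bullet> e)\<^sup>2"
 proof -
  have "?A \<bullet> ?A = \<xi> \<bullet> \<xi> + 2 * h * (\<xi> \<bullet> e) + h^2"
   by (simp add: inner_add_left inner_add_right e inner_commute[of e \<xi>] power2_eq_square distrib_left)
  then show ?thesis unfolding power2_norm_eq_inner by (simp add: inner_add_left e power2_eq_square algebra_simps)
 qed
 have b: "?A \<bullet> e = \<xi> \<bullet> e + h" by (simp add: inner_add_left e)
 show ?case unfolding fd.simps Suc.IH a unfolding b ..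
qed simp

lemma fourier_profile_decay_direction:
 fixes e :: "'a::euclidean_space"
 assumes \<rho>: "lp_profile \<rho>" and g: "integrable lborel (%\<xi>::'a. \<rho> (norm \<xi>))" and e: "e : Basis"
 shows "EX C>=0. ALL x. \<bar>x \<bullet> e\<bar> ^ k * norm (fourier_int (%\<xi>::'a. \<rho> (norm \<xi>)) x) <= C"
proof -
 let ?g = "%\<xi>::'a. \<rho> (norm \<xi>)"
 have ne: "norm e = 1" using e by simp
 obtain C where C: "0 <= C" "!!a h t. a >= 0 ==> h >= 0 ==> \<bar>fd k h (%s. \<rho> (sqrt (a + s^2))) t\<bar> <= C * h ^ k"
  using fd_profile_bound[OF \<rho>, of k] by blast
 \<comment> \<open>The step \<open>h\<close> below is at most pi, so \<open>k\<close> translations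
   move the support of radius 4/3 by at most \<open>k * pi\<close>.\<close>
 define R where "R = 4/3 + real k * pi"
 define V where "V = measure lborel (cball (0::'a) R)"
 let ?K = "C * V * pi ^ k + (LBINT \<xi>. \<bar>?g \<xi>\<bar>)"
 have i0: "0 <= (LBINT \<xi>. \<bar>?g \<xi>\<bar>)" by (rule L_integral_nonneg) simp
 have V0: "0 <= V" by (simp add: V_def)
 have "\<bar>x \<bullet> e\<bar> ^ k * norm (fourier_int ?g x) <= ?K" for x
 proof (cases "1 <= \<bar>x \<bullet> e\<bar>")
  case False
  then have "\<bar>x \<bullet> e\<bar> ^ k <= 1" by (intro power_le_one) auto
  then have "\<bar>x \<bullet> e\<bar> ^ k * norm (fourier_int ?g x) <= 1 * (LBINT \<xi>. \<bar>?g \<xi>\<bar>)"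
   using norm_fourier_int_le[of ?g x] by (intro mult_mono) auto
  then show ?thesis using C V0 by (simp add: add_increasing)
 next
  case True
  \<comment> \<open>With this step the phase along \<open>e\<close> is pi or - pi. Then 2^k times
    the Fourier integral is at most C V h^k, and h^k cancels the power of |x . e| up to
    pi^k.\<close>
  define h where "h = pi / \<bar>x \<bullet> e\<bar>"
  have h: "0 < h" "h <= pi" using True by (auto simp: h_def field_simps)
  have "x \<bullet> (h *\<^sub>R e) = pi \<or> x \<bullet> (h *\<^sub>R e) = - pi" using True by (auto simp: h_def abs_if)
  then have cv: "cis (x \<bullet> (h *\<^sub>R e)) = - 1" by (auto simp: cis.ctr complex_eq_iff)
  note F = fourier_int_fd[OF g cv, of k]
  have pt: "\<bar>fd k (h *\<^sub>R e) ?g \<xi>\<bar> <= C * h ^ k * indicator (cball 0 R) \<xi>" for \<xi>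
  proof (cases "norm \<xi> <= R")
   case True
   have "(\<xi> \<bullet> e)^2 <= (norm \<xi>)^2" using Basis_le_norm[OF e, of \<xi>] abs_le_square_iff[of "\<xi> \<bullet> e" "norm \<xi>"] by simp
   then show ?thesis unfolding fd_radial[OF ne] using C(2)[of "(norm \<xi>)^2 - (\<xi> \<bullet> e)\<^sup>2" h "\<xi> \<bullet> e"] h True by simp
  next
   case False
   have "real k * norm (h *\<^sub>R e) <= real k * pi" using h ne by (intro mult_left_mono) auto
   then have "fd k (h *\<^sub>R e) ?g \<xi> = 0" using False \<rho> by (intro fd_support[of "4/3"]) (auto simp: R_def lp_profile_def)
   then show ?thesis using False by simp
  qed
  have "2 ^ k * norm (fourier_int ?g x) = norm (fourier_int (fd k (h *\<^sub>R e) ?g) x)" using F by (simp add: norm_mult norm_power)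
  also have "... <= (LBINT \<xi>. \<bar>fd k (h *\<^sub>R e) ?g \<xi>\<bar>)" by (rule norm_fourier_int_le)
  also have "... <= (LBINT \<xi>. C * h ^ k * indicator (cball (0::'a) R) \<xi>)"
   using F pt by (intro integral_mono) (auto intro: emeasure_lborel_cball_finite)
  also have "... = C * h ^ k * V" by (simp add: V_def)
  finally have "\<bar>x \<bullet> e\<bar> ^ k * (1 * norm (fourier_int ?g x)) <= \<bar>x \<bullet> e\<bar> ^ k * (C * h ^ k * V)"
   by (intro mult_left_mono order_trans[OF mult_right_mono[of 1 "2 ^ k"]]) auto
  also have "... = C * V * pi ^ k" using True by (simp add: h_def power_divide)
  finally show ?thesis using i0 unfolding mult_1_left by linarith
 qed
 then show ?thesis using C i0 V0 by (intro exI[of _ ?K]) auto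
qed

lemma profile_integrable:
 assumes "lp_profile \<rho>"
 shows "integrable lborel (%\<xi>::'a::euclidean_space. \<rho> (norm \<xi>))"
proof (rule L_integrable_bound[of _ "indicat_real (cball 0 (4/3))"])
 have "continuous_on UNIV \<rho>"
  using profile_deriv_has_derivative[OF assms, of 0] by (intro continuous_at_imp_continuous_on ballI DERIV_isCont) auto
 then have "continuous_on UNIV (%\<xi>::'a. \<rho> (norm \<xi>))" by (rule continuous_on_compose2[of UNIV \<rho>]) (auto intro: continuous_intros)
 then show "(%\<xi>::'a. \<rho> (norm \<xi>)) : borel_measurable lborel" using borel_measurable_continuous_onI by (simp add: measurable_lborel1)
 show "AE \<xi> in lborel. norm (\<rho> (norm \<xi>)) <= norm (indicat_real (cball 0 (4/3)) \<xi>)"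
  using assms by (intro AE_I2) (auto simp: lp_profile_def indicator_def)
qed (auto intro: emeasure_lborel_cball_finite)

lemma fourier_profile_decay:
 assumes \<rho>: "lp_profile \<rho>"
 shows "EX C>=0. ALL x::'a::euclidean_space. norm (fourier_int (%\<xi>. \<rho> (norm \<xi>)) x) <= C / (1 + norm x) ^ k"
proof -
 let ?g = "%\<xi>::'a. \<rho> (norm \<xi>)"
 note g = profile_integrable[OF \<rho>, where 'a = 'a]
 have "ALL e:(Basis::'a set). EX C>=0. ALL x. \<bar>x \<bullet> e\<bar> ^ k * norm (fourier_int ?g x) <= C"
  using fourier_profile_decay_direction[OF \<rho> g] by blast
 then obtain c where c: "!!e. e : (Basis::'a set) ==> 0 <= c e" "!!e x. e : Basis ==> \<bar>x \<bullet> e\<bar> ^ k * norm (fourier_int ?g x) <= c e"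
  by metis
 define S where "S = (SUM e:(Basis::'a set). c e)"
 define I where "I = (LBINT \<xi>. \<bar>?g \<xi>\<bar>)"
 have I0: "0 <= I" unfolding I_def by (rule L_integral_nonneg) simp
 have S0: "0 <= S" unfolding S_def by (rule sum_nonneg) (rule c)
 let ?d = "real DIM('a)"
 let ?C = "2 ^ k * I + (2 * ?d) ^ k * S"
 have "norm (fourier_int ?g x) <= ?C / (1 + norm x) ^ k" for x
 proof -
  let ?n = "norm (fourier_int ?g x)"
  have "(1 + norm x) ^ k * ?n <= ?C"
  proof (cases "norm x <= 1")
   case True
   then have "(1 + norm x) ^ k <= 2 ^ k" by (intro power_mono) auto
   then have "(1 + norm x) ^ k * ?n <= 2 ^ k * I" unfolding I_def using norm_fourier_int_le[of ?g x] by (intro mult_mono) auto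
   then show ?thesis using S0 by (simp add: add_increasing2)
  next
   case False
   have "EX e:Basis. norm x <= ?d * \<bar>x \<bullet> e\<bar>"
   proof (rule ccontr)
    assume *: "~ ?thesis"
    then have lt: "\<bar>x \<bullet> e\<bar> < norm x / ?d" if "e : Basis" for e
     using * that by (auto simp: pos_less_divide_eq mult.commute not_le)
    have "(SUM e:Basis. \<bar>x \<bullet> e\<bar>) < (SUM e:(Basis::'a set). norm x / ?d)" by (rule sum_strict_mono) (use lt in auto)
    then show False using norm_le_l1[of x] by simp
   qed
   then obtain e where e: "e : Basis" "norm x <= ?d * \<bar>x \<bullet> e\<bar>" by blast
   have "(1 + norm x) ^ k <= (2 * ?d * \<bar>x \<bullet> e\<bar>) ^ k" using False e(2) by (intro power_mono) auto
   then have "(1 + norm x) ^ k * ?n <= (2 * ?d * \<bar>x \<bullet> e\<bar>) ^ k * ?n" by (rule mult_right_mono) simp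
   also have "... = (2 * ?d) ^ k * (\<bar>x \<bullet> e\<bar> ^ k * ?n)" by (simp add: power_mult_distrib)
   also have "... <= (2 * ?d) ^ k * S"
   proof (rule mult_left_mono)
    have "c e <= S" unfolding S_def by (rule member_le_sum) (use e c in auto)
    then show "\<bar>x \<bullet> e\<bar> ^ k * ?n <= S" using c(2)[OF e(1), of x] by simp
   qed simp
   finally show ?thesis using I0 by (simp add: add_increasing)
  qed
  then show ?thesis by (simp add: pos_le_divide_eq add_pos_nonneg mult.commute)
 qed
 then show ?thesis using I0 S0 by (intro exI[of _ ?C]) auto
qed

lemma fourier_profile_Lipschitz:
 assumes \<rho>: "lp_profile \<rho>"
 shows "EX C>=0. ALL x y::'a::euclidean_space. norm (fourier_int (%\<xi>. \<rho> (norm \<xi>)) x - fourier_int (%\<xi>. \<rho> (norm \<xi>)) y) <= C * norm (x - y)"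
proof -
 let ?g = "%\<xi>::'a. \<rho> (norm \<xi>)"
 note g = profile_integrable[OF \<rho>, where 'a = 'a]
 let ?I = "LBINT \<xi>. ?g \<xi>"
 have g0: "0 <= ?g \<xi>" for \<xi> using \<rho> by (simp add: lp_profile_def)
 have I0: "0 <= ?I" by (rule L_integral_nonneg) (rule g0)
 have "norm (fourier_int ?g x - fourier_int ?g y) <= (4/3 * ?I) * norm (x - y)" for x y
 proof -
  note i = fourier_integrable[OF g]
  have "fourier_int ?g x - fourier_int ?g y = (LBINT \<xi>. cis (x \<bullet> \<xi>) * complex_of_real (?g \<xi>) - cis (y \<bullet> \<xi>) * complex_of_real (?g \<xi>))"
   unfolding fourier_int_def by (rule L_integral_diff[OF i i, symmetric])
  also have "norm ... <= (LBINT \<xi>. norm (cis (x \<bullet> \<xi>) * complex_of_real (?g \<xi>) - cis (y \<bullet> \<xi>) * complex_of_real (?g \<xi>)))"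
   by (rule integral_norm_bound)
  also have "... <= (LBINT \<xi>. (4/3 * norm (x - y)) * ?g \<xi>)"
  proof (rule integral_mono)
   show "integrable lborel (%\<xi>. norm (cis (x \<bullet> \<xi>) * complex_of_real (?g \<xi>) - cis (y \<bullet> \<xi>) * complex_of_real (?g \<xi>)))"
    by (intro integrable_norm L_integrable_diff i)
   show "integrable lborel (%\<xi>. (4/3 * norm (x - y)) * ?g \<xi>)" using g by simp
   fix \<xi> :: 'a
   let ?A = "cis (x \<bullet> \<xi>) - cis (y \<bullet> \<xi>)"
   have "norm (cis (x \<bullet> \<xi>) * complex_of_real (?g \<xi>) - cis (y \<bullet> \<xi>) * complex_of_real (?g \<xi>)) = norm ?A * ?g \<xi>"
    using g0[of \<xi>] by (simp add: norm_mult[symmetric] left_diff_distrib[symmetric]) (simp add: norm_mult)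
   also have "... <= (norm (x - y) * norm \<xi>) * ?g \<xi>"
   proof (rule mult_right_mono[OF _ g0])
    have "norm ?A <= \<bar>x \<bullet> \<xi> - y \<bullet> \<xi>\<bar>"
    proof -
     have "cis (x \<bullet> \<xi>) - cis (y \<bullet> \<xi>) = cis (y \<bullet> \<xi>) * (cis (x \<bullet> \<xi> - y \<bullet> \<xi>) - 1)" by (simp add: cis_mult right_diff_distrib)
     then have "norm ?A = norm (iexp (x \<bullet> \<xi> - y \<bullet> \<xi>) - 1)" by (simp add: norm_mult cis_conv_exp)
     then show ?thesis using iexp_approx1[of "x \<bullet> \<xi> - y \<bullet> \<xi>" 0] by simp
    qed
    also have "... <= norm (x - y) * norm \<xi>" by (simp add: inner_diff_left[symmetric] Cauchy_Schwarz_ineq2)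
    finally show "norm ?A <= norm (x - y) * norm \<xi>" .
   qed
   also have "... <= (4/3 * norm (x - y)) * ?g \<xi>"
   proof (cases "norm \<xi> <= 4/3")
    case True
    then show ?thesis using g0[of \<xi>] mult_left_mono[of "norm \<xi>" "4/3" "norm (x - y)"] by (intro mult_right_mono) (auto simp: mult.commute)
   next
    case False
    then have "?g \<xi> = 0" using \<rho> by (simp add: lp_profile_def)
    then show ?thesis by simp
   qed
   finally show "norm (cis (x \<bullet> \<xi>) * complex_of_real (?g \<xi>) - cis (y \<bullet> \<xi>) * complex_of_real (?g \<xi>)) <= (4/3 * norm (x - y)) * ?g \<xi>" .
  qed
  also have "... = (4/3 * ?I) * norm (x - y)" by simp
  finally show ?thesis .
 qed
 then show ?thesis using I0 by (intro exI[of _ "4/3 * ?I"]) auto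
qed

text \<open>Each point is charged to the smallest dyadic ball that contains it. The ball of radius
  2^n has volume of order 2^(n d) and carries a weight of order 2^(- n k), so the resulting series
  is geometric.\<close>

lemma integrable_inverse_polynomial_norm:
 assumes k: "DIM('a) < k"
 shows "integrable lborel (%x::'a::euclidean_space. 1 / (1 + norm x) ^ k)"
proof (rule integrableI_bounded)
 let ?V = "unit_ball_vol (real DIM('a))"
 have pt: "ennreal (1 / (1 + norm x) ^ k) <= (\<Sum>n. ennreal (2 ^ k * (1 / 2 ^ n) ^ k) * indicator (cball 0 (2 ^ n)) x)" for x :: 'a
 proof -
  obtain n0 :: nat where "norm x < 2 ^ n0" using real_arch_pow[of 2 "norm x"] by auto
  then have ex: "EX n. norm x <= 2 ^ n" by (auto intro: less_imp_le)
  define n where "n = (LEAST n. norm x <= 2 ^ n)"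
  have n: "norm x <= 2 ^ n" unfolding n_def using ex by (rule LeastI_ex)
  have "2 ^ n <= 2 * (1 + norm x)"
  proof (cases n)
   case (Suc l)
   have "~ norm x <= 2 ^ l" using not_less_Least[of l "%n. norm x <= 2 ^ n"] Suc by (simp add: n_def)
   then show ?thesis using Suc by simp
  qed simp
  then have "1 / (1 + norm x) <= 2 * (1 / 2 ^ n)" by (simp add: field_simps add_pos_nonneg)
  then have "(1 / (1 + norm x)) ^ k <= (2 * (1 / 2 ^ n)) ^ k" by (intro power_mono) auto
  then have "1 / (1 + norm x) ^ k <= 2 ^ k * (1 / 2 ^ n) ^ k" by (simp only: power_mult_distrib power_divide power_one)
  then have "ennreal (1 / (1 + norm x) ^ k) <= ennreal (2 ^ k * (1 / 2 ^ n) ^ k) * indicator (cball 0 (2 ^ n)) x" using n by (simp add: ennreal_leI)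
  also have "... <= (\<Sum>n. ennreal (2 ^ k * (1 / 2 ^ n) ^ k) * indicator (cball 0 (2 ^ n)) x)"
   using sum_le_suminf[OF summableI, of "{n}" "%n. ennreal (2 ^ k * (1 / 2 ^ n) ^ k) * indicator (cball 0 (2 ^ n)) x"]
   by (simp only: sum.insert finite.emptyI empty_iff not_False_eq_True sum.empty add_0_right finite.insertI zero_le simp_thms)
  finally show ?thesis .
 qed
 let ?A = "\<integral>\<^sup>+(x::'a). ennreal (norm (1 / (1 + norm x) ^ k)) \<partial>lborel"
 have "?A <= (\<integral>\<^sup>+(x::'a). (\<Sum>n. ennreal (2 ^ k * (1 / 2 ^ n) ^ k) * indicator (cball 0 (2 ^ n)) x) \<partial>lborel)"
  using pt by (intro nn_integral_mono) simp
 also have "... = (\<Sum>n. \<integral>\<^sup>+(x::'a). ennreal (2 ^ k * (1 / 2 ^ n) ^ k) * indicator (cball 0 (2 ^ n)) x \<partial>lborel)"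
  by (rule nn_integral_suminf) (use borel_closed[OF closed_cball] in measurable)
 also have "... = (\<Sum>n. ennreal (2 ^ k * (1 / 2 ^ n) ^ k) * ennreal (?V * (2 ^ n) ^ DIM('a)))"
  by (intro suminf_cong) (subst nn_integral_cmult_indicator, auto simp: emeasure_cball)
 also have "... <= (\<Sum>n. ennreal (2 ^ k * ?V * (1/2) ^ n))"
 proof (intro suminf_le allI summableI)
  fix n
  have "2 ^ k * (1 / 2 ^ n) ^ k * (?V * (2 ^ n) ^ DIM('a)) = 2 ^ k * ?V * ((1 / 2 ^ n) ^ k * (2 ^ n) ^ DIM('a))" by simp
  also have "... <= 2 ^ k * ?V * (1/2) ^ n"
  proof (intro mult_left_mono mult_nonneg_nonneg)
   have "(1 / 2 ^ n) ^ k <= (1 / 2 ^ n :: real) ^ Suc DIM('a)" by (rule power_decreasing) (use k in auto)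
   then have "(1 / 2 ^ n) ^ k * (2 ^ n) ^ DIM('a) <= (1 / 2 ^ n :: real) ^ Suc DIM('a) * (2 ^ n) ^ DIM('a)" by (rule mult_right_mono) simp
   also have "... = (1/2) ^ n" by (simp add: power_one_over)
   finally show "(1 / 2 ^ n) ^ k * (2 ^ n) ^ DIM('a) <= (1/2 :: real) ^ n" .
  qed auto
  finally show "ennreal (2 ^ k * (1 / 2 ^ n) ^ k) * ennreal (?V * (2 ^ n) ^ DIM('a)) <= ennreal (2 ^ k * ?V * (1/2) ^ n)"
   by (simp add: ennreal_mult[symmetric] ennreal_leI)
 qed
 also have "... < \<infinity>"
 proof -
  have "summable (%n. 2 ^ k * ?V * (1/2) ^ n)" by (intro summable_mult summable_geometric) simp
  then show ?thesis by (subst suminf_ennreal2) auto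
 qed
 finally show "?A < \<infinity>" .
 show "(%x::'a. 1 / (1 + norm x) ^ k) : borel_measurable lborel" by measurable
qed

section \<open>The kernel has integral one\<close>

lemma gaussian_fourier_line:
 shows "integrable lborel (%s. cis (s * t) * complex_of_real (exp (- s\<^sup>2 / 2)))"
  and "(LBINT s. cis (s * t) * complex_of_real (exp (- s\<^sup>2 / 2))) = complex_of_real (sqrt (2 * pi) * exp (- t\<^sup>2 / 2))" (is ?L)
proof -
 have c: "0 < sqrt (2 * pi)" by simp
 have e: "std_normal_density s = exp (- s\<^sup>2 / 2) / sqrt (2 * pi)" for s by (simp add: std_normal_density_def)
 have i: "integrable lborel (%s. sqrt (2 * pi) * std_normal_density s)" using integrable_normal_density[of 1 0] by (intro integrable_mult_right) simp
 then have i': "integrable lborel (%s::real. exp (- s\<^sup>2 / 2))" by (simp add: e)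
 let ?A = "%s. cis (s * t) * complex_of_real (exp (- s\<^sup>2 / 2))"
 show "integrable lborel ?A"
 proof (rule L_integrable_bound[OF i'])
  have "continuous_on UNIV ?A" by (intro continuous_intros) auto
  then show "?A : borel_measurable lborel" using borel_measurable_continuous_onI by simp
 qed (simp add: norm_mult)
 have "complex_of_real (exp (- t\<^sup>2 / 2)) = (CLINT s|std_normal_distribution. iexp (t * s))"
  using fun_cong[OF char_std_normal_distribution, of t] by (simp add: char_def)
 also have "... = (CLBINT s. std_normal_density s *\<^sub>R iexp (t * s))" by (rule integral_density) auto
 also have "... = (CLBINT s. complex_of_real (1 / sqrt (2 * pi)) * (cis (s * t) * complex_of_real (exp (- s\<^sup>2 / 2))))"
  by (intro L_integral_cong refl) (simp add: e cis_conv_exp scaleR_conv_of_real mult_ac)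
 also have "... = complex_of_real (1 / sqrt (2 * pi)) * (CLBINT s. cis (s * t) * complex_of_real (exp (- s\<^sup>2 / 2)))"
  by (rule integral_mult_right_zero)
 finally have "complex_of_real (sqrt (2 * pi)) * complex_of_real (exp (- t\<^sup>2 / 2)) =
  complex_of_real (sqrt (2 * pi)) * (complex_of_real (1 / sqrt (2 * pi)) * (CLBINT s. cis (s * t) * complex_of_real (exp (- s\<^sup>2 / 2))))" by simp
 also have "... = complex_of_real (sqrt (2 * pi) * (1 / sqrt (2 * pi))) * (CLBINT s. cis (s * t) * complex_of_real (exp (- s\<^sup>2 / 2)))"
  by (simp only: of_real_mult mult.assoc)
 also have "sqrt (2 * pi) * (1 / sqrt (2 * pi)) = 1" using c by simp
 finally show ?L by (simp only: of_real_mult of_real_1 mult_1_left)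
qed

lemma cis_sum: "finite A ==> cis (SUM i:A. f i) = (PROD i:A. cis (f i))" by (induction A rule: finite_induct) (auto simp: cis_mult[symmetric])

text \<open>Lebesgue measure is the image of a product of copies of the line, and the integrand is a
  product over the coordinates, to each of which \<open>gaussian_fourier_line\<close>
  applies.\<close>

lemma gaussian_fourier:
 fixes y :: "'a::euclidean_space"
 shows "integrable lborel (%x::'a. exp (- (norm x)\<^sup>2 / 2))" (is ?I)
  and "(LBINT x. cis (x \<bullet> y) * complex_of_real (exp (- (norm x)\<^sup>2 / 2))) = complex_of_real (sqrt (2 * pi) ^ DIM('a) * exp (- (norm y)\<^sup>2 / 2))"
proof -
 interpret product_sigma_finite "%_::'a. lborel :: real measure" ..
 let ?P = "\<Pi>\<^sub>M b\<in>(Basis::'a set). (lborel :: real measure)"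
 let ?T = "%f. (SUM b:Basis. f b *\<^sub>R b) :: 'a"
 have L: "(lborel :: 'a measure) = distr ?P borel ?T" by (rule lborel_eq)
 have T: "?T : ?P \<rightarrow>\<^sub>M borel" by measurable
 have pt: "cis (?T s \<bullet> y) * complex_of_real (exp (- (norm (?T s))\<^sup>2 / 2)) =
  (PROD b:Basis. cis (s b * (y \<bullet> b)) * complex_of_real (exp (- (s b)\<^sup>2 / 2)))" for s y
 proof -
  have "?T s \<bullet> y = (SUM b:Basis. s b * (y \<bullet> b))" by (simp add: inner_sum_left inner_commute[of y])
  moreover have "(norm (?T s))^2 = (SUM b:Basis. (s b)^2)" unfolding power2_norm_eq_inner by (subst euclidean_inner) (simp add: power2_eq_square)
  ultimately show ?thesis by (simp add: cis_sum prod.distrib sum_divide_distrib sum_negf[symmetric] exp_sum)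
 qed
 have m: "(%x::'a. cis (x \<bullet> y) * complex_of_real (exp (- (norm x)\<^sup>2 / 2))) : borel_measurable borel" for y
  by (intro borel_measurable_continuous_onI continuous_intros) auto
 have int: "integrable ?P (%s. PROD b:Basis. cis (s b * (y \<bullet> b)) * complex_of_real (exp (- (s b)\<^sup>2 / 2)))" for y
  by (rule product_integrable_prod) (simp, rule gaussian_fourier_line)
 have "integrable lborel (%x::'a. cis (x \<bullet> 0) * complex_of_real (exp (- (norm x)\<^sup>2 / 2)))"
  unfolding L by (subst integrable_distr_eq[OF T m]) (simp only: pt int)
 then have "integrable lborel (%x::'a. Re (cis (x \<bullet> 0) * complex_of_real (exp (- (norm x)\<^sup>2 / 2))))" by (rule integrable_Re)
 then show ?I by simp
 let ?A = "LBINT x. cis (x \<bullet> y) * complex_of_real (exp (- (norm x)\<^sup>2 / 2))"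
 have "?A =
  (LINT s|?P. cis (?T s \<bullet> y) * complex_of_real (exp (- (norm (?T s))\<^sup>2 / 2)))" unfolding L by (rule integral_distr[OF T m])
 also have "... = (LINT s|?P. (PROD b:Basis. cis (s b * (y \<bullet> b)) * complex_of_real (exp (- (s b)\<^sup>2 / 2))))" by (simp only: pt)
 also have "... = (PROD b:Basis. LBINT s. cis (s * (y \<bullet> b)) * complex_of_real (exp (- s\<^sup>2 / 2)))"
  by (rule product_integral_prod) (simp, rule gaussian_fourier_line)
 also have "... = (PROD b:Basis. complex_of_real (sqrt (2 * pi) * exp (- (y \<bullet> b)\<^sup>2 / 2)))" by (simp only: gaussian_fourier_line)
 also have "... = complex_of_real (sqrt (2 * pi) ^ DIM('a) * exp (- (norm y)\<^sup>2 / 2))"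
 proof -
  have "(norm y)^2 = (SUM b:Basis. (y \<bullet> b)^2)" unfolding power2_norm_eq_inner by (subst euclidean_inner) (simp add: power2_eq_square)
  then have "exp (- (norm y)\<^sup>2 / 2) = (PROD b:Basis. exp (- (y \<bullet> b)\<^sup>2 / 2))"
   by (simp add: sum_divide_distrib sum_negf[symmetric] exp_sum)
  then show ?thesis by (simp only: of_real_prod[symmetric] prod.distrib prod_constant)
 qed
 finally show "?A = complex_of_real (sqrt (2 * pi) ^ DIM('a) * exp (- (norm y)\<^sup>2 / 2))" .
qed

lemma fourier_int_scale:
 fixes g :: "'a::euclidean_space => real"
 assumes [measurable]: "g : borel_measurable borel" and c: "0 < c"
 shows "fourier_int (%\<xi>. g (\<xi> /\<^sub>R c)) x = c ^ DIM('a) *\<^sub>R fourier_int g (c *\<^sub>R x)"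
proof -
 let ?A = "LBINT \<xi>. cis (x \<bullet> (0 + c *\<^sub>R \<xi>)) * complex_of_real (g ((0 + c *\<^sub>R \<xi>) /\<^sub>R c))"
 have "fourier_int (%\<xi>. g (\<xi> /\<^sub>R c)) x = \<bar>c\<bar> ^ DIM('a) *\<^sub>R ?A"
  unfolding fourier_int_def by (rule lborel_integral_affine) (use c in auto)
 also have "?A = fourier_int g (c *\<^sub>R x)" unfolding fourier_int_def using c by (intro L_integral_cong refl) simp
 finally show ?thesis using c by simp
qed

lemma fourier_int_continuous:
 assumes "lp_profile \<rho>"
 shows "continuous_on UNIV (fourier_int (%\<xi>::'a::euclidean_space. \<rho> (norm \<xi>)))"
proof -
 obtain C where C: "0 <= C" "!!x y::'a. norm (fourier_int (%\<xi>. \<rho> (norm \<xi>)) x - fourier_int (%\<xi>. \<rho> (norm \<xi>)) y) <= C * norm (x - y)"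
  using fourier_profile_Lipschitz[OF assms] by metis
 have "C-lipschitz_on UNIV (fourier_int (%\<xi>::'a. \<rho> (norm \<xi>)))" by (rule lipschitz_onI) (use C in \<open>auto simp: dist_norm\<close>)
 then show ?thesis by (rule lipschitz_on_continuous_on)
qed

text \<open>Fourier inversion at the origin, where the cutoff is 1. The pairing of the transform of
  the dilated cutoff with a Gaussian is evaluated in two ways: dilation turns the Gaussian into a
  factor tending to 1, and Fubini moves the transform onto the Gaussian, while the dilated cutoff
  tends to 1.\<close>

lemma fourier_profile_integral:
 assumes \<rho>: "lp_profile \<rho>"
 shows "integrable lborel (fourier_int (%\<xi>::'a::euclidean_space. \<rho> (norm \<xi>)))"
  and "(LBINT x. fourier_int (%\<xi>::'a::euclidean_space. \<rho> (norm \<xi>)) x) = complex_of_real ((2 * pi) ^ DIM('a))"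
proof -
 let ?g = "%\<xi>::'a. \<rho> (norm \<xi>)" and ?F = "fourier_int (%\<xi>::'a. \<rho> (norm \<xi>))"
 let ?w = "%x::'a. exp (- (norm x)\<^sup>2 / 2)" and ?s = "sqrt (2 * pi) ^ DIM('a)"
 note g = profile_integrable[OF \<rho>, where 'a = 'a] and w = gaussian_fourier(1)[where 'a = 'a]
 have gm [measurable]: "?g : borel_measurable borel" using borel_measurable_integrable[OF g] by simp
 have Fm [measurable]: "?F : borel_measurable borel" by (rule borel_measurable_continuous_onI) (rule fourier_int_continuous[OF \<rho>])
 have wm [measurable]: "?w : borel_measurable borel" by measurable
 obtain C where C: "0 <= C" "!!x::'a. norm (?F x) <= C / (1 + norm x) ^ Suc DIM('a)" using fourier_profile_decay[OF \<rho>] by blast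
 show F: "integrable lborel ?F"
 proof (rule L_integrable_bound)
  show "integrable lborel (%x::'a. C * (1 / (1 + norm x) ^ Suc DIM('a)))" by (intro integrable_mult_right integrable_inverse_polynomial_norm) simp
  show "AE x in lborel. norm (?F x) <= norm (C * (1 / (1 + norm (x::'a)) ^ Suc DIM('a)))" using C by (intro AE_I2) simp
 qed simp
 define A where "A N = (LBINT z. fourier_int (%\<eta>::'a. ?g (\<eta> /\<^sub>R 2 ^ N)) z * complex_of_real (?w z))" for N :: nat
 have A1: "A N = (LBINT x. ?F x * complex_of_real (?w (x /\<^sub>R 2 ^ N)))" for N
 proof -
  have "(LBINT x. ?F x * complex_of_real (?w (x /\<^sub>R 2 ^ N))) =
   \<bar>2 ^ N\<bar> ^ DIM('a) *\<^sub>R (LBINT x. ?F (0 + 2 ^ N *\<^sub>R x) * complex_of_real (?w ((0 + 2 ^ N *\<^sub>R x) /\<^sub>R 2 ^ N)))"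
   by (rule lborel_integral_affine) auto
  also have "... = (LBINT x. \<bar>2 ^ N\<bar> ^ DIM('a) *\<^sub>R (?F (0 + 2 ^ N *\<^sub>R x) * complex_of_real (?w ((0 + 2 ^ N *\<^sub>R x) /\<^sub>R 2 ^ N))))"
   by simp
  also have "... = A N" unfolding A_def by (intro L_integral_cong refl) (subst fourier_int_scale[OF gm], simp_all)
  finally show ?thesis ..
 qed
 have "(%N. LBINT x. ?F x * complex_of_real (?w (x /\<^sub>R 2 ^ N))) \<longlonglongrightarrow> (LBINT x. ?F x)"
 proof (rule integral_dominated_convergence[where w = "%x. norm (?F x)"])
  show "AE x in lborel. (%N. ?F x * complex_of_real (?w (x /\<^sub>R 2 ^ N))) \<longlonglongrightarrow> ?F x"
  proof (rule AE_I2)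
   fix x :: 'a
   have "(%N. (1/2::real) ^ N *\<^sub>R x) \<longlonglongrightarrow> 0 *\<^sub>R x" by (intro tendsto_intros LIMSEQ_realpow_zero) auto
   then have "(%N. x /\<^sub>R 2 ^ N) \<longlonglongrightarrow> 0" by (simp add: power_one_over inverse_eq_divide)
   then have "(%N. ?F x * complex_of_real (?w (x /\<^sub>R 2 ^ N))) \<longlonglongrightarrow> ?F x * complex_of_real (exp (- (norm (0::'a))\<^sup>2 / 2))"
    by (intro tendsto_intros) auto
   then show "(%N. ?F x * complex_of_real (?w (x /\<^sub>R 2 ^ N))) \<longlonglongrightarrow> ?F x" by simp
  qed
  show "AE x in lborel. norm (?F x * complex_of_real (?w (x /\<^sub>R 2 ^ N))) <= norm (?F x)" for N
   by (intro AE_I2) (simp add: norm_mult mult_left_le)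
 qed (use F in auto)
 then have lim1: "A \<longlonglongrightarrow> (LBINT x. ?F x)" unfolding A1 .
 have gN: "integrable lborel (%\<eta>::'a. ?g (\<eta> /\<^sub>R 2 ^ N))" for N
  using lborel_integrable_affine[OF g, of "1 / 2 ^ N" 0] by (simp add: inverse_eq_divide)
 have A2: "A N = (LBINT \<eta>. complex_of_real (?g (\<eta> /\<^sub>R 2 ^ N) * (?s * ?w \<eta>)))" for N
 proof -
  let ?h = "%z \<eta>. cis (z \<bullet> \<eta>) * complex_of_real (?g (\<eta> /\<^sub>R 2 ^ N)) * complex_of_real (?w z)"
  have hn: "norm (?h z \<eta>) = \<bar>?g (\<eta> /\<^sub>R 2 ^ N)\<bar> * ?w z" for z \<eta> by (simp add: norm_mult)
  have cm [measurable]: "(%p::'a \<times> 'a. cis (fst p \<bullet> snd p)) : borel_measurable (lborel \<Otimes>\<^sub>M lborel)"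
  proof -
   have "continuous_on UNIV (%p::'a \<times> 'a. cis (fst p \<bullet> snd p))" by (intro continuous_intros)
   then show ?thesis using borel_measurable_continuous_onI by (simp add: lborel_prod)
  qed
  have hi: "integrable (lborel \<Otimes>\<^sub>M lborel) (case_prod ?h)"
  proof (rule lborel_pair.Fubini_integrable)
   show "case_prod ?h : borel_measurable (lborel \<Otimes>\<^sub>M lborel)" unfolding case_prod_beta by measurable
   show "integrable lborel (%x. LBINT y. norm (case_prod ?h (x, y)))" unfolding case_prod_conv hn using w by simp
   show "AE x in lborel. integrable lborel (%y. case_prod ?h (x, y))"
    unfolding case_prod_conv by (intro AE_I2 integrable_mult_left fourier_integrable gN)
  qed
  have "A N = (LBINT z. LBINT \<eta>. ?h z \<eta>)" unfolding A_def fourier_int_def by simp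
  also have "... = (LBINT \<eta>. LBINT z. ?h z \<eta>)" by (rule lborel_pair.Fubini_integral[OF hi, symmetric])
  also have "... = (LBINT \<eta>. complex_of_real (?g (\<eta> /\<^sub>R 2 ^ N) * (?s * ?w \<eta>)))"
  proof (intro L_integral_cong refl)
   fix \<eta> :: 'a
   have "(LBINT z. ?h z \<eta>) = (LBINT z. complex_of_real (?g (\<eta> /\<^sub>R 2 ^ N)) * (cis (z \<bullet> \<eta>) * complex_of_real (?w z)))"
    by (intro L_integral_cong refl) (simp only: mult_ac)
   also have "... = complex_of_real (?g (\<eta> /\<^sub>R 2 ^ N)) * complex_of_real (?s * ?w \<eta>)"
    by (simp only: integral_mult_right_zero gaussian_fourier(2))
   finally show "(LBINT z. ?h z \<eta>) = complex_of_real (?g (\<eta> /\<^sub>R 2 ^ N) * (?s * ?w \<eta>))" by (simp only: of_real_mult)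
  qed
  finally show ?thesis .
 qed
 have "(%N. LBINT \<eta>. complex_of_real (?g (\<eta> /\<^sub>R 2 ^ N) * (?s * ?w \<eta>))) \<longlonglongrightarrow> (LBINT \<eta>. complex_of_real (?s * ?w \<eta>))"
 proof (rule integral_dominated_convergence[where w = "%x. ?s * ?w x"])
  show "AE \<eta> in lborel. (%N. complex_of_real (?g (\<eta> /\<^sub>R 2 ^ N) * (?s * ?w \<eta>))) \<longlonglongrightarrow> complex_of_real (?s * ?w \<eta>)"
  proof (rule AE_I2)
   fix \<eta> :: 'a
   obtain N0 :: nat where N0: "norm \<eta> * (4/3) < 2 ^ N0" using real_arch_pow[of 2 "norm \<eta> * (4/3)"] by auto
   have "?g (\<eta> /\<^sub>R 2 ^ N) = 1" if "N0 <= N" for N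
   proof -
    have "norm \<eta> * (4/3) <= 2 ^ N" using N0 power_increasing[OF that, of "2::real"] by linarith
    then have "norm (\<eta> /\<^sub>R 2 ^ N) <= 3/4" by (simp add: field_simps)
    then show ?thesis using \<rho> by (simp only: lp_profile_def)
   qed
   then have "eventually (%N. complex_of_real (?g (\<eta> /\<^sub>R 2 ^ N) * (?s * ?w \<eta>)) = complex_of_real (?s * ?w \<eta>)) sequentially"
    unfolding eventually_sequentially by (intro exI[of _ N0] allI impI) simp
   then show "(%N. complex_of_real (?g (\<eta> /\<^sub>R 2 ^ N) * (?s * ?w \<eta>))) \<longlonglongrightarrow> complex_of_real (?s * ?w \<eta>)" by (rule tendsto_eventually)
  qed
  show "AE \<eta> in lborel. norm (complex_of_real (?g (\<eta> /\<^sub>R 2 ^ N) * (?s * ?w \<eta>))) <= ?s * ?w \<eta>" for N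
  proof (rule AE_I2)
   fix \<eta> :: 'a
   have "\<bar>?g (\<eta> /\<^sub>R 2 ^ N)\<bar> <= 1" using \<rho> by (simp add: lp_profile_def)
   then have "\<bar>?g (\<eta> /\<^sub>R 2 ^ N)\<bar> * (?s * ?w \<eta>) <= 1 * (?s * ?w \<eta>)" by (rule mult_right_mono) simp
   then show "norm (complex_of_real (?g (\<eta> /\<^sub>R 2 ^ N) * (?s * ?w \<eta>))) <= ?s * ?w \<eta>"
    unfolding norm_of_real abs_mult[of "?g _"] by simp
  qed
  show "integrable lborel (%x::'a. ?s * ?w x)" using w by (rule integrable_mult_right)
 qed measurable
 then have lim2: "A \<longlonglongrightarrow> (LBINT \<eta>. complex_of_real (?s * ?w (\<eta>::'a)))" unfolding A2 .
 have "(LBINT \<eta>. complex_of_real (?s * ?w (\<eta>::'a))) = complex_of_real ?s * (LBINT \<eta>. cis (\<eta> \<bullet> 0) * complex_of_real (?w \<eta>))"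
  by (simp only: of_real_mult integral_mult_right_zero inner_zero_right cis_zero mult_1_left)
 also have "... = complex_of_real (?s * ?s)" unfolding gaussian_fourier(2) by simp
 also have "?s * ?s = (2 * pi) ^ DIM('a)" unfolding power_mult_distrib[symmetric] by simp
 finally show "(LBINT x. ?F x) = complex_of_real ((2 * pi) ^ DIM('a))" using LIMSEQ_unique[OF lim1 lim2] by simp
qed

text \<open>The convolution with the kernel of the symbol $\rho(2^{-N}|\xi|)$, the sum of the blocks up to \<open>N\<close>.\<close>

definition low_pass :: "(real => real) => nat => ('a::euclidean_space => 'b::euclidean_space) => 'a => 'b" where
 "low_pass \<rho> N f x = (LBINT u. lp_kernel \<rho> 0 u *\<^sub>R f (x - u /\<^sub>R 2 ^ N))"

lemma lp_kernel_0: "lp_kernel \<rho> 0 (x::'a::euclidean_space) = Re (fourier_int (%\<xi>. \<rho> (norm \<xi>)) x) / (2 * pi) ^ DIM('a)"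
 by (simp add: lp_kernel_def inverse_fourier_def fourier_int_def)

lemma lp_kernel_0_decay:
 assumes "lp_profile \<rho>"
 obtains C where "0 <= C" "!!x::'a::euclidean_space. \<bar>lp_kernel \<rho> 0 x\<bar> <= C / (1 + norm x) ^ k"
proof -
 obtain C where C: "0 <= C" "!!x::'a. norm (fourier_int (%\<xi>. \<rho> (norm \<xi>)) x) <= C / (1 + norm x) ^ k"
  using fourier_profile_decay[OF assms] by blast
 show thesis
 proof
  show "0 <= C / (2 * pi) ^ DIM('a)" using C by simp
  fix x :: 'a
  have "\<bar>Re (fourier_int (%\<xi>. \<rho> (norm \<xi>)) x)\<bar> <= C / (1 + norm x) ^ k" using abs_Re_le_cmod C(2) by (rule order_trans)
  then have "\<bar>Re (fourier_int (%\<xi>. \<rho> (norm \<xi>)) x)\<bar> / (2 * pi) ^ DIM('a) <= C / (1 + norm x) ^ k / (2 * pi) ^ DIM('a)"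
   by (rule divide_right_mono) simp
  then show "\<bar>lp_kernel \<rho> 0 x\<bar> <= C / (2 * pi) ^ DIM('a) / (1 + norm x) ^ k"
   unfolding lp_kernel_0 by (simp add: abs_divide mult.commute)
 qed
qed

lemma lp_kernel_0_Lipschitz:
 assumes "lp_profile \<rho>"
 obtains C where "0 <= C" "!!x y::'a::euclidean_space. \<bar>lp_kernel \<rho> 0 x - lp_kernel \<rho> 0 y\<bar> <= C * norm (x - y)"
proof -
 let ?A = "%\<xi>. \<rho> (norm \<xi>)"
 obtain C where C: "0 <= C" "!!x y::'a. norm (fourier_int ?A x - fourier_int ?A y) <= C * norm (x - y)"
  using fourier_profile_Lipschitz[OF assms] by metis
 show thesis
 proof
  show "0 <= C / (2 * pi) ^ DIM('a)" using C by simp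
  fix x y :: 'a
  have "\<bar>Re (fourier_int ?A x - fourier_int ?A y)\<bar> <= C * norm (x - y)" using abs_Re_le_cmod C(2) by (rule order_trans)
  then have "\<bar>Re (fourier_int ?A x - fourier_int ?A y)\<bar> / (2 * pi) ^ DIM('a) <= C * norm (x - y) / (2 * pi) ^ DIM('a)"
   by (rule divide_right_mono) simp
  then show "\<bar>lp_kernel \<rho> 0 x - lp_kernel \<rho> 0 y\<bar> <= C / (2 * pi) ^ DIM('a) * norm (x - y)"
   unfolding lp_kernel_0 diff_divide_distrib[symmetric] by (simp add: abs_divide)
 qed
qed

lemma lp_kernel_0_measurable:
 assumes "lp_profile \<rho>"
 shows "(lp_kernel \<rho> 0 :: 'a::euclidean_space => real) : borel_measurable borel"
proof (rule borel_measurable_continuous_onI)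
 obtain C where "0 <= C" "!!x y::'a. \<bar>lp_kernel \<rho> 0 x - lp_kernel \<rho> 0 y\<bar> <= C * norm (x - y)"
  using lp_kernel_0_Lipschitz[OF assms] by blast
 then have "C-lipschitz_on UNIV (lp_kernel \<rho> 0 :: 'a => real)" by (intro lipschitz_onI) (auto simp: dist_norm)
 then show "continuous_on UNIV (lp_kernel \<rho> 0 :: 'a => real)" by (rule lipschitz_on_continuous_on)
qed

lemma lp_kernel_0_integral:
 assumes \<rho>: "lp_profile \<rho>"
 shows "integrable lborel (lp_kernel \<rho> 0 :: 'a::euclidean_space => real)"
  and "(LBINT x. lp_kernel \<rho> 0 (x::'a::euclidean_space)) = 1"
proof -
 note F = fourier_profile_integral[OF \<rho>, where 'a = 'a]
 have R: "integrable lborel (%x::'a. Re (fourier_int (%\<xi>. \<rho> (norm \<xi>)) x))" by (rule integrable_Re[OF F(1)])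
 then show "integrable lborel (lp_kernel \<rho> 0 :: 'a => real)" unfolding lp_kernel_0[abs_def] by (rule integrable_divide)
 have "(LBINT x. lp_kernel \<rho> 0 (x::'a)) = (LBINT x. Re (fourier_int (%\<xi>. \<rho> (norm \<xi>)) (x::'a))) / (2 * pi) ^ DIM('a)"
  unfolding lp_kernel_0 by (rule integral_divide_zero)
 also have "(LBINT x. Re (fourier_int (%\<xi>. \<rho> (norm \<xi>)) (x::'a))) = (2 * pi) ^ DIM('a)" using integral_Re[OF F(1)] F(2) by simp
 finally show "(LBINT x. lp_kernel \<rho> 0 (x::'a)) = 1" by simp
qed

text \<open>Geometric interpolation between the Lipschitz bound, raised to \<delta>, and the rapid
  decay, raised to 1 - \<delta>. A power of \<open>norm h\<close> is gained while enough decay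
  remains for integrability.\<close>

lemma lp_kernel_0_difference:
 assumes \<rho>: "lp_profile \<rho>" and \<delta>: "0 < \<delta>" "\<delta> < 1"
 obtains C where "0 <= C"
  "!!u h::'a::euclidean_space. norm h <= 1 ==>
   \<bar>lp_kernel \<rho> 0 (u - h) - lp_kernel \<rho> 0 u\<bar> * (1 + norm u) <= C * norm h powr \<delta> * (1 / (1 + norm u) ^ Suc DIM('a))"
proof -
 let ?k = "lp_kernel \<rho> 0 :: 'a => real" and ?d = "real DIM('a)"
 \<comment> \<open>The decay after interpolation has order m (1 - \<delta>): d + 1 powers make the
   bound integrable, and one more pays for the factor \<open>1 + norm u\<close>.\<close>
 obtain m :: nat where m: "(?d + 2) / (1 - \<delta>) <= real m" using real_arch_simple by blast
 have m': "?d + 2 <= real m * (1 - \<delta>)" using m \<delta> by (simp add: pos_divide_le_eq)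
 obtain C1 where C1: "0 <= C1" "!!x y::'a. \<bar>?k x - ?k y\<bar> <= C1 * norm (x - y)" using lp_kernel_0_Lipschitz[OF \<rho>] by blast
 obtain C2 where C2: "0 <= C2" "!!x::'a. \<bar>?k x\<bar> <= C2 / (1 + norm x) ^ m" using lp_kernel_0_decay[OF \<rho>] by blast
 define A where "A = C1 + 1"
 define B where "B = C2 * (1 + 2 ^ m) + 1"
 have AB: "0 < A" "0 < B" using C1 C2 by (auto simp: A_def B_def add_nonneg_pos)
 show thesis
 proof
  show "0 <= A powr \<delta> * B powr (1 - \<delta>)" by simp
  fix u h :: 'a assume h: "norm h <= 1"
  let ?x = "\<bar>?k (u - h) - ?k u\<bar>" and ?n = "1 + norm u"
  have n0: "0 < ?n" by (simp add: add_pos_nonneg)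
  have "?x <= C1 * norm h" using C1(2)[of "u - h" u] by simp
  also have "... <= A * norm h" by (intro mult_right_mono) (auto simp: A_def)
  finally have x1: "?x <= A * norm h" .
  have x2: "?x <= B / ?n ^ m"
  proof -
   let ?A = "1 + norm (u - h)"
   have "norm u <= norm (u - h) + norm h" by norm
   then have "?n <= 2 * ?A" using h norm_ge_zero[of "u - h"] unfolding distrib_left by linarith
   then have "?n ^ m <= (2 * ?A) ^ m" by (rule power_mono) simp
   then have "?n ^ m <= 2 ^ m * ?A ^ m" by (simp only: power_mult_distrib)
   moreover have "0 < ?A ^ m" "0 < ?n ^ m" by (simp_all add: add_pos_nonneg)
   ultimately have "1 / ?A ^ m <= 2 ^ m / ?n ^ m" by (simp add: divide_simps mult.commute)
   then have "C2 * (1 / ?A ^ m) <= C2 * (2 ^ m / ?n ^ m)" using C2(1) by (rule mult_left_mono)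
   then have "C2 / ?A ^ m <= C2 * (2 ^ m / ?n ^ m)" by simp
   then have "?x <= C2 / ?n ^ m + C2 * (2 ^ m / ?n ^ m)" using C2(2)[of u] C2(2)[of "u - h"] by linarith
   also have "... = C2 * (1 + 2 ^ m) / ?n ^ m" by (simp add: add_divide_distrib distrib_left)
   also have "... <= B / ?n ^ m" by (intro divide_right_mono) (auto simp: B_def)
   finally show ?thesis .
  qed
  have x0: "0 <= ?x" by simp
  have "?x = ?x powr \<delta> * ?x powr (1 - \<delta>)" using x0 by (cases "?x = 0") (auto simp flip: powr_add)
  also have "... <= (A * norm h) powr \<delta> * (B / ?n ^ m) powr (1 - \<delta>)" using x0 x1 x2 \<delta> by (intro mult_mono powr_mono2) auto
  also have "(A * norm h) powr \<delta> = A powr \<delta> * norm h powr \<delta>" using AB by (simp add: powr_mult)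
  also have "(B / ?n ^ m) powr (1 - \<delta>) = B powr (1 - \<delta>) / ?n powr (real m * (1 - \<delta>))"
   using AB n0 by (simp add: powr_divide powr_powr flip: powr_realpow)
  also have "A powr \<delta> * norm h powr \<delta> * (B powr (1 - \<delta>) / ?n powr (real m * (1 - \<delta>))) <=
   A powr \<delta> * norm h powr \<delta> * (B powr (1 - \<delta>) / ?n powr (?d + 2))"
   using m' n0 by (intro mult_left_mono divide_left_mono powr_mono) auto
  also have "?n powr (?d + 2) = ?n ^ Suc DIM('a) * ?n"
  proof -
   have "?n powr (?d + 2) = ?n powr real (Suc (Suc DIM('a)))" by (simp add: add.commute)
   then show ?thesis using n0 by (simp only: powr_realpow power_Suc mult_ac)
  qed
  finally have "?x <= A powr \<delta> * norm h powr \<delta> * (B powr (1 - \<delta>) / (?n ^ Suc DIM('a) * ?n))" .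
  then have "?x * ?n <= A powr \<delta> * norm h powr \<delta> * (B powr (1 - \<delta>) / (?n ^ Suc DIM('a) * ?n)) * ?n"
   by (rule mult_right_mono) (use n0 in simp)
  also have "... = A powr \<delta> * B powr (1 - \<delta>) * norm h powr \<delta> * (1 / ?n ^ Suc DIM('a))" using n0 by (simp add: divide_simps)
  finally show "?x * ?n <= A powr \<delta> * B powr (1 - \<delta>) * norm h powr \<delta> * (1 / ?n ^ Suc DIM('a))" .
 qed
qed

lemma integrable_scaleR_bounded:
 fixes k :: "'a::euclidean_space => real" and f :: "'a => 'b::euclidean_space"
 assumes k: "integrable lborel k" and f: "f : borel_measurable borel" and b: "!!x. norm (f x) <= B"
 shows "integrable lborel (%x. k x *\<^sub>R f x)"
proof (rule L_integrable_bound)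
 show "integrable lborel (%x. B * \<bar>k x\<bar>)" using k by simp
 show "(%x. k x *\<^sub>R f x) : borel_measurable lborel" using borel_measurable_integrable[OF k] f by simp
 show "AE x in lborel. norm (k x *\<^sub>R f x) <= norm (B * \<bar>k x\<bar>)"
 proof (rule AE_I2)
  fix x
  have "0 <= B" using norm_ge_zero b order_trans by blast
  then show "norm (k x *\<^sub>R f x) <= norm (B * \<bar>k x\<bar>)"
   using mult_left_mono[OF b[of x], of "\<bar>k x\<bar>"] by (simp add: abs_mult mult.commute)
 qed
qed

lemma low_pass_convolution:
 fixes f :: "'a::euclidean_space => 'b::euclidean_space"
 assumes \<rho>: "lp_profile \<rho>" and f: "continuous_on UNIV f" "!!x. norm (f x) <= B"
 shows "integrable lborel (%y. ((2 ^ N) ^ DIM('a) * lp_kernel \<rho> 0 (2 ^ N *\<^sub>R (x - y))) *\<^sub>R f y)" (is ?I)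
  and "(LBINT y. ((2 ^ N) ^ DIM('a) * lp_kernel \<rho> 0 (2 ^ N *\<^sub>R (x - y))) *\<^sub>R f y) = low_pass \<rho> N f x"
proof -
 have [measurable]: "f : borel_measurable borel" using f(1) by (rule borel_measurable_continuous_onI)
 have km [measurable]: "(lp_kernel \<rho> 0 :: 'a => real) : borel_measurable borel" by (rule lp_kernel_0_measurable[OF \<rho>])
 let ?c = "- 1 / 2 ^ N :: real"
 have "integrable lborel (%y. lp_kernel \<rho> 0 (2 ^ N *\<^sub>R x + (- (2 ^ N)) *\<^sub>R y :: 'a))"
  by (rule lborel_integrable_affine[OF lp_kernel_0_integral(1)[OF \<rho>]]) simp
 then have "integrable lborel (%y. lp_kernel \<rho> 0 (2 ^ N *\<^sub>R (x - y) :: 'a))" by (simp add: scaleR_diff_right)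
 then have "integrable lborel (%y. (2 ^ N) ^ DIM('a) * lp_kernel \<rho> 0 (2 ^ N *\<^sub>R (x - y) :: 'a))" by (rule integrable_mult_right)
 then show ?I by (rule integrable_scaleR_bounded) (use f in auto)
 let ?A = "LBINT y. ((2 ^ N) ^ DIM('a) * lp_kernel \<rho> 0 (2 ^ N *\<^sub>R (x - y))) *\<^sub>R f y"
 have "?A =
  \<bar>?c\<bar> ^ DIM('a) *\<^sub>R (LBINT u. ((2 ^ N) ^ DIM('a) * lp_kernel \<rho> 0 (2 ^ N *\<^sub>R (x - (x + ?c *\<^sub>R u)))) *\<^sub>R f (x + ?c *\<^sub>R u))"
  by (rule lborel_integral_affine) auto
 also have "... = \<bar>?c\<bar> ^ DIM('a) *\<^sub>R (LBINT u. (2 ^ N) ^ DIM('a) *\<^sub>R (lp_kernel \<rho> 0 u *\<^sub>R f (x - u /\<^sub>R 2 ^ N)))"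
  by (intro arg_cong[where f = "scaleR (\<bar>?c\<bar> ^ DIM('a))"] L_integral_cong refl) (simp add: inverse_eq_divide)
 also have "... = (\<bar>?c\<bar> ^ DIM('a) * (2 ^ N) ^ DIM('a)) *\<^sub>R low_pass \<rho> N f x" unfolding low_pass_def by (simp only: integral_scaleR_right scaleR_scaleR[symmetric])
 also have "\<bar>?c\<bar> ^ DIM('a) * (2 ^ N) ^ DIM('a) = 1" by (simp flip: power_mult_distrib)
 finally show "?A = low_pass \<rho> N f x" by simp
qed

text \<open>The symbol of block \<open>Suc j\<close> is a difference of two dilated cutoffs, and
  dilating a symbol dilates its kernel inversely. Hence the blocks become increments of
  \<open>low_pass\<close>.\<close>

lemma lp_kernel_Suc:
 assumes \<rho>: "lp_profile \<rho>"
 shows "lp_kernel \<rho> (Suc j) (z::'a::euclidean_space) =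
  (2 ^ Suc j) ^ DIM('a) * lp_kernel \<rho> 0 (2 ^ Suc j *\<^sub>R z) - (2 ^ j) ^ DIM('a) * lp_kernel \<rho> 0 (2 ^ j *\<^sub>R z)"
proof -
 let ?g = "%\<xi>::'a. \<rho> (norm \<xi>)"
 note g = profile_integrable[OF \<rho>, where 'a = 'a]
 have gm: "?g : borel_measurable borel" using borel_measurable_integrable[OF g] by simp
 have gi: "integrable lborel (%\<xi>::'a. ?g (\<xi> /\<^sub>R 2 ^ n))" for n
  using lborel_integrable_affine[OF g, of "1 / 2 ^ n" 0] by (simp add: inverse_eq_divide)
 have "(LBINT \<xi>. cis (z \<bullet> \<xi>) * complex_of_real (lp_symbol \<rho> (Suc j) \<xi>)) =
  (LBINT \<xi>. cis (z \<bullet> \<xi>) * complex_of_real (?g (\<xi> /\<^sub>R 2 ^ Suc j)) - cis (z \<bullet> \<xi>) * complex_of_real (?g (\<xi> /\<^sub>R 2 ^ j)))"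
  by (intro L_integral_cong refl) (simp add: divide_inverse right_diff_distrib mult.commute[of "norm _"] del: power_Suc)
 also have "... = fourier_int (%\<xi>. ?g (\<xi> /\<^sub>R 2 ^ Suc j)) z - fourier_int (%\<xi>. ?g (\<xi> /\<^sub>R 2 ^ j)) z"
  unfolding fourier_int_def by (rule L_integral_diff[OF fourier_integrable[OF gi] fourier_integrable[OF gi]])
 also have "... = (2 ^ Suc j) ^ DIM('a) *\<^sub>R fourier_int ?g (2 ^ Suc j *\<^sub>R z) - (2 ^ j) ^ DIM('a) *\<^sub>R fourier_int ?g (2 ^ j *\<^sub>R z)"
  by (subst (1 2) fourier_int_scale[OF gm]) simp_all
 finally have "lp_kernel \<rho> (Suc j) z = Re ((2 ^ Suc j) ^ DIM('a) *\<^sub>R fourier_int ?g (2 ^ Suc j *\<^sub>R z) - (2 ^ j) ^ DIM('a) *\<^sub>R fourier_int ?g (2 ^ j *\<^sub>R z)) / (2 * pi) ^ DIM('a)"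
  unfolding lp_kernel_def inverse_fourier_def by (simp only: scaleR_complex.simps mult_1_left times_divide_eq_left)
 then show ?thesis unfolding lp_kernel_0 by (simp only: minus_complex.simps scaleR_complex.simps diff_divide_distrib times_divide_eq_right)
qed

lemma lp_block_Suc:
 fixes f :: "'a::euclidean_space => 'b::euclidean_space"
 assumes \<rho>: "lp_profile \<rho>" and f: "continuous_on UNIV f" "!!x. norm (f x) <= B"
 shows "lp_block \<rho> (Suc j) f x = low_pass \<rho> (Suc j) f x - low_pass \<rho> j f x"
proof -
 note L = low_pass_convolution[OF \<rho> f]
 show ?thesis unfolding lp_block_def lp_kernel_Suc[OF \<rho>] scaleR_diff_left L(2)[symmetric] by (rule L_integral_diff[OF L(1) L(1)])
qed

lemma low_pass_tendsto:
 fixes f :: "'a::euclidean_space => 'b::euclidean_space"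
 assumes \<rho>: "lp_profile \<rho>" and f: "continuous_on UNIV f" "!!x. norm (f x) <= B"
 shows "(%N. low_pass \<rho> N f x) \<longlonglongrightarrow> f x"
proof -
 let ?k = "lp_kernel \<rho> 0 :: 'a => real"
 note k = lp_kernel_0_integral[OF \<rho>, where 'a = 'a]
 have [measurable]: "f : borel_measurable borel" using f(1) by (rule borel_measurable_continuous_onI)
 have km [measurable]: "?k : borel_measurable borel" by (rule lp_kernel_0_measurable[OF \<rho>])
 have "(%N. LBINT u. ?k u *\<^sub>R f (x - u /\<^sub>R 2 ^ N)) \<longlonglongrightarrow> (LBINT u. ?k u *\<^sub>R f x)"
 proof (rule integral_dominated_convergence[where w = "%u. B * \<bar>?k u\<bar>"])
  show "AE u in lborel. (%N. ?k u *\<^sub>R f (x - u /\<^sub>R 2 ^ N)) \<longlonglongrightarrow> ?k u *\<^sub>R f x"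
  proof (rule AE_I2)
   fix u :: 'a
   have "(%N. (1/2::real) ^ N *\<^sub>R u) \<longlonglongrightarrow> 0 *\<^sub>R u" by (intro tendsto_intros LIMSEQ_realpow_zero) auto
   then have "(%N. u /\<^sub>R 2 ^ N) \<longlonglongrightarrow> 0" by (simp add: power_one_over inverse_eq_divide)
   then have "(%N. x - u /\<^sub>R 2 ^ N) \<longlonglongrightarrow> x - 0" by (intro tendsto_diff tendsto_const)
   then have "(%N. f (x - u /\<^sub>R 2 ^ N)) \<longlonglongrightarrow> f x" using f(1) by (intro continuous_on_tendsto_compose[of UNIV f]) auto
   then show "(%N. ?k u *\<^sub>R f (x - u /\<^sub>R 2 ^ N)) \<longlonglongrightarrow> ?k u *\<^sub>R f x" by (intro tendsto_scaleR tendsto_const)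
  qed
  show "AE u in lborel. norm (?k u *\<^sub>R f (x - u /\<^sub>R 2 ^ N)) <= B * \<bar>?k u\<bar>" for N
   using mult_left_mono[OF f(2), of "\<bar>?k _\<bar>"] by (intro AE_I2) (simp add: mult.commute[of _ "norm _"] mult.commute[of B])
  show "integrable lborel (%u. B * \<bar>?k u\<bar>)" using k by simp
 qed measurable
 moreover have "(LBINT u. ?k u *\<^sub>R f x) = f x" using k by simp
 ultimately show ?thesis unfolding low_pass_def by simp
qed

text \<open>The block \<open>Suc j\<close> is an increment of the low-pass approximations and
  carries the weight 2^(\<alpha> j) after the index shift. The error at level \<open>N\<close> is
  therefore a geometric tail.\<close>

lemma besov_holder_low_pass:
 fixes f :: "'a::euclidean_space => 'b::euclidean_space"
 assumes \<rho>: "lp_profile \<rho>" and f: "continuous_on UNIV f" "!!x. norm (f x) <= B"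
  and C: "!!j x. 2 powr (\<alpha> * (real j - 1)) * norm (lp_block \<rho> j f x) <= C" and \<alpha>: "0 < \<alpha>"
 shows "norm (f x - low_pass \<rho> N f x) <= C / (1 - 2 powr (- \<alpha>)) * 2 powr (- \<alpha> * N)"
proof -
 define q :: real where "q = 2 powr (- \<alpha>)"
 have q: "0 < q" "q < 1" using \<alpha> by (auto simp: q_def powr_less_one)
 have q': "2 powr (- \<alpha> * real j) = q ^ j" for j by (simp add: q_def powr_realpow[symmetric] powr_powr)
 have C0: "0 <= C" using C[of 0 undefined] by (rule order_trans[rotated]) simp
 have inc: "norm (low_pass \<rho> (Suc j) f x - low_pass \<rho> j f x) <= C * q ^ j" for j
 proof -
  have "2 powr (\<alpha> * real j) * norm (low_pass \<rho> (Suc j) f x - low_pass \<rho> j f x) <= C"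
   using C[of "Suc j" x] unfolding lp_block_Suc[OF \<rho> f] by simp
  then have "q ^ j * (2 powr (\<alpha> * real j) * norm (low_pass \<rho> (Suc j) f x - low_pass \<rho> j f x)) <= q ^ j * C"
   using q by (intro mult_left_mono) auto
  moreover have "q ^ j * 2 powr (\<alpha> * real j) = 1" by (simp add: q'[symmetric] powr_add[symmetric])
  ultimately show ?thesis by (simp add: mult.assoc[symmetric] mult.commute)
 qed
 have "norm (low_pass \<rho> (N + m) f x - low_pass \<rho> N f x) <= C / (1 - q) * (q ^ N - q ^ (N + m))" for m
 proof (induction m)
  case (Suc m)
  have "norm (low_pass \<rho> (N + Suc m) f x - low_pass \<rho> N f x) <=
   norm (low_pass \<rho> (Suc (N + m)) f x - low_pass \<rho> (N + m) f x) + norm (low_pass \<rho> (N + m) f x - low_pass \<rho> N f x)"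
   using norm_triangle_ineq[of "low_pass \<rho> (Suc (N + m)) f x - low_pass \<rho> (N + m) f x" "low_pass \<rho> (N + m) f x - low_pass \<rho> N f x"] by simp
  also have "... <= C * q ^ (N + m) + C / (1 - q) * (q ^ N - q ^ (N + m))" by (rule add_mono[OF inc Suc])
  also have "... = C / (1 - q) * (q ^ N - q ^ (N + Suc m))" using q by (simp add: field_simps)
  finally show ?case .
 qed simp
 also have "C / (1 - q) * (q ^ N - q ^ (N + m)) <= C / (1 - q) * q ^ N" for m using q C0 by (intro mult_left_mono) auto
 finally have b: "norm (low_pass \<rho> (N + m) f x - low_pass \<rho> N f x) <= C / (1 - q) * q ^ N" for m .
 have "(%m. low_pass \<rho> (N + m) f x) \<longlonglongrightarrow> f x"
  using LIMSEQ_ignore_initial_segment[OF low_pass_tendsto[OF \<rho> f], of N] by (simp add: add.commute)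
 then have "(%m. norm (low_pass \<rho> (N + m) f x - low_pass \<rho> N f x)) \<longlonglongrightarrow> norm (f x - low_pass \<rho> N f x)"
  by (intro tendsto_intros)
 then have "norm (f x - low_pass \<rho> N f x) <= C / (1 - q) * q ^ N" by (rule LIMSEQ_le_const2) (use b in blast)
 then show ?thesis unfolding q' by (simp add: q_def)
qed

text \<open>Moving the argument translates the kernel by 2^N (x - y). Both kernels have integral
  one, so \<open>f x\<close> may be subtracted, and only increments of \<open>f\<close> over
  distances |u| / 2^N enter, at the price of a weight \<open>1 + norm u\<close>. The constant
  \<open>K\<close> precedes \<open>M\<close>, as the bound is iterated with changing
  \<open>M\<close>.\<close>

lemma low_pass_increment:
 assumes \<rho>: "lp_profile \<rho>" and \<delta>: "0 < \<delta>" "\<delta> < 1"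
 obtains K where "0 <= K"
  "!!(f::'a::euclidean_space => 'b::euclidean_space) B M \<beta> \<eta> N x y. continuous_on UNIV f ==> (!!x. norm (f x) <= B) ==>
   0 < \<beta> ==> \<beta> < 1 ==> 0 <= M ==> 0 <= \<eta> ==> (!!x y. norm (f x - f y) <= M * (norm (x - y) powr \<beta> + \<eta>)) ==>
   norm (2 ^ N *\<^sub>R (x - y)) <= 1 ==>
   norm (low_pass \<rho> N f x - low_pass \<rho> N f y) <= K * norm (2 ^ N *\<^sub>R (x - y)) powr \<delta> * (M * ((1 / 2 ^ N) powr \<beta> + \<eta>))"
proof -
 let ?k = "lp_kernel \<rho> 0 :: 'a => real"
 obtain C where C: "0 <= C" "!!u h::'a. norm h <= 1 ==>
   \<bar>?k (u - h) - ?k u\<bar> * (1 + norm u) <= C * norm h powr \<delta> * (1 / (1 + norm u) ^ Suc DIM('a))"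
  using lp_kernel_0_difference[OF \<rho> \<delta>] by blast
 define V where "V = (LBINT u. 1 / (1 + norm (u::'a)) ^ Suc DIM('a))"
 have Vi: "integrable lborel (%u::'a. 1 / (1 + norm u) ^ Suc DIM('a))" by (rule integrable_inverse_polynomial_norm) simp
 have V0: "0 <= V" unfolding V_def by (rule L_integral_nonneg) simp
 show thesis
 proof
  show "0 <= C * V" using C V0 by simp
  fix f :: "'a => 'b" and B M \<beta> \<eta> :: real and N :: nat and x y :: 'a
  assume f: "continuous_on UNIV f" "!!x. norm (f x) <= B" and \<beta>: "0 < \<beta>" "\<beta> < 1" and M: "0 <= M" "0 <= \<eta>"
   and H: "!!x y. norm (f x - f y) <= M * (norm (x - y) powr \<beta> + \<eta>)"
   and h1: "norm (2 ^ N *\<^sub>R (x - y)) <= 1"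
  define h where "h = 2 ^ N *\<^sub>R (x - y)"
  have fm [measurable]: "f : borel_measurable borel" using f(1) by (rule borel_measurable_continuous_onI)
  have km [measurable]: "?k : borel_measurable borel" by (rule lp_kernel_0_measurable[OF \<rho>])
  note k = lp_kernel_0_integral[OF \<rho>, where 'a = 'a]
  have kh: "integrable lborel (%u. ?k (u - h))" using lborel_integrable_shift[OF k(1), of "- h"] by simp
  have kh1: "(LBINT u. ?k (u - h)) = 1" using lborel_integral_shift[OF km, of "- h"] k(2) by simp
  let ?f = "%u. f (x - u /\<^sub>R 2 ^ N)"
  have fN: "?f : borel_measurable borel" by measurable
  have i1: "integrable lborel (%u. ?k u *\<^sub>R ?f u)" "integrable lborel (%u. ?k (u - h) *\<^sub>R ?f u)"
   by (rule integrable_scaleR_bounded[OF k(1) fN], rule f, rule integrable_scaleR_bounded[OF kh fN], rule f)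
  have y: "low_pass \<rho> N f y = (LBINT u. ?k (u - h) *\<^sub>R ?f u)"
  proof -
   have "(LBINT u. (%v. ?k (v - h) *\<^sub>R ?f v) (u + h)) = (LBINT u. ?k (u - h) *\<^sub>R ?f u)" by (rule lborel_integral_shift) measurable
   moreover have "x - (u + h) /\<^sub>R 2 ^ N = y - u /\<^sub>R 2 ^ N" for u by (simp add: h_def scaleR_add_right)
   ultimately show ?thesis by (simp add: low_pass_def)
  qed
  let ?B = "LBINT u. (?k u *\<^sub>R ?f u - ?k (u - h) *\<^sub>R ?f u) - (?k u - ?k (u - h)) *\<^sub>R f x"
  have "low_pass \<rho> N f x - low_pass \<rho> N f y = (LBINT u. ?k u *\<^sub>R ?f u - ?k (u - h) *\<^sub>R ?f u)"
   unfolding y unfolding low_pass_def by (rule L_integral_diff[symmetric, OF i1])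
  also have "... = ?B"
  proof -
   have "integrable lborel (%u. ?k u - ?k (u - h))" by (rule L_integrable_diff[OF k(1) kh])
   moreover have "(LBINT u. ?k u - ?k (u - h)) = 0" using L_integral_diff[OF k(1) kh] k(2) kh1 by simp
   moreover note L_integrable_diff[OF i1]
   ultimately show ?thesis by (subst L_integral_diff) auto
  qed
  finally have eq: "low_pass \<rho> N f x - low_pass \<rho> N f y = ?B" .
  let ?A = "(1 / 2 ^ N) powr \<beta> + \<eta>"
  have "norm (low_pass \<rho> N f x - low_pass \<rho> N f y) <=
   (LBINT u. (C * norm h powr \<delta> * (M * ?A)) * (1 / (1 + norm (u::'a)) ^ Suc DIM('a)))" unfolding eq
  proof (rule order_trans[OF integral_norm_bound integral_mono])
   show "integrable lborel (%u. norm ((?k u *\<^sub>R ?f u - ?k (u - h) *\<^sub>R ?f u) - (?k u - ?k (u - h)) *\<^sub>R f x))"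
    by (intro integrable_norm L_integrable_diff i1 integrable_scaleR_left k kh)
   show "integrable lborel (%u::'a. (C * norm h powr \<delta> * (M * ?A)) * (1 / (1 + norm u) ^ Suc DIM('a)))"
    by (rule integrable_mult_right[OF Vi])
   fix u :: 'a
   have "(?k u *\<^sub>R ?f u - ?k (u - h) *\<^sub>R ?f u) - (?k u - ?k (u - h)) *\<^sub>R f x = (?k u - ?k (u - h)) *\<^sub>R (?f u - f x)"
    by (simp add: algebra_simps)
   then have "norm ((?k u *\<^sub>R ?f u - ?k (u - h) *\<^sub>R ?f u) - (?k u - ?k (u - h)) *\<^sub>R f x) = \<bar>?k (u - h) - ?k u\<bar> * norm (?f u - f x)"
    by (simp add: abs_minus_commute)
   also have "... <= \<bar>?k (u - h) - ?k u\<bar> * (M * ?A * (1 + norm u))"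
   proof (rule mult_left_mono)
    have "norm ((x - u /\<^sub>R 2 ^ N) - x) powr \<beta> = (1 / 2 ^ N) powr \<beta> * norm u powr \<beta>"
     by (simp add: inverse_eq_divide powr_divide)
    then have "norm (?f u - f x) <= M * ((1 / 2 ^ N) powr \<beta> * norm u powr \<beta> + \<eta>)" using H[of "x - u /\<^sub>R 2 ^ N" x] by simp
    also have "... <= M * ((1 / 2 ^ N) powr \<beta> * (1 + norm u) + \<eta> * (1 + norm u))"
    proof (intro mult_left_mono add_mono M)
     have "norm u powr \<beta> <= (1 + norm u) powr \<beta>" using \<beta> by (intro powr_mono2) auto
     also have "... <= (1 + norm u) powr 1" using \<beta> by (intro powr_mono) auto
     finally show "norm u powr \<beta> <= 1 + norm u" by simp
     show "\<eta> <= \<eta> * (1 + norm u)" using M by (simp add: distrib_left)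
    qed auto
    also have "... = M * ?A * (1 + norm u)" by (simp add: algebra_simps)
    finally show "norm (?f u - f x) <= M * ?A * (1 + norm u)" .
   qed simp
   also have "... = (\<bar>?k (u - h) - ?k u\<bar> * (1 + norm u)) * (M * ?A)" by simp
   also have "... <= (C * norm h powr \<delta> * (1 / (1 + norm u) ^ Suc DIM('a))) * (M * ?A)"
    using C(2)[of h u] h1 M unfolding h_def[symmetric] by (intro mult_right_mono) auto
   finally show "norm ((?k u *\<^sub>R ?f u - ?k (u - h) *\<^sub>R ?f u) - (?k u - ?k (u - h)) *\<^sub>R f x) <=
    (C * norm h powr \<delta> * (M * ?A)) * (1 / (1 + norm u) ^ Suc DIM('a))" by (simp only: mult_ac)
  qed
  also have "... = (C * norm h powr \<delta> * (M * ?A)) * V" unfolding V_def by (rule integral_mult_right_zero)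
  finally show "norm (low_pass \<rho> N f x - low_pass \<rho> N f y) <= C * V * norm (2 ^ N *\<^sub>R (x - y)) powr \<delta> * (M * ?A)"
   unfolding h_def by (simp only: mult_ac)
 qed
qed

text \<open>With $2^N |x - y|$ a small constant, a Hoelder bound with constant \<open>M\<close> improves itself to one
 with constant \<open>A + M / 2\<close>. The error \<open>\<eta>\<close> makes some constant available at the start.\<close>

lemma besov_holder_imp_holder:
 fixes f :: "'a::euclidean_space => 'b::euclidean_space"
 assumes f: "f : besov_holder \<alpha>" and \<beta>: "0 < \<beta>" "\<beta> < 1" "\<beta> <= \<alpha>"
 obtains C where "0 <= C" "!!x y. norm (f x - f y) <= C * norm (x - y) powr \<beta>"
proof -
 obtain \<rho> C where fc: "continuous_on UNIV f" and fb: "bounded (range f)" and \<rho>: "lp_profile \<rho>"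
  and C: "!!j x. 2 powr (\<alpha> * (real j - 1)) * norm (lp_block \<rho> j f x) <= C" using f unfolding besov_holder_def by blast
 obtain B where B: "!!x. norm (f x) <= B" using fb by (auto simp: bounded_iff)
 have B0: "0 <= B" using norm_ge_zero B order_trans by blast
 have \<alpha>: "0 < \<alpha>" using \<beta> by simp
 \<comment> \<open>The exponent has to lie strictly between \<beta> and 1: the positive power
   \<delta> - \<beta> of the small ratio \<open>len\<close> is the gain that closes the
   argument.\<close>
 define \<delta> where "\<delta> = (1 + \<beta>) / 2"
 have \<delta>: "0 < \<delta>" "\<delta> < 1" "\<beta> < \<delta>" using \<beta> by (auto simp: \<delta>_def)
 define C' where "C' = C / (1 - 2 powr (- \<alpha>))"
 note LP = besov_holder_low_pass[OF \<rho> fc B C \<alpha>, folded C'_def]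
 have C0: "0 <= C'" using order_trans[OF norm_ge_zero LP[of undefined 0]] by simp
 obtain K where K: "0 <= K"
  "!!M \<eta> N x y. 0 <= M ==> 0 <= \<eta> ==> (!!x y. norm (f x - f y) <= M * (norm (x - y) powr \<beta> + \<eta>)) ==>
   norm (2 ^ N *\<^sub>R (x - y)) <= 1 ==>
   norm (low_pass \<rho> N f x - low_pass \<rho> N f y) <= K * norm (2 ^ N *\<^sub>R (x - y)) powr \<delta> * (M * ((1 / 2 ^ N) powr \<beta> + \<eta>))"
  using low_pass_increment[OF \<rho> \<delta>(1,2), where 'a = 'a and 'b = 'b] fc B \<beta> by metis
 let ?F = "\<delta> - \<beta>"
 \<comment> \<open>\<open>len\<close> bounds 2^N |x - y|. The choice limits the contribution of the
   low frequencies to half of the old constant \<open>M\<close>.\<close>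
 obtain len where len: "0 < len" "len <= 1" "2 * K * len powr ?F <= 1/2"
 proof -
  have "((%l. 2 * K * l powr ?F) \<longlongrightarrow> 2 * K * 0) (at_right 0)"
   proof (intro tendsto_mult tendsto_const tendsto_zero_powrI[OF _ tendsto_const])
   show "((%x. x) \<longlongrightarrow> (0::real)) (at_right 0)" by (rule tendsto_ident_at)
   show "eventually (%x::real. 0 <= x) (at_right 0)" by (rule eventually_mono[OF eventually_at_right_less]) simp
  qed (use \<delta> in simp)
  then have "eventually (%l. 2 * K * l powr ?F < 1/2) (at_right 0)" by (rule order_tendstoD) simp
  moreover have "eventually (%l::real. l : {0<..<1}) (at_right 0)" by (rule eventually_at_right_real) simp
  ultimately have "eventually (%l. 2 * K * l powr ?F < 1/2 & l : {0<..<1}) (at_right 0)" by eventually_elim simp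
  then obtain l where "2 * K * l powr ?F < 1/2 & l : {0<..<1}" using eventually_happens trivial_limit_at_right_real by blast
  then show thesis by (intro that[of l]) auto
 qed
 \<comment> \<open>The parts that do not involve \<open>M\<close>: the two approximation errors for
   close points, and twice the bound of \<open>f\<close> for points at distance more than
   \<open>len\<close>.\<close>
 define A where "A = (4 * C' + 2 * B) * len powr (- \<beta>)"
 have A0: "0 <= A" using C0 B0 by (simp add: A_def)
 have step: "norm (f x - f y) <= (A + M / 2) * (norm (x - y) powr \<beta> + \<eta>)"
  if M: "0 <= M" and \<eta>: "0 <= \<eta>" and H: "!!x y. norm (f x - f y) <= M * (norm (x - y) powr \<beta> + \<eta>)" for M \<eta> x y
 proof -
  define r where "r = norm (x - y)"
  let ?A = "len powr (- \<beta>) * r powr \<beta>"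
  let ?B = "r powr \<beta> + \<eta>"
  consider "r = 0" | "0 < r" "r <= len" | "len < r" by (force simp: r_def)
  then show ?thesis
  proof cases
   case 1
   then show ?thesis using A0 M \<eta> by (simp add: r_def)
  next
   case 3
   have "norm (f x - f y) <= 2 * B" using B[of x] B[of y] norm_triangle_ineq4[of "f x" "f y"] by linarith
   also have "2 * B <= (4 * C' + 2 * B) * 1" using C0 by simp
   also have "... <= (4 * C' + 2 * B) * ?A"
   proof (rule mult_left_mono)
    have "1 = len powr (- \<beta>) * len powr \<beta>" using len by (simp flip: powr_add)
    also have "... <= len powr (- \<beta>) * r powr \<beta>" using 3 len \<beta> by (intro mult_left_mono powr_mono2) auto
    finally show "1 <= len powr (- \<beta>) * r powr \<beta>" .
   qed (use C0 B0 in simp)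
   also have "... = A * r powr \<beta>" by (simp add: A_def)
   also have "... <= (A + M / 2) * ?B" using A0 M \<eta> by (intro mult_mono) auto
   finally show ?thesis by (simp add: r_def)
  next
   case 2
   have "EX N. len < 2 ^ N * r" using real_arch_pow[of 2 "len / r"] 2 by (auto simp: pos_divide_less_eq)
   then have L: "len < 2 ^ (LEAST N. len < 2 ^ N * r) * r" by (rule LeastI_ex)
   \<comment> \<open>\<open>N\<close> is the last level with 2^N r <= len, so that 2^(-N) is
     comparable to r / len.\<close>
   obtain N where N: "(LEAST N. len < 2 ^ N * r) = Suc N" using L 2 by (cases "LEAST N. len < 2 ^ N * r") auto
   have N1: "len < 2 * (2 ^ N * r)" using L unfolding N by simp
   have N2: "2 ^ N * r <= len" using not_less_Least[of N "%N. len < 2 ^ N * r"] unfolding N by simp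
   have "1 / 2 ^ N <= 2 * r / len" using N1 len by (simp add: field_simps)
   then have "(1 / 2 ^ N) powr \<beta> <= (2 * r / len) powr \<beta>" using \<beta> by (intro powr_mono2) auto
   also have "... = 2 powr \<beta> * ?A"
    
    using powr_divide[of "2 * r" len \<beta>] powr_mult[of 2 r \<beta>] powr_minus_divide[of len \<beta>] 2 len by simp
   also have "... <= 2 * ?A" using \<beta> powr_mono[of \<beta> 1 2] by (intro mult_right_mono) auto
   finally have pN: "(1 / 2 ^ N) powr \<beta> <= 2 * ?A" .
   have hN: "norm (2 ^ N *\<^sub>R (x - y)) = 2 ^ N * r" by (simp add: r_def)
   let ?E = "- \<alpha> * N"
   have "norm (f x - f y) <= norm (f x - low_pass \<rho> N f x) + norm (f y - low_pass \<rho> N f y) + norm (low_pass \<rho> N f x - low_pass \<rho> N f y)"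
    by norm
   also have "... <= C' * 2 powr ?E + C' * 2 powr ?E + K * (2 ^ N * r) powr \<delta> * (M * ((1 / 2 ^ N) powr \<beta> + \<eta>))"
    using K(2)[OF M \<eta> H, of N x y] N2 len unfolding hN by (intro add_mono LP) auto
   also have "... <= A * ?B + M / 2 * ?B"
   proof (rule add_mono)
    have "2 powr ?E <= 2 powr (- \<beta> * N)" using \<beta> by (intro powr_mono) (auto simp: mult_right_mono)
    also have "... = (1 / 2 ^ N) powr \<beta>"
    proof -
     have "1 / 2 ^ N = 2 powr (- real N)" by (simp add: powr_minus powr_realpow inverse_eq_divide)
     then show ?thesis by (simp add: powr_powr mult.commute)
    qed
    finally have "2 powr ?E <= 2 * ?A" using pN by simp
    then have "C' * 2 powr ?E <= C' * (2 * ?A)" using C0 by (rule mult_left_mono)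
    then have "C' * 2 powr ?E + C' * 2 powr ?E <= 4 * C' * ?A" by (simp add: mult_ac)
    also have "... <= (4 * C' + 2 * B) * ?A" using B0 by (intro mult_right_mono) auto
    also have "... = A * r powr \<beta>" by (simp add: A_def)
    also have "... <= A * ?B" using A0 \<eta> by (intro mult_left_mono) auto
    finally show "C' * 2 powr ?E + C' * 2 powr ?E <= A * ?B" .
    have "(1 / 2 ^ N) powr \<beta> + \<eta> <= 2 * len powr (- \<beta>) * ?B"
    proof -
     have "1 powr (- \<beta>) <= len powr (- \<beta>)" using len \<beta> by (intro powr_mono2') auto
     then have "\<eta> * 1 <= \<eta> * (2 * len powr (- \<beta>))" using \<eta> by (intro mult_left_mono) auto
     then show ?thesis using pN by (simp add: distrib_left mult_ac)
    qed
    then have "K * (2 ^ N * r) powr \<delta> * (M * ((1 / 2 ^ N) powr \<beta> + \<eta>)) <= K * len powr \<delta> * (M * (2 * len powr (- \<beta>) * ?B))"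
     using K(1) M 2 N2 \<delta> \<eta> by (intro mult_mono mult_left_mono powr_mono2) auto
    also have "... = (2 * K * len powr ?F) * (M * ?B)" by (simp add: powr_diff powr_minus divide_inverse)
    also have "... <= 1/2 * (M * ?B)" using len M \<eta> by (intro mult_right_mono) auto
    finally show "K * (2 ^ N * r) powr \<delta> * (M * ((1 / 2 ^ N) powr \<beta> + \<eta>)) <= M / 2 * ?B" by simp
   qed
   also have "... = (A + M / 2) * ?B" by (simp add: distrib_right)
   finally show ?thesis by (simp add: r_def)
  qed
 qed
 have fin: "norm (f x - f y) <= 2 * A * (norm (x - y) powr \<beta> + \<eta>)" if \<eta>: "0 < \<eta>" for \<eta> x y
 proof -
  \<comment> \<open>Boundedness gives a first constant, since an increment is at most 2 B = M0
    \<eta>. Iterating \<open>step\<close> halves its excess over \<open>2 * A\<close>, and only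
    afterwards does \<eta> tend to 0.\<close>
  define M0 where "M0 = 2 * B / \<eta>"
  have M0: "0 <= M0" using B0 \<eta> by (simp add: M0_def)
  have it: "norm (f x - f y) <= (2 * A + M0 / 2 ^ n) * (norm (x - y) powr \<beta> + \<eta>)" for n x y
  proof (induction n arbitrary: x y)
   case 0
   have "norm (f x - f y) <= 2 * B" using B[of x] B[of y] norm_triangle_ineq4[of "f x" "f y"] by linarith
   also have "... = M0 * \<eta>" using \<eta> by (simp add: M0_def)
   also have "... <= (2 * A + M0 / 2 ^ 0) * (norm (x - y) powr \<beta> + \<eta>)" using M0 A0 \<eta> by (intro mult_mono) auto
   finally show ?case .
  next
   case (Suc n)
   have "norm (f x - f y) <= (A + (2 * A + M0 / 2 ^ n) / 2) * (norm (x - y) powr \<beta> + \<eta>)"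
    by (rule step[OF _ _ Suc]) (use M0 A0 \<eta> in auto)
   then show ?case by (simp add: add_divide_distrib mult.commute)
  qed
  have "(%n. (2 * A + M0 * (1/2) ^ n) * (norm (x - y) powr \<beta> + \<eta>)) \<longlonglongrightarrow> (2 * A + M0 * 0) * (norm (x - y) powr \<beta> + \<eta>)"
   by (intro tendsto_intros LIMSEQ_realpow_zero) auto
  then have "norm (f x - f y) <= (2 * A + M0 * 0) * (norm (x - y) powr \<beta> + \<eta>)"
   by (rule LIMSEQ_le_const) (use it[of x y] in \<open>auto simp: power_one_over\<close>)
  then show ?thesis by simp
 qed
 show thesis
 proof
  show "0 <= 2 * A" using A0 by simp
  fix x y :: 'a
  have "((%\<eta>. 2 * A * (norm (x - y) powr \<beta> + \<eta>)) \<longlongrightarrow> 2 * A * (norm (x - y) powr \<beta> + 0)) (at_right 0)"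
   by (intro tendsto_intros)
  moreover have "eventually (%\<eta>. norm (f x - f y) <= 2 * A * (norm (x - y) powr \<beta> + \<eta>)) (at_right 0)"
   using fin by (auto simp: eventually_at_right_less intro: eventually_mono[OF eventually_at_right_less])
  ultimately have "norm (f x - f y) <= 2 * A * (norm (x - y) powr \<beta> + 0)" by (intro tendsto_lowerbound) auto
  then show "norm (f x - f y) <= 2 * A * norm (x - y) powr \<beta>" by simp
 qed
qed

section \<open>Lipschitz averages and uniqueness\<close>

definition grid_pt :: "nat => ('n::finite => int) => real ^ 'n" where
 "grid_pt n z = (\<chi> i. real_of_int (z i) / 2 ^ n)"

definition in_box :: "nat => nat => ('n => int) => bool" where
 "in_box \<rho> n z \<longleftrightarrow> (ALL i. \<bar>z i\<bar> <= int \<rho> * 2 ^ n)"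

definition edge_bound :: "nat => (real ^ 'n => real) => nat => real => bool" where
 "edge_bound \<rho> D n c \<longleftrightarrow> (ALL z j. in_box \<rho> n z & in_box \<rho> n (z(j := z j + 1)) -->
  \<bar>D (grid_pt n (z(j := z j + 1))) - D (grid_pt n z)\<bar> <= c)"

lemma grid_pt_double: "grid_pt (Suc n) (%i. 2 * z i) = grid_pt n z" by (simp add: grid_pt_def vec_eq_iff)

lemma in_box_double: "in_box \<rho> (Suc n) (%i. 2 * z i) = in_box \<rho> n z" by (simp add: in_box_def abs_mult)

lemma in_box_upd: "in_box \<rho> n z ==> \<bar>a\<bar> <= int \<rho> * 2 ^ n ==> in_box \<rho> n (z(j := a))" by (auto simp: in_box_def)

text \<open>If all transverse coordinates are even, the edge is half of a coarse edge, and the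
  second difference at the midpoint compares the two halves. If a transverse coordinate is odd, both
  end points are compared with the averages of their neighbours in that direction, which leads to
  two parallel edges with one odd coordinate less. Hence the induction on the number
  \<open>s\<close> of odd transverse coordinates, each of which costs one \<zeta>.\<close>

lemma edge_bound_refine:
 fixes D :: "real ^ 'n => real"
 assumes E: "edge_bound \<rho> D n c" and c: "0 <= \<zeta>"
  and sd: "!!z j. in_box \<rho> (Suc n) z ==> \<bar>z j\<bar> < int \<rho> * 2 ^ Suc n ==>
   \<bar>D (grid_pt (Suc n) (z(j := z j + 1))) + D (grid_pt (Suc n) (z(j := z j - 1)))
    - 2 * D (grid_pt (Suc n) z)\<bar> <= \<zeta>"
 shows "edge_bound \<rho> D (Suc n) (c / 2 + (real CARD('n) + 1) * \<zeta>)"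
proof -
 let ?P = "grid_pt (Suc n)"
 \<comment> \<open>The faces of the box have even indices at level \<open>Suc n\<close>, so the
   neighbours of an odd coordinate stay in the box.\<close>
 have odd_strict: "\<bar>z i\<bar> < int \<rho> * 2 ^ Suc n" if "odd (z i)" "in_box \<rho> (Suc n) z" for z and i :: 'n
 proof -
  have "\<bar>z i\<bar> <= int \<rho> * 2 ^ Suc n" using that by (auto simp: in_box_def)
  moreover have "\<bar>z i\<bar> ~= int \<rho> * 2 ^ Suc n"
  proof
   assume "\<bar>z i\<bar> = int \<rho> * 2 ^ Suc n"
   then have "even \<bar>z i\<bar>" by simp
   with that(1) show False by simp
  qed
  ultimately show ?thesis by simp
 qed
 have key: "\<bar>D (?P (z(j := z j + 1))) - D (?P z)\<bar> <= c / 2 + (real s + 1) * \<zeta>"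
  if "card {i. i ~= j & odd (z i)} = s" "in_box \<rho> (Suc n) z" "in_box \<rho> (Suc n) (z(j := z j + 1))" for s z and j :: 'n using that
 proof (induction s arbitrary: z)
  case 0
  then have ev: "even (z i)" if "i ~= j" for i using that by auto
  have half: "\<bar>D (?P (y(j := y j + 2))) - D (?P y)\<bar> <= c"
   if y: "!!i. even (y i)" "in_box \<rho> (Suc n) y" "in_box \<rho> (Suc n) (y(j := y j + 2))" for y
  proof -
   define y' where "y' i = y i div 2" for i
   have 1: "y = (%i. 2 * y' i)" using y by (auto simp: y'_def)
   have 2: "y(j := y j + 2) = (%i. 2 * (y'(j := y' j + 1)) i)" by (auto simp: 1)
   show ?thesis using E y(2,3) unfolding 2 unfolding 1 grid_pt_double in_box_double edge_bound_def by blast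
  qed
  show ?case
  proof (cases "even (z j)")
   case True
   define u where "u = z(j := z j + 1)"
   have ub: "in_box \<rho> (Suc n) u" using 0(3) unfolding u_def .
   have us: "\<bar>u j\<bar> < int \<rho> * 2 ^ Suc n" using odd_strict[of u j] ub True by (simp add: u_def)
   have s1: "\<bar>D (?P (u(j := u j + 1))) + D (?P (u(j := u j - 1))) - 2 * D (?P u)\<bar> <= \<zeta>" by (rule sd[OF ub us])
   have e1: "u(j := u j + 1) = z(j := z j + 2)" "u(j := u j - 1) = z" by (auto simp: u_def)
   have "\<bar>D (?P (z(j := z j + 2))) - D (?P z)\<bar> <= c"
   proof (rule half)
    show "even (z i)" for i using ev True by (cases "i = j") auto
    show "in_box \<rho> (Suc n) z" by fact
    have "\<bar>u j + 1\<bar> <= int \<rho> * 2 ^ Suc n" using us by linarith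
    then show "in_box \<rho> (Suc n) (z(j := z j + 2))" using in_box_upd[OF ub, of "u j + 1" j] e1 by simp
   qed
   then show ?thesis using s1[unfolded e1, unfolded u_def] c by (simp only: of_nat_0 add_0 mult_1_left)
  next
   case False
   have us: "\<bar>z j\<bar> < int \<rho> * 2 ^ Suc n" using odd_strict[of z j] False 0 by simp
   have s1: "\<bar>D (?P (z(j := z j + 1))) + D (?P (z(j := z j - 1))) - 2 * D (?P z)\<bar> <= \<zeta>" by (rule sd[of z j, OF _ us]) fact
   let ?y = "z(j := z j - 1)"
   have e1: "?y(j := ?y j + 2) = z(j := z j + 1)" by auto
   have "\<bar>D (?P (?y(j := ?y j + 2))) - D (?P ?y)\<bar> <= c"
   proof (rule half)
    show "even (?y i)" for i using ev False by (cases "i = j") auto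
    have "\<bar>z j - 1\<bar> <= int \<rho> * 2 ^ Suc n" using us by linarith
    then show "in_box \<rho> (Suc n) ?y" by (rule in_box_upd[OF 0(2)])
    show "in_box \<rho> (Suc n) (?y(j := ?y j + 2))" unfolding e1 by fact
   qed
   then show ?thesis using s1[unfolded e1] c unfolding e1 by (simp only: of_nat_0 add_0 mult_1_left)
  qed
 next
  case (Suc s)
  then obtain i where i: "i ~= j" "odd (z i)" by (metis (mono_tags, lifting) Collect_empty_eq card.empty nat.distinct(1))
  let ?u = "z(j := z j + 1)"
  have zi: "\<bar>z i\<bar> < int \<rho> * 2 ^ Suc n" using odd_strict i Suc by blast
  have s1: "\<bar>D (?P (z(i := z i + 1))) + D (?P (z(i := z i - 1))) - 2 * D (?P z)\<bar> <= \<zeta>" by (rule sd[of z i, OF _ zi]) fact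
  have s2: "\<bar>D (?P (?u(i := z i + 1))) + D (?P (?u(i := z i - 1))) - 2 * D (?P ?u)\<bar> <= \<zeta>" using sd[of ?u i] zi i Suc by simp
  have e: "\<bar>D (?P (?u(i := a))) - D (?P (z(i := a)))\<bar> <= c / 2 + (real s + 1) * \<zeta>" if a: "a = z i + 1 \<or> a = z i - 1" for a
  proof -
   let ?v = "z(i := a)"
   have eq: "?u(i := a) = ?v(j := ?v j + 1)" using i by auto
   have "even a" using a i by auto
   then have "{k. k ~= j & odd (?v k)} = {k. k ~= j & odd (z k)} - {i}" by auto
   then have 1: "card {k. k ~= j & odd (?v k)} = s" using Suc i by simp
   have a': "\<bar>a\<bar> <= int \<rho> * 2 ^ Suc n" using a zi by linarith
   have 2: "in_box \<rho> (Suc n) ?v" by (rule in_box_upd[OF _ a']) fact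
   have 3: "in_box \<rho> (Suc n) (?v(j := ?v j + 1))" unfolding eq[symmetric] by (rule in_box_upd[OF _ a']) fact
   show ?thesis using Suc.IH[OF 1 2 3] unfolding eq .
  qed
  have e1: "\<bar>D (?P (?u(i := z i + 1))) - D (?P (z(i := z i + 1)))\<bar> <= c / 2 + (real s + 1) * \<zeta>"
   and e2: "\<bar>D (?P (?u(i := z i - 1))) - D (?P (z(i := z i - 1)))\<bar> <= c / 2 + (real s + 1) * \<zeta>" using e by blast+
  have "(real (Suc s) + 1) * \<zeta> = (real s + 1) * \<zeta> + \<zeta>" by (simp add: algebra_simps)
  then show ?case using s1 s2 e1 e2 by linarith
 qed
 show ?thesis unfolding edge_bound_def
 proof (intro allI impI)
  fix z and j :: 'n
  assume z: "in_box \<rho> (Suc n) z & in_box \<rho> (Suc n) (z(j := z j + 1))"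
  let ?s = "card {i. i ~= j & odd (z i)}"
  have "?s <= CARD('n)" by (rule card_mono) auto
  then have "(real ?s + 1) * \<zeta> <= (real CARD('n) + 1) * \<zeta>" using c by (intro mult_right_mono) auto
  then show "\<bar>D (?P (z(j := z j + 1))) - D (?P z)\<bar> <= c / 2 + (real CARD('n) + 1) * \<zeta>" using key[of j z, OF refl] z by linarith
 qed
qed

text \<open>Multiplied by 2^n, the edge bounds grow from level to level by a multiple of q^n only
  and stay bounded. Without the factor q they would grow linearly in n, as for general Zygmund
  functions.\<close>

lemma edge_bound_dyadic:
 fixes D :: "real ^ 'n => real"
 assumes bd: "!!y. \<bar>D y\<bar> <= B" and q: "0 < q" "q < 1" and z: "0 <= \<zeta>"
  and sd: "!!n z j. in_box \<rho> n z ==> \<bar>z j\<bar> < int \<rho> * 2 ^ n ==>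
   \<bar>D (grid_pt n (z(j := z j + 1))) + D (grid_pt n (z(j := z j - 1)))
    - 2 * D (grid_pt n z)\<bar> <= \<zeta> * (q / 2) ^ n"
 shows "edge_bound \<rho> D n ((2 * B + (real CARD('n) + 1) * \<zeta> / (1 - q)) / 2 ^ n)"
proof -
 let ?d = "(real CARD('n) + 1) * \<zeta>"
 have "edge_bound \<rho> D n ((2 * B + ?d * (SUM k<=n. q ^ k)) / 2 ^ n)"
 proof (induction n)
  case 0
  have "\<bar>D y - D y'\<bar> <= 2 * B + ?d" for y y' using bd[of y] bd[of y'] mult_nonneg_nonneg[OF _ z, of "real CARD('n) + 1"] by simp
  then show ?case by (auto simp: edge_bound_def)
 next
  case (Suc n)
  have "edge_bound \<rho> D (Suc n) (((2 * B + ?d * (SUM k<=n. q ^ k)) / 2 ^ n) / 2 +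
    (real CARD('n) + 1) * (\<zeta> * (q / 2) ^ Suc n))" by (rule edge_bound_refine[OF Suc _ sd]) (use q z in auto)
  moreover have "((2 * B + ?d * (SUM k<=n. q ^ k)) / 2 ^ n) / 2 +
    (real CARD('n) + 1) * (\<zeta> * (q / 2) ^ Suc n) = (2 * B + ?d * (SUM k<=Suc n. q ^ k)) / 2 ^ Suc n" by (simp add: field_simps power_divide)
  ultimately show ?case by simp
 qed
 moreover have "(SUM k<=n. q ^ k) <= 1 / (1 - q)" using q by (simp add: sum_gp0 field_simps)
 then have "?d * (SUM k<=n. q ^ k) <= ?d / (1 - q)" using mult_left_mono[of "(SUM k<=n. q ^ k)" "1 / (1 - q)" ?d] z by simp
 then have "(2 * B + ?d * (SUM k<=n. q ^ k)) / 2 ^ n <= (2 * B + ?d / (1 - q)) / 2 ^ n" by (intro divide_right_mono) auto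
 ultimately show ?thesis unfolding edge_bound_def by (meson order_trans)
qed

text \<open>A step of one coordinate towards its target stays in the box, so the end points are
  joined by as many edges as their l1 distance.\<close>

lemma edge_bound_path:
 fixes D :: "real ^ 'n => real"
 assumes E: "edge_bound \<rho> D n c"
  and "in_box \<rho> n z" "in_box \<rho> n z'"
 shows "\<bar>D (grid_pt n z') - D (grid_pt n z)\<bar> <= c * (SUM i:UNIV. real_of_int \<bar>z' i - z i\<bar>)" using assms(2,3)
proof (induction "nat (SUM i:UNIV. \<bar>z' i - z i\<bar>)" arbitrary: z z')
 case 0
 then have "(SUM i:UNIV. \<bar>z' i - z i\<bar>) = 0" using sum_nonneg[of UNIV "%i. \<bar>z' i - z i\<bar>"] by linarith
 then have "z' i - z i = 0" for i by (simp add: sum_nonneg_eq_0_iff)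
 then have "z' = z" by (simp add: fun_eq_iff)
 then show ?case by simp
next
 case (Suc s)
 have step: "\<bar>D (grid_pt n z') - D (grid_pt n z)\<bar> <= c * (SUM i:UNIV. real_of_int \<bar>z' i - z i\<bar>)" if lt: "z j < z' j" and z: "in_box \<rho> n z" "in_box \<rho> n z'"
   and s: "Suc s = nat (SUM i:UNIV. \<bar>z' i - z i\<bar>)"
   and IH: "!!z z'. s = nat (SUM i:UNIV. \<bar>z' i - z i\<bar>) ==> in_box \<rho> n z ==> in_box \<rho> n z' ==>
    \<bar>D (grid_pt n z') - D (grid_pt n z)\<bar> <= c * (SUM i:UNIV. real_of_int \<bar>z' i - z i\<bar>)" for z z' :: "'n => int" and j :: 'n
 proof -
  let ?u = "z(j := z j + 1)"
  have "\<bar>z j\<bar> <= int \<rho> * 2 ^ n" "\<bar>z' j\<bar> <= int \<rho> * 2 ^ n" using z unfolding in_box_def by blast+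
  then have "\<bar>z j + 1\<bar> <= int \<rho> * 2 ^ n" using lt by linarith
  then have u: "in_box \<rho> n ?u" by (rule in_box_upd[OF z(1)])
  have sm: "(SUM i:UNIV. \<bar>z' i - z i\<bar>) = (SUM i:UNIV. \<bar>z' i - ?u i\<bar>) + 1"
   unfolding sum.remove[OF finite_class.finite_UNIV UNIV_I, of _ j]
   using lt by (simp add: sum.cong[of "UNIV - {j}" _ "%i. \<bar>z' i - z i\<bar>" "%i. \<bar>z' i - ?u i\<bar>"])
  have smr: "(SUM i:UNIV. real_of_int \<bar>z' i - z i\<bar>) = (SUM i:UNIV. real_of_int \<bar>z' i - ?u i\<bar>) + 1"
   using arg_cong[OF sm, of real_of_int] by simp
  have "s = nat (SUM i:UNIV. \<bar>z' i - ?u i\<bar>)" using s sm by linarith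
  from IH[OF this u z(2)] have "\<bar>D (grid_pt n z') - D (grid_pt n ?u)\<bar> <= c * (SUM i:UNIV. real_of_int \<bar>z' i - ?u i\<bar>)" .
  moreover have "\<bar>D (grid_pt n ?u) - D (grid_pt n z)\<bar> <= c" using E z u unfolding edge_bound_def by blast
  ultimately show ?thesis unfolding smr distrib_left mult_1_right by linarith
 qed
 have "EX j. z' j ~= z j"
 proof (rule ccontr)
  assume "~ ?thesis"
  then show False using Suc(2) by simp
 qed
 then obtain j where "z' j ~= z j" by blast
 then consider "z j < z' j" | "z' j < z j" by linarith
 then show ?case
 proof cases
  case 1
  then show ?thesis by (rule step) (use Suc in auto)
 next
  case 2
  have "\<bar>D (grid_pt n z) - D (grid_pt n z')\<bar> <= c * (SUM i:UNIV. real_of_int \<bar>z i - z' i\<bar>)"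
   by (rule step[OF 2 Suc(4) Suc(3)]) (use Suc in \<open>auto simp: abs_minus_commute\<close>)
  then show ?thesis by (simp add: abs_minus_commute)
 qed
qed

text \<open>Only second differences at the matching dyadic scale enter, so that for a random \<open>D\<close>
 finitely many of them have to be controlled per scale.\<close>

lemma dyadic_zygmund_lipschitz:
 fixes D :: "real ^ 'n => real"
 assumes cont: "continuous_on UNIV D" and bd: "!!y. \<bar>D y\<bar> <= B"
  and q: "0 < q" "q < 1" and z: "0 <= \<zeta>"
  and sd: "!!n z j. in_box \<rho> n z ==> \<bar>z j\<bar> < int \<rho> * 2 ^ n ==>
   \<bar>D (grid_pt n (z(j := z j + 1))) + D (grid_pt n (z(j := z j - 1)))
    - 2 * D (grid_pt n z)\<bar> <= \<zeta> * (q / 2) ^ n"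
  and y: "!!i. \<bar>y $ i\<bar> < \<rho>" and y': "!!i. \<bar>y' $ i\<bar> < \<rho>"
 shows "\<bar>D y' - D y\<bar> <= (2 * B + (real CARD('n) + 1) * \<zeta> / (1 - q)) * (SUM i:UNIV. \<bar>y' $ i - y $ i\<bar>)"
proof -
 let ?L = "2 * B + (real CARD('n) + 1) * \<zeta> / (1 - q)"
 define f where "f n (y :: real ^ 'n) = (%i. \<lfloor>2 ^ n * y $ i\<rfloor>)" for n y
 have lim1: "(%n. real_of_int \<lfloor>2 ^ n * (a :: real)\<rfloor> / 2 ^ n) \<longlonglongrightarrow> a" for a
 proof (rule tendsto_sandwich[of "%n. a - 1 / 2 ^ n" _ _ "%n. a"])
  show "(%n. a - 1 / 2 ^ n) \<longlonglongrightarrow> a" by (rule tendsto_eq_intros LIMSEQ_divide_realpow_zero refl | simp)+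
  show "\<forall>\<^sub>F n in sequentially. a - 1 / 2 ^ n <= real_of_int \<lfloor>2 ^ n * a\<rfloor> / 2 ^ n"
  proof (intro always_eventually allI)
   fix n
   have "2 ^ n * a - 1 <= real_of_int \<lfloor>2 ^ n * a\<rfloor>" by linarith
   then have "(2 ^ n * a - 1) / 2 ^ n <= real_of_int \<lfloor>2 ^ n * a\<rfloor> / 2 ^ n" by (rule divide_right_mono) simp
   then show "a - 1 / 2 ^ n <= real_of_int \<lfloor>2 ^ n * a\<rfloor> / 2 ^ n" by (simp add: diff_divide_distrib)
  qed
  show "\<forall>\<^sub>F n in sequentially. real_of_int \<lfloor>2 ^ n * a\<rfloor> / 2 ^ n <= a"
  proof (intro always_eventually allI)
   fix n
   have "real_of_int \<lfloor>2 ^ n * a\<rfloor> / 2 ^ n <= (2 ^ n * a) / 2 ^ n" by (rule divide_right_mono) simp_all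
   then show "real_of_int \<lfloor>2 ^ n * a\<rfloor> / 2 ^ n <= a" by simp
  qed
 qed auto
 have lim: "(%n. grid_pt n (f n y)) \<longlonglongrightarrow> y" for y unfolding grid_pt_def f_def using lim1 by (intro vec_tendstoI) simp
 have limD: "(%n. D (grid_pt n (f n y))) \<longlonglongrightarrow> D y" for y using cont by (intro continuous_on_tendsto_compose[OF cont lim]) auto
 have box: "in_box \<rho> n (f n y)" if "!!i. \<bar>y $ i\<bar> < \<rho>" for n y unfolding in_box_def f_def
 proof
  fix i
  have "\<bar>y $ i\<bar> <= \<rho>" using that[of i] by simp
  then have "\<bar>2 ^ n * y $ i\<bar> <= 2 ^ n * \<rho>" by (simp add: abs_mult)
  then have "2 ^ n * y $ i <= of_int (int \<rho> * 2 ^ n)" "of_int (- (int \<rho> * 2 ^ n)) <= 2 ^ n * y $ i" 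
   by (simp_all add: mult.commute abs_le_iff)
  then have "- (int \<rho> * 2 ^ n) <= \<lfloor>2 ^ n * y $ i\<rfloor>" "\<lfloor>2 ^ n * y $ i\<rfloor> <= int \<rho> * 2 ^ n"
   using le_floor_iff floor_mono[of "2 ^ n * y $ i" "of_int (int \<rho> * 2 ^ n)"] floor_of_int by (blast, metis)
  then show "\<bar>\<lfloor>2 ^ n * y $ i\<rfloor>\<bar> <= int \<rho> * 2 ^ n" by simp
 qed
 have "\<bar>D (grid_pt n (f n y')) - D (grid_pt n (f n y))\<bar> <=
   ?L * (SUM i:UNIV. \<bar>grid_pt n (f n y') $ i - grid_pt n (f n y) $ i\<bar>)" for n
 proof -
  have "\<bar>D (grid_pt n (f n y')) - D (grid_pt n (f n y))\<bar> <=
   ?L / 2 ^ n * (SUM i:UNIV. real_of_int \<bar>f n y' i - f n y i\<bar>)"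
   by (rule edge_bound_path[OF edge_bound_dyadic[OF bd q z sd] box[OF y] box[OF y']])
  also have "(SUM i:UNIV. real_of_int \<bar>f n y' i - f n y i\<bar>) =
   2 ^ n * (SUM i:UNIV. \<bar>grid_pt n (f n y') $ i - grid_pt n (f n y) $ i\<bar>)" unfolding sum_distrib_left
   by (intro sum.cong) (auto simp: grid_pt_def diff_divide_distrib[symmetric])
  finally show ?thesis by simp
 qed
 then show ?thesis by (intro LIMSEQ_le[of "%n. \<bar>D (grid_pt n (f n y')) - D (grid_pt n (f n y))\<bar>"
    _ "%n. ?L * (SUM i:UNIV. \<bar>grid_pt n (f n y') $ i - grid_pt n (f n y) $ i\<bar>)"])
   (auto intro!: tendsto_intros limD lim)
qed

section \<open>Uniqueness by dyadic sewing\<close>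

lemma zero_if_halving:
 fixes u :: real
 assumes "!!n. u <= c / 2 ^ n"
 shows "u <= 0"
proof (rule LIMSEQ_le_const)
 show "(%n. c / 2 ^ n) \<longlonglongrightarrow> 0" by (rule LIMSEQ_divide_realpow_zero) simp
qed (use assms in auto)

text \<open>A halving argument. Let the increments of the difference \<delta> of the solutions over
  the dyadic intervals of level \<open>l\<close> in a block of level \<open>l0\<close> be at most g
  r^l. Each increment is the average \<open>A\<close> at the initial value of \<delta> plus a defect
  \<open>E\<close>; the Lipschitz bound on averages makes both so small that g may be replaced by g
  / 2. Iteration leaves zero increments, and the value zero is passed on from block to
  block.\<close>

lemma dyadic_averaging_unique:
 fixes b :: "'a::euclidean_space => 'a" and x x' :: "real => 'a"
 assumes cx: "continuous_on {0..1} x" and cx': "continuous_on {0..1} x'"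
  and cb: "continuous_on UNIV b"
  and eq: "!!t. t : {0..1} ==> x' t - x t = integral {0..t} (%s. b (x' s) - b (x s))"
  and bB: "!!z. norm (b z) <= B"
  and hb: "!!y z. norm (b y - b z) <= C * norm (y - z) powr \<alpha>" and C: "0 <= C" and \<alpha>: "0 < \<alpha>"
  and r: "1 / 2 <= r" "r < 1" "r * r < 1 / 2" and K: "0 <= K"
  and avg: "!!l k y y'. k < 2 ^ l ==> norm y <= 2 * B ==> norm y' <= 2 * B ==>
   norm (integral {real k / 2 ^ l..real (Suc k) / 2 ^ l} (%s. b (x s + y) - b (x s + y')))
    <= K * r ^ l * norm (y - y')"
  and t: "t : {0..1}"
 shows "x' t = x t"
proof -
 define \<delta> where "\<delta> t = x' t - x t" for t
 define d where "d l k = real k / 2 ^ l" for l k :: nat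
 have d2: "d (Suc l) (2 * k) = d l k" for l k by (simp add: d_def)
 have d2': "d (Suc l) (Suc (Suc (2 * k))) = d l (Suc k)" for l k by (simp add: d_def field_simps)
 have dmono: "d l k <= d l k'" if "k <= k'" for l k k' using that by (simp add: d_def divide_right_mono)
 have d01: "d l k : {0..1}" if "k <= 2 ^ l" for l k
 proof -
  have "real k <= 2 ^ l" using that by (metis of_nat_le_iff of_nat_numeral of_nat_power)
  then show ?thesis by (simp add: d_def)
 qed
 have dlen: "d l (Suc k) - d l k = 1 / 2 ^ l" for l k by (simp add: d_def field_simps)
 have cby: "continuous_on {0..1} (%s. b (z s))" if "continuous_on {0..1} z" for z :: "real => 'a" using continuous_on_compose2[OF cb that] by auto
 have int: "(%s. b (z s) - b (z' s)) integrable_on {u..v}"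
  if "continuous_on {0..1} z" "continuous_on {0..1} z'" "0 <= u" "v <= 1" for u v and z z' :: "real => 'a"
 proof (rule integrable_continuous_real)
  have "continuous_on {0..1} (%s. b (z s) - b (z' s))" by (intro continuous_intros cby that)
  then show "continuous_on {u..v} (%s. b (z s) - b (z' s))" by (rule continuous_on_subset) (use that in auto)
 qed
 have B0: "0 <= B" using bB norm_ge_zero order_trans by blast
 let ?B = "%s. b (x' s) - b (x s)"
 have inc: "\<delta> v - \<delta> u = integral {u..v} ?B" if "0 <= u" "u <= v" "v <= 1" for u v
 proof -
  have "integral {0..u} ?B + integral {u..v} ?B
   = integral {0..v} ?B" by (rule Henstock_Kurzweil_Integration.integral_combine) (use that int cx cx' in auto)
  then show ?thesis using eq[of u] eq[of v] that by (simp add: \<delta>_def algebra_simps)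
 qed
 have lip: "norm (\<delta> v - \<delta> u) <= 2 * B * (v - u)" if "0 <= u" "u <= v" "v <= 1" for u v unfolding inc[OF that]
 proof (rule integral_bound[OF that(2)])
  show "continuous_on {u..v} ?B" by (rule continuous_on_subset[of "{0..1}"]) (use that in \<open>auto intro!: continuous_intros cby cx cx'\<close>)
  fix s show "norm (b (x' s) - b (x s)) <= 2 * B" using norm_triangle_ineq4[of "b (x' s)" "b (x s)"] bB[of "x' s"] bB[of "x s"] by linarith
 qed
 have \<delta>0: "\<delta> 0 = 0" using eq[of 0] by (simp add: \<delta>_def)
 have \<delta>B: "norm (\<delta> v) <= 2 * B" if "v : {0..1}" for v using lip[of 0 v] that \<delta>0 B0 mult_left_le[of v "2 * B"] by auto
 define A where "A l k y = integral {d l k..d l (Suc k)} (%s. b (x s + y) - b (x s))" for l k y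
 \<comment> \<open>The defect of freezing \<delta> at the left end point. By \<open>Esplit\<close>,
   refining an interval changes the sum of the defects only through the new frozen value in the
   right half.\<close>
 define E where "E l k = (\<delta> (d l (Suc k)) - \<delta> (d l k)) - A l k (\<delta> (d l k))" for l k
 have Aint: "(%s. b (x s + y) - b (x s + y')) integrable_on {u..v}" if "0 <= u" "v <= 1" for u v y y'
  by (rule int) (use that in \<open>auto intro!: continuous_intros cx\<close>)
 have Adiff: "norm (A l k y - A l k y') <= K * r ^ l * norm (y - y')" if "k < 2 ^ l" "norm y <= 2 * B" "norm y' <= 2 * B" for l k y y'
 proof -
  have "0 <= d l k" "d l (Suc k) <= 1" using d01[of k l] d01[of "Suc k" l] that by auto
  then have "A l k y - A l k y' = integral {d l k..d l (Suc k)} (%s. (b (x s + y) - b (x s)) - (b (x s + y') - b (x s)))"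
   unfolding A_def using Aint[of _ _ _ 0] by (intro Henstock_Kurzweil_Integration.integral_diff[symmetric]) auto
  then show ?thesis using avg[OF that] by (simp add: d_def)
 qed
 have A0: "A l k 0 = 0" for l k by (simp add: A_def)
 have Asplit: "A l k y = A (Suc l) (2 * k) y + A (Suc l) (Suc (2 * k)) y" if "k < 2 ^ l" for l k y
 proof -
  have *: "d (Suc l) (2 * k) <= d (Suc l) (Suc (2 * k))" "d (Suc l) (Suc (2 * k)) <= d (Suc l) (Suc (Suc (2 * k)))" by (auto intro: dmono)
  have "0 <= d l k" "d l (Suc k) <= 1" using d01[of k l] d01[of "Suc k" l] that by auto
  then show ?thesis unfolding A_def using Henstock_Kurzweil_Integration.integral_combine[OF *, of "%s. b (x s + y) - b (x s)"] Aint[of _ _ _ 0]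
   unfolding d2 d2' by (simp add: Aint[of _ _ _ 0, simplified])
 qed
 have Esplit: "E l k = E (Suc l) (2 * k) + E (Suc l) (Suc (2 * k)) +
   (A (Suc l) (Suc (2 * k)) (\<delta> (d (Suc l) (Suc (2 * k)))) - A (Suc l) (Suc (2 * k)) (\<delta> (d l k)))" if "k < 2 ^ l" for l k
  unfolding E_def Asplit[OF that] d2 d2' by simp
 define a where "a = 2 powr (- \<alpha>)"
 have a: "0 < a" "a < 1" using \<alpha> powr_less_mono[of "-\<alpha>" 0 2] by (auto simp: a_def)
 define e0 where "e0 = C * (2 * B) powr \<alpha>"
 have e0: "0 <= e0" using C by (simp add: e0_def)
 \<comment> \<open>A crude bound from Hoelder continuity of \<open>b\<close> alone. Its size is
   2^(-l) a^l with a < 1, so the sum of the 2^p defects at level l + p tends to 0 with growing p,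
   which is what the refinement below ends in.\<close>
 have E0: "norm (E l k) <= e0 * (1 / 2) ^ l * a ^ l" if k: "k < 2 ^ l" for l k
 proof -
  let ?I = "{d l k..d l (Suc k)}"
  have dd: "0 <= d l k" "d l k <= d l (Suc k)" "d l (Suc k) <= 1" using d01[of k l] d01[of "Suc k" l] dmono[of k "Suc k" l] k by auto
  have "E l k = integral ?I (%s. (b (x' s) - b (x s)) - (b (x s + \<delta> (d l k)) - b (x s)))" unfolding E_def A_def inc[OF dd]
   by (intro Henstock_Kurzweil_Integration.integral_diff[symmetric] int cx cx' continuous_intros) (use dd in auto)
  also have "norm ... <= (C * (2 * B * (1 / 2 ^ l)) powr \<alpha>) * (d l (Suc k) - d l k)"
  proof (rule integral_bound[OF dd(2)])
   show "continuous_on ?I (%s. b (x' s) - b (x s) - (b (x s + \<delta> (d l k)) - b (x s)))"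
    by (rule continuous_on_subset[of "{0..1}"]) (use dd in \<open>auto intro!: continuous_intros cby cx cx'\<close>)
   fix s assume s: "s : ?I"
   have "norm (x' s - (x s + \<delta> (d l k))) = norm (\<delta> s - \<delta> (d l k))" by (simp add: \<delta>_def algebra_simps)
   also have "... <= 2 * B * (s - d l k)" by (rule lip) (use s dd in auto)
   also have "... <= 2 * B * (1 / 2 ^ l)" using s dlen[of l k] B0 by (intro mult_left_mono) auto
   finally have "norm (x' s - (x s + \<delta> (d l k))) powr \<alpha> <= (2 * B * (1 / 2 ^ l)) powr \<alpha>"
    using \<alpha> by (intro powr_mono2) auto
   then have "C * norm (x' s - (x s + \<delta> (d l k))) powr \<alpha> <= C * (2 * B * (1 / 2 ^ l)) powr \<alpha>"
    using C by (intro mult_left_mono) auto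
   then show "norm (b (x' s) - b (x s) - (b (x s + \<delta> (d l k)) - b (x s))) <= C * (2 * B * (1 / 2 ^ l)) powr \<alpha>"
    using hb[of "x' s" "x s + \<delta> (d l k)"] by (simp add: algebra_simps)
  qed
  also have "(2 * B * (1 / 2 ^ l)) powr \<alpha> = (2 * B) powr \<alpha> * a ^ l"
  proof -
   have "(1 / 2 ^ l) powr \<alpha> = a ^ l" by (simp add: a_def powr_def ln_div ln_realpow exp_of_nat_mult[symmetric])
   then show ?thesis using B0 by (subst powr_mult) auto
  qed
  finally show ?thesis unfolding dlen e0_def by (simp add: power_divide mult_ac)
 qed
 \<comment> \<open>The fixed point of c = 2 r^2 c + r^2, the recursion of the accumulated defects
   under one refinement; it is positive because r^2 < 1/2.\<close>
 define c where "c = r * r / (1 - 2 * (r * r))"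
 \<comment> \<open>The sum of r^i over i >= 1: a dyadic point is reached from the start of its block
   by at most one interval of each finer level.\<close>
 define c2 where "c2 = r / (1 - r)"
 have c: "0 < c" "2 * (r * r) * c + r * r = c" using r by (auto simp: c_def field_simps)
 have c2: "0 < c2" using r by (auto simp: c2_def)
 \<comment> \<open>Blocks of this length make the constant of the estimate 1/2, whatever
   \<open>g\<close> is.\<close>
 obtain l0 where l0: "K * (c2 + c) * r ^ l0 <= 1 / 2"
 proof -
  have "(%n. K * (c2 + c) * r ^ n) \<longlonglongrightarrow> 0" using r by (intro tendsto_mult_right_zero LIMSEQ_realpow_zero) auto
  then have "\<forall>\<^sub>F n in sequentially. K * (c2 + c) * r ^ n < 1 / 2" by (rule order_tendstoD) simp
  then show ?thesis using that by (auto simp: eventually_sequentially intro: less_imp_le)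
 qed
 define J where "J k0 l k \<longleftrightarrow> l0 <= l & k0 * 2 ^ (l - l0) <= k & k < Suc k0 * 2 ^ (l - l0)" for k0 l k
 have Jlt: "k < 2 ^ l" if "J k0 l k" "k0 < 2 ^ l0" for k0 l k
 proof -
  have "k < Suc k0 * 2 ^ (l - l0)" using that by (simp add: J_def)
  also have "... <= 2 ^ l0 * 2 ^ (l - l0)" using that(2) by (intro mult_right_mono) auto
  also have "... = 2 ^ l" using that by (simp add: J_def flip: power_add)
  finally show ?thesis .
 qed
 have Jsuc: "J k0 (Suc l) (2 * k)" "J k0 (Suc l) (Suc (2 * k))" if "J k0 l k" for k0 l k using that by (auto simp: J_def Suc_diff_le)
 have block: "\<delta> (d l (Suc k)) = \<delta> (d l k)" if k0: "k0 < 2 ^ l0" and z: "\<delta> (d l0 k0) = 0" and Jk: "J k0 l k" for k0 l k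
 proof -
  define P where "P g \<longleftrightarrow> (ALL l k. J k0 l k --> norm (\<delta> (d l (Suc k)) - \<delta> (d l k)) <= g * r ^ l)" for g
  have halve: "P (g / 2)" if P: "P g" and g: "0 <= g" for g
  proof -
   have start: "norm (\<delta> (d (l0 + n) k)) <= g * r ^ l0 * (SUM i=1..n. r ^ i)" if "J k0 (l0 + n) k" for n k using that
   proof (induction n arbitrary: k)
    case 0
    then have "k = k0" by (auto simp: J_def)
    then show ?case using z by simp
   next
    case (Suc n)
    let ?k = "k div 2"
    have Jk: "J k0 (l0 + n) ?k" using Suc.prems by (auto simp: J_def)
    have IH: "norm (\<delta> (d (l0 + n) ?k)) <= g * r ^ l0 * (SUM i=1..n. r ^ i)" using Suc.IH[OF Jk] .
    have le: "g * r ^ l0 * (SUM i=1..n. r ^ i) + g * r ^ (l0 + Suc n) = g * r ^ l0 * (SUM i=1..Suc n. r ^ i)"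
     by (simp add: algebra_simps power_add)
    have g0: "0 <= g * r ^ (l0 + Suc n)" using g r by simp
    show ?case
    proof (cases "even k")
     case True
     then have "d (l0 + Suc n) k = d (l0 + n) ?k" using d2[of "l0 + n" ?k] by simp
     then show ?thesis using IH le g0 by simp
    next
     case False
     then have k: "k = Suc (2 * ?k)" by simp
     have "norm (\<delta> (d (l0 + Suc n) k) - \<delta> (d (l0 + Suc n) (2 * ?k))) <= g * r ^ (l0 + Suc n)"
      using P Jsuc(1)[OF Jk] k unfolding P_def by (metis add_Suc_right)
     moreover have "d (l0 + Suc n) (2 * ?k) = d (l0 + n) ?k" using d2 by simp
     ultimately show ?thesis using IH le norm_triangle_sub[of "\<delta> (d (l0 + Suc n) k)" "\<delta> (d (l0 + n) ?k)"] by simp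
    qed
   qed
   have gs: "(SUM i=1..n. r ^ i) <= c2" for n
   proof -
    have "(SUM i=1..n. r ^ i) * (1 - r) = r - r ^ Suc n"
    proof (induction n)
     case (Suc n)
     then show ?case by (simp add: distrib_right) (simp add: algebra_simps)
    qed simp
    also have "... <= r" using r by simp
    finally show ?thesis unfolding c2_def using r by (subst pos_le_divide_eq) auto
   qed
   have start': "norm (\<delta> (d l k)) <= g * r ^ l0 * c2" if "J k0 l k" for l k
   proof -
    have "norm (\<delta> (d (l0 + (l - l0)) k)) <= g * r ^ l0 * (SUM i=1..l - l0. r ^ i)"
     by (rule start) (use that in \<open>auto simp: J_def\<close>)
    also have "... <= g * r ^ l0 * c2" using gs g r by (intro mult_left_mono) auto
    finally show ?thesis using that by (simp add: J_def)
   qed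
   \<comment> \<open>Here the defect is refined \<open>p\<close> times. The last summand comes from
     \<open>E0\<close> at level l + p and disappears in the limit, which gives
     \<open>Eb'\<close>.\<close>
   have Eb: "norm (E l k) <= K * g * c * (r * r) ^ l + e0 * (1 / 2) ^ l * a ^ (l + p)" if "J k0 l k" for l k p using that
   proof (induction p arbitrary: l k)
    case 0
    then show ?case using E0[OF Jlt[OF 0 k0]] K g c r by (simp add: add_increasing)
   next
    case (Suc p)
    let ?l = "Suc l"
    note J2 = Jsuc[OF Suc.prems]
    have k: "k < 2 ^ l" "Suc (2 * k) < 2 ^ ?l" using Jlt[OF _ k0] Suc.prems J2 by blast+
    let ?A = "A ?l (Suc (2 * k)) (\<delta> (d ?l (Suc (2 * k)))) - A ?l (Suc (2 * k)) (\<delta> (d l k))"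
    have "d ?l (Suc (2 * k)) : {0..1}" "d l k : {0..1}" using k by (metis d01 less_imp_le)+
    then have "norm ?A
     <= K * r ^ ?l * norm (\<delta> (d ?l (Suc (2 * k))) - \<delta> (d l k))" by (intro Adiff k \<delta>B)
    also have "norm (\<delta> (d ?l (Suc (2 * k))) - \<delta> (d l k)) <= g * r ^ ?l" using P J2(1) unfolding P_def by (metis d2)
    finally have 1: "norm ?A
     <= K * r ^ ?l * (g * r ^ ?l)" using K r by (auto simp: mult_left_mono)
    have eq1: "2 * (K * g * c * (r * r) ^ ?l) + K * r ^ ?l * (g * r ^ ?l) = K * g * c * (r * r) ^ l"
    proof -
     have "2 * (K * g * c * (r * r) ^ ?l) + K * r ^ ?l * (g * r ^ ?l)
      = K * g * (r * r) ^ l * (2 * (r * r) * c + r * r)" by (simp add: algebra_simps power_mult_distrib)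
     also have "... = K * g * (r * r) ^ l * c" unfolding c(2) ..
     finally show ?thesis by (simp add: mult_ac)
    qed
    have eq2: "2 * (e0 * (1 / 2) ^ ?l * a ^ (?l + p)) = e0 * (1 / 2) ^ l * a ^ (l + Suc p)" by simp
    have "norm (E l k) <= norm (E ?l (2 * k)) + norm (E ?l (Suc (2 * k))) +
      norm ?A" unfolding Esplit[OF k(1)] by (rule norm_triangle_mono[OF norm_triangle_ineq]) simp
    then show ?case using 1 eq1 eq2 Suc.IH[OF J2(1)] Suc.IH[OF J2(2)] by linarith
   qed
   have Eb': "norm (E l k) <= K * g * c * (r * r) ^ l" if "J k0 l k" for l k
   proof (rule LIMSEQ_le_const)
    have "(%p. K * g * c * (r * r) ^ l + e0 * (1 / 2) ^ l * (a ^ l * a ^ p)) \<longlonglongrightarrow> K * g * c * (r * r) ^ l + e0 * (1 / 2) ^ l * (a ^ l * 0)"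
     using a by (intro tendsto_intros LIMSEQ_realpow_zero) auto
    then show "(%p. K * g * c * (r * r) ^ l + e0 * (1 / 2) ^ l * a ^ (l + p)) \<longlonglongrightarrow> K * g * c * (r * r) ^ l"
     by (simp add: power_add)
   qed (use Eb[OF that] in auto)
   show ?thesis unfolding P_def
   proof (intro allI impI)
    fix l k assume Jk: "J k0 l k"
    have k: "k < 2 ^ l" using Jlt[OF Jk k0] .
    have "norm (A l k (\<delta> (d l k)) - A l k 0) <= K * r ^ l * norm (\<delta> (d l k) - 0)"
     by (intro Adiff k \<delta>B d01) (use k B0 in auto)
    also have "... <= K * r ^ l * (g * r ^ l0 * c2)" using start'[OF Jk] K r by (intro mult_left_mono) auto
    finally have 1: "norm (A l k (\<delta> (d l k))) <= K * r ^ l * (g * r ^ l0 * c2)" by (simp add: A0)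
    have "r ^ l * r ^ l <= r ^ l * r ^ l0" using Jk r by (intro mult_left_mono power_decreasing) (auto simp: J_def)
    then have "K * g * c * (r * r) ^ l <= K * g * c * (r ^ l * r ^ l0)" using K g c by (intro mult_left_mono) (auto simp: power_mult_distrib)
    then have "norm (E l k) <= K * g * c * (r ^ l * r ^ l0)" using Eb'[OF Jk] by linarith
    then have "norm (\<delta> (d l (Suc k)) - \<delta> (d l k)) <= K * g * c * (r ^ l * r ^ l0) + K * r ^ l * (g * r ^ l0 * c2)"
     using 1 norm_triangle_ineq[of "E l k" "A l k (\<delta> (d l k))"] by (simp add: E_def)
    also have "... = (g * r ^ l) * (K * (c2 + c) * r ^ l0)" by (simp add: algebra_simps)
    also have "... <= (g * r ^ l) * (1 / 2)" using l0 g r by (intro mult_left_mono) auto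
    finally show "norm (\<delta> (d l (Suc k)) - \<delta> (d l k)) <= g / 2 * r ^ l" by simp
   qed
  qed
  \<comment> \<open>The start of the iteration uses r >= 1/2: increments of \<delta> are at most 2 B
    2^(-l), hence at most 2 B r^l.\<close>
  have "P (2 * B / 2 ^ n)" for n
  proof (induction n)
   case 0
   show ?case unfolding P_def
   proof (intro allI impI)
    fix l k assume "J k0 l k"
    then have k: "k < 2 ^ l" using Jlt k0 by blast
    have "norm (\<delta> (d l (Suc k)) - \<delta> (d l k)) <= 2 * B * (d l (Suc k) - d l k)"
     by (rule lip) (use d01[of k l] d01[of "Suc k" l] dmono[of k "Suc k" l] k in auto)
    also have "... = 2 * B * (1 / 2) ^ l" by (simp add: dlen power_divide)
    also have "... <= 2 * B * r ^ l" using r B0 by (intro mult_left_mono power_mono) auto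
    finally show "norm (\<delta> (d l (Suc k)) - \<delta> (d l k)) <= 2 * B / 2 ^ 0 * r ^ l" by simp
   qed
  next
   case (Suc n)
   then show ?case using halve[OF Suc] B0 by (simp add: mult.commute)
  qed
  then have "norm (\<delta> (d l (Suc k)) - \<delta> (d l k)) <= (2 * B * r ^ l) / 2 ^ n" for n
   using Jk unfolding P_def by (metis times_divide_eq_left)
  then have "norm (\<delta> (d l (Suc k)) - \<delta> (d l k)) <= 0" by (rule zero_if_halving)
  then show ?thesis by simp
 qed
 have inner: "\<delta> (d l (k0 * 2 ^ (l - l0) + n)) = 0" if "\<delta> (d l0 k0) = 0" "k0 < 2 ^ l0" "l0 <= l" "n <= 2 ^ (l - l0)" for l k0 n
  using that(4)
 proof (induction n)
  case 0
  have "(2 :: real) ^ l = 2 ^ (l - l0) * 2 ^ l0" using that(3) by (simp flip: power_add)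
  then have "d l (k0 * 2 ^ (l - l0)) = d l0 k0" by (simp add: d_def)
  then show ?case using that by simp
 next
  case (Suc n)
  then have "J k0 l (k0 * 2 ^ (l - l0) + n)" using that by (simp add: J_def)
  from block[OF that(2,1) this] Suc show ?case by simp
 qed
 have coarse: "\<delta> (d l0 k0) = 0" if "k0 <= 2 ^ l0" for k0 using that
 proof (induction k0)
  case 0
  then show ?case using \<delta>0 by (simp add: d_def)
 next
  case (Suc k0)
  then show ?case using inner[of k0 l0 1] by simp
 qed
 have all: "\<delta> (d l k) = 0" if "k <= 2 ^ l" "l0 <= l" for l k
 proof (cases "k = 2 ^ l")
  case True
  then have "d l k = d l0 (2 ^ l0)" by (simp add: d_def)
  then show ?thesis using coarse[of "2 ^ l0"] by simp
 next
  case False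
  let ?M = "2 ^ (l - l0) :: nat"
  have "k < 2 ^ l0 * ?M" using that False by (simp flip: power_add)
  then have "k div ?M < 2 ^ l0" by (simp add: less_mult_imp_div_less)
  moreover have "k = k div ?M * ?M + k mod ?M" by (rule div_mult_mod_eq[symmetric])
  ultimately show ?thesis using inner[of "k div ?M" l "k mod ?M"] coarse[of "k div ?M"] that(2)
   by (metis less_imp_le mod_less_divisor pos2 zero_less_power)
 qed
 have "norm (\<delta> t) <= (2 * B) / 2 ^ n" for n
 proof -
  let ?l = "l0 + n" let ?k = "nat \<lfloor>t * 2 ^ ?l\<rfloor>"
  have t01: "0 <= t" "t <= 1" using t by auto
  have k1: "real ?k <= t * 2 ^ ?l" using t01 by simp
  also have "... <= 2 ^ ?l" using t01 by simp
  finally have "?k <= 2 ^ ?l" by (metis of_nat_le_iff of_nat_numeral of_nat_power)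
  then have z: "\<delta> (d ?l ?k) = 0" using all by simp
  have k2: "t * 2 ^ ?l <= real ?k + 1" using t01 by linarith
  have dt: "d ?l ?k <= t" using k1 by (simp add: d_def field_simps)
  have "t <= (real ?k + 1) / 2 ^ ?l" using k2 by (simp add: pos_le_divide_eq)
  then have "t - d ?l ?k <= 1 / 2 ^ ?l" by (simp add: d_def add_divide_distrib)
  moreover have "1 / 2 ^ ?l <= 1 / (2 :: real) ^ n" by (simp add: power_add field_simps)
  ultimately have "2 * B * (t - d ?l ?k) <= 2 * B * (1 / 2 ^ n)" using B0 by (intro mult_left_mono) auto
  moreover have "norm (\<delta> t - \<delta> (d ?l ?k)) <= 2 * B * (t - d ?l ?k)" by (rule lip) (use dt t01 in \<open>auto simp: d_def\<close>)
  ultimately show ?thesis using z by simp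
 qed
 then have "norm (\<delta> t) <= 0" by (rule zero_if_halving)
 then show ?thesis by (simp add: \<delta>_def)
qed

text \<open>The samples belong to an approximation of \<open>x\<close>. Uniform continuity of
  \<open>g\<close> replaces them by values of \<open>x\<close>, and that of the composition with
  \<open>x\<close> compares the Riemann sum with the integral.\<close>

lemma dyadic_riemann_limit:
 fixes x :: "real => 'a::euclidean_space" and g :: "'a => 'b::euclidean_space"
 assumes cx: "continuous_on {0..1} x" and ug: "uniformly_continuous_on UNIV g"
  and r: "filterlim r at_top sequentially"
  and X: "!!e. e > 0 ==> \<forall>\<^sub>F m in sequentially. ALL i<2 ^ r m. norm (X m i - x (real i / 2 ^ r m)) < e"
  and pq: "p <= q" "q <= 2 ^ l"
 shows "(%m. (1 / 2 ^ r m) *\<^sub>R (SUM i = p * 2 ^ (r m - l)..<q * 2 ^ (r m - l). g (X m i)))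
  \<longlonglongrightarrow> integral {real p / 2 ^ l..real q / 2 ^ l} (%s. g (x s))"
proof (rule tendstoI)
 fix e :: real assume e: "e > 0"
 obtain \<eta> where \<eta>: "\<eta> > 0" "!!y z. norm (y - z) < \<eta> ==> norm (g y - g z) < e / 4"
  using ug e unfolding uniformly_continuous_on_def dist_norm by (metis UNIV_I zero_less_divide_iff zero_less_numeral)
 let ?A = "%s. g (x s)"
 have cg: "continuous_on {0..1} ?A" using continuous_on_compose2[OF uniformly_continuous_imp_continuous[OF ug] cx] by auto
 obtain h where h: "h > 0" "!!s t. s : {0..1} ==> t : {0..1} ==> \<bar>s - t\<bar> < h ==> norm (g (x s) - g (x t)) < e / 4"
  using compact_uniformly_continuous[OF cg] e unfolding uniformly_continuous_on_def dist_norm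
  by (metis compact_Icc real_norm_def zero_less_divide_iff zero_less_numeral)
 obtain n0 :: nat where n0: "1 / 2 ^ n0 < h"
  using h(1) by (metis one_div_two_eq_zero one_less_numeral_iff power_one_over real_arch_pow_inv semiring_norm(76) div_by_1 half_gt_zero_iff less_numeral_extra(1) divide_less_eq_1_pos zero_less_numeral)
 have ev: "\<forall>\<^sub>F m in sequentially. max n0 l <= r m" using r unfolding filterlim_at_top by blast
 show "\<forall>\<^sub>F m in sequentially. dist ((1 / 2 ^ r m) *\<^sub>R (SUM i = p * 2 ^ (r m - l)..<q * 2 ^ (r m - l). g (X m i)))
  (integral {real p / 2 ^ l..real q / 2 ^ l} ?A) < e" using ev X[OF \<eta>(1)]
 proof eventually_elim
  case (elim m)
  let ?N = "2 ^ r m :: real"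
  define P where "P = p * 2 ^ (r m - l)"
  have pw: "(2::real) ^ r m = 2 ^ l * 2 ^ (r m - l)" using elim by (simp flip: power_add)
  have pwn: "(2::nat) ^ r m = 2 ^ l * 2 ^ (r m - l)" using elim by (simp flip: power_add)
  have Ple: "p * 2 ^ (r m - l) <= q * 2 ^ (r m - l)" using pq by simp
  have Qle: "q * 2 ^ (r m - l) <= 2 ^ r m" unfolding pwn using pq by simp
  have Nh: "1 / ?N < h"
  proof -
   have "1 / ?N <= 1 / 2 ^ n0" using elim by (intro divide_left_mono power_increasing) auto
   then show ?thesis using n0 by linarith
  qed
  have int: "?A integrable_on {u..v}" if "0 <= u" "v <= 1" for u v
   by (rule integrable_continuous_real, rule continuous_on_subset[OF cg]) (use that in auto)
  have main: "norm ((SUM i = P..<P + n. (1 / ?N) *\<^sub>R g (X m i)) - integral {real P / ?N..real (P + n) / ?N} ?A)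
   <= real n * (e / 2 / ?N)" if "P + n <= 2 ^ r m" for n using that
  proof (induction n)
   case 0
   then show ?case by simp
  next
   case (Suc n)
   let ?i = "P + n"
   let ?u = "real ?i / ?N" and ?v = "real (Suc ?i) / ?N"
   have "real (Suc ?i) <= ?N" using Suc.prems by (metis add_Suc_right of_nat_le_iff of_nat_numeral of_nat_power)
   then have uv: "0 <= ?u" "?u <= ?v" "?v <= 1" "?v - ?u = 1 / ?N" by (auto simp: field_simps)
   have comb: "integral {real P / ?N..?u} ?A + integral {?u..?v} ?A
    = integral {real P / ?N..?v} ?A"
    by (rule Henstock_Kurzweil_Integration.integral_combine) (use uv in \<open>auto intro!: int divide_right_mono\<close>)
   have "(1 / ?N) *\<^sub>R g (X m ?i) - integral {?u..?v} ?A = integral {?u..?v} (%s. g (X m ?i) - g (x s))"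
    using uv by (subst Henstock_Kurzweil_Integration.integral_diff) (auto intro!: int)
   also have "norm ... <= (e / 2) * (?v - ?u)"
   proof (rule integral_bound[OF uv(2)])
    show "continuous_on {?u..?v} (%s. g (X m ?i) - g (x s))" by (intro continuous_intros continuous_on_subset[OF cg]) (use uv in auto)
    fix s assume s: "s : {?u..?v}"
    have "norm (g (X m ?i) - g (x ?u)) < e / 4" using elim(2) Suc.prems by (intro \<eta>) (metis add_Suc_right less_eq_Suc_le)
    moreover have "norm (g (x ?u) - g (x s)) < e / 4"
    proof (rule h(2))
     have "0 <= s" "s <= 1" "s - ?u <= ?v - ?u" "?u <= s" using s uv unfolding atLeastAtMost_iff by linarith+
     then show "s : {0..1}" "\<bar>?u - s\<bar> < h" using Nh uv(4) by (simp, linarith)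
    qed (use uv in auto)
    ultimately show "norm (g (X m ?i) - g (x s)) <= e / 2" using norm_triangle_ineq[of "g (X m ?i) - g (x ?u)" "g (x ?u) - g (x s)"] by simp
   qed
   finally have "norm ((1 / ?N) *\<^sub>R g (X m ?i) - integral {?u..?v} ?A) <= e / 2 / ?N" using uv by simp
   moreover have "(SUM i = P..<P + Suc n. (1 / ?N) *\<^sub>R g (X m i)) - integral {real P / ?N..real (P + Suc n) / ?N} ?A
    = ((SUM i = P..<P + n. (1 / ?N) *\<^sub>R g (X m i)) - integral {real P / ?N..?u} ?A)
     + ((1 / ?N) *\<^sub>R g (X m ?i) - integral {?u..?v} ?A)" using comb by (simp add: algebra_simps)
   moreover have "real (Suc n) * (e / 2 / ?N) = real n * (e / 2 / ?N) + e / 2 / ?N" by (simp add: algebra_simps add_divide_distrib)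
   ultimately show ?case using Suc.IH Suc.prems by (smt (verit) Suc_leD add_Suc_right norm_triangle_ineq)
  qed
  let ?n = "q * 2 ^ (r m - l) - P"
  have Pn: "P + ?n = q * 2 ^ (r m - l)" using Ple by (simp add: P_def)
  have "?n <= 2 ^ r m" using Qle Pn by linarith
  then have "real ?n <= real (2 ^ r m)" by (simp only: of_nat_le_iff)
  then have "real ?n <= ?N" by simp
  then have "real ?n * (e / 2 / ?N) <= ?N * (e / 2 / ?N)" using e by (intro mult_right_mono) auto
  then have "real ?n * (e / 2 / ?N) <= e / 2" by simp
  moreover have eqs: "real P / ?N = real p / 2 ^ l" "real (q * 2 ^ (r m - l)) / ?N = real q / 2 ^ l" unfolding pw by (simp_all add: P_def)
  moreover note main[of ?n, unfolded Pn, OF Qle, unfolded eqs]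
  ultimately show ?case using e unfolding dist_norm P_def[symmetric] scaleR_right.sum by linarith
 qed
qed

section \<open>Innovations of fractional Brownian motion\<close>

lemma integrable_lborel_from_has_integral:
 fixes f :: "real => real"
 assumes "(f has_integral I) S" and "!!x. x : S ==> 0 <= f x" and "f : borel_measurable borel" "S : sets borel"
 shows "integrable lborel (%x. indicator S x * f x)" "(LBINT x. indicator S x * f x) = I"
proof -
 have hi: "((%x. indicator S x * f x) has_integral I) UNIV"
 proof -
  have "(%x. indicator S x * f x) = (%x. if x : S then f x else 0)" by auto
  then show ?thesis using assms(1) has_integral_restrict_UNIV[of S f I] by simp
 qed
 have m: "(%x. indicator S x * f x) : borel_measurable borel" using assms by measurable
 have nn: "0 <= indicator S x * f x" for x using assms(2) by (auto simp: indicator_def)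
 have N: "(\<integral>\<^sup>+x. ennreal (indicator S x * f x) \<partial>lborel) = I" by (rule nn_integral_has_integral_lborel[OF m nn hi])
 show 1: "integrable lborel (%x. indicator S x * f x)" by (rule integrableI_nonneg) (use m nn N in auto)
 show "(LBINT x. indicator S x * f x) = I" using integral_lborel[OF 1] hi by (simp add: integral_unique)
qed

lemma integrable_mult_of_squares:
 fixes f g :: "'a => real"
 assumes [measurable]: "f : borel_measurable M" "g : borel_measurable M"
  and "integrable M (%x. (f x)^2)" "integrable M (%x. (g x)^2)"
 shows "integrable M (%x. f x * g x)"
proof (rule L_integrable_bound)
 show "integrable M (%x. (f x)^2 + (g x)^2)" using assms by simp
 have "\<bar>f x * g x\<bar> <= (f x)^2 + (g x)^2" for x
 proof -
  have "2 * (\<bar>f x\<bar> * \<bar>g x\<bar>) <= (f x)^2 + (g x)^2" using sum_squares_bound[of "\<bar>f x\<bar>" "\<bar>g x\<bar>"] by simp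
  moreover have "0 <= \<bar>f x\<bar> * \<bar>g x\<bar>" by simp
  ultimately show ?thesis unfolding abs_mult by linarith
 qed
 then show "AE x in M. norm (f x * g x) <= norm ((f x)^2 + (g x)^2)" by auto
qed simp

lemma integral_cauchy_schwarz:
 fixes f g :: "'a => real"
 assumes [measurable]: "f : borel_measurable M" "g : borel_measurable M"
  and f: "integrable M (%x. (f x)^2)" and g: "integrable M (%x. (g x)^2)"
 shows "(LINT x|M. f x * g x)^2 <= (LINT x|M. (f x)^2) * (LINT x|M. (g x)^2)"
proof -
 let ?A = "LINT x|M. (f x)^2" and ?G = "LINT x|M. (g x)^2" and ?c = "LINT x|M. f x * g x"
 have fg: "integrable M (%x. f x * g x)" by (rule integrable_mult_of_squares) (use assms in auto)
 have *: "0 <= p^2 * ?A + 2 * p * q * ?c + q^2 * ?G" for p q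
 proof -
  have "0 <= (LINT x|M. (p * f x + q * g x)^2)" by simp
  also have "(LINT x|M. (p * f x + q * g x)^2) = (LINT x|M. p^2 * (f x)^2 + 2 * p * q * (f x * g x) + q^2 * (g x)^2)"
   by (intro L_integral_cong) (auto simp: power2_eq_square algebra_simps)
  also have "... = p^2 * ?A + 2 * p * q * ?c + q^2 * ?G" using f g fg by simp
  finally show ?thesis .
 qed
 have A: "0 <= ?A" and G: "0 <= ?G" by simp_all
 show ?thesis
 proof (cases "?G = 0")
  case True
  have "?c = 0"
  proof (rule ccontr)
   assume "?c ~= 0"
   then show False using *[of 1 "- (?A + 1) / (2 * ?c)"] True A by (simp add: field_simps)
  qed
  then show ?thesis using True by simp
 next
  case False
  have "0 <= ?G * (?G * ?A - ?c\<^sup>2)" using *[of ?G "- ?c"] by (simp add: power2_eq_square algebra_simps)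
  then show ?thesis using False G by (simp add: zero_le_mult_iff mult.commute)
 qed
qed

text \<open>The Mandelbrot--van Ness kernel. Since \<open>0 powr a = 0\<close> for every \<open>a\<close>, the expression
 \<open>max 0 x powr a\<close> is $x_+^a$ with value \<open>0\<close> at \<open>0\<close> also for nonpositive exponents.\<close>

definition mvn_kernel :: "real => real => real => real" where
 "mvn_kernel H t u = max 0 (t - u) powr (H - 1/2) - max 0 (- u) powr (H - 1/2)"

text \<open>The variance at time 1 of the process built from this kernel.\<close>

definition mvn_const :: "real => real" where
 "mvn_const H = (LBINT u. (mvn_kernel H 1 u)^2)"

lemma mvn_kernel_measurable [measurable]: "mvn_kernel H t : borel_measurable borel" unfolding mvn_kernel_def by measurable

lemma mvn_kernel_0 [simp]: "mvn_kernel H 0 u = 0" by (simp add: mvn_kernel_def)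

lemma integrable_pos_part_powr:
 assumes "p > -1"
 shows "integrable lborel (%u. indicator {0..c} u * max 0 u powr p :: real)"
proof (cases "c >= 0")
 case True
 have "integrable lborel (%u. indicator {0..c} u * u powr p)"
  by (rule integrable_lborel_from_has_integral(1)[OF has_integral_powr_from_0[OF assms True]]) auto
 moreover have "indicator {0..c} u * u powr p = indicator {0..c} u * max 0 u powr p" for u :: real by (auto simp: indicator_def)
 ultimately show ?thesis by simp
qed (simp add: indicator_def)

text \<open>Three ranges. For u >= 0 only the first power survives; between -1 and 0 the two powers
  are estimated separately, and H > 0 makes the exponent 2 H - 1 integrable at the singularities;
  below -1 the mean value theorem gives the decay |u|^(2 H - 3), integrable at infinity since H <
  1.\<close>

lemma mvn_kernel_1_sq_integrable:
 assumes H: "0 < H" "H < 1"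
 shows "integrable lborel (%u. (mvn_kernel H 1 u)^2)"
proof -
 let ?a = "H - 1/2"
 define g where "g u = indicator {0..1} u * max 0 u powr (2 * H - 1)" for u :: real
 define h where "h u = indicator {1..} u * u powr (2 * H - 3)" for u :: real
 have gi: "integrable lborel g" unfolding g_def using H by (intro integrable_pos_part_powr) auto
 have hi: "integrable lborel h" unfolding h_def by (rule integrable_lborel_from_has_integral(1)[OF has_integral_powr_to_inf]) (use H in auto)
 have one: "integrable lborel (indicat_real {-1..0 :: real})" by simp
 let ?B = "%u. g (1 + (-1) * u) + (h (0 + (-1) * u) + (2 * g (0 + (-1) * u) + 4 * indicator {-1..0} u))"
 have sq: "(y powr ?a)^2 = y powr (2 * H - 1)" for y by (simp add: power2_eq_square flip: powr_add)
 show ?thesis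
 proof (rule L_integrable_bound)
  show "integrable lborel ?B" by (intro L_integrable_add lborel_integrable_real_affine gi hi integrable_mult_right one) auto
  show "AE u in lborel. norm ((mvn_kernel H 1 u)^2) <= norm (?B u)"
  proof (rule AE_I2)
   fix u :: real
   have g0: "0 <= g x" "0 <= h x" for x by (auto simp: g_def h_def)
   have "(mvn_kernel H 1 u)^2 <= ?B u"
   proof -
    consider "u >= 0" | "-1 < u" "u < 0" | "u <= -1" by linarith
    then show ?thesis
    proof cases
     case 1
     then have "(mvn_kernel H 1 u)^2 = max 0 (1 - u) powr (2 * H - 1)" by (simp add: mvn_kernel_def sq)
     also have "... <= g (1 + (-1) * u)" using 1 by (auto simp: g_def indicator_def max_def)
     finally show ?thesis using g0[of "0 + (-1) * u"] by (smt (verit) indicator_pos_le)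
    next
     case 2
     have "(mvn_kernel H 1 u)^2 <= 2 * ((1 - u) powr ?a)^2 + 2 * ((- u) powr ?a)^2"
      using 2 sum_squares_bound[of "(1 - u) powr ?a" "(- u) powr ?a"] zero_le_power2[of "(1-u) powr ?a + (- u) powr ?a"]
      by (simp add: mvn_kernel_def power2_eq_square algebra_simps)
     also have "... = 2 * (1 - u) powr (2 * H - 1) + 2 * (- u) powr (2 * H - 1)" unfolding sq ..
     also have "(1 - u) powr (2 * H - 1) <= 2"
     proof -
      have "(1 - u) powr (2 * H - 1) <= (1 - u) powr 1" using 2 H by (intro powr_mono) auto
      then show ?thesis using 2 by simp
     qed
     finally have "(mvn_kernel H 1 u)^2 <= 4 + 2 * (- u) powr (2 * H - 1)" by simp
     also have "... = 4 * indicator {-1..0} u + 2 * g (0 + (-1) * u)" using 2 by (simp add: g_def indicator_def)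
     finally show ?thesis using g0(1)[of "1 + (-1) * u"] g0(2)[of "0 + (-1) * u"] by linarith
    next
     case 3
     let ?v = "- u"
     have v: "?v >= 1" using 3 by simp
     have "EX z. ?v < z & z < ?v + 1 & (?v + 1) powr ?a - ?v powr ?a = (?v + 1 - ?v) * (?a * z powr (?a - 1))"
      using v by (intro MVT2) (auto intro!: derivative_eq_intros simp: field_simps powr_diff)
     then obtain z where z: "?v < z" "(?v + 1) powr ?a - ?v powr ?a = ?a * z powr (?a - 1)" by auto
     have "(mvn_kernel H 1 u)^2 = (?a * z powr (?a - 1))^2" using v unfolding z(2)[symmetric] by (simp add: mvn_kernel_def max_def add.commute)
     also have "... = ?a^2 * z powr (2 * H - 3)" by (simp add: power_mult_distrib power2_eq_square[of "z powr _"] flip: powr_add)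
     also have "... <= 1 * ?v powr (2 * H - 3)"
     proof (rule mult_mono)
      show "?a^2 <= 1" using H abs_square_le_1[of ?a] by (simp add: abs_le_iff)
      show "z powr (2 * H - 3) <= ?v powr (2 * H - 3)" using z v H by (intro powr_mono2') auto
     qed auto
     also have "... = h (0 + (-1) * u)" using v by (simp add: h_def indicator_def)
     finally show ?thesis using g0(1)[of "1 + (-1) * u"] g0(1)[of "0 + (-1) * u"] by (smt (verit) indicator_pos_le)
    qed
   qed
   then show "norm ((mvn_kernel H 1 u)^2) <= norm (?B u)" by simp
  qed
 qed simp
qed

text \<open>Stationarity of the increments and self-similarity at the level of kernels: the parts in
  - u cancel, and the rest is homogeneous.\<close>

lemma mvn_kernel_diff:
 assumes "s < t"
 shows "mvn_kernel H t (s + (t - s) * x) - mvn_kernel H s (s + (t - s) * x) = (t - s) powr (H - 1/2) * mvn_kernel H 1 x"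
proof -
 have mx: "max 0 ((t - s) * y) = (t - s) * max 0 y" for y using assms by (auto simp: max_def zero_le_mult_iff mult_le_0_iff)
 have 1: "max 0 (t - (s + (t - s) * x)) = (t - s) * max 0 (1 - x)" using mx[of "1 - x"] by (simp add: algebra_simps)
 have 2: "max 0 (s - (s + (t - s) * x)) = (t - s) * max 0 (- x)" using mx[of "- x"] by (simp add: algebra_simps)
 show ?thesis unfolding mvn_kernel_def 1 2 using assms by (simp add: powr_mult right_diff_distrib)
qed

lemma mvn_kernel_diff_sq:
 assumes H: "0 < H" "H < 1"
 shows "integrable lborel (%u. (mvn_kernel H t u - mvn_kernel H s u)^2)" (is ?I)
  and "(LBINT u. (mvn_kernel H t u - mvn_kernel H s u)^2) = mvn_const H * \<bar>t - s\<bar> powr (2 * H)" (is ?L)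
proof -
 have *: "integrable lborel (%u. (mvn_kernel H t u - mvn_kernel H s u)^2) &
  (LBINT u. (mvn_kernel H t u - mvn_kernel H s u)^2) = mvn_const H * (t - s) powr (2 * H)" if st: "s < t" for s t
 proof
  let ?f = "%u. (mvn_kernel H t u - mvn_kernel H s u)^2"
  have eq: "?f (s + (t - s) * x) = (t - s) powr (2 * H - 1) * (mvn_kernel H 1 x)^2" for x
   unfolding mvn_kernel_diff[OF st] by (simp add: power_mult_distrib power2_eq_square[of "_ powr _"] flip: powr_add)
  show "integrable lborel ?f" using lborel_integrable_real_affine_iff[of "t - s" ?f s] st mvn_kernel_1_sq_integrable[OF H] unfolding eq by simp
  have "integral\<^sup>L lborel ?f = (t - s) * (LBINT x. ?f (s + (t - s) * x))" using lborel_integral_real_affine[of "t - s" ?f s] st by simp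
  also have "... = (t - s) * (t - s) powr (2 * H - 1) * mvn_const H" unfolding eq by (simp add: mvn_const_def)
  also have "(t - s) * (t - s) powr (2 * H - 1) = (t - s) powr (2 * H)" using st by (simp add: powr_diff)
  finally show "integral\<^sup>L lborel ?f = mvn_const H * (t - s) powr (2 * H)" by simp
 qed
 have "integrable lborel (%u. (mvn_kernel H t u - mvn_kernel H s u)^2) &
  (LBINT u. (mvn_kernel H t u - mvn_kernel H s u)^2) = mvn_const H * \<bar>t - s\<bar> powr (2 * H)"
  using *[of s t] *[of t s] by (cases s t rule: linorder_cases) (auto simp: power2_commute)
 then show ?I
  and ?L by auto
qed

lemma mvn_kernel_sq_integrable:
 "0 < H ==> H < 1 ==> integrable lborel (%u. (mvn_kernel H t u)^2)" using mvn_kernel_diff_sq(1)[of H t 0] by simp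

lemma mvn_kernel_mult_integrable:
 "0 < H ==> H < 1 ==> integrable lborel (%u. mvn_kernel H s u * mvn_kernel H t u)"
 by (intro integrable_mult_of_squares mvn_kernel_sq_integrable) auto

text \<open>Polarisation, as the three squared norms are known from
  \<open>mvn_kernel_diff_sq\<close>. A covariance with factor \<open>c\<close> is thus 2 c /
  \<open>mvn_const H\<close> times the Gram matrix of the kernels.\<close>

lemma mvn_kernel_inner:
 assumes H: "0 < H" "H < 1" and "0 <= s" "0 <= t"
 shows "(LBINT u. mvn_kernel H s u * mvn_kernel H t u) =
  mvn_const H / 2 * (t powr (2 * H) + s powr (2 * H) - \<bar>t - s\<bar> powr (2 * H))"
proof -
 let ?K = "mvn_kernel H"
 have "(LBINT u. (?K t u - ?K s u)^2) =
   (LBINT u. (?K t u)^2 + (?K s u)^2 - 2 * (?K s u * ?K t u))" by (intro L_integral_cong) (auto simp: power2_eq_square algebra_simps)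
 also have "... = (LBINT u. (?K t u)^2) + (LBINT u. (?K s u)^2) - 2 * (LBINT u. ?K s u * ?K t u)"
  using mvn_kernel_sq_integrable[OF H] mvn_kernel_mult_integrable[OF H] by simp
 finally show ?thesis using mvn_kernel_diff_sq(2)[OF H, of t s] mvn_kernel_diff_sq(2)[OF H, of t 0] mvn_kernel_diff_sq(2)[OF H, of s 0] assms
  by (simp add: algebra_simps)
qed

lemma mvn_kernel_future_zero: "0 <= s ==> s <= u ==> mvn_kernel H s u = 0" by (simp add: mvn_kernel_def)

lemma integral_pos_part_powr:
 assumes "p > -1" "s < t"
 shows "integrable lborel (%u. indicator {s..t} u * max 0 (t - u) powr p :: real)"
  and "(LBINT u. indicator {s..t} u * max 0 (t - u) powr p) = (t - s) powr (p + 1) / (p + 1)"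
proof -
 let ?f = "%u. indicator {0..t - s} u * u powr p :: real"
 have c: "0 <= t - s" using assms by simp
 note I = integrable_lborel_from_has_integral[OF has_integral_powr_from_0[OF assms(1) c]]
 have eq: "?f (t + (-1) * u) = indicator {s..t} u * max 0 (t - u) powr p" for u by (auto simp: indicator_def)
 show "integrable lborel (%u. indicator {s..t} u * max 0 (t - u) powr p)" using lborel_integrable_real_affine[of ?f "-1" t] I(1) unfolding eq by simp
 show "(LBINT u. indicator {s..t} u * max 0 (t - u) powr p) = (t - s) powr (p + 1) / (p + 1)"
  using lborel_integral_real_affine[of "-1" ?f t] I(2) unfolding eq by simp
qed

lemma integrable_sum_mult_sq:
 fixes a :: "'i => real"
 assumes [measurable]: "!!i. i : I ==> f i : borel_measurable M" and "finite I"
  and "!!i. i : I ==> integrable M (%u. (f i u :: real)^2)"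
 shows "integrable M (%u. (SUM i:I. a i * f i u)^2)"
proof -
 have "integrable M (%u. a i * a j * (f i u * f j u))" if "i : I" "j : I" for i j
  by (intro integrable_mult_right integrable_mult_of_squares) (use assms that in auto)
 then have "integrable M (%u. SUM i:I. SUM j:I. a i * a j * (f i u * f j u))" by simp
 then show ?thesis by (simp add: power2_eq_square sum_product mult_ac)
qed

lemma mvn_kernel_quadratic_form:
 assumes H: "0 < H" "H < 1" and "finite I" and t: "!!i. i : I ==> 0 <= t i"
 shows "(LBINT u. (SUM i:I. a i * mvn_kernel H (t i) u)^2) =
  mvn_const H / 2 * (SUM i:I. SUM j:I. a i * a j * (t i powr (2 * H) + t j powr (2 * H) - \<bar>t i - t j\<bar> powr (2 * H)))"
proof -
 let ?K = "%i. mvn_kernel H (t i)"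
 have "(LBINT u. (SUM i:I. a i * ?K i u)^2) = (LBINT u. (SUM i:I. SUM j:I. a i * a j * (?K i u * ?K j u)))"
  by (intro L_integral_cong refl) (simp add: power2_eq_square sum_product mult_ac)
 also have "... = (SUM i:I. SUM j:I. a i * a j * (LBINT u. ?K i u * ?K j u))" using mvn_kernel_mult_integrable[OF H] by simp
 also have "... = (SUM i:I. SUM j:I. mvn_const H / 2 * (a i * a j * (t i powr (2 * H) + t j powr (2 * H) - \<bar>t i - t j\<bar> powr (2 * H))))"
  by (intro sum.cong refl) (simp add: mvn_kernel_inner[OF H t t] abs_minus_commute add.commute)
 finally show ?thesis by (simp add: sum_distrib_left)
qed

text \<open>Strong local nondeterminism: after time \<open>s\<close> only the kernel of \<open>t\<close> is nonzero.\<close>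

lemma mvn_kernel_nondeterminism:
 assumes H: "0 < H" "H < 1" and "finite I" and si: "!!i. i : I ==> 0 <= r i & r i <= s" and s: "0 <= s" "s < t"
 shows "(t - s) powr (2 * H) / (2 * H) <= (LBINT u. (mvn_kernel H t u - (SUM i:I. a i * mvn_kernel H (r i) u))^2)"
proof -
 have p: "2 * H - 1 > -1" using H by simp
 have "(t - s) powr (2 * H) / (2 * H) = (LBINT u. indicator {s..t} u * max 0 (t - u) powr (2 * H - 1))"
  using integral_pos_part_powr(2)[OF p s(2)] by simp
 also have "... <= (LBINT u. (mvn_kernel H t u - (SUM i:I. a i * mvn_kernel H (r i) u))^2)"
 proof (rule integral_mono)
  show "integrable lborel (%u. indicator {s..t} u * max 0 (t - u) powr (2 * H - 1))" by (rule integral_pos_part_powr(1)[OF p s(2)])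
  \<comment> \<open>The option type adds the kernel of \<open>t\<close>, with coefficient 1, to the
    given family.\<close>
  let ?b = "%i. case i of None => 1 | Some i => - a i"
  let ?q = "%i. case i of None => t | Some i => r i"
  have "integrable lborel (%u. (SUM i:insert None (Some ` I). ?b i * mvn_kernel H (?q i) u)^2)"
   by (intro integrable_sum_mult_sq mvn_kernel_sq_integrable H) (use \<open>finite I\<close> in auto)
  then show "integrable lborel (%u. (mvn_kernel H t u - (SUM i:I. a i * mvn_kernel H (r i) u))^2)"
   using \<open>finite I\<close> by (simp add: sum.reindex sum_negf)
  fix u
  show "indicator {s..t} u * max 0 (t - u) powr (2 * H - 1) <= (mvn_kernel H t u - (SUM i:I. a i * mvn_kernel H (r i) u))^2"
  proof (cases "u : {s..t}")
   case True
   then have "(SUM i:I. a i * mvn_kernel H (r i) u) = 0"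
   proof (intro sum.neutral ballI)
    fix i assume "i : I"
    then have "mvn_kernel H (r i) u = 0" using si[of i] True by (intro mvn_kernel_future_zero) auto
    then show "a i * mvn_kernel H (r i) u = 0" by simp
   qed
   moreover have "mvn_kernel H t u = (max 0 (t - u)) powr (H - 1/2)" using True s by (simp add: mvn_kernel_def)
   ultimately show ?thesis using True by (simp add: power2_eq_square flip: powr_add)
  qed simp
 qed
 finally show ?thesis .
qed

lemma mvn_const_pos:
 assumes "0 < H" "H < 1" shows "0 < mvn_const H" using mvn_kernel_nondeterminism[OF assms, of "{}" r 0 1 a] assms
 by (simp add: mvn_const_def) (smt (verit) divide_pos_pos)

text \<open>Convolution of the powers H - 1/2 and 1/2 - H gives a first power, with a Beta constant.
  As \<tau> >= 0, only u > 0 matters, where the second part of the kernel vanishes; as t <= 1, the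
  cutoff at 1 is invisible. The ramps obtained this way span the piecewise linear paths, which is
  how the drift gets represented by the kernel.\<close>

lemma mvn_kernel_beta_integral:
 assumes H: "0 < H" "H < 1" and \<tau>: "0 <= \<tau>" and t: "0 <= t" "t <= 1"
 shows "(LBINT u. mvn_kernel H t u * (indicator {..1} u * max 0 (u - \<tau>) powr (1/2 - H))) =
  Beta (3/2 - H) (H + 1/2) * max 0 (t - \<tau>)"
proof -
 have eq: "mvn_kernel H t u * (indicator {..1} u * max 0 (u - \<tau>) powr (1/2 - H)) =
   max 0 (t - u) powr (H - 1/2) * max 0 (u - \<tau>) powr (1/2 - H)" for u using \<tau> t by (auto simp: mvn_kernel_def indicator_def max_def)
 show ?thesis
 proof (cases "\<tau> < t")
  case False
  then have z: "max 0 (t - u) powr (H - 1/2) * max 0 (u - \<tau>) powr (1/2 - H) = 0" for u by (auto simp: max_def)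
  show ?thesis unfolding eq z using False by simp
 next
  case True
  let ?f = "%u. max 0 (t - u) powr (H - 1/2) * max 0 (u - \<tau>) powr (1/2 - H)"
  let ?g = "%x. indicator {0..1} x * (x powr ((3/2 - H) - 1) * (1 - x) powr ((H + 1/2) - 1))"
  have fg: "?f (\<tau> + (t - \<tau>) * x) = ?g x" for x
  proof (cases "0 < x & x < 1")
   case x: True
   have "t - (\<tau> + (t - \<tau>) * x) = (t - \<tau>) * (1 - x)" by (simp add: algebra_simps)
   moreover have "0 < (t - \<tau>) * (1 - x)" "0 < (t - \<tau>) * x" using True x by auto
   ultimately have "?f (\<tau> + (t - \<tau>) * x) = ((t - \<tau>) * (1 - x)) powr (H - 1/2) * ((t - \<tau>) * x) powr (1/2 - H)"
    by (simp add: max_def)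
   also have "... = ((t - \<tau>) powr (H - 1/2) * (t - \<tau>) powr (1/2 - H)) * ((1 - x) powr (H - 1/2) * x powr (1/2 - H))"
    using True x by (simp add: powr_mult)
   also have "(t - \<tau>) powr (H - 1/2) * (t - \<tau>) powr (1/2 - H) = 1" using True by (simp flip: powr_add)
   finally show ?thesis using x by (simp add: indicator_def algebra_simps)
  next
   case x: False
   then have "t - (\<tau> + (t - \<tau>) * x) <= 0 \<or> (\<tau> + (t - \<tau>) * x) - \<tau> <= 0"
   proof (cases "x <= 0")
    case True
    then show ?thesis using \<open>\<tau> < t\<close> by (simp add: mult_le_0_iff)
   next
    case False
    then have "(t - \<tau>) * 1 <= (t - \<tau>) * x" using x \<open>\<tau> < t\<close> by (intro mult_left_mono) auto
    then show ?thesis by simp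
   qed
   then have "?f (\<tau> + (t - \<tau>) * x) = 0" by (auto simp: max_def)
   moreover have "?g x = 0" using x by (auto simp: indicator_def)
   ultimately show ?thesis by (simp only:)
  qed
  have "integral\<^sup>L lborel ?f = (t - \<tau>) * (LBINT x. ?f (\<tau> + (t - \<tau>) * x))"
   using lborel_integral_real_affine[of "t - \<tau>" ?f \<tau>] True by simp
  also have "... = (t - \<tau>) * (LBINT x. ?g x)" unfolding fg ..
  also have "(LBINT x. ?g x) = Beta (3/2 - H) (H + 1/2)" by (rule integrable_lborel_from_has_integral(2)[OF has_integral_Beta_real]) (use H in auto)
  finally show ?thesis unfolding eq using True by simp
 qed
qed

section \<open>The energy of the drift\<close>

lemma weighted_powr_increment:
 fixes x y \<eta> th :: real
 assumes x: "0 < x" "x <= y" "y <= 2 * x" and \<eta>: "0 < \<eta>" "\<eta> < th"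
 shows "y powr th * (x powr (- \<eta>) - y powr (- \<eta>)) <= 2 powr th * (\<eta> / (th - \<eta>)) * (y powr (th - \<eta>) - x powr (th - \<eta>))"
proof -
 let ?C = "\<eta> / (th - \<eta>)"
 \<comment> \<open>Monotonicity of \<open>F\<close> is the integrated form of s^th d(- s^(- \<eta>))
   = \<eta> / (th - \<eta>) d s^(th - \<eta>), with s^th bounded below by x^th. It makes weighted
   increments telescope. Passing from the weight at \<open>x\<close> to the one at \<open>y\<close>
   costs 2^th, because y <= 2 x.\<close>
 define F where "F s = ?C * s powr (th - \<eta>) + x powr th * s powr (- \<eta>)" for s
 have "F x <= F y"
 proof (rule DERIV_nonneg_imp_nondecreasing[OF x(2)])
  fix s assume s: "x <= s" "s <= y"
  then have s0: "0 < s" using x by simp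
  have "(F has_real_derivative ?C * ((th - \<eta>) * s powr (th - \<eta> - 1)) + x powr th * ((- \<eta>) * s powr (- \<eta> - 1))) (at s)"
   unfolding F_def by (intro DERIV_add DERIV_cmult has_real_derivative_powr s0)
  moreover have "?C * ((th - \<eta>) * s powr (th - \<eta> - 1)) + x powr th * ((- \<eta>) * s powr (- \<eta> - 1)) = \<eta> * s powr (- \<eta> - 1) * (s powr th - x powr th)"
  proof -
   have "s powr (th - \<eta> - 1) = s powr (- \<eta> - 1) * s powr th" by (simp flip: powr_add add: algebra_simps)
   then show ?thesis using \<eta> by (simp add: field_simps)
  qed
  moreover have "0 <= \<eta> * s powr (- \<eta> - 1) * (s powr th - x powr th)"
   using \<eta> s x by (intro mult_nonneg_nonneg) (auto intro!: powr_mono2)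
  ultimately show "EX d. (F has_real_derivative d) (at s) & 0 <= d" by metis
 qed
 then have 1: "x powr th * (x powr (- \<eta>) - y powr (- \<eta>)) <= ?C * (y powr (th - \<eta>) - x powr (th - \<eta>))"
  by (simp add: F_def algebra_simps)
 have "y powr th <= (2 * x) powr th" using x \<eta> by (intro powr_mono2) auto
 also have "... = 2 powr th * x powr th" using x by (simp add: powr_mult)
 finally have "y powr th * (x powr (- \<eta>) - y powr (- \<eta>)) <= 2 powr th * x powr th * (x powr (- \<eta>) - y powr (- \<eta>))"
  using x \<eta> by (intro mult_right_mono) (auto intro!: powr_mono2')
 also have "... <= 2 powr th * (?C * (y powr (th - \<eta>) - x powr (th - \<eta>)))" unfolding mult.assoc using 1 by (intro mult_left_mono) auto
 finally show ?thesis by (simp add: mult.assoc)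
qed

text \<open>For a >= 0 the weights are bounded and monotone, and the sum telescopes. For a < 0 they
  blow up near u; the factor with exponent \<open>th\<close> compensates through
  \<open>weighted_powr_increment\<close>, whose ratio condition holds for all increments but the
  last. That one is kept as the second summand.\<close>

lemma weight_sum_bound:
 fixes a th u :: real
 assumes th: "0 < th" "0 < th + a" and k: "k < N" and u: "real k / N < u" "u <= 1"
 defines "w \<equiv> %j. max 0 (u - real j / N) powr a"
 shows "(SUM j<k. (real (k - j) / N) powr th * \<bar>w (Suc j) - w j\<bar>)
  <= (1 + 2 powr th * \<bar>a\<bar> / (th + a)) + (1 / real N) powr th * (u - real k / N) powr a"
proof -
 have N: "0 < real N" using k by simp
 have lt: "real j / N < u" if "j <= k" for j
 proof -
  have "real j / N <= real k / N" using that by (simp add: divide_right_mono)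
  then show ?thesis using u by simp
 qed
 have w: "w j = (u - real j / N) powr a" if "j <= k" for j using lt[OF that] by (simp add: w_def)
 have r1: "(real (k - j) / N) powr th <= 1" for j using k th by (intro powr_le1) auto
 have w0: "w 0 = u powr a" and u0: "0 < u" using w[of 0] lt[of 0] by auto
 show ?thesis
 proof (cases "0 <= a")
  case True
  have dec: "w (Suc j) <= w j" for j unfolding w_def using True N divide_right_mono[of "real j" "real (Suc j)" "real N"] by (intro powr_mono2) auto
  have "(SUM j<k. (real (k - j) / N) powr th * \<bar>w (Suc j) - w j\<bar>) <= (SUM j<k. 1 * (w j - w (Suc j)))"
   using dec r1 by (intro sum_mono mult_mono) (simp_all del: of_nat_diff)
  also have "... = w 0 - w k" by (simp add: sum_lessThan_telescope')
  also have "... <= 1" using w0 u0 u True powr_le1[of a u] powr_ge_zero[of "max 0 (u - real k / N)" a] unfolding w_def by linarith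
  also have "1 <= (1 + 2 powr th * \<bar>a\<bar> / (th + a)) + (1 / real N) powr th * (u - real k / N) powr a" using th by simp
  finally show ?thesis .
 next
  case False
  define \<eta> where "\<eta> = - a"
  have \<eta>: "0 < \<eta>" "\<eta> < th" using False th by (auto simp: \<eta>_def)
  let ?C = "2 powr th * (\<eta> / (th - \<eta>))"
  have C: "0 <= ?C" using \<eta> by simp
  define G where "G j = (u - real j / N) powr (th - \<eta>)" for j
  have G: "G j <= 1" if "j <= k" for j unfolding G_def using lt[OF that] u \<eta> divide_nonneg_nonneg[of "real j" "real N"] by (intro powr_le1) linarith+
  have inc: "w j <= w (Suc j)" if "Suc j <= k" for j
  proof -
   have "real j / N <= real (Suc j) / N" by (rule divide_right_mono) auto
   then show ?thesis unfolding w[OF that] w[OF Suc_leD[OF that]] using lt[OF that] False by (intro powr_mono2') auto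
  qed
  show ?thesis
  proof (cases k)
   case 0
   then show ?thesis using th by simp
  next
   case (Suc k')
   have "(SUM j<k'. (real (k - j) / N) powr th * \<bar>w (Suc j) - w j\<bar>) <= (SUM j<k'. ?C * (G j - G (Suc j)))"
   proof (rule sum_mono)
    fix j assume "j : {..<k'}"
    then have j: "j < k'" "Suc j <= k" "j <= k" using Suc by auto
    let ?x = "u - real (Suc j) / N" and ?y = "u - real j / N"
    have xy: "?y = ?x + 1 / N" using N by (simp add: field_simps)
    have "real (Suc (Suc j)) / N < u" using j Suc by (intro lt) auto
    then have x: "1 / N <= ?x" "0 < 1 / real N" using N by (simp_all add: field_simps)
    have x0: "0 < ?x" using lt[OF j(2)] by simp
    have "real (k - j) / N <= ?y"
    proof -
     have "real (k - j) / N = real k / N - real j / N" using j by (simp add: of_nat_diff diff_divide_distrib)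
     then show ?thesis using u by simp
    qed
    then have "(real (k - j) / N) powr th <= ?y powr th" using th by (intro powr_mono2) auto
    then have "(real (k - j) / N) powr th * \<bar>w (Suc j) - w j\<bar> <= ?y powr th * (?x powr (- \<eta>) - ?y powr (- \<eta>))"
     using inc[OF j(2)] w[OF j(2)] w[OF j(3)] by (simp add: \<eta>_def mult_right_mono)
    also have "... <= ?C * (?y powr (th - \<eta>) - ?x powr (th - \<eta>))"
     proof (rule weighted_powr_increment)
      show "?y <= 2 * ?x" proof -
       have "e <= a ==> a + e <= 2 * a" for a e :: real by linarith
       then show ?thesis unfolding xy using x by blast
      qed
     qed (use x0 x xy \<eta> in linarith)+
    finally show "(real (k - j) / N) powr th * \<bar>w (Suc j) - w j\<bar> <= ?C * (G j - G (Suc j))" by (simp only: G_def)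
   qed
   also have "... = ?C * (G 0 - G k')" unfolding sum_distrib_left[symmetric] sum_lessThan_telescope' ..
   also have "... <= ?C * 1" using G[of 0] C powr_ge_zero[of "u - real k' / N" "th - \<eta>"] unfolding G_def by (intro mult_left_mono) linarith+
   finally have 1: "(SUM j<k'. (real (k - j) / N) powr th * \<bar>w (Suc j) - w j\<bar>) <= 2 powr th * \<bar>a\<bar> / (th + a)"
    using False by (simp add: \<eta>_def)
   \<comment> \<open>The distance from u to k / N may be far smaller than 1 / N, so the ratio of the
     two arguments is unbounded here.\<close>
   have "\<bar>w k - w k'\<bar> <= (u - real k / N) powr a" using inc[of k'] w[of k] Suc by (simp add: w_def)
   then have "(real (k - k') / N) powr th * \<bar>w (Suc k') - w k'\<bar> <= (1 / real N) powr th * (u - real k / N) powr a"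
    using Suc by (simp add: mult_left_mono)
   then show ?thesis using 1 unfolding Suc sum.lessThan_Suc by simp
  qed
 qed
qed

lemma integral_pos_part_powr':
 assumes "p > -1" "s < t"
 shows "integrable lborel (%u. indicator {s<..t} u * max 0 (u - s) powr p :: real)"
  and "(LBINT u. indicator {s<..t} u * max 0 (u - s) powr p) = (t - s) powr (p + 1) / (p + 1)"
proof -
 let ?f = "%u. indicator {0..t - s} u * u powr p :: real"
 have c: "0 <= t - s" using assms by simp
 note I = integrable_lborel_from_has_integral[OF has_integral_powr_from_0[OF assms(1) c]]
 have eq: "?f (- s + 1 * u) = indicator {s<..t} u * max 0 (u - s) powr p" for u by (auto simp: indicator_def)
 show "integrable lborel (%u. indicator {s<..t} u * max 0 (u - s) powr p)"
  using lborel_integrable_real_affine[of ?f 1 "- s"] I(1) unfolding eq by simp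
 show "(LBINT u. indicator {s<..t} u * max 0 (u - s) powr p) = (t - s) powr (p + 1) / (p + 1)"
  using lborel_integral_real_affine[of 1 ?f "- s"] I(2) unfolding eq by simp
qed

text \<open>The fractional derivative of order \<open>H + 1/2\<close> of the piecewise linear path with slopes
 \<open>\<beta> j\<close> on the grid of mesh \<open>1 / N\<close>, up to a constant factor.\<close>

definition drift_derivative :: "real => nat => (nat => real) => real => real" where
 "drift_derivative H N \<beta> u =
  (SUM j<N. (\<beta> j - (if j = 0 then 0 else \<beta> (j - 1))) * (indicator {..1} u * max 0 (u - real j / N) powr (1/2 - H)))"

lemma drift_derivative_measurable [measurable]: "drift_derivative H N \<beta> : borel_measurable borel" unfolding drift_derivative_def by measurable

lemma pos_part_sq_integrable:
 assumes H: "H < 1" and s: "0 <= s" "s < 1"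
 shows "integrable lborel (%u. (indicator {..1} u * max 0 (u - s) powr (1/2 - H))^2 :: real)"
proof -
 have "(indicator {..1} u * max 0 (u - s) powr (1/2 - H))^2 = indicator {s<..1} u * max 0 (u - s) powr (1 - 2 * H)" for u :: real
  by (auto simp: indicator_def power2_eq_square max_def simp flip: powr_add)
 then show ?thesis using integral_pos_part_powr'(1)[of "1 - 2 * H" s 1] assms by simp
qed

text \<open>Each jump of the slope contributes a ramp by \<open>mvn_kernel_beta_integral\<close>,
  and the ramps add up to the polygon at the grid time. This puts the drift into the form required
  by the last conclusion of \<open>fbm_innovations\<close>.\<close>

lemma drift_derivative_inner:
 assumes H: "0 < H" "H < 1" and k: "k < N"
 shows "(LBINT u. mvn_kernel H (real (Suc k) / N) u * drift_derivative H N \<beta> u) =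
  Beta (3/2 - H) (H + 1/2) * ((SUM j<=k. \<beta> j) / N)"
proof -
 let ?t = "real (Suc k) / N" and ?B = "Beta (3/2 - H) (H + 1/2)"
 let ?c = "%j. \<beta> j - (if j = 0 then 0 else \<beta> (j - 1))"
 let ?f = "%j u. indicator {..1} u * max 0 (u - real j / N) powr (1/2 - H)"
 have N: "0 < real N" using k by simp
 have t: "0 <= ?t" "?t <= 1" using k by (auto simp: field_simps)
 have fi: "integrable lborel (%u. mvn_kernel H ?t u * ?f j u)" if "j < N" for j
  by (intro integrable_mult_of_squares mvn_kernel_sq_integrable pos_part_sq_integrable H) (use that in auto)
 have "(LBINT u. mvn_kernel H ?t u * drift_derivative H N \<beta> u) = (LBINT u. (SUM j<N. ?c j * (mvn_kernel H ?t u * ?f j u)))"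
  by (simp add: drift_derivative_def sum_distrib_left mult_ac)
 also have "... = (SUM j<N. ?c j * (LBINT u. mvn_kernel H ?t u * ?f j u))"
 proof -
  have "(LBINT u. (SUM j<N. ?c j * (mvn_kernel H ?t u * ?f j u))) = (SUM j<N. LBINT u. ?c j * (mvn_kernel H ?t u * ?f j u))"
   by (rule L_integral_sum) (rule integrable_mult_right, rule fi, simp)
  then show ?thesis by (simp only: integral_mult_right_zero)
 qed
 also have "... = (SUM j<N. ?c j * (?B * max 0 (?t - real j / N)))"
  by (intro sum.cong refl arg_cong2[where f = "(*)"] mvn_kernel_beta_integral H t) auto
 also have "... = ?B * (SUM j<N. ?c j * max 0 (?t - real j / N))" by (simp add: sum_distrib_left mult_ac)
 also have "(SUM j<N. ?c j * max 0 (?t - real j / N)) = (SUM j<Suc k. ?c j * (real (Suc k - j) / N))"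
 proof (rule sum.mono_neutral_cong_right)
  show "ALL j:{..<N} - {..<Suc k}. ?c j * max 0 (?t - real j / N) = 0"
  proof
   fix j assume "j : {..<N} - {..<Suc k}"
   then have "?t <= real j / N" by (intro divide_right_mono) auto
   then show "?c j * max 0 (?t - real j / N) = 0" by simp
  qed
  fix j assume "j : {..<Suc k}"
  then have "?t - real j / N = real (Suc k - j) / N" by (simp add: of_nat_diff diff_divide_distrib add_divide_distrib)
  then show "?c j * max 0 (?t - real j / N) = ?c j * (real (Suc k - j) / N)" by simp
 qed (use k in auto)
 also have "... = (SUM j<Suc k. ?c j * real (Suc k - j)) / N" by (simp only: sum_divide_distrib times_divide_eq_right)
 also have "(SUM j<Suc k. ?c j * real (Suc k - j)) = (SUM j<=k. \<beta> j)"
 proof (induction k)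
  case (Suc k)
  have tel: "(SUM j<Suc n. ?c j) = \<beta> n" for n by (induction n) auto
  have "(SUM j<Suc (Suc k). ?c j * real (Suc (Suc k) - j)) = (SUM j<Suc (Suc k). ?c j * real (Suc k - j) + ?c j)"
   by (intro sum.cong refl) (simp add: Suc_diff_le algebra_simps)
  also have "... = (SUM j<Suc (Suc k). ?c j * real (Suc k - j)) + \<beta> (Suc k)" unfolding sum.distrib tel ..
  also have "(SUM j<Suc (Suc k). ?c j * real (Suc k - j)) = (SUM j<Suc k. ?c j * real (Suc k - j))" by simp
  finally show ?case using Suc by simp
 qed simp
 finally show ?thesis .
qed

text \<open>Abel summation relative to the current slope. The differences \<beta> k - \<beta> j will
  be small for j near k, which is where the increments of the weights are large if H > 1/2.\<close>

lemma drift_derivative_abel: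
 fixes H :: real
 assumes k: "k < N" and u: "real k / N < u" "u <= real (Suc k) / N"
 defines "w \<equiv> %j. max 0 (u - real j / N) powr (1/2 - H)"
 shows "drift_derivative H N \<beta> u = \<beta> k * w 0 + (SUM j<k. (\<beta> k - \<beta> j) * (w (Suc j) - w j))"
proof -
 let ?c = "%j. \<beta> j - (if j = 0 then 0 else \<beta> (j - 1))"
 have N: "0 < real N" using k by simp
 have "real (Suc k) / N <= 1" using k by (simp add: field_simps)
 then have u1: "u <= 1" using u by simp
 have "drift_derivative H N \<beta> u = (SUM j<Suc k. ?c j * w j)" unfolding drift_derivative_def w_def
 proof (rule sum.mono_neutral_cong_right)
  show "ALL j:{..<N} - {..<Suc k}. ?c j * (indicator {..1} u * max 0 (u - real j / N) powr (1/2 - H)) = 0"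
  proof
   fix j assume "j : {..<N} - {..<Suc k}"
   then have "real (Suc k) / N <= real j / N" by (intro divide_right_mono) auto
   then show "?c j * (indicator {..1} u * max 0 (u - real j / N) powr (1/2 - H)) = 0" using u by simp
  qed
 qed (use k u1 in auto)
 also have "(SUM j<Suc n. ?c j * w j) = \<beta> n * w 0 + (SUM j<n. (\<beta> n - \<beta> j) * (w (Suc j) - w j))" for n
 proof (induction n)
  case (Suc n)
  have "(SUM j<Suc n. (\<beta> (Suc n) - \<beta> j) * (w (Suc j) - w j)) =
   (SUM j<Suc n. (\<beta> n - \<beta> j) * (w (Suc j) - w j) + (\<beta> (Suc n) - \<beta> n) * (w (Suc j) - w j))"
   by (intro sum.cong refl) (simp add: algebra_simps)
  also have "... = (SUM j<n. (\<beta> n - \<beta> j) * (w (Suc j) - w j)) + (\<beta> (Suc n) - \<beta> n) * (w (Suc n) - w 0)"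
   by (simp add: sum.distrib sum_distrib_left[symmetric] sum_lessThan_telescope del: sum.lessThan_Suc)
    (simp add: sum_lessThan_telescope)
  finally show ?case using Suc by (simp add: algebra_simps)
 qed simp
 finally show ?thesis .
qed

text \<open>After \<open>drift_derivative_abel\<close>, Cauchy--Schwarz with the weights ((k - j) /
  N)^th balances the second moments of the slope increments against the increments of the kernel
  weights, so that \<open>weight_sum_bound\<close> applies. Second moments suffice because the
  expectation is taken for each u before integrating. The bound is free of \<open>N\<close>.\<close>

lemma expected_drift_energy:
 fixes \<beta> :: "nat => 'w => real"
 assumes M: "prob_space M" and \<beta>m: "!!j. j < N ==> \<beta> j : borel_measurable M"
  and \<beta>b: "!!j v. j < N ==> \<bar>\<beta> j v\<bar> <= B"
  and H: "0 < H" "H < 1" and th: "0 < th" "H - 1/2 < th" and D: "0 <= D"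
  and inc: "!!j k. j < k ==> k < N ==> prob_space.expectation M (%v. (\<beta> k v - \<beta> j v)^2) <= D * (real (k - j) / N) powr (2 * th)"
 defines "A \<equiv> 1 + 2 powr th * \<bar>1/2 - H\<bar> / (th + (1/2 - H))"
 shows "integrable M (%v. LBINT u. (drift_derivative H N (%j. \<beta> j v) u)^2)"
  and "(LINT v|M. LINT u|lborel. (drift_derivative H N (%j. \<beta> j v) u)^2) <=
   B^2 / (1 - H) + 4 * D * A^2 + 2 * D / (1 - H)"
proof -
 interpret prob_space M by fact
 let ?a = "1/2 - H"
 let ?f = "%j u. indicator {..1} u * max 0 (u - real j / N) powr ?a"
 define c where "c j v = \<beta> j v - (if j = 0 then 0 else \<beta> (j - 1) v)" for j v
 have g: "drift_derivative H N (%j. \<beta> j v) u = (SUM j<N. c j v * ?f j u)" for v u by (simp add: drift_derivative_def c_def)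
 have B: "0 <= B" if "0 < N" using \<beta>b[OF that, of undefined] by linarith
 have cm [measurable]: "c j : borel_measurable M" if "j < N" for j unfolding c_def using \<beta>m that by (cases "j = 0") auto
 have cb: "\<bar>c j v\<bar> <= 2 * B" if "j < N" for j v
  using \<beta>b[OF that, of v] \<beta>b[of "j - 1" v] that unfolding c_def by (cases "j = 0") (simp, simp, linarith)
 have cci: "integrable M (%v. c i v * c j v)" if "i < N" "j < N" for i j
 proof (rule integrable_const_bound[of _ "(2 * B) * (2 * B)"])
  show "AE v in M. norm (c i v * c j v) <= (2 * B) * (2 * B)"
   using cb that B by (intro AE_I2) (simp only: real_norm_def abs_mult, rule mult_mono, simp_all)
 qed (use that in measurable)
 have ffi: "integrable lborel (%u. ?f i u * ?f j u)" if "i < N" "j < N" for i j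
  by (rule integrable_mult_of_squares) (use that H in \<open>auto intro!: pos_part_sq_integrable\<close>)
 have sq: "(SUM j<N. x j * y j)^2 = (SUM i<N. SUM j<N. (x i * x j) * (y i * y j))" for x y :: "nat => real"
  unfolding power2_eq_square sum_product by (intro sum.cong refl) (simp add: mult_ac)
 have int_u: "(LBINT u. (SUM j<N. c j v * ?f j u)^2) = (SUM i<N. SUM j<N. (c i v * c j v) * (LBINT u. ?f i u * ?f j u))" for v
 proof -
  have "(LBINT u. (SUM j<N. c j v * ?f j u)^2) = (LBINT u. (SUM i<N. SUM j<N. (c i v * c j v) * (?f i u * ?f j u)))" unfolding sq ..
  also have "... = (SUM i<N. LBINT u. (SUM j<N. (c i v * c j v) * (?f i u * ?f j u)))"
   by (rule L_integral_sum) (intro L_integrable_sum integrable_mult_right ffi, auto)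
  also have "... = (SUM i<N. SUM j<N. LBINT u. (c i v * c j v) * (?f i u * ?f j u))"
   by (intro sum.cong refl L_integral_sum integrable_mult_right ffi) auto
  finally show ?thesis by simp
 qed
 have e1: "integrable M (%v. (c i v * c j v) * y)" if "i < N" "j < N" for i j y using cci[OF that] by simp
 show "integrable M (%v. LBINT u. (drift_derivative H N (%j. \<beta> j v) u)^2)" unfolding g int_u by (intro L_integrable_sum e1) auto
 have E_sum: "expectation (%v. SUM i<N. SUM j<N. (c i v * c j v) * y i j) = (SUM i<N. SUM j<N. expectation (%v. c i v * c j v) * y i j)" for y
 proof -
  have "expectation (%v. SUM i<N. SUM j<N. (c i v * c j v) * y i j) = (SUM i<N. expectation (%v. SUM j<N. (c i v * c j v) * y i j))"
   by (rule L_integral_sum) (intro L_integrable_sum e1, auto)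
  also have "... = (SUM i<N. SUM j<N. expectation (%v. (c i v * c j v) * y i j))" by (intro sum.cong refl L_integral_sum e1) auto
  finally show ?thesis by simp
 qed
 \<comment> \<open>Expectation and integral are exchanged by expanding both into finite double
   sums.\<close>
 define e where "e u = expectation (%v. (SUM j<N. c j v * ?f j u)^2)" for u
 have e: "e u = (SUM i<N. SUM j<N. expectation (%v. c i v * c j v) * (?f i u * ?f j u))" for u unfolding e_def sq E_sum ..
 let ?J = "LINT v|M. LINT u|lborel. (drift_derivative H N (%j. \<beta> j v) u)^2"
 have swap: "?J = (LBINT u. e u)"
 proof -
  have "(LBINT u. e u) = (SUM i<N. LBINT u. (SUM j<N. expectation (%v. c i v * c j v) * (?f i u * ?f j u)))"
   unfolding e by (rule L_integral_sum) (intro L_integrable_sum integrable_mult_right ffi, auto)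
  also have "... = (SUM i<N. SUM j<N. LBINT u. expectation (%v. c i v * c j v) * (?f i u * ?f j u))"
   by (intro sum.cong refl L_integral_sum integrable_mult_right ffi) auto
  finally show ?thesis unfolding g int_u E_sum by simp
 qed
 have ei: "integrable lborel e" unfolding e by (intro L_integrable_sum integrable_mult_right ffi) auto
 \<comment> \<open>The majorant of \<open>e\<close>: a term for the current slope, one for the
   regular part of \<open>weight_sum_bound\<close>, and one for its last increment, which is
   singular at the left end of each cell.\<close>
 define b where "b u = 2 * B^2 * (indicator {0<..1} u * max 0 (u - 0) powr (2 * ?a)) + (4 * D * A^2 * indicator {0<..1} u +
  4 * D * (1 / real N) powr (2 * th) * (SUM k<N. indicator {real k / N<..real (Suc k) / N} u * max 0 (u - real k / N) powr (2 * ?a)))" for u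
 have pw: "-1 < 2 * ?a" using H by simp
 have A0: "1 <= A" using th by (simp add: A_def)
 have pk: "integrable lborel (%u. indicator {real k / N<..real (Suc k) / N} u * max 0 (u - real k / N) powr (2 * ?a))"
  "(LBINT u. indicator {real k / N<..real (Suc k) / N} u * max 0 (u - real k / N) powr (2 * ?a)) = (1 / real N) powr (2 * ?a + 1) / (2 * ?a + 1)"
  if "k < N" for k
 proof -
  have s: "real k / N < real (Suc k) / N" using that by (intro divide_strict_right_mono) auto
  have d: "real (Suc k) / N - real k / N = 1 / real N" by (simp add: add_divide_distrib)
  show "integrable lborel (%u. indicator {real k / N<..real (Suc k) / N} u * max 0 (u - real k / N) powr (2 * ?a))"
   "(LBINT u. indicator {real k / N<..real (Suc k) / N} u * max 0 (u - real k / N) powr (2 * ?a)) = (1 / real N) powr (2 * ?a + 1) / (2 * ?a + 1)"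
   using integral_pos_part_powr'[OF pw s] unfolding d by auto
 qed
 have i0: "integrable lborel (%u. indicator {0<..1} u * max 0 (u - 0) powr (2 * ?a))"
  "(LBINT u. indicator {0<..1} u * max 0 (u - 0) powr (2 * ?a)) = 1 / (2 * ?a + 1)" using integral_pos_part_powr'[OF pw, of 0 1] by auto
 have one: "integrable lborel (indicat_real {0<..1 :: real})" by simp
 have psum: "integrable lborel (%u. SUM k<N. indicator {real k / N<..real (Suc k) / N} u * max 0 (u - real k / N) powr (2 * ?a))"
  by (intro L_integrable_sum pk) auto
 have bi: "integrable lborel b" unfolding b_def by (intro L_integrable_add integrable_mult_right i0 one psum)
 let ?B = "SUM k<N. (1 / real N) powr (2 * ?a + 1) / (2 * ?a + 1)"
 have Eb: "(LBINT u. b u) = 2 * B^2 * (1 / (2 * ?a + 1)) + (4 * D * A^2 * 1 +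
  4 * D * (1 / real N) powr (2 * th) * ?B)"
 proof -
  let ?G = "LBINT u. (SUM k<N. indicator {real k / N<..real (Suc k) / N} u * max 0 (u - real k / N) powr (2 * ?a))"
  let ?U = "LBINT u. 2 * B^2 * (indicator {0<..1} u * max 0 (u - 0) powr (2 * ?a))"
  have "(LBINT u. b u) = ?U + ((LBINT u. 4 * D * A^2 * indicator {0<..1::real} u) +
  (LBINT u. 4 * D * (1 / real N) powr (2 * th) * (SUM k<N. indicator {real k / N<..real (Suc k) / N} u * max 0 (u - real k / N) powr (2 * ?a))))"
   unfolding b_def by (rule trans[OF L_integral_add], (intro L_integrable_add integrable_mult_right i0 one psum)+,
     rule arg_cong2[where f = "(+)", OF refl L_integral_add], (intro integrable_mult_right one psum)+)
  also have "?G =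
    ?B"
  proof -
   have "?G =
    (SUM k<N. LBINT u. indicator {real k / N<..real (Suc k) / N} u * max 0 (u - real k / N) powr (2 * ?a))"
    by (rule L_integral_sum) (rule pk, simp)
   also have "... = ?B" by (intro sum.cong refl pk) simp
   finally show ?thesis .
  qed
  then have "(LBINT u. 4 * D * (1 / real N) powr (2 * th) * (SUM k<N. indicator {real k / N<..real (Suc k) / N} u * max 0 (u - real k / N) powr (2 * ?a))) =
    4 * D * (1 / real N) powr (2 * th) * ?B" by (simp only: integral_mult_right_zero)
  moreover have "?U = 2 * B^2 * (1 / (2 * ?a + 1))" by (simp only: integral_mult_right_zero i0)
  moreover have "(LBINT u. 4 * D * A^2 * indicator {0<..1 :: real} u) = 4 * D * A^2 * 1" by simp
  ultimately show ?thesis by (simp only:)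
 qed
 have eb: "e u <= b u" for u
 proof (cases "0 < u & u <= 1 & 0 < N")
  case False
  have "?f j u = 0" if "j < N" for j
  proof -
   have "u <= 0 \<or> 1 < u" using False that by auto
   then show ?thesis by (auto simp: indicator_def max_def) (smt (verit) divide_nonneg_nonneg of_nat_0_le_iff)
  qed
  then have "c j v * ?f j u = 0" if "j < N" for j v using that by (simp only: mult_zero_right)
  then have "e u = expectation (%v. (SUM j<N. 0)^2)" unfolding e_def by (intro L_integral_cong refl arg_cong[where f = "%x. x^2"] sum.cong) simp_all
  then have "e u = 0" by simp
  moreover have "0 <= b u" unfolding b_def using D by (intro add_nonneg_nonneg mult_nonneg_nonneg sum_nonneg) auto
  ultimately show ?thesis by simp
 next
  case True
  then have u: "0 < u" "u <= 1" and N: "0 < real N" "0 < N" by auto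
  \<comment> \<open>The cell of u, open on the left and closed on the right, so that the base u - k
    / N of the singular power is positive.\<close>
  define k where "k = nat (\<lceil>u * N\<rceil> - 1)"
  have cl: "0 < \<lceil>u * N\<rceil>" using u N by simp
  have "real k = of_int \<lceil>u * N\<rceil> - 1" using cl by (simp add: k_def)
  then have k1: "real k < u * N" "u * N <= real k + 1" by linarith+
  have "u * N <= N" using u N by (simp add: mult_left_le_one_le)
  then have kN: "k < N" using k1 by linarith
  have uk: "real k / N < u" "u <= real (Suc k) / N" using k1 N by (simp_all add: field_simps)
  define w where "w j = max 0 (u - real j / N) powr ?a" for j
  define x where "x j v = \<beta> k v - \<beta> j v" for j v
  define r where "r j = (real (k - j) / N) powr th" for j
  define d where "d j = w (Suc j) - w j" for j
  define S where "S = (SUM j<k. r j * \<bar>d j\<bar>)"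
  have r0: "0 < r j" if "j < k" for j using that N by (simp add: r_def)
  have S0: "0 <= S" unfolding S_def using r0 by (intro sum_nonneg mult_nonneg_nonneg) (auto intro: less_imp_le)
  have xm [measurable]: "x j : borel_measurable M" if "j < k" for j unfolding x_def using \<beta>m that kN by auto
  have xi: "integrable M (%v. (x j v)^2)" if "j < k" for j
  proof (rule integrable_const_bound[of _ "(2 * B)^2"])
   have "\<bar>x j v\<bar> <= 2 * B" for v using \<beta>b[OF kN, of v] \<beta>b[of j v] that kN by (auto simp: x_def)
   then show "AE v in M. norm ((x j v)^2) <= (2 * B)^2" using power_mono[of "\<bar>x j _\<bar>" "2 * B" 2] by (intro AE_I2) simp
  qed (use that in measurable)
  have pt: "(SUM j<N. c j v * ?f j u)^2 <= 2 * B^2 * u powr (2 * ?a) + 2 * S * (SUM j<k. (\<bar>d j\<bar> / r j) * (x j v)^2)" for v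
  proof -
   let ?Q = "SUM j<k. x j v * d j"
   have "(SUM j<N. c j v * ?f j u) = \<beta> k v * w 0 + ?Q"
    using drift_derivative_abel[OF kN uk, of H "%j. \<beta> j v"] unfolding g w_def x_def d_def .
   then have "(SUM j<N. c j v * ?f j u)^2 <= 2 * (\<beta> k v * w 0)^2 + 2 * ?Q^2"
    using sum_squares_bound[of "\<beta> k v * w 0" "SUM j<k. x j v * d j"] by (simp add: power2_sum)
   moreover have "(\<beta> k v * w 0)^2 <= B^2 * u powr (2 * ?a)"
   proof -
    have "(w 0)^2 = u powr (2 * ?a)" using u by (simp add: w_def power2_eq_square flip: powr_add)
    moreover have "(\<beta> k v)^2 <= B^2" using \<beta>b[OF kN, of v] B[OF N(2)] by (simp add: abs_le_square_iff[symmetric])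
    ultimately show ?thesis by (simp add: power_mult_distrib mult_right_mono)
   qed
   moreover have "?Q^2 <= S * (SUM j<k. (\<bar>d j\<bar> / r j) * (x j v)^2)"
   proof -
    let ?A = "SUM j<k. sqrt (r j * \<bar>d j\<bar>) * (sqrt (\<bar>d j\<bar> / r j) * \<bar>x j v\<bar>)"
    have "?Q^2 <= ?A^2"
    proof (rule power2_le_iff_abs_le[THEN iffD2])
     have "\<bar>SUM j<k. x j v * d j\<bar> <= (SUM j<k. \<bar>x j v * d j\<bar>)" by (rule sum_abs)
     also have "... = ?A"
     proof (intro sum.cong refl)
      fix j assume "j : {..<k}"
      then have "r j ~= 0" using r0[of j] by auto
      then have "sqrt (r j * \<bar>d j\<bar>) * sqrt (\<bar>d j\<bar> / r j) = \<bar>d j\<bar>"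
       by (simp add: real_sqrt_mult[symmetric] power2_eq_square[symmetric])
      then show "\<bar>x j v * d j\<bar> = sqrt (r j * \<bar>d j\<bar>) * (sqrt (\<bar>d j\<bar> / r j) * \<bar>x j v\<bar>)"
       by (simp add: abs_mult mult.assoc[symmetric])
     qed
     finally show "\<bar>SUM j<k. x j v * d j\<bar> <= ?A" .
     show "0 <= ?A" using less_imp_le[OF r0] by (intro sum_nonneg mult_nonneg_nonneg) auto
    qed
    also have "... <= (SUM j<k. (sqrt (r j * \<bar>d j\<bar>))^2) * (SUM j<k. (sqrt (\<bar>d j\<bar> / r j) * \<bar>x j v\<bar>)^2)"
     by (rule Cauchy_Schwarz_ineq_sum)
    also have "... = S * (SUM j<k. (\<bar>d j\<bar> / r j) * (x j v)^2)"
    proof -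
     have "(SUM j<k. (sqrt (r j * \<bar>d j\<bar>))^2) = S" unfolding S_def using r0 by (intro sum.cong refl) (simp add: less_imp_le)
     moreover have "(SUM j<k. (sqrt (\<bar>d j\<bar> / r j) * \<bar>x j v\<bar>)^2) = (SUM j<k. (\<bar>d j\<bar> / r j) * (x j v)^2)"
      using r0 by (intro sum.cong refl) (simp add: power_mult_distrib less_imp_le)
     ultimately show ?thesis by simp
    qed
    finally show ?thesis .
   qed
   ultimately show ?thesis by linarith
  qed
  let ?E = "%v. 2 * B^2 * u powr (2 * ?a) + 2 * S * (SUM j<k. (\<bar>d j\<bar> / r j) * (x j v)^2)"
  let ?F = "(1 / real N) powr (2 * th) * (u - real k / N) powr (2 * ?a)"
  let ?K = "SUM j<k. (\<bar>d j\<bar> / r j) * expectation (%v. (x j v)^2)"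
  have "e u <= expectation ?E" unfolding e_def
  proof (rule integral_mono)
   show "integrable M (%v. (SUM j<N. c j v * ?f j u)^2)" unfolding sq by (intro L_integrable_sum e1) auto
   show "integrable M ?E" by (intro L_integrable_add integrable_mult_right L_integrable_sum xi integrable_const) auto
  qed (rule pt)
  also have "... = 2 * B^2 * u powr (2 * ?a) + 2 * S * ?K"
  proof -
   have "expectation (%v. SUM j<k. (\<bar>d j\<bar> / r j) * (x j v)^2) = (SUM j<k. expectation (%v. (\<bar>d j\<bar> / r j) * (x j v)^2))"
    by (rule L_integral_sum) (intro integrable_mult_right xi, simp)
   moreover have "integrable M (%v. SUM j<k. (\<bar>d j\<bar> / r j) * (x j v)^2)" by (intro L_integrable_sum integrable_mult_right xi) simp
   ultimately show ?thesis by (simp add: prob_space)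
  qed
  also have "?K <= (SUM j<k. D * (r j * \<bar>d j\<bar>))"
  proof (rule sum_mono)
   fix j assume "j : {..<k}"
   then have j: "j < k" by simp
   have "expectation (%v. (x j v)^2) <= D * (r j)^2" using inc[OF j kN] by (simp add: x_def r_def power2_eq_square[of "_ powr _"] flip: powr_add)
   then have "(\<bar>d j\<bar> / r j) * expectation (%v. (x j v)^2) <= (\<bar>d j\<bar> / r j) * (D * (r j)^2)"
    using r0[OF j] by (intro mult_left_mono) auto
   also have "... = D * (r j * \<bar>d j\<bar>)" using r0[OF j] by (simp add: power2_eq_square)
   finally show "(\<bar>d j\<bar> / r j) * expectation (%v. (x j v)^2) <= D * (r j * \<bar>d j\<bar>)" .
  qed
  also have "(SUM j<k. D * (r j * \<bar>d j\<bar>)) = D * S" by (simp add: S_def sum_distrib_left)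
  finally have "e u <= 2 * B^2 * u powr (2 * ?a) + 2 * S * (D * S)" using S0 by (simp add: mult_left_mono)
  also have "2 * S * (D * S) = 2 * D * S^2" by (simp add: power2_eq_square)
  also have "... <= 2 * D * (A + (1 / real N) powr th * (u - real k / N) powr ?a)^2"
  proof (intro mult_left_mono power_mono S0)
   show "S <= A + (1 / real N) powr th * (u - real k / N) powr ?a"
    unfolding S_def r_def d_def w_def A_def by (rule weight_sum_bound[OF th(1) _ kN uk(1) u(2)]) (use th in simp)
  qed (use D in auto)
  also have "... <= 2 * D * (2 * A^2 + 2 * ?F)"
  proof (rule mult_left_mono)
   have "((1 / real N) powr th * (u - real k / N) powr ?a)^2 = (1 / real N) powr (2 * th) * (u - real k / N) powr (2 * ?a)"
    by (simp add: power_mult_distrib power2_eq_square[of "_ powr _"] flip: powr_add)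
   then show "(A + (1 / real N) powr th * (u - real k / N) powr ?a)^2 <= 2 * A^2 + 2 * ?F"
    using sum_squares_bound[of A "(1 / real N) powr th * (u - real k / N) powr ?a"] by (simp add: power2_sum)
  qed (use D in auto)
  also have "2 * B^2 * u powr (2 * ?a) + 2 * D * (2 * A^2 + 2 * ?F) <= b u"
  proof -
   have "(u - real k / N) powr (2 * ?a) = indicator {real k / N<..real (Suc k) / N} u * max 0 (u - real k / N) powr (2 * ?a)" using uk by simp
   also have "... <= (SUM k<N. indicator {real k / N<..real (Suc k) / N} u * max 0 (u - real k / N) powr (2 * ?a))"
    by (rule member_le_sum) (use kN in auto)
   finally have "4 * D * (1 / real N) powr (2 * th) * (u - real k / N) powr (2 * ?a) <=
     4 * D * (1 / real N) powr (2 * th) * (SUM k<N. indicator {real k / N<..real (Suc k) / N} u * max 0 (u - real k / N) powr (2 * ?a))"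
    using D by (intro mult_left_mono) auto
   then show ?thesis using u unfolding b_def by (simp add: algebra_simps)
  qed
  finally show ?thesis by simp
 qed
 have "(LBINT u. e u) <= (LBINT u. b u)" by (rule integral_mono[OF ei bi eb])
 also have "... <= B^2 / (1 - H) + 4 * D * A^2 + 2 * D / (1 - H)"
 proof -
  have a1: "2 * ?a + 1 = 2 * (1 - H)" by simp
  \<comment> \<open>The \<open>N\<close> cells contribute (1 / N)^(2 - 2 H) each, up to a constant.
    With the prefactor this amounts to (1 / N)^(2 (th + 1/2 - H)), whose exponent is positive by the
    second condition on \<open>th\<close>.\<close>
  have "(1 / real N) powr (2 * th) * ?B <= 1 / (2 * (1 - H))"
  proof (cases "N = 0")
   case False
   have "(1 / real N) powr (2 * th) * ?B =
    (real N * (1 / real N)) * ((1 / real N) powr (2 * (th + ?a)) / (2 * (1 - H)))"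
        proof -
     have "(1 / real N) powr (2 * th) * (1 / real N) powr (2 * (1 - H)) = (1 / real N) * (1 / real N) powr (2 * (th + ?a))"
      using False powr_add[of "1 / real N" 1 "2 * (th + ?a)"] by (simp flip: powr_add) (simp add: algebra_simps)
     then show ?thesis unfolding a1 by (simp add: mult_ac)
    qed

   also have "... = (1 / real N) powr (2 * (th + ?a)) / (2 * (1 - H))" using False by simp
   also have "... <= 1 / (2 * (1 - H))" using False th H by (intro divide_right_mono powr_le1) auto
   finally show ?thesis .
  qed (use H in simp)
  then have *: "4 * D * ((1 / real N) powr (2 * th) * ?B) <= 4 * D * (1 / (2 * (1 - H)))" using D by (intro mult_left_mono) auto
  show ?thesis proof -
   have "2 * B^2 * (1 / (2 * (1 - H))) = B^2 / (1 - H)" "4 * D * (1 / (2 * (1 - H))) = 2 * D / (1 - H)" using H by (simp_all add: divide_simps)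
   moreover have "4 * D * A^2 * 1 = 4 * D * A^2" by simp
   moreover have "4 * D * (1 / real N) powr (2 * th) * ?B =
    4 * D * ((1 / real N) powr (2 * th) * ?B)" by (simp only: mult.assoc)
   ultimately show ?thesis using * unfolding Eb a1 by linarith
  qed
 qed
 finally show "?J <= B^2 / (1 - H) + 4 * D * A^2 + 2 * D / (1 - H)" unfolding swap .
qed

text \<open>A Cholesky factorisation \<open>R = L L\<^sup>T\<close> together with \<open>M = L\<^sup>-\<^sup>1\<close>, with positivity of the Schur
 complements as the hypothesis.\<close>

lemma cholesky:
 fixes R :: "nat => nat => real"
 assumes sym: "!!i j. R i j = R j i"
  and pos: "!!k a. k < N ==>
   0 < R k k - 2 * (SUM l<k. a l * R l k) + (SUM l<k. SUM m<k. a l * a m * R l m)"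
 obtains L M :: "nat => nat => real"
 where "!!i j. i < j ==> L i j = 0" "!!i j. i < j ==> M i j = 0"
  "!!i j. i < N ==> j < N ==> (SUM k<N. L i k * M k j) = of_bool (i = j)"
  "!!i j. i < N ==> j < N ==> (SUM k<N. SUM l<N. M i k * M j l * R k l) = of_bool (i = j)"
proof -
 have "EX L M. (ALL i j. i < j --> L i j = 0) & (ALL i j. i < j --> M i j = 0) &
  (ALL i<n. ALL j<n. (SUM k<n. L i k * M k j) = of_bool (i = j)) &
  (ALL i<n. ALL j<n. (SUM k<n. SUM l<n. M i k * M j l * R k l) = (of_bool (i = j) :: real))" if "n <= N" for n using that
 proof (induction n)
  case 0
  show ?case by (intro exI[of _ "%_ _. 0"]) auto
 next
  case (Suc n)
  from Suc.IH[OF Suc_leD[OF Suc.prems]] obtain L M :: "nat => nat => real" where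
   IH: "(ALL i j. i < j --> L i j = 0) & (ALL i j. i < j --> M i j = 0) &
    (ALL i<n. ALL j<n. (SUM k<n. L i k * M k j) = of_bool (i = j)) &
    (ALL i<n. ALL j<n. (SUM k<n. SUM l<n. M i k * M j l * R k l) = of_bool (i = j))" by (elim exE)
  have Lz: "!!i j. i < j ==> L i j = 0" and Mz: "!!i j. i < j ==> M i j = 0" using IH by blast+
  have LM: "!!i j. i < n ==> j < n ==> (SUM k<n. L i k * M k j) = of_bool (i = j)" using IH by blast
  have MRM: "!!i j. i < n ==> j < n ==> (SUM k<n. SUM l<n. M i k * M j l * R k l) = of_bool (i = j)" using IH by blast
  \<comment> \<open>\<open>p j\<close> is the covariance of the new variable with innovation
    \<open>j\<close>, \<open>a k\<close> is its regression coefficient on the old variable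
    \<open>k\<close>, and \<sigma> below is the standard deviation of the residual. The new row of
    \<open>L\<close> expands the new variable in innovations, that of \<open>M\<close> the new
    innovation in variables.\<close>
  define p where "p j = (SUM k<n. M j k * R k n)" for j
  define a where "a k = (SUM j<n. p j * M j k)" for k
  let ?A = "SUM k<n. a k * R k n"
  let ?B = "SUM j<n. (p j)^2"
  have aR: "?A = ?B"
  proof -
   have "?A = (SUM k<n. SUM j<n. p j * (M j k * R k n))" by (simp add: a_def sum_distrib_right mult.assoc)
   also have "... = (SUM j<n. SUM k<n. p j * (M j k * R k n))" by (rule sum.swap)
   also have "... = ?B" by (simp add: p_def power2_eq_square flip: sum_distrib_left)
   finally show ?thesis .
  qed
  have aM: "(SUM k<n. SUM l<n. a k * M i l * R k l) = p i" if "i < n" for i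
  proof -
   have "(SUM k<n. SUM l<n. a k * M i l * R k l) = (SUM k<n. SUM l<n. SUM j<n. p j * (M j k * M i l * R k l))"
    by (simp add: a_def sum_distrib_right mult.assoc)
   also have "... = (SUM k<n. SUM j<n. SUM l<n. p j * (M j k * M i l * R k l))" by (intro sum.cong refl sum.swap)
   also have "... = (SUM j<n. SUM k<n. SUM l<n. p j * (M j k * M i l * R k l))" by (rule sum.swap)
   also have "... = (SUM j<n. p j * of_bool (j = i))" using MRM that by (simp flip: sum_distrib_left)
   finally show ?thesis using that by (simp add: of_bool_def if_distrib cong: if_cong)
  qed
  have aa: "(SUM l<n. SUM m<n. a l * a m * R l m) = ?B"
  proof -
   have "(SUM l<n. SUM m<n. a l * a m * R l m) = (SUM l<n. SUM m<n. SUM j<n. p j * (a l * M j m * R l m))"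
    by (simp add: a_def[of m for m] sum_distrib_right sum_distrib_left mult_ac)
   also have "... = (SUM l<n. SUM j<n. SUM m<n. p j * (a l * M j m * R l m))" by (intro sum.cong refl sum.swap)
   also have "... = (SUM j<n. SUM l<n. SUM m<n. p j * (a l * M j m * R l m))" by (rule sum.swap)
   also have "... = (SUM j<n. p j * p j)" using aM by (simp flip: sum_distrib_left)
   finally show ?thesis by (simp add: power2_eq_square)
  qed
  define \<sigma> where "\<sigma> = sqrt (R n n - ?B)"
  have "0 < R n n - ?B" using pos[of n a] Suc.prems aR aa by simp
  then have \<sigma>: "0 < \<sigma>" "\<sigma>^2 = R n n - ?B" by (auto simp: \<sigma>_def)
  define L' where "L' i j = (if i = n then (if j < n then p j else if j = n then \<sigma> else 0) else if j < n then L i j else 0)" for i j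
  define M' where "M' i j = (if i = n then (if j < n then - a j / \<sigma> else if j = n then 1 / \<sigma> else 0) else if j < n then M i j else 0)" for i j
  have 1: "L' i j = 0" "M' i j = 0" if "i < j" for i j using that Lz Mz by (auto simp: L'_def M'_def)
  have 2: "(SUM k<Suc n. L' i k * M' k j) = of_bool (i = j)" if "i < Suc n" "j < Suc n" for i j
  proof -
   consider "i < n" "j < n" | "i < n" "j = n" | "i = n" "j < n" | "i = n" "j = n" using \<open>i < Suc n\<close> \<open>j < Suc n\<close> unfolding less_Suc_eq by blast
   then show ?thesis
   proof cases
    case 1 then show ?thesis using LM by (simp add: L'_def M'_def)
   next
    case 2 then show ?thesis by (simp add: L'_def M'_def)
   next
    case 3 then show ?thesis using \<sigma> by (simp add: L'_def M'_def a_def)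
   next
    case 4 then show ?thesis using \<sigma> by (simp add: L'_def M'_def)
   qed
  qed
  have Mn: "M' n k = (if k < n then - a k else 1) / \<sigma>" if "k < Suc n" for k using that by (simp add: M'_def)
  have last: "(SUM k<Suc n. SUM l<Suc n. M' n k * M' i l * R k l) = 0" if "i < n" for i
  proof -
   have "(SUM k<Suc n. SUM l<Suc n. M' n k * M' i l * R k l) = (SUM k<Suc n. SUM l<n. M' n k * M i l * R k l)" using that by (simp add: M'_def)
   also have "... = (SUM k<n. SUM l<n. - (a k * M i l * R k l) / \<sigma>) + (SUM l<n. M i l * R l n / \<sigma>)" by (simp add: M'_def sym[of n])
   also have "... = (- (SUM k<n. SUM l<n. a k * M i l * R k l) + p i) / \<sigma>"
    by (simp add: p_def sum_negf diff_divide_distrib sum_divide_distrib)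
   finally show ?thesis using aM[OF that] by simp
  qed
  have 3: "(SUM k<Suc n. SUM l<Suc n. M' i k * M' j l * R k l) = of_bool (i = j)" if "i < Suc n" "j < Suc n" for i j
  proof -
   consider "i < n" "j < n" | "i < n" "j = n" | "i = n" "j < n" | "i = n" "j = n" using \<open>i < Suc n\<close> \<open>j < Suc n\<close> unfolding less_Suc_eq by blast
   then show ?thesis
   proof cases
    case 1 then show ?thesis using MRM by (simp add: M'_def)
   next
    case 2
    have "(SUM k<Suc n. SUM l<Suc n. M' i k * M' n l * R k l) = (SUM k<Suc n. SUM l<Suc n. M' n k * M' i l * R k l)"
     by (subst sum.swap) (intro sum.cong refl, simp add: sym mult_ac)
    from trans[OF this last[OF 2(1)]] show ?thesis using 2 by (simp del: sum.lessThan_Suc)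
   next
    case 3 then show ?thesis using last[of j] by simp
   next
    case 4
    have "(SUM k<Suc n. SUM l<Suc n. M' n k * M' n l * R k l) =
     ((SUM k<n. SUM l<n. a k * a l * R k l) - ?A - (SUM l<n. a l * R n l) + R n n) / \<sigma>^2"
     by (simp add: M'_def sum.distrib sum_negf sum_subtractf power2_eq_square diff_divide_distrib add_divide_distrib sum_divide_distrib)
    also have "(SUM l<n. a l * R n l) = ?A" by (simp add: sym[of n])
    also have "((SUM k<n. SUM l<n. a k * a l * R k l) - ?A - ?A + R n n) / \<sigma>^2 = 1"
    proof -
     have "(SUM k<n. SUM l<n. a k * a l * R k l) - ?A - ?A + R n n = \<sigma>^2" unfolding aa aR \<sigma>(2) by simp
     then show ?thesis using \<sigma>(1) by simp
    qed
    finally show ?thesis using 4 by simp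
   qed
  qed
  show ?case by (intro exI[of _ L'] exI[of _ M'] conjI allI impI; (rule 1 2 3; assumption))
 qed
 from this[OF order_refl] obtain L M :: "nat => nat => real" where
  *: "(ALL i j. i < j --> L i j = 0) & (ALL i j. i < j --> M i j = 0) &
   (ALL i<N. ALL j<N. (SUM k<N. L i k * M k j) = of_bool (i = j)) &
   (ALL i<N. ALL j<N. (SUM k<N. SUM l<N. M i k * M j l * R k l) = of_bool (i = j))" by (elim exE)
 show ?thesis by (rule that[of L M]) (use * in blast)+
qed

text \<open>The covariance matrix is a multiple of the Gram matrix of the kernels, so its quadratic
  forms are L2 norms. Both last conclusions rest on this: tail sums of squares of a row of
  \<open>L\<close> are conditional variances, bounded below by
  \<open>mvn_kernel_nondeterminism\<close>, and the whitened coefficients of \<open>g\<close> are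
  bounded by the norm of \<open>g\<close>, a discrete Cameron--Martin inequality. The grid starts at
  1 / N, since the process vanishes at time 0 and the matrix would be singular.\<close>

lemma fbm_innovations:
 assumes H: "0 < H" "H < 1" and c: "0 < c" and N: "0 < N"
 defines "t \<equiv> %k. real (Suc k) / real N"
 obtains L M :: "nat => nat => real"
 where "!!i j. i < j ==> L i j = 0" "!!i j. i < j ==> M i j = 0"
  "!!i j. i < N ==> j < N ==> (SUM k<N. L i k * M k j) = of_bool (i = j)"
  "!!i j. i < N ==> j < N ==> (SUM k<N. SUM l<N. M i k * M j l *
    (c * (t k powr (2 * H) + t l powr (2 * H) - \<bar>t k - t l\<bar> powr (2 * H)))) = of_bool (i = j)"
  "!!i s. i < N ==> s <= i ==>
    c / (mvn_const H * H) * (real (Suc i - s) / real N) powr (2 * H) <= (SUM l = s..<N. (L i l)^2)"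
  "!!g. g : borel_measurable borel ==> integrable lborel (%u. (g u)^2) ==>
    (SUM i<N. (SUM k<N. M i k * (LBINT u. mvn_kernel H (t k) u * g u))^2)
     <= mvn_const H / (2 * c) * (LBINT u. (g u)^2)"
proof -
 let ?\<kappa> = "mvn_const H"
 define R where "R k l = c * (t k powr (2 * H) + t l powr (2 * H) - \<bar>t k - t l\<bar> powr (2 * H))" for k l
 note \<kappa> = mvn_const_pos[OF H]
 have t0: "0 <= t k" for k by (simp add: t_def)
 have tm: "t k <= t l" if "k <= l" for k l using that by (simp add: t_def divide_right_mono)
 have sym: "R i j = R j i" for i j by (simp add: R_def abs_minus_commute)
 have quad: "(SUM k:I. SUM l:I. a k * a l * R k l) = 2 * c / ?\<kappa> * (LBINT u. (SUM k:I. a k * mvn_kernel H (t k) u)^2)" if "finite I" for I a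
 proof -
  have "(SUM k:I. SUM l:I. a k * a l * R k l) =
   c * (SUM i:I. SUM j:I. a i * a j * (t i powr (2 * H) + t j powr (2 * H) - \<bar>t i - t j\<bar> powr (2 * H)))"
   by (simp add: R_def sum_distrib_left mult_ac)
  then show ?thesis using mvn_kernel_quadratic_form[OF H that, of t a] t0 \<kappa> by (simp add: field_simps)
 qed
 have nondet: "c / (?\<kappa> * H) * (real (Suc i - s) / real N) powr (2 * H) <=
   (SUM k<Suc i. SUM l<Suc i. a k * a l * R k l)" if s: "s <= i" and a: "a i = 1" "!!k. s <= k ==> k < i ==> a k = 0" for i s a
 proof -
  have st: "real s / N < t i" "0 <= real s / N" using s N by (auto simp: t_def divide_strict_right_mono)
  have ker: "(SUM k<Suc i. a k * mvn_kernel H (t k) u) = mvn_kernel H (t i) u - (SUM k<s. - a k * mvn_kernel H (t k) u)" for u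
  proof -
   have "(SUM k<i. a k * mvn_kernel H (t k) u) = (SUM k<s. a k * mvn_kernel H (t k) u)" by (rule sum.mono_neutral_right) (use s a in auto)
   then show ?thesis using a by (simp add: sum_negf)
  qed
  have q1: "(SUM k<Suc i. SUM l<Suc i. a k * a l * R k l) =
    2 * c / ?\<kappa> * (LBINT u. (mvn_kernel H (t i) u - (SUM k<s. - a k * mvn_kernel H (t k) u))^2)"
   by (simp only: quad[OF finite_lessThan] ker)
  have q2: "(t i - real s / N) powr (2 * H) / (2 * H) <=
    (LBINT u. (mvn_kernel H (t i) u - (SUM k<s. - a k * mvn_kernel H (t k) u))^2)"
   by (rule mvn_kernel_nondeterminism[OF H _ _ st(2,1)]) (use t0 in \<open>auto simp: t_def divide_right_mono\<close>)
  have q3: "t i - real s / N = real (Suc i - s) / N" using s by (simp add: t_def of_nat_diff diff_divide_distrib add_divide_distrib)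
  have "2 * c / ?\<kappa> * ((real (Suc i - s) / N) powr (2 * H) / (2 * H)) <= (SUM k<Suc i. SUM l<Suc i. a k * a l * R k l)"
   unfolding q1 by (rule mult_left_mono[OF q2[unfolded q3]]) (use \<kappa> c in simp)
  moreover have "2 * c / ?\<kappa> * (x / (2 * H)) = c / (?\<kappa> * H) * x" for x using \<kappa> H by (simp add: field_simps)
  ultimately show ?thesis by (simp only:)
 qed
 have pos: "0 < R k k - 2 * (SUM l<k. a l * R l k) + (SUM l<k. SUM m<k. a l * a m * R l m)" if "k < N" for k a
 proof -
  \<comment> \<open>With s = k, \<open>nondet\<close> bounds below the variance of the new variable
    minus any combination of the old ones, which is the Schur condition of
    \<open>cholesky\<close>.\<close>
  define b where "b l = (if l = k then 1 else - a l)" for l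
  have b: "b k = 1" "!!l. l < k ==> b l = - a l" by (auto simp: b_def)
  have "(SUM l<Suc k. SUM m<Suc k. b l * b m * R l m) =
   (SUM l<k. SUM m<k. a l * a m * R l m) - (SUM l<k. a l * R l k) - (SUM m<k. a m * R k m) + R k k"
   by (simp add: b sum.distrib sum_negf sum_subtractf)
  also have "(SUM m<k. a m * R k m) = (SUM l<k. a l * R l k)" by (intro sum.cong refl) (simp only: sym[of k])
  finally have "(SUM l<Suc k. SUM m<Suc k. b l * b m * R l m) =
   R k k - 2 * (SUM l<k. a l * R l k) + (SUM l<k. SUM m<k. a l * a m * R l m)" by linarith
  moreover have "0 < c / (?\<kappa> * H) * (real (Suc k - k) / real N) powr (2 * H)" using c \<kappa> H N by simp
  moreover note nondet[of k k b]
  ultimately show ?thesis using b(1) by (simp del: sum.lessThan_Suc)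
 qed
 obtain L M where LM: "!!i j. i < j ==> L i j = 0" "!!i j. i < j ==> M i j = 0"
  "!!i j. i < N ==> j < N ==> (SUM k<N. L i k * M k j) = of_bool (i = j)"
  "!!i j. i < N ==> j < N ==> (SUM k<N. SUM l<N. M i k * M j l * R k l) = of_bool (i = j)" by (rule cholesky[OF sym pos]) blast+
 have quadM: "(SUM k<N. SUM l<N. (SUM i<N. u i * M i k) * (SUM i<N. u i * M i l) * R k l) = (SUM i<N. (u i)^2)" for u
 proof -
  have "(SUM k<N. SUM l<N. (SUM i<N. u i * M i k) * (SUM i<N. u i * M i l) * R k l)
   = (SUM k<N. SUM l<N. SUM i<N. SUM j<N. u i * u j * (M i k * M j l * R k l))"
  proof (intro sum.cong refl)
   fix k l
   show "(SUM i<N. u i * M i k) * (SUM i<N. u i * M i l) * R k l = (SUM i<N. SUM j<N. u i * u j * (M i k * M j l * R k l))"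
    by (subst sum_product) (simp add: sum_distrib_right sum_distrib_left mult_ac)
  qed
  also have "... = (SUM k<N. SUM i<N. SUM l<N. SUM j<N. u i * u j * (M i k * M j l * R k l))" by (intro sum.cong refl sum.swap)
  also have "... = (SUM i<N. SUM k<N. SUM l<N. SUM j<N. u i * u j * (M i k * M j l * R k l))" by (rule sum.swap)
  also have "... = (SUM i<N. SUM k<N. SUM j<N. SUM l<N. u i * u j * (M i k * M j l * R k l))" by (intro sum.cong refl sum.swap)
  also have "... = (SUM i<N. SUM j<N. SUM k<N. SUM l<N. u i * u j * (M i k * M j l * R k l))" by (intro sum.cong refl sum.swap)
  also have "... = (SUM i<N. SUM j<N. u i * u j * of_bool (i = j))" using LM(4) by (simp flip: sum_distrib_left)
  also have "... = (SUM i<N. (u i)^2)" by (simp add: of_bool_def power2_eq_square if_distrib cong: if_cong)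
  finally show ?thesis .
 qed
 have snd: "c / (?\<kappa> * H) * (real (Suc i - s) / real N) powr (2 * H) <= (SUM l = s..<N. (L i l)^2)" if i: "i < N" "s <= i" for i s
 proof -
  \<comment> \<open>The part of variable \<open>i\<close> carried by the innovations from
    \<open>s\<close> on. In terms of the variables it is variable \<open>i\<close> minus a
    combination of those before \<open>s\<close>, as \<open>nondet\<close> requires.\<close>
  define u where "u l = (if s <= l then L i l else 0)" for l
  define a where "a k = (SUM l<N. u l * M l k)" for k
  have a1: "a k = of_bool (k = i)" if "s <= k" "k < N" for k
  proof -
   have "a k = (SUM l<N. L i l * M l k)" unfolding a_def by (intro sum.cong refl) (use LM(2) that in \<open>auto simp: u_def\<close>)
   then show ?thesis using LM(3)[OF i(1) that(2)] by (auto simp: of_bool_def)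
  qed
  have u0: "u l = 0" if "i < l" for l using that LM(1) by (simp add: u_def)
  have "a k = 0" if "i < k" for k unfolding a_def
   by (intro sum.neutral ballI) (use that u0 LM(2) in \<open>metis linorder_not_less mult_eq_0_iff order.strict_trans1\<close>)
  then have "(SUM k<N. SUM l<N. a k * a l * R k l) = (SUM k<Suc i. SUM l<Suc i. a k * a l * R k l)"
   using i by (intro sum.mono_neutral_cong_right) (auto intro!: sum.mono_neutral_right sum.neutral)
  moreover have "(SUM k<N. SUM l<N. a k * a l * R k l) = (SUM l<N. (u l)^2)" unfolding a_def by (rule quadM)
  moreover have "(SUM l<N. (u l)^2) = (SUM l = s..<N. (L i l)^2)" by (rule sum.mono_neutral_cong_right) (auto simp: u_def)
  ultimately show ?thesis using nondet[OF i(2), of a] a1 i by auto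
 qed
 have cm: "(SUM i<N. (SUM k<N. M i k * (LBINT u. mvn_kernel H (t k) u * g u))^2)
   <= ?\<kappa> / (2 * c) * (LBINT u. (g u)^2)" if [measurable]: "g : borel_measurable borel" and g: "integrable lborel (%u. (g u)^2)" for g
 proof -
  define h where "h k = (LBINT u. mvn_kernel H (t k) u * g u)" for k
  define v where "v i = (SUM k<N. M i k * h k)" for i
  \<comment> \<open>Duality: |v|^2 is the scalar product of \<open>F\<close> and \<open>g\<close>,
    and the squared norm of \<open>F\<close> is a multiple of |v|^2, so Cauchy--Schwarz leaves a
    factor |v|^2 that cancels.\<close>
  define a where "a k = (SUM i<N. v i * M i k)" for k
  define F where "F u = (SUM k<N. a k * mvn_kernel H (t k) u)" for u
  let ?S = "SUM i<N. (v i)^2" and ?G = "LBINT u. (g u)^2"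
  have [measurable]: "F : borel_measurable borel" unfolding F_def by measurable
  have Fi: "integrable lborel (%u. (F u)^2)" unfolding F_def by (intro integrable_sum_mult_sq mvn_kernel_sq_integrable H) auto
  have hi: "integrable lborel (%u. mvn_kernel H (t k) u * g u)" for k by (intro integrable_mult_of_squares mvn_kernel_sq_integrable H g) auto
  have "?S = (SUM i<N. SUM k<N. v i * M i k * h k)" 
   by (intro sum.cong refl) (simp add: power2_eq_square v_def[of i for i] sum_distrib_left mult.assoc)
  also have "... = (SUM k<N. SUM i<N. v i * M i k * h k)" by (rule sum.swap)
  also have "... = (SUM k<N. a k * h k)" by (simp add: a_def sum_distrib_right)
  also have "... = (LBINT u. (SUM k<N. a k * (mvn_kernel H (t k) u * g u)))" using hi by (simp add: h_def)
  also have "... = (LBINT u. F u * g u)" by (simp add: F_def sum_distrib_right mult.assoc)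
  finally have SF: "?S = (LBINT u. F u * g u)" .
  have "?S = 2 * c / ?\<kappa> * (LBINT u. (F u)^2)" using quadM[of v] quad[of "{..<N}" a] by (simp add: a_def F_def)
  then have "(LBINT u. (F u)^2) = ?\<kappa> / (2 * c) * ?S" using \<kappa> c by (simp add: field_simps)
  then have "?S * ?S <= ?S * (?\<kappa> / (2 * c) * ?G)"
   using integral_cauchy_schwarz[of F lborel g] Fi g SF by (simp add: power2_eq_square mult_ac)
  moreover have "0 <= ?S" by (simp add: sum_nonneg)
  moreover have "0 <= ?\<kappa> / (2 * c) * ?G" using \<kappa> c by simp
  ultimately have "?S <= ?\<kappa> / (2 * c) * ?G" by (metis mult_le_cancel_left_pos order.order_iff_strict)
  then show ?thesis by (simp add: v_def h_def)
 qed
 show ?thesis by (rule that[OF LM(1,2,3) LM(4)[unfolded R_def] snd cm])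
qed

section \<open>Independent normal variables from characteristic functions\<close>

abbreviation "std_normal \<equiv> std_normal_distribution"

abbreviation gauss :: "'i set => ('i => real) measure" where
 "gauss I \<equiv> PiM I (%_. std_normal)"

text \<open>The normalised weight is a density under which \<open>X\<close> is standard normal, by
  the uniqueness theorem for characteristic functions. A weight of total mass 0 vanishes almost
  surely and is treated apart.\<close>

lemma weighted_std_normal:
 assumes M: "prob_space M" and X [measurable]: "X : borel_measurable M"
  and g [measurable]: "g : borel_measurable M" and g0: "!!w. 0 <= g w" and gB: "!!w. g w <= (B :: real)"
  and ch: "!!u :: real. (LINT w|M. of_real (g w) * iexp (u * X w)) = of_real C * of_real (exp (- u\<^sup>2 / 2))"
  and A [measurable]: "A : sets borel"
 shows "(LINT w|M. g w * indicator A (X w)) = C * measure std_normal A"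
proof -
 interpret prob_space M by fact
 have gi: "integrable M g" by (rule integrable_const_bound[of _ B]) (use g0 gB in auto)
 have C: "C = expectation g" using ch[of 0] by (simp add: gi)
 show ?thesis
 proof (cases "C = 0")
  case True
  then have "AE w in M. g w = 0" using C gi g0 by (simp add: integral_nonneg_eq_0_iff_AE)
  then have "(LINT w|M. g w * indicator A (X w)) = (LINT w|M. 0)" by (intro integral_cong_AE) auto
  then show ?thesis using True by simp
 next
  case False
  then have C0: "0 < C" using C g0 by (simp add: order_less_le)
  define M' where "M' = density M (%w. ennreal (g w / C))"
  have em: "emeasure M' (space M') = 1"
  proof -
   have "emeasure M' (space M') = (\<integral>\<^sup>+w. ennreal (g w / C) \<partial>M)"
    unfolding M'_def by (subst emeasure_density) (auto intro!: nn_integral_cong)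
   also have "... = ennreal (LINT w|M. g w / C)" using gi g0 C0 by (intro nn_integral_eq_integral) auto
   finally show ?thesis using C C0 by simp
  qed
  interpret M': prob_space M' by (rule prob_spaceI) (rule em)
  have [measurable]: "X : borel_measurable M'" by (simp add: M'_def)
  interpret D: real_distribution "distr M' borel X" by (rule M'.real_distribution_distr) simp
  have dens: "(LINT w|M'. f w) = (LINT w|M. (g w / C) *\<^sub>R f w)"
   if [measurable]: "f : borel_measurable M" for f :: "_ => 'b::{banach, second_countable_topology}"
   unfolding M'_def by (rule integral_density) (use g0 C0 in auto)
  have "char (distr M' borel X) u = char std_normal u" for u
  proof -
   have "char (distr M' borel X) u = (LINT w|M'. iexp (u * X w))" unfolding char_def by (rule integral_distr) auto
   also have "... = (LINT w|M. (1 / of_real C) * (of_real (g w) * iexp (u * X w)))"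
    by (subst dens) (auto intro!: L_integral_cong simp: scaleR_conv_of_real)
   also have "... = of_real (exp (- u\<^sup>2 / 2))" using ch[of u] C0 by simp
   finally show ?thesis by (simp add: char_std_normal_distribution)
  qed
  then have "distr M' borel X = std_normal" by (intro Levy_uniqueness D.real_distribution_axioms real_dist_normal_dist) auto
  then have "measure std_normal A = measure (distr M' borel X) A" by simp
  also have "... = (LINT x|distr M' borel X. indicator A x)" by simp
  also have "... = (LINT w|M'. indicator A (X w))" by (rule integral_distr) auto
  also have "... = (LINT w|M. (1 / C) * (g w * indicator A (X w)))" by (subst dens) (auto intro!: L_integral_cong)
  also have "... = (LINT w|M. g w * indicator A (X w)) / C" by simp
  finally show ?thesis using C0 by (simp add: field_simps)
 qed
qed

text \<open>The weights \<open>1 + cos (Y + \<theta>)\<close> are nonnegative, so the one-dimensional uniqueness theorem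
 applies to them, and they span \<open>iexp Y\<close>.\<close>

lemma char_peel:
 assumes M: "prob_space M" and X [measurable]: "X : borel_measurable M" and Y [measurable]: "Y : borel_measurable M"
  and g [measurable]: "g : borel_measurable M" and g0: "!!w. 0 <= g w" and gB: "!!w. g w <= (1 :: real)"
  and ch0: "!!u. (LINT w|M. of_real (g w) * iexp (u * X w)) = of_real c0 * of_real (exp (- u\<^sup>2 / 2))"
  and ch1: "!!u. (LINT w|M. of_real (g w) * iexp (u * X w + Y w)) = of_real c * of_real (exp (- u\<^sup>2 / 2))"
  and ch2: "!!u. (LINT w|M. of_real (g w) * iexp (u * X w - Y w)) = of_real c * of_real (exp (- u\<^sup>2 / 2))"
  and A [measurable]: "A : sets borel"
 shows "(LINT w|M. of_real (g w * indicator A (X w)) * iexp (Y w)) = of_real (c * measure std_normal A)"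
proof -
 interpret prob_space M by fact
 have ib: "integrable M (%w. of_real (g w) * iexp (Z w))" if [measurable]: "Z : borel_measurable M" for Z
  by (rule integrable_const_bound[of _ 1]) (use g0 gB in \<open>auto simp: norm_mult\<close>)
 have rb: "integrable M (%w. g w * indicator A (X w) * h w)" if [measurable]: "h : borel_measurable M" and h: "!!w. \<bar>h w\<bar> <= 1" for h
 proof (rule integrable_const_bound[of _ 1])
  have "\<bar>g w\<bar> * \<bar>h w\<bar> <= 1 * 1" for w by (intro mult_mono) (use g0 gB h in auto)
  then show "AE w in M. norm (g w * indicator A (X w) * h w) <= 1" by (auto simp: abs_mult indicator_def)
 qed simp
 have cge: "0 <= 1 + cos x" for x :: real using cos_ge_minus_one[of x] by linarith
 have ie: "iexp y = cis y" for y by (simp add: cis_conv_exp)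
 have cosint: "(LINT w|M. g w * (1 + cos (Y w + \<theta>)) * indicator A (X w)) = (c0 + c * cos \<theta>) * measure std_normal A" for \<theta>
 proof (rule weighted_std_normal[OF M X])
  show "0 <= g w * (1 + cos (Y w + \<theta>))" for w using g0 cge by (intro mult_nonneg_nonneg) auto
  show "g w * (1 + cos (Y w + \<theta>)) <= 2" for w
  proof -
   have "g w * (1 + cos (Y w + \<theta>)) <= 1 * 2" using g0 gB cge cos_le_one[of "Y w + \<theta>"] by (intro mult_mono) auto
   then show ?thesis by simp
  qed
  fix u :: real
  have cs: "complex_of_real (cos (y + \<theta>)) = (cis \<theta> * iexp y + cis (- \<theta>) * iexp (- y)) / 2" for y
   by (simp only: ie) (simp add: complex_eq_iff cos_add)
  have i1: "integrable M (%w. of_real (g w) * iexp (u * X w))" by (rule ib) simp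
  have i2: "integrable M (%w. (cis \<theta> / 2) * (of_real (g w) * iexp (u * X w + Y w)))" by (intro integrable_mult_right ib) simp
  have i3: "integrable M (%w. (cis (- \<theta>) / 2) * (of_real (g w) * iexp (u * X w - Y w)))" by (intro integrable_mult_right ib) simp
  let ?A = "LINT w|M. of_real (g w * (1 + cos (Y w + \<theta>))) * iexp (u * X w)"
  have "of_real (g w * (1 + cos (Y w + \<theta>))) * iexp (u * X w) = of_real (g w) * iexp (u * X w) +
   ((cis \<theta> / 2) * (of_real (g w) * iexp (u * X w + Y w)) + (cis (- \<theta>) / 2) * (of_real (g w) * iexp (u * X w - Y w)))" for w
   unfolding of_real_mult of_real_add cs by (simp add: exp_add exp_diff exp_minus field_simps distrib_left right_diff_distrib)
  then have "?A =
   (LINT w|M. of_real (g w) * iexp (u * X w)) +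
   ((cis \<theta> / 2) * (LINT w|M. of_real (g w) * iexp (u * X w + Y w)) +
    (cis (- \<theta>) / 2) * (LINT w|M. of_real (g w) * iexp (u * X w - Y w)))" by (simp only: L_integral_add[OF i1 L_integrable_add[OF i2 i3]]
     L_integral_add[OF i2 i3] integral_mult_right_zero)
  also have "... = of_real (c0 + c * cos \<theta>) * of_real (exp (- u\<^sup>2 / 2))"
   unfolding ch0 ch1 ch2 by (simp add: complex_eq_iff field_simps)
  finally show "?A =
   of_real (c0 + c * cos \<theta>) * of_real (exp (- u\<^sup>2 / 2))" .
 qed auto
 have base: "(LINT w|M. g w * indicator A (X w)) = c0 * measure std_normal A" by (rule weighted_std_normal[OF M X g g0 gB ch0 A])
 have split: "(LINT w|M. g w * (1 + h w) * indicator A (X w)) =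
   (LINT w|M. g w * indicator A (X w)) + (LINT w|M. g w * indicator A (X w) * h w)"
  if [measurable]: "h : borel_measurable M" and h: "!!w. \<bar>h w\<bar> <= 1" for h using rb[of h] rb[of "%_. 1"] h
  by (subst L_integral_add[symmetric]) (auto simp: algebra_simps intro!: L_integral_cong)
 have c: "(LINT w|M. g w * indicator A (X w) * cos (Y w)) = c * measure std_normal A"
  using cosint[of 0] split[of "%w. cos (Y w)"] base by (simp add: algebra_simps)
 have s: "(LINT w|M. g w * indicator A (X w) * sin (Y w)) = 0"
  using cosint[of "- (pi / 2)"] split[of "%w. sin (Y w)"] base by (simp add: algebra_simps cos_diff)
 let ?B = "LINT w|M. complex_of_real (g w * indicator A (X w) * cos (Y w))"
 have "(LINT w|M. of_real (g w * indicator A (X w)) * iexp (Y w)) =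
  (LINT w|M. of_real (g w * indicator A (X w) * cos (Y w)) + \<i> * of_real (g w * indicator A (X w) * sin (Y w)))"
  by (intro L_integral_cong refl) (simp add: cis_conv_exp[symmetric] complex_eq_iff)
 also have "... = ?B +
   (LINT w|M. \<i> * complex_of_real (g w * indicator A (X w) * sin (Y w)))"
  by (intro L_integral_add integrable_mult_right integrable_of_real rb) auto
 also have "?B = of_real (c * measure std_normal A)" by (simp only: integral_complex_of_real c)
 also have "(LINT w|M. \<i> * complex_of_real (g w * indicator A (X w) * sin (Y w))) = 0"
  by (simp only: integral_mult_right_zero integral_complex_of_real s, simp)
 finally show ?thesis by simp
qed

text \<open>Coordinates are converted one at a time from exponentials to indicators.
  \<open>J\<close> holds those already converted, and each step is \<open>char_peel\<close> with the
  product of their indicators as weight.\<close>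

lemma iid_std_normal_of_char:
 fixes X :: "'i => 'a => real"
 assumes M: "prob_space M" and I: "finite I" and X: "!!i. i : I ==> X i : borel_measurable M"
  and ch: "!!a. (LINT w|M. iexp (SUM i:I. a i * X i w)) = of_real (exp (- (SUM i:I. (a i)^2) / 2))"
 shows "distr M (PiM I (%_. borel)) (%w. \<lambda>i\<in>I. X i w) = gauss I"
proof -
 interpret prob_space M by fact
 interpret S: prob_space std_normal using real_dist_normal_dist by (simp add: real_distribution_def)
 interpret P: product_sigma_finite "%_ :: 'i. std_normal" ..
 have main: "(LINT w|M. of_real (PROD i:J. indicator (A i) (X i w)) * iexp (SUM i:I - J. a i * X i w)) =
   of_real ((PROD i:J. measure std_normal (A i)) * exp (- (SUM i:I - J. (a i)^2) / 2))"
  if J: "finite J" "J \<subseteq> I" and A: "!!i. i : J ==> A i : sets borel" for J A a using J A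
 proof (induction J arbitrary: a rule: finite_induct)
  case empty
  then show ?case using ch[of a] by simp
 next
  case (insert m J)
  note [measurable] = X
  have mI: "m : I" and JI: "J \<subseteq> I" using insert by auto
  have [measurable]: "X m : borel_measurable M" using X mI by auto
  have mea: "(%w. PROD i:J. indicat_real (A i) (X i w)) : borel_measurable M"
  proof (rule borel_measurable_prod)
   fix i assume i: "i : J"
   then have [measurable]: "A i : sets borel" "X i : borel_measurable M" using insert JI X by auto
   show "(%w. indicat_real (A i) (X i w)) : borel_measurable M" by measurable
  qed
  let ?g = "%w. PROD i:J. indicat_real (A i) (X i w)"
  let ?Y = "%w. SUM i:I - insert m J. a i * X i w"
  let ?c0 = "PROD i:J. measure std_normal (A i)"
  have IJ: "I - J = insert m (I - insert m J)" using mI insert by auto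
  have IH: "(LINT w|M. of_real (?g w) * iexp (u * X m w + (SUM i:I - insert m J. b i * X i w))) =
   of_real (?c0 * exp (- (SUM i:I - insert m J. (b i)^2) / 2)) * of_real (exp (- u\<^sup>2 / 2))" for u b
  proof -
   have s: "(SUM i:I - insert m J. (if i = m then u else b i) * X i w) = (SUM i:I - insert m J. b i * X i w)" for w by (intro sum.cong) auto
   have s2: "(SUM i:I - insert m J. (if i = m then u else b i)^2) = (SUM i:I - insert m J. (b i)^2)" by (intro sum.cong) auto
   have fin: "finite (I - insert m J)" using I by auto
   have "(LINT w|M. of_real (?g w) * iexp (SUM i:I - J. (if i = m then u else b i) * X i w)) =
   of_real (?c0 * exp (- (SUM i:I - J. (if i = m then u else b i)^2) / 2))" by (rule insert.IH) (use insert in auto)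
   then show ?thesis unfolding IJ sum.insert[OF fin, of m] using s s2 fin by (simp add: add_divide_distrib exp_add[symmetric] flip: of_real_mult)
  qed
  have "(LINT w|M. of_real (?g w * indicator (A m) (X m w)) * iexp (?Y w)) =
   of_real (?c0 * exp (- (SUM i:I - insert m J. (a i)^2) / 2) * measure std_normal (A m))"
  proof (rule char_peel[OF M])
   show "?Y : borel_measurable M" using X by (intro borel_measurable_sum) auto
   show "0 <= ?g w" for w by (intro prod_nonneg) auto
   show "?g w <= 1" for w by (intro prod_le_1) auto
   fix u
   show "(LINT w|M. of_real (?g w) * iexp (u * X m w)) = of_real ?c0 * of_real (exp (- u\<^sup>2 / 2))" using IH[of u "%_. 0"] by simp
   show "(LINT w|M. of_real (?g w) * iexp (u * X m w + ?Y w)) = of_real (?c0 * exp (- (SUM i:I - insert m J. (a i)^2) / 2)) * of_real (exp (- u\<^sup>2 / 2))"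
    by (rule IH)
   show "(LINT w|M. of_real (?g w) * iexp (u * X m w - ?Y w)) = of_real (?c0 * exp (- (SUM i:I - insert m J. (a i)^2) / 2)) * of_real (exp (- u\<^sup>2 / 2))"
    using IH[of u "%i. - a i"] by (simp add: sum_negf)
  qed (use mea insert in auto)
  then show ?case using insert by (simp add: mult_ac)
 qed
 let ?Z = "%w. \<lambda>i\<in>I. X i w"
 let ?B = "PiM I (%_. borel)"
 have Z [measurable]: "?Z : measurable M ?B" using X by (intro measurable_restrict) auto
 show ?thesis
 proof (rule P.PiM_eqI[OF I])
  show "sets (distr M ?B ?Z) = sets (gauss I)" by (simp cong: sets_PiM_cong)
  fix A assume A: "!!i. i : I ==> A i : sets std_normal"
  have AS: "Pi\<^sub>E I A : sets ?B" using A I by (intro sets_PiM_I_finite) auto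
  let ?A = "?Z -` Pi\<^sub>E I A \<inter> space M"
  have "emeasure (distr M ?B ?Z) (Pi\<^sub>E I A) = emeasure M ?A" using AS by (simp add: emeasure_distr)
  also have "... = ennreal (prob ?A)" by (rule emeasure_eq_measure)
  also have "prob ?A = (LINT w|M. indicat_real ?A w)" using measurable_sets[OF Z AS] by simp
  also have "... = (LINT w|M. (PROD i:I. indicator (A i) (X i w)))"
   by (intro L_integral_cong refl) (use I in \<open>auto simp: indicator_def PiE_iff prod.If_cases prod_zero_iff\<close>)
  also have "complex_of_real ... = of_real (PROD i:I. measure std_normal (A i))"
   using main[of I A "%_. 0"] A I by (simp flip: integral_complex_of_real of_real_prod)
  then have "(LINT w|M. (PROD i:I. indicator (A i) (X i w))) = (PROD i:I. measure std_normal (A i))" using of_real_eq_iff by blast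
  finally show "emeasure (distr M ?B ?Z) (Pi\<^sub>E I A) = (PROD i:I. emeasure std_normal (A i))"
   by (simp only: S.emeasure_eq_measure prod_ennreal measure_nonneg)
 qed
qed

lemma gaussian_var_moments:
 assumes M: "prob_space M" and G: "gaussian_var M X"
 shows "integrable M X" "integrable M (%w. (X w)^2)"
  and "prob_space.expectation M X = 0 ==>
   (LINT w|M. iexp (X w)) = of_real (exp (- prob_space.expectation M (%w. (X w)^2) / 2))"
proof -
 interpret prob_space M by fact
 have [measurable]: "X : borel_measurable M" using G by (simp add: gaussian_var_def)
 let ?A = "%w. (X w)^2"
 let ?B = "LINT w|M. iexp (X w)"
 from G consider m where "AE w in M. X w = m" | m \<sigma> where "\<sigma> > 0" "distributed M lborel X (normal_density m \<sigma>)"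
  by (auto simp: gaussian_var_def)
 then have "integrable M X & integrable M ?A & (expectation X = 0 -->
   ?B = of_real (exp (- expectation ?A / 2)))"
 proof cases
  case 1
  have e: "expectation X = m" using 1 integral_cong_AE[of X M "%_. m"] by (simp add: prob_space)
  have e2: "expectation ?A = m^2"
  proof -
   have "AE w in M. (X w)^2 = m^2" using 1 by auto
   then have "expectation ?A = expectation (%_. m^2)" by (intro integral_cong_AE) auto
   then show ?thesis by (simp add: prob_space)
  qed
  have "?B = (LINT w|M. iexp m)" by (rule integral_cong_AE) (use 1 in auto)
  moreover have "integrable M X" using 1 by (intro integrable_const_bound[of _ "\<bar>m\<bar>"]) auto
  moreover have "integrable M ?A" using 1 by (intro integrable_const_bound[of _ "m^2"]) auto
  ultimately show ?thesis using e e2 by (simp add: prob_space)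
 next
  case 2
  have i1: "integrable M (%w. (X w - m) ^ k)" for k
   using distributed_integrable[OF 2(2), of "%x. (x - m) ^ k"] integrable_normal_moment[OF 2(1), of m k] by simp
  have iX: "integrable M X" using L_integrable_add[OF i1[of 1] integrable_const[of m]] by simp
  have "?A = (%w. (X w - m) ^ 2 + (2 * m * X w - m\<^sup>2))" by (auto simp: power2_eq_square algebra_simps)
  then have iX2: "integrable M ?A" using i1[of 2] iX by simp
  have "?B = of_real (exp (- expectation ?A / 2))" if E: "expectation X = 0"
  proof -
   have m: "m = 0" using normal_distributed_expectation[OF 2(1)] 2(2) E by simp
   have v: "expectation ?A = \<sigma>^2" using normal_distributed_variance[OF 2(1), of X m] 2(2) E by simp
   have "distributed M lborel (%w. (X w - m) / \<sigma>) std_normal_density" using normal_standard_normal_convert[OF 2(1)] 2(2) by blast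
   then have D: "distr M lborel (%w. X w / \<sigma>) = std_normal" by (simp add: distributed_def m)
   have "?B = (LINT w|M. iexp (\<sigma> * (X w / \<sigma>)))" using 2 by simp
   also have "... = (LINT x|distr M lborel (%w. X w / \<sigma>). iexp (\<sigma> * x))" by (subst integral_distr) auto
   also have "... = char std_normal \<sigma>" unfolding D char_def ..
   finally show ?thesis by (simp add: char_std_normal_distribution v)
  qed
  then show ?thesis using iX iX2 by blast
 qed
 then show "integrable M X" "integrable M ?A"
  and "expectation X = 0 ==> ?B = of_real (exp (- expectation ?A / 2))" by auto
qed

text \<open>Within a component the whitened combinations have the identity as covariance; across
  components independence factorises the characteristic function. Together this is the hypothesis of
  \<open>iid_std_normal_of_char\<close>.\<close>

lemma fbm_innovations_iid:
 fixes W :: "real => 'w => real ^ 'n" and t :: "nat => real" and K :: "nat => nat => real"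
 assumes fbm: "fractional_brownian_motion M H W"
  and t01: "!!k. k < N ==> t k : {0..1}" and inj: "inj_on t {..<N}"
  and cov: "!!i s t. s : {0..1} ==> t : {0..1} ==>
    prob_space.expectation M (%w. W s w $ i * W t w $ i) = R s t"
  and K: "!!i j. i < N ==> j < N ==> (SUM k<N. SUM l<N. K i k * K j l * R (t k) (t l)) = of_bool (i = j)"
 shows "distr M (PiM ({..<N} \<times> UNIV) (%_. borel)) (%w. \<lambda>(k, i)\<in>{..<N} \<times> UNIV. SUM l<N. K k l * W (t l) w $ i)
  = gauss ({..<N} \<times> UNIV)"
proof -
 interpret prob_space M using fbm by (simp add: fractional_brownian_motion_def)
 have indep: "indep_vars (%i. \<Pi>\<^sub>M t\<in>{0..1::real}. (borel :: real measure)) (%i w. \<lambda>t\<in>{0..1}. W t w $ i) UNIV"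
  and gp: "!!i. gaussian_process M {0..1} (%t w. W t w $ i)"
  and mean: "!!i t. t : {0..1} ==> expectation (%w. W t w $ i) = 0" using fbm by (auto simp: fractional_brownian_motion_def)
 have comb: "gaussian_var M (%w. SUM l<N. \<beta> l * W (t l) w $ i)" for \<beta> i
 proof -
  \<comment> \<open>\<open>gaussian_process\<close> speaks of sums over sets of times, so the
    coefficients are transported along the injective \<open>t\<close>.\<close>
  have "gaussian_var M (%w. SUM s:t ` {..<N}. \<beta> (the_inv_into {..<N} t s) * W s w $ i)"
  proof (rule gp[of i, unfolded gaussian_process_def, rule_format])
   show "finite (t ` {..<N}) & t ` {..<N} \<subseteq> {0..1}" using t01 by (simp add: image_subset_iff)
  qed
  moreover have "(SUM s:t ` {..<N}. \<beta> (the_inv_into {..<N} t s) * W s w $ i) = (SUM l<N. \<beta> l * W (t l) w $ i)" for w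
   by (subst sum.reindex[OF inj]) (intro sum.cong refl, simp add: the_inv_into_f_f[OF inj])
  ultimately show ?thesis by simp
 qed
 have single: "gaussian_var M (%w. W (t l) w $ i)" if "l < N" for l i
  using comb[of "%m. of_bool (m = l)" i] that by (simp add: of_bool_def if_distrib if_distribR cong: if_cong)
 have Wm [measurable]: "(%w. W (t l) w $ i) : borel_measurable M" if "l < N" for l i using single[OF that] by (simp add: gaussian_var_def)
 have char1: "(LINT w|M. iexp (SUM l<N. (SUM k<N. a k * K k l) * W (t l) w $ i)) = of_real (exp (- (SUM k<N. (a k)^2) / 2))" for a i
 proof -
  let ?\<beta> = "%l. SUM k<N. a k * K k l"
  let ?S = "%w. SUM l<N. ?\<beta> l * W (t l) w $ i"
  have int2: "integrable M (%w. W (t k) w $ i * W (t l) w $ i)" if "k < N" "l < N" for k l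
   by (rule integrable_mult_of_squares) (use that single gaussian_var_moments(2)[OF prob_space_axioms] Wm in auto)
  have E: "expectation ?S = 0" using mean t01 gaussian_var_moments(1)[OF prob_space_axioms single] by simp
  have gen: "expectation (%w. SUM k<N. SUM l<N. c k l * (W (t k) w $ i * W (t l) w $ i)) =
    (SUM k<N. SUM l<N. c k l * R (t k) (t l))" for c
  proof -
   have ci: "integrable M (%w. c k l * (W (t k) w $ i * W (t l) w $ i))" if "k < N" "l < N" for k l
    using int2[OF that] by (rule integrable_mult_right)
   have "expectation (%w. SUM k<N. SUM l<N. c k l * (W (t k) w $ i * W (t l) w $ i)) =
     (SUM k<N. expectation (%w. SUM l<N. c k l * (W (t k) w $ i * W (t l) w $ i)))" by (rule L_integral_sum) (intro L_integrable_sum ci, auto)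
   also have "... = (SUM k<N. SUM l<N. expectation (%w. c k l * (W (t k) w $ i * W (t l) w $ i)))" by (intro sum.cong refl L_integral_sum ci) auto
   also have "... = (SUM k<N. SUM l<N. c k l * R (t k) (t l))" by (intro sum.cong refl) (use cov t01 in simp)
   finally show ?thesis .
  qed
  have "expectation (%w. (?S w)^2) = expectation (%w. SUM k<N. SUM l<N. ?\<beta> k * ?\<beta> l * (W (t k) w $ i * W (t l) w $ i))"
   by (intro L_integral_cong refl, unfold power2_eq_square, subst sum_product)
    (intro sum.cong refl, simp only: mult_ac)
  also have "... = (SUM k<N. SUM l<N. ?\<beta> k * ?\<beta> l * R (t k) (t l))" by (rule gen)
  also have "... = (SUM k<N. SUM l<N. SUM p<N. SUM q<N. a p * a q * (K p k * K q l * R (t k) (t l)))"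
  proof (intro sum.cong refl)
   fix k l
   show "?\<beta> k * ?\<beta> l * R (t k) (t l) = (SUM p<N. SUM q<N. a p * a q * (K p k * K q l * R (t k) (t l)))"
    by (subst sum_product) (simp add: sum_distrib_right sum_distrib_left mult_ac)
  qed
  also have "... = (SUM k<N. SUM p<N. SUM l<N. SUM q<N. a p * a q * (K p k * K q l * R (t k) (t l)))" by (intro sum.cong refl sum.swap)
  also have "... = (SUM p<N. SUM k<N. SUM l<N. SUM q<N. a p * a q * (K p k * K q l * R (t k) (t l)))" by (rule sum.swap)
  also have "... = (SUM p<N. SUM k<N. SUM q<N. SUM l<N. a p * a q * (K p k * K q l * R (t k) (t l)))" by (intro sum.cong refl sum.swap)
  also have "... = (SUM p<N. SUM q<N. SUM k<N. SUM l<N. a p * a q * (K p k * K q l * R (t k) (t l)))" by (intro sum.cong refl sum.swap)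
  also have "... = (SUM p<N. SUM q<N. a p * a q * of_bool (p = q))" using K by (simp flip: sum_distrib_left)
  also have "... = (SUM p<N. (a p)^2)" by (simp add: of_bool_def power2_eq_square if_distrib cong: if_cong)
  finally have V: "expectation (%w. (?S w)^2) = (SUM p<N. (a p)^2)" .
  show ?thesis using gaussian_var_moments(3)[OF prob_space_axioms comb E] unfolding V .
 qed
 let ?I = "{..<N} \<times> (UNIV :: 'n set)"
 let ?Z = "%(k, i) w. SUM l<N. K k l * W (t l) w $ i"
 have "distr M (PiM ?I (%_. borel)) (%w. \<lambda>p\<in>?I. ?Z p w) = gauss ?I"
 proof (rule iid_std_normal_of_char[OF prob_space_axioms])
  show "?Z p : borel_measurable M" if "p : ?I" for p by (cases p) auto
  fix a :: "nat \<times> 'n => real"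
  let ?f = "%i (x :: real => real). iexp (SUM l<N. (SUM k<N. a (k, i) * K k l) * x (t l))"
  have fm: "?f i : borel_measurable (\<Pi>\<^sub>M t\<in>{0..1::real}. (borel :: real measure))" for i using t01 by measurable
  have iv: "indep_vars (%_. borel) (%i. ?f i \<circ> (%w. \<lambda>t\<in>{0..1}. W t w $ i)) UNIV"
   by (rule indep_vars_compose[OF indep]) (use fm in auto)
  have eqf: "(?f i \<circ> (%w. \<lambda>t\<in>{0..1}. W t w $ i)) w = iexp (SUM l<N. (SUM k<N. a (k, i) * K k l) * W (t l) w $ i)" for i w
   using t01 by simp
  have "(SUM p:?I. a p * ?Z p w) = (SUM i:UNIV. SUM l<N. (SUM k<N. a (k, i) * K k l) * W (t l) w $ i)" for w
  proof -
   have "(SUM p:?I. a p * ?Z p w) = (SUM k<N. SUM i:UNIV. a (k, i) * (SUM l<N. K k l * W (t l) w $ i))"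
    by (simp add: sum.cartesian_product split_beta)
   also have "... = (SUM i:UNIV. SUM k<N. SUM l<N. a (k, i) * K k l * W (t l) w $ i)" by (subst sum.swap) (simp add: sum_distrib_left mult.assoc)
   also have "... = (SUM i:UNIV. SUM l<N. SUM k<N. a (k, i) * K k l * W (t l) w $ i)" by (intro sum.cong refl sum.swap)
   finally show ?thesis by (simp add: sum_distrib_right)
  qed
  then have "(LINT w|M. iexp (SUM p:?I. a p * ?Z p w)) = (LINT w|M. (PROD i:UNIV. (?f i \<circ> (%w. \<lambda>t\<in>{0..1}. W t w $ i)) w))"
   unfolding eqf by (simp add: sum_distrib_left exp_sum)
  also have "... = (PROD i:UNIV. LINT w|M. (?f i \<circ> (%w. \<lambda>t\<in>{0..1}. W t w $ i)) w)"
  proof (rule indep_vars_lebesgue_integral[OF _ iv])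
   show "integrable M (?f i \<circ> (%w. \<lambda>t\<in>{0..1}. W t w $ i))" for i
   proof (rule integrable_const_bound[of _ 1])
    show "?f i \<circ> (%w. \<lambda>t\<in>{0..1}. W t w $ i) : borel_measurable M" using iv by (auto simp: indep_vars_def)
   qed (simp add: eqf)
  qed simp
  also have "... = (PROD i:UNIV. of_real (exp (- (SUM k<N. (a (k, i))^2) / 2)))" unfolding eqf char1 ..
  also have "... = of_real (exp (- (SUM p:?I. (a p)^2) / 2))"
  proof -
   have "(SUM p:?I. (a p)^2) = (SUM i:UNIV. SUM k<N. (a (k, i))^2)" by (subst sum.swap) (simp add: sum.cartesian_product split_beta)
   then show ?thesis by (simp add: exp_sum[symmetric] sum_negf sum_divide_distrib flip: of_real_prod)
  qed
  finally show "(LINT w|M. iexp (SUM p:?I. a p * ?Z p w)) = of_real (exp (- (SUM p:?I. (a p)^2) / 2))" .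
 qed simp
 moreover have "(%w. \<lambda>p\<in>?I. ?Z p w) = (%w. \<lambda>(k, i)\<in>?I. SUM l<N. K k l * W (t l) w $ i)"
  by (auto simp: fun_eq_iff restrict_def)
 ultimately show ?thesis by simp
qed

section \<open>Averages along Gaussian paths\<close>

text \<open>Conditioning is replaced by tilting: under the density proportional to the exponential
  of \<theta> times the partial sum, the next difference is centred by \<open>orth\<close>, and
  Hoeffding's lemma bounds its exponential moment.\<close>

lemma azuma_mgf:
 fixes D :: "nat => 'a => real"
 assumes M: "prob_space M" and D: "!!k. k < n ==> D k : borel_measurable M"
  and b: "!!k w. k < n ==> \<bar>D k w\<bar> <= \<delta>"
  and orth: "!!k. k < n ==> (LINT w|M. exp (\<theta> * (SUM i<k. D i w)) * D k w) = 0"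
  and \<theta>: "0 < \<theta>" and kn: "k <= n"
 shows "(\<integral>\<^sup>+w. ennreal (exp (\<theta> * (SUM i<k. D i w))) \<partial>M) <= ennreal (exp (real k * (\<theta>^2 * \<delta>^2 / 2)))"
 using kn
proof (induction k)
 case 0
 interpret prob_space M by fact
 show ?case by (simp add: emeasure_space_1)
next
 case (Suc k)
 interpret prob_space M by fact
 let ?S = "%w. SUM i<k. D i w"
 have k: "k < n" using Suc by simp
 have [measurable]: "D k : borel_measurable M" "?S : borel_measurable M" using D k by (auto intro!: borel_measurable_sum)
 have Sb: "?S w <= real k * \<delta>" for w using sum_bounded_above[of "{..<k}" "%i. D i w" \<delta>] b k by (force simp: abs_le_iff)
 have int: "integrable M (%w. exp (\<theta> * ?S w))"
  by (rule integrable_const_bound[of _ "exp (\<theta> * (real k * \<delta>))"]) (use \<theta> Sb in auto)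
 define c where "c = expectation (%w. exp (\<theta> * ?S w))"
 have nc: "(\<integral>\<^sup>+w. ennreal (exp (\<theta> * ?S w)) \<partial>M) = ennreal c"
  unfolding c_def using int by (intro nn_integral_eq_integral) auto
 have c0: "0 <= c" unfolding c_def by (intro L_integral_nonneg) auto
 have "c ~= 0"
 proof
  assume "c = 0"
  then have "AE w in M. exp (\<theta> * ?S w) = 0" unfolding c_def using int by (subst (asm) integral_nonneg_eq_0_iff_AE) auto
  then show False using AE_False by simp
 qed
 then have c: "0 < c" using c0 by simp
 define M' where "M' = density M (%w. ennreal (exp (\<theta> * ?S w) / c))"
 have M'int: "(\<integral>\<^sup>+w. f w \<partial>M') = (\<integral>\<^sup>+w. ennreal (exp (\<theta> * ?S w) / c) * f w \<partial>M)"
  if [measurable]: "f : borel_measurable M" for f unfolding M'_def by (rule nn_integral_density) auto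
 have "emeasure M' (space M') = (\<integral>\<^sup>+w. ennreal (exp (\<theta> * ?S w) / c) \<partial>M)"
  unfolding M'_def by (subst emeasure_density) (auto intro!: nn_integral_cong)
 also have "... = ennreal (LINT w|M. exp (\<theta> * ?S w) / c)" using int c by (intro nn_integral_eq_integral) auto
 finally have "emeasure M' (space M') = 1" using c by (simp add: c_def[symmetric])
 then interpret M': prob_space M' by (rule prob_spaceI)
 interpret I: interval_bounded_random_variable M' "D k" "- \<delta>" \<delta>
  by unfold_locales (use b k in \<open>auto simp: M'_def abs_le_iff minus_le_iff\<close>)
 have "integral\<^sup>L M' (D k) = (LINT w|M. (exp (\<theta> * ?S w) / c) *\<^sub>R D k w)" unfolding M'_def using c by (intro integral_density) auto
 also have "... = (LINT w|M. exp (\<theta> * ?S w) * D k w) / c" by simp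
 finally have "integral\<^sup>L M' (D k) = 0" using orth[OF k] by simp
 from I.Hoeffdings_lemma_nn_integral_0[OF \<theta> this]
 have H: "(\<integral>\<^sup>+w. ennreal (exp (\<theta> * D k w)) \<partial>M') <= ennreal (exp (\<theta>^2 * \<delta>^2 / 2))"
  by (simp add: power2_eq_square field_simps)
 have "(\<integral>\<^sup>+w. ennreal (exp (\<theta> * (SUM i<Suc k. D i w))) \<partial>M) =
   (\<integral>\<^sup>+w. ennreal c * (ennreal (exp (\<theta> * ?S w) / c) * ennreal (exp (\<theta> * D k w))) \<partial>M)"
  using c by (intro nn_integral_cong) (simp add: ennreal_mult[symmetric] distrib_left exp_add)
 also have "... = ennreal c * (\<integral>\<^sup>+w. ennreal (exp (\<theta> * D k w)) \<partial>M')" by (subst M'int) (auto simp: nn_integral_cmult)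
 also have "... <= ennreal (exp (real k * (\<theta>^2 * \<delta>^2 / 2))) * ennreal (exp (\<theta>^2 * \<delta>^2 / 2))"
  using Suc H nc by (intro mult_mono) auto
 also have "... = ennreal (exp (real (Suc k) * (\<theta>^2 * \<delta>^2 / 2)))"
  by (simp add: ennreal_mult[symmetric] exp_add[symmetric] algebra_simps)
 finally show ?case .
qed

lemma azuma_upper_tail:
 fixes D :: "nat => 'a => real"
 assumes M: "prob_space M" and D: "!!k. k < n ==> D k : borel_measurable M"
  and b: "!!k w. k < n ==> \<bar>D k w\<bar> <= \<delta>"
  and orth: "!!k \<theta>. k < n ==> (LINT w|M. exp (\<theta> * (SUM i<k. D i w)) * D k w) = 0"
  and n: "0 < n" and \<delta>: "0 < \<delta>" and x: "0 < x"
 shows "measure M {w : space M. x <= (SUM i<n. D i w)} <= exp (- (x^2 / (2 * real n * \<delta>^2)))"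
proof -
 interpret prob_space M by fact
 let ?S = "%w. SUM i<n. D i w"
 \<comment> \<open>The minimiser of the exponent - \<theta> x + n \<theta>^2 \<delta>^2 / 2.\<close>
 define \<theta> where "\<theta> = x / (real n * \<delta>^2)"
 have \<theta>: "0 < \<theta>" using n \<delta> x by (simp add: \<theta>_def)
 have [measurable]: "?S : borel_measurable M" using D by (intro borel_measurable_sum) auto
 let ?A = "\<integral>\<^sup>+w. ennreal (exp (- \<theta> * x)) * ennreal (exp (\<theta> * ?S w)) \<partial>M"
 have "emeasure M {w : space M. x <= ?S w} <= ?A"
 proof (subst nn_integral_indicator[symmetric])
  show "(\<integral>\<^sup>+w. indicator {w : space M. x <= ?S w} w \<partial>M) <= ?A"
  proof (rule nn_integral_mono)
   fix w
   have "1 <= exp (- \<theta> * x) * exp (\<theta> * ?S w)" if "x <= ?S w"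
    using mult_left_mono[OF that, of \<theta>] \<theta> by (simp flip: exp_add)
   then have "indicator {w : space M. x <= ?S w} w <= ennreal (exp (- \<theta> * x) * exp (\<theta> * ?S w))"
    by (auto simp: indicator_def ennreal_1[symmetric] simp del: ennreal_1 intro!: ennreal_leI)
   then show "indicator {w : space M. x <= ?S w} w <= ennreal (exp (- \<theta> * x)) * ennreal (exp (\<theta> * ?S w))" by (simp add: ennreal_mult)
  qed
 qed simp
 also have "... = ennreal (exp (- \<theta> * x)) * (\<integral>\<^sup>+w. ennreal (exp (\<theta> * ?S w)) \<partial>M)"
  by (rule nn_integral_cmult) simp
 also have "... <= ennreal (exp (- \<theta> * x)) * ennreal (exp (real n * (\<theta>^2 * \<delta>^2 / 2)))"
  by (intro mult_left_mono azuma_mgf[OF M D b orth \<theta> order_refl]) auto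
 also have "... = ennreal (exp (- (x^2 / (2 * real n * \<delta>^2))))"
 proof -
  have "- \<theta> * x + real n * (\<theta>^2 * \<delta>^2 / 2) = - (x^2 / (2 * real n * \<delta>^2))"
   using n \<delta> by (simp add: \<theta>_def field_simps power2_eq_square)
  then show ?thesis by (simp only: ennreal_mult[symmetric] exp_ge_zero exp_add[symmetric])
 qed
 finally show ?thesis by (simp add: emeasure_eq_measure)
qed

lemma azuma_tail:
 fixes D :: "nat => 'a => real"
 assumes M: "prob_space M" and D: "!!k. k < n ==> D k : borel_measurable M"
  and b: "!!k w. k < n ==> \<bar>D k w\<bar> <= \<delta>"
  and orth: "!!k \<theta>. k < n ==> (LINT w|M. exp (\<theta> * (SUM i<k. D i w)) * D k w) = 0"
  and n: "0 < n" and \<delta>: "0 < \<delta>" and x: "0 < x"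
 shows "measure M {w : space M. x <= \<bar>SUM i<n. D i w\<bar>} <= 2 * exp (- (x^2 / (2 * real n * \<delta>^2)))"
proof -
 interpret prob_space M by fact
 let ?A = "{w : space M. x <= (SUM i<n. D i w)}" and ?B = "{w : space M. x <= (SUM i<n. - D i w)}"
 have [measurable]: "(%w. SUM i<n. D i w) : borel_measurable M" "(%w. SUM i<n. - D i w) : borel_measurable M"
  using D by (auto intro!: borel_measurable_sum)
 have "measure M ?A <= exp (- (x^2 / (2 * real n * \<delta>^2)))" by (rule azuma_upper_tail) (use assms in auto)
 moreover have "measure M ?B <= exp (- (x^2 / (2 * real n * \<delta>^2)))"
 proof (rule azuma_upper_tail[OF M])
  show "(LINT w|M. exp (\<theta> * (SUM i<k. - D i w)) * - D k w) = 0" if "k < n" for k \<theta>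
   using orth[OF that, of "- \<theta>"] by (simp add: sum_negf)
 qed (use assms in auto)
 moreover have "{w : space M. x <= \<bar>SUM i<n. D i w\<bar>} \<subseteq> ?A \<union> ?B" by (auto simp: sum_negf)
 then have "measure M {w : space M. x <= \<bar>SUM i<n. D i w\<bar>} <= measure M ?A + measure M ?B"
  by (intro order.trans[OF finite_measure_mono measure_Un_le]) auto
 ultimately show ?thesis by linarith
qed

lemma exp_minus_le_inverse_power:
 fixes y :: real
 assumes "0 < y" shows "exp (- y) <= fact p / y ^ p"
proof -
 have "y ^ p /\<^sub>R fact p <= (\<Sum>n. y ^ n /\<^sub>R fact n)"
  using sum_le_suminf[of "%n. y ^ n /\<^sub>R fact n" "{p}"] summable_exp_generic[of y] assms by auto
 then have "y ^ p / fact p <= exp y" by (simp add: exp_def divide_inverse mult.commute)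
 then show ?thesis using assms by (simp add: exp_minus field_simps)
qed

lemma sum_inverse_powr_le:
 assumes "0 <= \<theta>" "\<theta> < 1"
 shows "(SUM i = 1..n. real i powr (- \<theta>)) <= real n powr (1 - \<theta>) / (1 - \<theta>)"
proof (induction n)
 case (Suc n)
 have "real (Suc n) powr (- \<theta>) <= (real (Suc n) powr (1 - \<theta>) - real n powr (1 - \<theta>)) / (1 - \<theta>)"
 proof (cases "n = 0")
  case True
  then show ?thesis using assms by (simp add: field_simps)
 next
  case False
  have "EX z. real n < z & z < real (Suc n) & real (Suc n) powr (1 - \<theta>) - real n powr (1 - \<theta>) =
    (real (Suc n) - real n) * ((1 - \<theta>) * z powr (1 - \<theta> - 1))" using False by (intro MVT2 has_real_derivative_powr) auto
  then obtain z where z: "real n < z" "z < real (Suc n)"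
   "real (Suc n) powr (1 - \<theta>) - real n powr (1 - \<theta>) = (1 - \<theta>) * z powr (- \<theta>)" by auto
  have "real (Suc n) powr (- \<theta>) <= z powr (- \<theta>)" using z False assms by (intro powr_mono2') auto
  then show ?thesis unfolding z(3) using assms by simp
 qed
 then show ?case using Suc by (simp add: diff_divide_distrib)
qed simp

text \<open>The tail estimate behind stochastic sewing, for a family \<open>A s i\<close> playing the role of the
 conditional expectation of a summand with index \<open>i\<close> given the past of \<open>s\<close>. The predicate \<open>ad s\<close>
 stands for measurability with respect to that past. The sum over a dyadic block telescopes along
 the dyadic levels, each level contributing a sum of martingale differences.\<close>

lemma dyadic_sewing_tail:
 fixes A :: "nat => nat => 'a => real" and ad :: "nat => ('a => real) => bool"
 assumes M: "prob_space M"
  and ad_meas: "!!s Y. ad s Y ==> Y : borel_measurable M"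
  and ad_mono: "!!s s' Y. s <= s' ==> ad s Y ==> ad s' Y"
  and ad_sum: "!!s c K Y. finite K ==> (!!k :: nat. k : K ==> ad s (Y k)) ==> ad s (%v. SUM k:K. c * Y k v)"
  and ad_diff: "!!s Y Z. ad s Y ==> ad s Z ==> ad s (%v. Y v - Z v)"
  and ad_exp: "!!s Y. ad s Y ==> ad s (%v. exp (Y v))"
  and adA: "!!s i. i < N ==> ad s (A s i)"
  and orth: "!!s s' i Y B. s <= s' ==> i < N ==> ad s Y ==> (!!v. \<bar>Y v\<bar> <= B) ==>
    (LINT v|M. Y v * A s' i v) = (LINT v|M. Y v * A s i v)"
  and bA: "!!s i v. s <= i ==> i < N ==> \<bar>A s i v\<bar> <= U * (real (max 1 (i - s)) / real N) powr (- \<theta>)"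
  and \<theta>: "0 <= \<theta>" "\<theta> < 1/2" and U: "0 < U"
  and blk: "p + 2 ^ r <= N" and X: "0 < X" and P: "0 < (P :: nat)"
  and q: "q = (1 - 2 * \<theta>) / 4"
 shows "measure M {v : space M. 3 * U * (2 ^ r / real N) powr (1 - \<theta>) * (1 + X / (1 - 2 powr (- q)))
   <= \<bar>(SUM i = p..<p + 2 ^ r. A i i v) / real N\<bar>} <= 2 * 8 ^ P * fact P / (1 - 2 powr (- 2 * q * P)) / X ^ (2 * P)"
proof -
 interpret prob_space M by fact
 have N: "0 < N" using blk by (metis add_leE not_less_eq_eq not_one_le_zero one_le_numeral one_le_power gr0I le_zero_eq)
 \<comment> \<open>The factor 3: in a block of n indices the first one counts 1 and the others at
   most 2 n^\<gamma>, by \<open>sum_inverse_powr_le\<close> and \<gamma> >= 1/2.\<close>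
 define V where "V = 3 * U"
 define \<gamma> where "\<gamma> = 1 - \<theta>"
 have \<gamma>: "1/2 < \<gamma>" "\<gamma> <= 1" using \<theta> by (auto simp: \<gamma>_def)
 have q0: "0 < q" "4 * q = 2 * \<gamma> - 1" using \<theta> q by (auto simp: \<gamma>_def)
 have V: "0 < V" using U by (simp add: V_def)
 \<comment> \<open>The prediction, from the past of \<open>s\<close>, of the normalised sum over the
   indices from \<open>a\<close> to \<open>b\<close>.\<close>
 define J where "J s a b v = (SUM i = a..<b. (1 / real N) * A s i v)" for s a b v
 have adJ: "ad s (J s a b)" if "b <= N" for s a b unfolding J_def by (intro ad_sum adA) (use that in auto)
 have Jb: "\<bar>J s a b v\<bar> <= V * (real (b - a) / N) powr \<gamma>" if "s <= a" "a < b" "b <= N" for s a b v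
 proof -
  have le: "\<bar>A s i v\<bar> <= U * (real (max 1 (i - a)) / N) powr (- \<theta>)" if "i : {a..<b}" for i
  proof -
   have "\<bar>A s i v\<bar> <= U * (real (max 1 (i - s)) / N) powr (- \<theta>)"
    by (rule bA) (use that \<open>s \<le> a\<close> \<open>b \<le> N\<close> in auto)
   also have "... <= U * (real (max 1 (i - a)) / N) powr (- \<theta>)"
    using \<open>s \<le> a\<close> N \<theta> U by (intro mult_left_mono powr_mono2') (auto simp: divide_right_mono max_def)
   finally show ?thesis .
  qed
  have "\<bar>J s a b v\<bar> <= (SUM i = a..<b. \<bar>(1 / real N) * A s i v\<bar>)" unfolding J_def by (rule sum_abs)
  also have "... <= (SUM i = a..<b. (1 / real N) * (U * (real (max 1 (i - a)) / N) powr (- \<theta>)))"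
   using le by (intro sum_mono) (auto simp: abs_mult intro!: divide_right_mono)
  also have "... = (U / N) * N powr \<theta> * (SUM i = a..<b. real (max 1 (i - a)) powr (- \<theta>))"
   unfolding sum_distrib_left using N by (intro sum.cong refl) (simp add: powr_divide powr_minus field_simps)
  also have "(SUM i = a..<b. real (max 1 (i - a)) powr (- \<theta>)) = (SUM i = 0..<b - a. real (max 1 i) powr (- \<theta>))"
   using \<open>a < b\<close> sum.shift_bounds_nat_ivl[of "%i. real (max 1 (i - a)) powr (- \<theta>)" 0 a "b - a"] by simp
  also have "... = 1 + (SUM i = 1..<b - a. real i powr (- \<theta>))"
   using \<open>a < b\<close> by (subst sum.atLeast_Suc_lessThan) (auto intro!: sum.cong)
  also have "(SUM i = 1..<b - a. real i powr (- \<theta>)) <= (SUM i = 1..b - a. real i powr (- \<theta>))" by (intro sum_mono2) auto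
  also have "... <= real (b - a) powr \<gamma> / \<gamma>" unfolding \<gamma>_def by (rule sum_inverse_powr_le) (use \<theta> in auto)
  also have "... <= 2 * real (b - a) powr \<gamma>" using mult_left_mono[of 1 "\<gamma> * 2" "real (b - a) powr \<gamma>"] \<gamma> by (simp add: field_simps)
  also have "1 + 2 * real (b - a) powr \<gamma> <= 3 * real (b - a) powr \<gamma>"
   using \<open>a < b\<close> \<gamma> by (simp add: ge_one_powr_ge_zero)
  finally have "\<bar>J s a b v\<bar> <= (U / N) * N powr \<theta> * (3 * real (b - a) powr \<gamma>)"
   using U N by (simp add: mult_left_mono divide_right_mono)
  also have "... = V * (real (b - a) / N) powr \<gamma>" using N by (simp add: V_def \<gamma>_def powr_divide powr_diff field_simps)
  finally show ?thesis .
 qed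
 define len where "len = 2 ^ r / real N"
 have len: "0 < len" using N by (simp add: len_def)
 \<comment> \<open>The right half of block \<open>k\<close> of level \<open>g\<close>, predicted
   from its own start instead of from the start of the block. The blocks of one level are disjoint
   in time, so these are martingale differences.\<close>
 define D where "D g k v = (let w = 2 ^ (r - Suc g); a = p + k * (2 * w) in
   J (a + w) (a + w) (a + 2 * w) v - J a (a + w) (a + 2 * w) v)" for g k v
 define S where "S g v = (SUM k<2 ^ g. J (p + k * 2 ^ (r - g)) (p + k * 2 ^ (r - g)) (p + Suc k * 2 ^ (r - g)) v)" for g v
 have top: "S r v = (SUM i = p..<p + 2 ^ r. A i i v) / real N" for v
 proof -
  have "S r v = (SUM k = 0..<2 ^ r. A (k + p) (k + p) v / real N)" by (simp add: S_def J_def lessThan_atLeast0 add.commute)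
  then show ?thesis using sum.shift_bounds_nat_ivl[of "%i. A i i v / real N" 0 p "2 ^ r"] by (simp add: sum_divide_distrib add.commute)
 qed
 have bot: "S 0 v = J p p (p + 2 ^ r) v" for v by (simp add: S_def)
 have step: "S (Suc g) v = S g v + (SUM k<2 ^ g. D g k v)" if g: "g < r" for g v
 proof -
  let ?w = "2 ^ (r - Suc g) :: nat"
  have w2: "2 ^ (r - g) = 2 * ?w" using g by (simp flip: power_Suc add: Suc_diff_Suc)
  define F where "F k = J (p + k * ?w) (p + k * ?w) (p + Suc k * ?w) v" for k
  have "S (Suc g) v = (SUM k<2 * 2 ^ g. F k)" by (simp add: S_def F_def)
  also have "... = (SUM k<2 ^ g. F (2 * k) + F (Suc (2 * k)))"
  proof -
   have "(SUM k<2 * n. F k) = (SUM k<n. F (2 * k) + F (Suc (2 * k)))" for n by (induction n) (auto simp: algebra_simps)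
   then show ?thesis .
  qed
  also have "... = (SUM k<2 ^ g. J (p + k * 2 ^ (r - g)) (p + k * 2 ^ (r - g)) (p + Suc k * 2 ^ (r - g)) v + D g k v)"
  proof (intro sum.cong refl)
   fix k
   let ?a = "p + k * (2 * ?w)"
   have "J ?a ?a (?a + ?w) v + J ?a (?a + ?w) (?a + 2 * ?w) v = J ?a ?a (?a + 2 * ?w) v" unfolding J_def by (rule sum.atLeastLessThan_concat) auto
   moreover have "p + (2 * k) * ?w = ?a" "p + Suc (2 * k) * ?w = ?a + ?w" "p + Suc (Suc (2 * k)) * ?w = ?a + 2 * ?w"
    "p + Suc k * (2 * ?w) = ?a + 2 * ?w" by (simp_all add: algebra_simps)
   ultimately show "F (2 * k) + F (Suc (2 * k)) =
    J (p + k * 2 ^ (r - g)) (p + k * 2 ^ (r - g)) (p + Suc k * 2 ^ (r - g)) v + D g k v" unfolding F_def D_def Let_def w2 by (simp only:)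
  qed
  finally show ?thesis by (simp add: S_def sum.distrib)
 qed
 have tele: "S r v = J p p (p + 2 ^ r) v + (SUM g<r. SUM k<2 ^ g. D g k v)" for v
 proof -
  have "S n v = S 0 v + (SUM g<n. SUM k<2 ^ g. D g k v)" if "n <= r" for n using that by (induction n) (auto simp: step)
  then show ?thesis using bot by simp
 qed
 define \<delta> where "\<delta> g = 2 * V * (len * 2 powr (- real g)) powr \<gamma>" for g
 \<comment> \<open>Level \<open>g\<close> is allowed \<Lambda> 2^(- q g), which sums to the factor 1
   / (1 - 2^(- q)) of the statement. There are 2^g differences of order 2^(- \<gamma> g), so with 4
   q = 2 \<gamma> - 1 the exponent in Azuma's bound is X^2 2^(2 q g) / 8 and still grows with
   g.\<close>
 define \<Lambda> where "\<Lambda> = V * len powr \<gamma> * X"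
 have \<Lambda>: "0 < \<Lambda>" using V len X by (simp add: \<Lambda>_def)
 have idx: "p + k * (2 * 2 ^ (r - Suc g)) + 2 * 2 ^ (r - Suc g) <= N" if "g < r" "k < 2 ^ g" for g k
 proof -
  have "k * (2 * 2 ^ (r - Suc g)) + 2 * 2 ^ (r - Suc g) = Suc k * 2 ^ (r - g)" using that by (simp flip: power_Suc add: Suc_diff_Suc)
  also have "... <= 2 ^ g * 2 ^ (r - g)" using that by (intro mult_right_mono) auto
  also have "... = 2 ^ r" using that by (simp flip: power_add)
  finally show ?thesis using blk by simp
 qed
 have Db: "\<bar>D g k v\<bar> <= \<delta> g" if "g < r" "k < 2 ^ g" for g k v
 proof -
  let ?w = "2 ^ (r - Suc g) :: nat" let ?a = "p + k * (2 * ?w)"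
  have i: "?a + 2 * ?w <= N" by (rule idx[OF that])
  have "real ?w <= 2 ^ r * 2 powr (- real g)"
  proof -
   have "real ?w = 2 powr real (r - Suc g)" by (simp add: powr_realpow)
   also have "... <= 2 powr (real r + (- real g))" using that by (intro powr_mono) auto
   also have "2 powr (real r + (- real g)) = 2 ^ r * 2 powr (- real g)" unfolding powr_add by (simp add: powr_realpow)
   finally show ?thesis .
  qed
  then have "real ?w / N <= len * 2 powr (- real g)" using N by (simp add: len_def divide_right_mono)
  then have le: "V * (real ?w / N) powr \<gamma> <= V * (len * 2 powr (- real g)) powr \<gamma>"
   using V \<gamma> by (intro mult_left_mono powr_mono2) auto
  have "\<bar>J (?a + ?w) (?a + ?w) (?a + 2 * ?w) v\<bar> <= V * (real (?a + 2 * ?w - (?a + ?w)) / N) powr \<gamma>" by (rule Jb) (use i in auto)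
  moreover have "\<bar>J ?a (?a + ?w) (?a + 2 * ?w) v\<bar> <= V * (real (?a + 2 * ?w - (?a + ?w)) / N) powr \<gamma>" by (rule Jb) (use i in auto)
  moreover have "?a + 2 * ?w - (?a + ?w) = ?w" by simp
  ultimately show ?thesis using le unfolding D_def Let_def \<delta>_def by (simp only:) linarith
 qed
 have adD: "ad (p + Suc k * (2 * 2 ^ (r - Suc g))) (D g k)" if "g < r" "k < 2 ^ g" for g k unfolding D_def Let_def
  by (intro ad_diff; rule ad_mono[OF _ adJ]) (use idx[OF that] in auto)
 have bad: "measure M {v : space M. \<Lambda> * 2 powr (- (q * g)) <= \<bar>SUM k<2 ^ g. D g k v\<bar>} <=
   2 * 8 ^ P * fact P / X ^ (2 * P) * (2 powr (- 2 * q * P)) ^ g" if g: "g < r" for g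
 proof -
  let ?x = "\<Lambda> * 2 powr (- (q * g))"
  have "measure M {v : space M. ?x <= \<bar>SUM k<2 ^ g. D g k v\<bar>} <= 2 * exp (- (?x^2 / (2 * real (2 ^ g) * (\<delta> g)^2)))"
  proof (rule azuma_tail[OF M])
   show "D g k : borel_measurable M" if "k < 2 ^ g" for k using adD[OF g that] ad_meas by blast
   show "\<bar>D g k v\<bar> <= \<delta> g" if "k < 2 ^ g" for k v using Db[OF g that] .
   show "(LINT v|M. exp (\<theta>' * (SUM i<k. D g i v)) * D g k v) = 0" if k: "k < 2 ^ g" for k \<theta>'
   proof -
    let ?w = "2 ^ (r - Suc g) :: nat" let ?a = "p + k * (2 * ?w)"
    let ?Y = "%v. exp (SUM i<k. \<theta>' * D g i v)"
    have adY: "ad ?a ?Y"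
    proof (intro ad_exp ad_sum)
     fix i assume "i : {..<k}"
     then have "i < k" by simp
     then have "p + Suc i * (2 * ?w) <= ?a" by (intro add_left_mono mult_right_mono) auto
     then show "ad ?a (D g i)" by (rule ad_mono[OF _ adD]) (use g k \<open>i < k\<close> in auto)
    qed simp
    have Yb: "\<bar>?Y v\<bar> <= exp (real k * (\<bar>\<theta>'\<bar> * \<delta> g))" for v
    proof -
     have "(SUM i<k. \<theta>' * D g i v) <= (SUM i<k. \<bar>\<theta>'\<bar> * \<delta> g)"
     proof (intro sum_mono)
      fix i assume "i : {..<k}"
      then have "\<bar>D g i v\<bar> <= \<delta> g" using k by (intro Db g) auto
      then have "\<bar>\<theta>' * D g i v\<bar> <= \<bar>\<theta>'\<bar> * \<delta> g" unfolding abs_mult by (intro mult_left_mono) auto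
      then show "\<theta>' * D g i v <= \<bar>\<theta>'\<bar> * \<delta> g" by linarith
     qed
     then show ?thesis by simp
    qed
    have Ym: "?Y : borel_measurable M" using adY ad_meas by blast
    have iN: "i < N" if "i : {?a + ?w..<?a + 2 * ?w}" for i using that idx[OF g k] by auto
    have Ai: "integrable M (%v. ?Y v * A s i v)" if "s <= i" "i < N" for s i
    proof (rule integrable_const_bound)
     show "AE v in M. norm (?Y v * A s i v) <=
       exp (real k * (\<bar>\<theta>'\<bar> * \<delta> g)) * (U * (real (max 1 (i - s)) / real N) powr (- \<theta>))"
      using Yb bA[OF that] by (auto simp: abs_mult simp del: abs_exp_cancel intro!: mult_mono)
     show "(%v. ?Y v * A s i v) : borel_measurable M" using Ym ad_meas[OF adA[OF that(2)]] by measurable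
    qed
    have JE: "(LINT v|M. ?Y v * J s (?a + ?w) (?a + 2 * ?w) v) =
      (SUM i = ?a + ?w..<?a + 2 * ?w. (1 / real N) * (LINT v|M. ?Y v * A s i v))" 
     and Jint: "integrable M (%v. ?Y v * J s (?a + ?w) (?a + 2 * ?w) v)" if "s <= ?a + ?w" for s
    proof -
     have eq: "?Y v * J s (?a + ?w) (?a + 2 * ?w) v = (SUM i = ?a + ?w..<?a + 2 * ?w. (1 / real N) * (?Y v * A s i v))" for v
      by (simp add: J_def sum_distrib_left mult_ac)
     have ii: "integrable M (%v. (1 / real N) * (?Y v * A s i v))" if "i : {?a + ?w..<?a + 2 * ?w}" for i
      by (intro integrable_mult_right Ai) (use iN[OF that] that \<open>s \<le> ?a + ?w\<close> in auto)
     show "integrable M (%v. ?Y v * J s (?a + ?w) (?a + 2 * ?w) v)" unfolding eq by (intro L_integrable_sum ii)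
     show "(LINT v|M. ?Y v * J s (?a + ?w) (?a + 2 * ?w) v) =
      (SUM i = ?a + ?w..<?a + 2 * ?w. (1 / real N) * (LINT v|M. ?Y v * A s i v))" unfolding eq by (subst L_integral_sum[OF ii]) simp_all
    qed
    have "(LINT v|M. ?Y v * D g k v) = (LINT v|M. ?Y v * J (?a + ?w) (?a + ?w) (?a + 2 * ?w) v - ?Y v * J ?a (?a + ?w) (?a + 2 * ?w) v)"
     by (simp add: D_def Let_def right_diff_distrib)
    also have "... = (LINT v|M. ?Y v * J (?a + ?w) (?a + ?w) (?a + 2 * ?w) v) - (LINT v|M. ?Y v * J ?a (?a + ?w) (?a + 2 * ?w) v)"
     by (intro L_integral_diff Jint) auto
    also have "... = 0"
    proof -
     have "(LINT v|M. ?Y v * A (?a + ?w) i v) = (LINT v|M. ?Y v * A ?a i v)" if "i : {?a + ?w..<?a + 2 * ?w}" for i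
      by (rule orth[OF _ iN[OF that] adY Yb]) simp
     then show ?thesis by (subst JE, simp, subst JE, simp, simp)
    qed
    finally show ?thesis by (simp add: sum_distrib_left)
   qed
  qed (use V len \<Lambda> in \<open>auto simp: \<delta>_def\<close>)
  also have "?x^2 / (2 * real (2 ^ g) * (\<delta> g)^2) = X^2 * 2 powr (2 * q * g) / 8"
  proof -
   have sq: "(y powr z)^2 = y powr (2 * z)" for y z :: real by (simp add: power2_eq_square flip: powr_add)
   have 1: "?x^2 = V^2 * len powr (2 * \<gamma>) * X^2 * 2 powr (- (2 * q * g))"
    unfolding \<Lambda>_def power_mult_distrib sq by (simp add: mult.assoc)
   have "(\<delta> g)^2 = 4 * V^2 * ((len * 2 powr (- real g)) powr (2 * \<gamma>))" unfolding \<delta>_def power_mult_distrib sq by simp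
   also have "(len * 2 powr (- real g)) powr (2 * \<gamma>) = len powr (2 * \<gamma>) * 2 powr (- (2 * \<gamma> * g))"
    using len by (simp add: powr_mult powr_powr mult.commute mult.left_commute)
   finally have 2: "(\<delta> g)^2 = 4 * V^2 * (len powr (2 * \<gamma>) * 2 powr (- (2 * \<gamma> * g)))" .
   have e: "2 powr (- (2 * q * g)) = 2 powr (2 * q * g) * (2 powr real g * 2 powr (- (2 * \<gamma> * g)))"
   proof -
    have "2 * q * g + (real g + - (2 * \<gamma> * g)) = 2 * q * g - (2 * \<gamma> - 1) * g" by (simp add: algebra_simps)
    also have "... = - (2 * q * g)" unfolding q0(2)[symmetric] by (simp add: algebra_simps)
    finally have e0: "2 * q * g + (real g + - (2 * \<gamma> * g)) = - (2 * q * g)" .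
    show ?thesis unfolding powr_add[symmetric] e0 ..
   qed
   have nz: "V^2 ~= 0" "len powr (2 * \<gamma>) ~= 0" "2 powr real g ~= (0::real)" "2 powr (- (2 * \<gamma> * g)) ~= (0::real)" using V len by auto
   have p: "real (2 ^ g) = 2 powr real g" by (simp add: powr_realpow)
   show ?thesis unfolding 1 2 e p using nz by (simp add: field_simps)
  qed
  also have "2 * exp (- (X^2 * 2 powr (2 * q * g) / 8)) <= 2 * (fact P / (X^2 * 2 powr (2 * q * g) / 8) ^ P)"
   using X by (intro mult_left_mono exp_minus_le_inverse_power) auto
  also have "... = 2 * 8 ^ P * fact P / X ^ (2 * P) * (2 powr (- 2 * q * P)) ^ g"
  proof -
   have "(2 powr (2 * q * g)) ^ P = 2 powr (2 * q * P * g)" by (simp add: powr_power mult_ac)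
   moreover have "(2 powr (- 2 * q * P)) ^ g = 1 / 2 powr (2 * q * P * g)"
   proof -
    have "(2 powr (- 2 * q * P)) ^ g = 2 powr ((- 2 * q * P) * g)" by (simp add: powr_power mult.commute)
    also have "(- 2 * q * P) * g = - (2 * q * P * g)" by simp
    finally show ?thesis by (simp add: powr_minus_divide)
   qed
   moreover have "X ^ (2 * P) = (X^2) ^ P" by (rule power_mult)
   ultimately show ?thesis using X by (simp add: power_divide power_mult_distrib field_simps)
  qed
  finally show ?thesis .
 qed
 let ?E = "%g. {v : space M. \<Lambda> * 2 powr (- (q * g)) <= \<bar>SUM k<2 ^ g. D g k v\<bar>}"
 have Em: "?E g : sets M" if "g < r" for g
 proof -
  have "(%v. SUM k<2 ^ g. D g k v) : borel_measurable M" using adD[OF that] ad_meas by (intro borel_measurable_sum) blast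
  then show ?thesis by measurable
 qed
 have geo: "(SUM g<n. (2 powr (- z)) ^ g) <= 1 / (1 - 2 powr (- z))" if "0 < z" for z :: real and n :: nat
 proof -
  have "2 powr (- z) < 2 powr 0" using that by (intro powr_less_mono) auto
  then have "2 powr (- z) < 1" by simp
  then have "(SUM g<n. (2 powr (- z)) ^ g) = (1 - (2 powr (- z)) ^ n) / (1 - 2 powr (- z))" using that by (simp add: sum_gp_strict)
  also have "... <= 1 / (1 - 2 powr (- z))" using \<open>2 powr (- z) < 1\<close> by (intro divide_right_mono) auto
  finally show ?thesis .
 qed
 let ?A = "1 + X / (1 - 2 powr (- q))"
 have cover: "{v : space M. V * len powr \<gamma> * ?A <= \<bar>S r v\<bar>} \<subseteq> (UN g<r. ?E g)"
 proof (intro subsetI)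
  fix v assume "v : {v : space M. V * len powr \<gamma> * ?A <= \<bar>S r v\<bar>}"
  then have v: "v : space M" "V * len powr \<gamma> * ?A <= \<bar>S r v\<bar>" by auto
  show "v : (UN g<r. ?E g)"
  proof (rule ccontr)
   assume nE: "v ~: (UN g<r. ?E g)"
   have lt: "\<bar>SUM k<2 ^ g. D g k v\<bar> < \<Lambda> * 2 powr (- (q * g))" if "g < r" for g
   proof (rule ccontr)
    assume "~ ?thesis"
    then have "v : ?E g" using v(1) by (simp add: not_less)
    with nE that show False by blast
   qed
   have dn: "0 < 1 - 2 powr (- q)" using q0 powr_less_mono[of "- q" 0 2] by simp
   have p1: "p < p + 2 ^ r" by simp
   have Jp: "\<bar>J p p (p + 2 ^ r) v\<bar> <= V * len powr \<gamma>" using Jb[OF order_refl p1 blk, of v] by (simp add: len_def)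
   show False
   proof (cases "r = 0")
    case True
    have "V * len powr \<gamma> * 1 < V * len powr \<gamma> * ?A" using V len divide_pos_pos[OF X dn] by (intro mult_strict_left_mono) simp_all
    moreover have "S r v = J p p (p + 2 ^ r) v" using tele[of v] True by simp
    ultimately show ?thesis using v(2) Jp by linarith
   next
    case False
    have "\<bar>S r v\<bar> <= \<bar>J p p (p + 2 ^ r) v\<bar> + (SUM g<r. \<bar>SUM k<2 ^ g. D g k v\<bar>)"
     unfolding tele by (rule order.trans[OF abs_triangle_ineq]) (simp add: sum_abs)
    also have "(SUM g<r. \<bar>SUM k<2 ^ g. D g k v\<bar>) < (SUM g<r. \<Lambda> * 2 powr (- (q * g)))"
     using False by (intro sum_strict_mono lt) auto
    also have "(SUM g<r. \<Lambda> * 2 powr (- (q * g))) = \<Lambda> * (SUM g<r. (2 powr (- q)) ^ g)"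
     unfolding sum_distrib_left by (intro sum.cong refl) (simp add: powr_power mult.commute)
    also have "... <= \<Lambda> * (1 / (1 - 2 powr (- q)))" using geo[OF q0(1)] \<Lambda> by (intro mult_left_mono) auto
    finally have "\<bar>S r v\<bar> < V * len powr \<gamma> + \<Lambda> * (1 / (1 - 2 powr (- q)))" using Jp by linarith
    also have "... = V * len powr \<gamma> * ?A" by (simp add: \<Lambda>_def distrib_left)
    finally show False using v by simp
   qed
  qed
 qed
 have "measure M {v : space M. V * len powr \<gamma> * ?A <= \<bar>S r v\<bar>} <= measure M (UN g<r. ?E g)"
  by (rule finite_measure_mono[OF cover]) (intro sets.finite_UN, simp, rule Em, simp)
 also have "... <= (SUM g<r. measure M (?E g))" by (rule measure_UNION_le) (simp, rule Em, simp)
 also have "... <= (SUM g<r. 2 * 8 ^ P * fact P / X ^ (2 * P) * (2 powr (- 2 * q * P)) ^ g)" by (rule sum_mono) (rule bad, simp)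
 also have "... = 2 * 8 ^ P * fact P / X ^ (2 * P) * (SUM g<r. (2 powr (- (2 * q * P))) ^ g)" by (simp add: sum_distrib_left)
 also have "... <= 2 * 8 ^ P * fact P / X ^ (2 * P) * (1 / (1 - 2 powr (- (2 * q * P))))"
  using geo[of "2 * q * P" r] q0 P X by (intro mult_left_mono) auto
 finally show ?thesis unfolding top V_def len_def \<gamma>_def by (simp add: field_simps)
qed

section \<open>Shifts and averages of standard normal variables\<close>

lemma std_normal_prob: "prob_space std_normal" using real_dist_normal_dist by (simp add: real_distribution_def)

lemma std_normal_UNIV [simp]: "measure std_normal UNIV = 1" "emeasure std_normal UNIV = 1"
 using prob_space.prob_space[OF std_normal_prob] prob_space.emeasure_space_1[OF std_normal_prob] by simp_all

lemma std_normal_product: "product_sigma_finite (%_. std_normal)"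
proof -
 interpret prob_space std_normal by (rule std_normal_prob)
 show ?thesis by unfold_locales
qed

lemma std_normal_density_shift:
 "std_normal_density (z - k) = exp (k * z - k\<^sup>2 / 2) * std_normal_density z"
 by (simp add: normal_density_def exp_add[symmetric] power2_eq_square algebra_simps add_divide_distrib diff_divide_distrib)

lemma nn_integral_std_normal_shift:
 assumes [measurable]: "F : borel_measurable borel"
 shows "(\<integral>\<^sup>+z. F (z + k) \<partial>std_normal) = (\<integral>\<^sup>+z. ennreal (exp (k * z - k\<^sup>2 / 2)) * F z \<partial>std_normal)"
proof -
 have "(\<integral>\<^sup>+z. F (z + k) \<partial>std_normal) = (\<integral>\<^sup>+z. ennreal (std_normal_density ((k + 1 * z) - k)) * F (k + 1 * z) \<partial>lborel)"
  by (subst nn_integral_density) (auto simp: add.commute)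
 also have "... = (\<integral>\<^sup>+z. ennreal (std_normal_density (z - k)) * F z \<partial>lborel)"
  by (subst nn_integral_real_affine[of "%z. ennreal (std_normal_density (z - k)) * F z" 1 k]) auto
 also have "... = (\<integral>\<^sup>+z. ennreal (std_normal_density z) * (ennreal (exp (k * z - k\<^sup>2 / 2)) * F z) \<partial>lborel)"
  by (intro nn_integral_cong) (simp add: std_normal_density_shift ennreal_mult mult_ac)
 also have "... = (\<integral>\<^sup>+z. ennreal (exp (k * z - k\<^sup>2 / 2)) * F z \<partial>std_normal)" by (subst nn_integral_density) auto
 finally show ?thesis .
qed

lemma std_normal_exp:
 "integrable std_normal (%z. exp (k * z))" "(LINT z|std_normal. exp (k * z)) = exp (k^2 / 2)"
proof -
 interpret prob_space std_normal by (rule std_normal_prob)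
 have "(\<integral>\<^sup>+z. ennreal (exp (k * z)) \<partial>std_normal) = (\<integral>\<^sup>+z. ennreal (exp (k^2 / 2)) * (ennreal (exp (k * z - k\<^sup>2 / 2)) * 1) \<partial>std_normal)"
  by (intro nn_integral_cong) (simp add: ennreal_mult[symmetric] exp_add[symmetric])
 also have "... = ennreal (exp (k^2 / 2)) * (\<integral>\<^sup>+z. 1 \<partial>std_normal)"
  by (subst nn_integral_cmult, simp) (subst nn_integral_std_normal_shift[symmetric], auto)
 finally have *: "(\<integral>\<^sup>+z. ennreal (exp (k * z)) \<partial>std_normal) = ennreal (exp (k^2 / 2))" by (simp add: emeasure_space_1)
 show "integrable std_normal (%z. exp (k * z))" by (rule integrableI_nonneg) (use * in auto)
 show "(LINT z|std_normal. exp (k * z)) = exp (k^2 / 2)" by (subst integral_eq_nn_integral) (use * in auto)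
qed

lemma integral_std_normal_shift:
 fixes F :: "real => real"
 assumes [measurable]: "F : borel_measurable borel" and b: "!!z. \<bar>F z\<bar> <= B"
 shows "integrable std_normal (%z. F z * exp (k * z - k\<^sup>2 / 2))" (is ?I)
  "(LINT z|std_normal. F (z + k)) = (LINT z|std_normal. F z * exp (k * z - k\<^sup>2 / 2))" (is ?L)
proof -
 have "(LINT z|std_normal. F (z + k)) = (LBINT z. std_normal_density ((k + 1 * z) - k) *\<^sub>R F (k + 1 * z))"
  by (subst integral_density) (auto simp: add.commute)
 also have "... = (LBINT z. std_normal_density (z - k) *\<^sub>R F z)"
  by (subst lborel_integral_real_affine[of 1 "%z. std_normal_density (z - k) *\<^sub>R F z" k]) auto
 also have "... = (LBINT z. std_normal_density z *\<^sub>R (F z * exp (k * z - k\<^sup>2 / 2)))"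
  by (intro L_integral_cong) (simp_all add: std_normal_density_shift mult_ac)
 also have "... = (LINT z|std_normal. F z * exp (k * z - k\<^sup>2 / 2))" by (subst integral_density) auto
 finally show ?L .
 show ?I
 proof (rule L_integrable_bound)
  show "integrable std_normal (%z. (B * exp (- (k^2 / 2))) * exp (k * z))" by (intro integrable_mult_right std_normal_exp)
  have "\<bar>F z * exp (k * z - k\<^sup>2 / 2)\<bar> <= \<bar>B * exp (- (k^2 / 2)) * exp (k * z)\<bar>" for z
  proof -
   have "\<bar>F z * exp (k * z - k\<^sup>2 / 2)\<bar> <= \<bar>B\<bar> * exp (k * z - k\<^sup>2 / 2)" using b[of z] by (simp add: abs_mult)
   also have "... = \<bar>B * exp (- (k^2 / 2)) * exp (k * z)\<bar>" by (simp add: abs_mult mult.assoc exp_add[symmetric])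
   finally show ?thesis .
  qed
  then show "AE z in std_normal. norm (F z * exp (k * z - k\<^sup>2 / 2)) <= norm (B * exp (- (k^2 / 2)) * exp (k * z))" by simp
 qed simp
qed

text \<open>The densities of the shifts by k and - k have opposite first-order terms, so their sum
  differs from 2 by order k^2. The factor \<open>1 + \<bar>z\<bar>\<close> will absorb a Hoelder
  increment, and the exponentials on the right have explicit Gaussian integrals.\<close>

lemma second_difference_weight_bound:
 fixes k z :: real
 assumes k: "\<bar>k\<bar> <= 1"
 shows "(1 + \<bar>z\<bar>) * \<bar>exp (k * z - k\<^sup>2 / 2) + exp (- k * z - k\<^sup>2 / 2) - 2\<bar> <= k^2 * (3 * (exp (3 * z) + exp (- 3 * z)))"
proof -
 have e1: "exp a + exp (- a) - 2 <= a^2 * exp \<bar>a\<bar>" for a :: real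
 proof -
  have pos: "exp a + exp (- a) - 2 <= a^2 * exp a" if "0 <= a" for a :: real
  proof -
   have "exp (a / 2) - exp (- (a / 2)) = exp (a / 2) * (1 - exp (- a))" by (simp add: right_diff_distrib exp_add[symmetric])
   also have "... <= exp (a / 2) * a" using exp_ge_add_one_self[of "- a"] by (intro mult_left_mono) auto
   finally have "(exp (a / 2) - exp (- (a / 2)))^2 <= (exp (a / 2) * a)^2" using that by (intro power_mono) auto
   then show ?thesis by (simp add: power2_eq_square algebra_simps exp_add[symmetric])
  qed
  show ?thesis using pos[of a] pos[of "- a"] by (cases "0 <= a") auto
 qed
 have nn: "0 <= exp a + exp (- a) - 2" for a :: real
 proof -
  have "0 <= (exp (a / 2) - exp (- (a / 2)))^2" by simp
  then show ?thesis by (simp add: power2_eq_square algebra_simps exp_add[symmetric])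
 qed
 let ?c = "exp (- (k^2 / 2))"
 have c: "0 < ?c" "?c <= 1" "2 * (1 - ?c) <= k^2" using exp_ge_add_one_self[of "- (k^2 / 2)"] by auto
 let ?A = "exp (k * z) + exp (- (k * z)) - 2"
 let ?B = "- k * z - k\<^sup>2 / 2"
 let ?E = "k * z - k\<^sup>2 / 2"
 have split: "exp ?E + exp ?B - 2 = ?c * ?A - 2 * (1 - ?c)"
 proof -
  have "exp ?E = ?c * exp (k * z)" "exp ?B = ?c * exp (- (k * z))" by (simp_all add: exp_add[symmetric])
  then show ?thesis by (simp add: algebra_simps)
 qed
 have k2: "k^2 <= 1" using k by (simp add: abs_square_le_1)
 have "?c * ?A <= 1 * ((k * z)^2 * exp \<bar>k * z\<bar>)" using c e1 nn by (intro mult_mono) auto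
 also have "... <= k^2 * (z^2 * exp \<bar>z\<bar>)"
 proof -
  have "\<bar>k * z\<bar> <= \<bar>z\<bar>" using k by (simp add: abs_mult mult_left_le_one_le)
  then have "(k * z)^2 * exp \<bar>k * z\<bar> <= (k * z)^2 * exp \<bar>z\<bar>" by (intro mult_left_mono) auto
  then show ?thesis by (simp add: power_mult_distrib mult.assoc)
 qed
 finally have p2: "?c * ?A <= k^2 * (z^2 * exp \<bar>z\<bar>)" .
 have p1: "0 <= ?c * ?A" using c nn[of "k * z"] by (intro mult_nonneg_nonneg) auto
 have "\<bar>exp ?E + exp ?B - 2\<bar> <= k^2 * (1 + z^2 * exp \<bar>z\<bar>)"
 proof -
  have gen: "\<bar>p - v\<bar> <= u + w" if "0 <= p" "p <= w" "0 <= v" "v <= u" for p v u w :: real using that by linarith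
  show ?thesis unfolding split distrib_left mult_1_right by (rule gen[OF p1 p2 _ c(3)]) (use c(2) in simp)
 qed
 moreover have "1 + z^2 * exp \<bar>z\<bar> <= 3 * exp (2 * \<bar>z\<bar>)"
 proof -
  have "\<bar>z\<bar>^2 / 2 <= exp \<bar>z\<bar>" using exp_lower_Taylor_quadratic[of "\<bar>z\<bar>"] by simp
  then have "z^2 * exp \<bar>z\<bar> <= (2 * exp \<bar>z\<bar>) * exp \<bar>z\<bar>" by (intro mult_right_mono) auto
  also have "... = 2 * exp (2 * \<bar>z\<bar>)" by (simp flip: exp_add)
  finally show ?thesis using one_le_exp_iff[of "2 * \<bar>z\<bar>"] by linarith
 qed
 ultimately have 1: "\<bar>exp ?E + exp ?B - 2\<bar> <= k^2 * (3 * exp (2 * \<bar>z\<bar>))" by (meson mult_left_mono order_trans zero_le_power2)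
 have "(1 + \<bar>z\<bar>) * \<bar>exp ?E + exp ?B - 2\<bar> <= exp \<bar>z\<bar> * (k^2 * (3 * exp (2 * \<bar>z\<bar>)))"
  using exp_ge_add_one_self[of "\<bar>z\<bar>"] 1 by (intro mult_mono) auto
 also have "... = k^2 * (3 * exp (3 * \<bar>z\<bar>))" by (simp add: mult_ac flip: exp_add)
 also have "... <= k^2 * (3 * (exp (3 * z) + exp (- 3 * z)))" by (intro mult_left_mono) (cases "0 <= z"; simp)+
 finally show ?thesis .
qed

text \<open>The standard normal integral of 3 (exp (3 z) + exp (- 3 z)), both exponentials having
  expectation exp (9/2).\<close>

definition sd_const :: real where "sd_const = 6 * exp (9 / 2)"

lemma sd_const: "2 <= sd_const" using one_le_exp_iff[of "9 / 2 :: real"] unfolding sd_const_def by linarith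

text \<open>Gaussian smoothing at scale \<open>\<sigma>\<close> trades two powers of the step for two powers of \<open>\<sigma>\<close>.\<close>

lemma gaussian_second_difference:
 fixes f :: "real => real"
 assumes [measurable]: "f : borel_measurable borel" and B: "!!x. \<bar>f x\<bar> <= B"
  and f: "!!x y. \<bar>f x - f y\<bar> <= C * \<bar>x - y\<bar> powr \<alpha>" and C: "0 <= C" and \<alpha>: "0 < \<alpha>" "\<alpha> <= 1"
  and \<epsilon>: "0 <= \<epsilon>" "\<epsilon> <= 1" and \<sigma>: "0 < \<sigma>" and h: "0 < h"
 shows "\<bar>LINT z|std_normal. f (x + \<sigma> * z + h) + f (x + \<sigma> * z - h) - 2 * f (x + \<sigma> * z)\<bar>
  <= sd_const * C * h powr (1 + \<epsilon>) * \<sigma> powr (\<alpha> - 1 - \<epsilon>)"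
proof -
 interpret prob_space std_normal by (rule std_normal_prob)
 have fi: "integrable std_normal (%z. f (u + \<sigma> * z))" for u by (rule integrable_const_bound[of _ B]) (use B in auto)
 let ?A = "\<alpha> - 1 - \<epsilon>"
 let ?B = "1 + \<epsilon>"
 show ?thesis
 proof (cases "\<sigma> <= h")
  \<comment> \<open>Smoothing at a scale below the step gains nothing, but the Hoelder bound already
    has the required size.\<close>
  case True
  have le: "h powr \<alpha> <= h powr ?B * \<sigma> powr ?A"
  proof -
   have "h powr \<alpha> = h powr ?B * h powr ?A" by (simp flip: powr_add)
   also have "... <= h powr ?B * \<sigma> powr ?A" using True \<sigma> \<alpha> \<epsilon> by (intro mult_left_mono powr_mono2') auto
   finally show ?thesis .
  qed
  have pt: "\<bar>f (u + h) + f (u - h) - 2 * f u\<bar> <= 2 * C * h powr \<alpha>" for u using f[of "u + h" u] f[of "u - h" u] h by simp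
  have "\<bar>LINT z|std_normal. f (x + \<sigma> * z + h) + f (x + \<sigma> * z - h) - 2 * f (x + \<sigma> * z)\<bar>
    <= (LINT z|std_normal. 2 * C * h powr \<alpha>)"
  proof (rule integral_abs_bound_integral)
   have "integrable std_normal (%z. f (x + \<sigma> * z + h))" "integrable std_normal (%z. f (x + \<sigma> * z - h))"
    using fi[of "x + h"] fi[of "x - h"] by (simp_all add: algebra_simps)
   then show "integrable std_normal (%z. f (x + \<sigma> * z + h) + f (x + \<sigma> * z - h) - 2 * f (x + \<sigma> * z))" using fi[of x] by simp
  qed (use pt in auto)
  also have "... = 2 * (C * h powr \<alpha>)" by (simp add: prob_space)
  also have "... <= sd_const * (C * (h powr ?B * \<sigma> powr ?A))" using sd_const C le by (intro mult_mono mult_left_mono) auto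
  finally show ?thesis by (simp add: mult.assoc)
 next
  case False
  \<comment> \<open>The step is moved from \<open>f\<close> to the Gaussian density, where it
    becomes a shift by h / \<sigma> <= 1. The symmetrised weight \<open>?E\<close> has mean zero,
    which allows \<open>f x\<close> to be subtracted.\<close>
  define k where "k = h / \<sigma>"
  have k: "0 < k" "k <= 1" using False h \<sigma> by (auto simp: k_def)
  let ?g = "%z. f (x + \<sigma> * z)"
  let ?E = "%z. exp (k * z - k\<^sup>2 / 2) + exp (- k * z - k\<^sup>2 / 2) - 2"
  have gk: "?g (z + k) = f (x + \<sigma> * z + h)" "?g (z + - k) = f (x + \<sigma> * z - h)" for z
   using \<sigma> by (simp_all add: k_def algebra_simps)
  have sh: "integrable std_normal (%z. F z * exp (k' * z - k\<^sup>2 / 2))"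
   "(LINT z|std_normal. F (z + k')) = (LINT z|std_normal. F z * exp (k' * z - k\<^sup>2 / 2))"
   if "F : borel_measurable borel" "!!z. \<bar>F z\<bar> <= B'" "k' = k \<or> k' = - k" for F B' k'
   using integral_std_normal_shift[OF that(1,2), of k'] that(3) by auto
  note g1 = sh[of ?g B k] and g2 = sh[of ?g B "- k"]
  note o1 = sh[of "%_. 1" 1 k] and o2 = sh[of "%_. 1" 1 "- k"]
  have one: "(LINT z|std_normal. f x * ?E z) = 0" using o1 o2 by (simp add: prob_space)
  have iE: "integrable std_normal (%z. f x * ?E z)" using o1 o2 by auto
  have igE: "integrable std_normal (%z. ?g z * ?E z)"
  proof -
   have "integrable std_normal (%z. ?g z * exp (k * z - k\<^sup>2 / 2) + ?g z * exp (- k * z - k\<^sup>2 / 2) - 2 * ?g z)" using g1 g2 B fi by auto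
   then show ?thesis by (simp add: algebra_simps)
  qed
  let ?F = "LINT z|std_normal. f (x + \<sigma> * z + h) + f (x + \<sigma> * z - h) - 2 * f (x + \<sigma> * z)"
  have "?F =
    (LINT z|std_normal. ?g (z + k)) + (LINT z|std_normal. ?g (z + - k)) - 2 * (LINT z|std_normal. ?g z)"
   unfolding gk using fi[of "x + h"] fi[of "x - h"] fi[of x] by (simp add: algebra_simps)
  also have "... = (LINT z|std_normal. ?g z * exp (k * z - k\<^sup>2 / 2)) + (LINT z|std_normal. ?g z * exp (- k * z - k\<^sup>2 / 2)) - 2 * (LINT z|std_normal. ?g z)"
   using g1(2) g2(2) B by simp
  also have "... = (LINT z|std_normal. ?g z * exp (k * z - k\<^sup>2 / 2) + ?g z * exp (- k * z - k\<^sup>2 / 2) - 2 * ?g z)"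
   using g1(1) g2(1) B fi by simp
  also have "... = (LINT z|std_normal. ?g z * ?E z)" by (simp add: algebra_simps)
  also have "... = (LINT z|std_normal. (?g z - f x) * ?E z)" using one iE igE by (simp add: left_diff_distrib)
  finally have main: "?F =
    (LINT z|std_normal. (?g z - f x) * ?E z)" .
  have "\<bar>LINT z|std_normal. (?g z - f x) * ?E z\<bar> <= (LINT z|std_normal. C * \<sigma> powr \<alpha> * (k^2 * (3 * (exp (3 * z) + exp (- 3 * z)))))"
  proof (rule integral_abs_bound_integral)
   show "integrable std_normal (%z. (?g z - f x) * ?E z)" using iE igE by (simp add: left_diff_distrib)
   show "integrable std_normal (%z. C * \<sigma> powr \<alpha> * (k^2 * (3 * (exp (3 * z) + exp (- 3 * z)))))"
    using std_normal_exp(1)[of 3] std_normal_exp(1)[of "-3"] by (intro integrable_mult_right) auto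
   fix z :: real
   have "\<bar>?g z - f x\<bar> <= C * \<bar>\<sigma> * z\<bar> powr \<alpha>" using f[of "x + \<sigma> * z" x] by simp
   also have "... = C * \<sigma> powr \<alpha> * \<bar>z\<bar> powr \<alpha>" using \<sigma> by (simp add: abs_mult powr_mult)
   also have "... <= C * \<sigma> powr \<alpha> * (1 + \<bar>z\<bar>)"
   proof (rule mult_left_mono)
    show "\<bar>z\<bar> powr \<alpha> <= 1 + \<bar>z\<bar>"
    proof (cases "\<bar>z\<bar> <= 1")
     case True
     then have "\<bar>z\<bar> powr \<alpha> <= 1" using \<alpha> by (intro powr_le1) auto
     then show ?thesis by simp
    next
     case False
     then have "\<bar>z\<bar> powr \<alpha> <= \<bar>z\<bar> powr 1" using \<alpha> by (intro powr_mono) auto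
     then show ?thesis by simp
    qed
   qed (use C in auto)
   finally have "\<bar>(?g z - f x) * ?E z\<bar> <= C * \<sigma> powr \<alpha> * (1 + \<bar>z\<bar>) * \<bar>?E z\<bar>"
    unfolding abs_mult by (rule mult_right_mono) simp
   also have "... <= C * \<sigma> powr \<alpha> * (k^2 * (3 * (exp (3 * z) + exp (- 3 * z))))"
    unfolding mult.assoc[of "C * \<sigma> powr \<alpha>"] using second_difference_weight_bound[of k z] k C by (intro mult_left_mono) auto
   finally show "\<bar>(?g z - f x) * ?E z\<bar> <= C * \<sigma> powr \<alpha> * (k^2 * (3 * (exp (3 * z) + exp (- 3 * z))))" .
  qed
  also have "... = sd_const * C * (\<sigma> powr \<alpha> * k^2)" using std_normal_exp[of 3] std_normal_exp[of "-3"] by (simp add: sd_const_def)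
  also have "... <= sd_const * C * (h powr ?B * \<sigma> powr ?A)"
  proof (rule mult_left_mono)
   have "k^2 <= k powr ?B" using powr_mono'[of "1 + \<epsilon>" 2 k] k \<epsilon> by (simp add: powr_numeral)
   then have "\<sigma> powr \<alpha> * k^2 <= \<sigma> powr \<alpha> * k powr ?B" by (intro mult_left_mono) auto
   also have "... = h powr ?B * \<sigma> powr ?A" using h \<sigma> by (simp add: k_def powr_divide powr_diff powr_add)
   finally show "\<sigma> powr \<alpha> * k^2 <= h powr ?B * \<sigma> powr ?A" .
  qed (use C sd_const in auto)
  finally show ?thesis unfolding main by (simp add: mult.assoc)
 qed
qed

lemma std_normal_linear_combination:
 assumes B: "finite B"
 shows "distr (gauss B) borel (%z. SUM i:B. a i * z i) = distr std_normal borel (%\<zeta>. sqrt (SUM i:B. (a i)^2) * \<zeta>)"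
proof -
 interpret G: prob_space std_normal by (rule std_normal_prob)
 interpret P: product_sigma_finite "%_. std_normal" by (rule std_normal_product)
 let ?E = "%_. std_normal"
 interpret PB: prob_space "PiM B ?E" by (intro prob_space_PiM std_normal_prob)
 have [measurable]: "(%z. SUM i:B. a i * z i) : borel_measurable (PiM B ?E)" by measurable
 have ch: "(LINT x|std_normal. iexp (v * x)) = of_real (exp (- v\<^sup>2 / 2))" for v
  using fun_cong[OF char_std_normal_distribution, of v] by (simp only: char_def)
 show ?thesis
 proof (rule Levy_uniqueness)
  let ?B = "distr (PiM B ?E) borel (%z. SUM i:B. a i * z i)"
  show "real_distribution ?B" by (rule PB.real_distribution_distr) measurable
  let ?A = "distr std_normal borel (%\<zeta>. sqrt (SUM i:B. (a i)^2) * \<zeta>)"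
  show "real_distribution ?A" by (rule G.real_distribution_distr) measurable
  show "char ?B = char ?A"
  proof
   fix u
   have "char ?B u = (LINT z|PiM B ?E. iexp (u * (SUM i:B. a i * z i)))" unfolding char_def by (rule integral_distr) auto
   also have "... = (LINT z|PiM B ?E. (PROD i:B. iexp ((u * a i) * z i)))"
    using B by (intro L_integral_cong refl) (simp add: exp_sum[symmetric] sum_distrib_left mult_ac)
   also have "... = (PROD i:B. LINT x|std_normal. iexp ((u * a i) * x))"
    by (intro P.product_integral_prod[OF B] G.integrable_const_bound[of _ 1]) auto
   also have "... = (PROD i:B. of_real (exp (- (u * a i)\<^sup>2 / 2)))" by (simp only: ch)
   also have "... = of_real (exp (- (u * sqrt (SUM i:B. (a i)^2))\<^sup>2 / 2))"
    using B by (simp add: exp_sum[symmetric] sum_nonneg power_mult_distrib sum_distrib_left sum_negf sum_divide_distrib flip: of_real_prod)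
   also have "... = (LINT x|std_normal. iexp ((u * sqrt (SUM i:B. (a i)^2)) * x))" by (simp only: ch)
   also have "... = char ?A u" unfolding char_def by (subst integral_distr) (auto simp: mult.assoc)
   finally show "char ?B u = char ?A u" .
  qed
 qed
qed

text \<open>A conditional expectation given the coordinates in \<open>A\<close>, with measurability
  with respect to them expressed as invariance under changes of the others. The linear combination
  of the remaining coordinates is normal and independent of those in \<open>A\<close>, so only its
  standard deviation enters.\<close>

lemma gaussian_freeze:
 fixes Y :: "('i => real) => real" and \<Phi> :: "('i => real) => real => real"
 assumes A: "finite A" and B: "finite B" and AB: "A \<inter> B = {}"
  and Ym: "Y : borel_measurable (gauss (A \<union> B))" and Yb: "!!z. \<bar>Y z\<bar> <= b1"
  and Yd: "!!z z'. (!!i. i : A ==> z i = z' i) ==> Y z = Y z'"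
  and \<Phi>m: "(%(z, x). \<Phi> z x) : borel_measurable (gauss (A \<union> B) \<Otimes>\<^sub>M borel)" and \<Phi>b: "!!z x. \<bar>\<Phi> z x\<bar> <= b2"
  and \<Phi>d: "!!z z'. (!!i. i : A ==> z i = z' i) ==> \<Phi> z = \<Phi> z'"
 shows "(LINT z|gauss (A \<union> B). Y z * \<Phi> z (SUM i:B. a i * z i)) =
  (LINT z|gauss (A \<union> B). Y z * (LINT \<zeta>|std_normal. \<Phi> z (sqrt (SUM i:B. (a i)^2) * \<zeta>)))"
proof -
 interpret G: prob_space std_normal by (rule std_normal_prob)
 interpret P: product_sigma_finite "%_. std_normal" by (rule std_normal_product)
 let ?G = "%I. gauss I"
 interpret PAB: prob_space "?G (A \<union> B)" by (intro prob_space_PiM std_normal_prob)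
 interpret PA: prob_space "?G A" by (intro prob_space_PiM std_normal_prob)
 interpret PB: prob_space "?G B" by (intro prob_space_PiM std_normal_prob)
 note [measurable] = Ym \<Phi>m
 let ?\<sigma> = "sqrt (SUM i:B. (a i)^2)"
 let ?B = "?G (A \<union> B)"
 have [measurable]: "(%z. SUM i:B. a i * z i) : borel_measurable ?B" by measurable
 have \<Phi>1: "(%z. \<Phi> z (SUM i:B. a i * z i)) : borel_measurable ?B"
  using measurable_compose[OF measurable_Pair[OF measurable_ident_sets[OF refl] \<open>(\<lambda>z. \<Sum>i\<in>B. a i * z i) \<in> borel_measurable ?B\<close>] \<Phi>m]
  by simp
 have \<Phi>2: "(%z. LINT \<zeta>|std_normal. \<Phi> z (?\<sigma> * \<zeta>)) : borel_measurable ?B"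
 proof (rule G.borel_measurable_lebesgue_integral)
  have "(%(z, \<zeta>). (z, ?\<sigma> * \<zeta>)) : ?G (A \<union> B) \<Otimes>\<^sub>M std_normal \<rightarrow>\<^sub>M ?G (A \<union> B) \<Otimes>\<^sub>M borel" by measurable
  from measurable_compose[OF this \<Phi>m]
  show "(%(z, \<zeta>). \<Phi> z (?\<sigma> * \<zeta>)) : borel_measurable (?G (A \<union> B) \<Otimes>\<^sub>M std_normal)"
   by (simp add: split_beta')
 qed
 have b12: "0 <= b1" "0 <= b2" using Yb[of undefined] \<Phi>b[of undefined undefined] by linarith+
 have \<Phi>2b: "\<bar>LINT \<zeta>|std_normal. \<Phi> z (?\<sigma> * \<zeta>)\<bar> <= b2" for z
 proof (cases "integrable std_normal (%\<zeta>. \<Phi> z (?\<sigma> * \<zeta>))")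
  case True
  have "\<bar>LINT \<zeta>|std_normal. \<Phi> z (?\<sigma> * \<zeta>)\<bar> <= (LINT \<zeta>|std_normal. b2)"
   by (rule integral_abs_bound_integral) (use True \<Phi>b in auto)
  then show ?thesis by (simp add: G.prob_space)
 next
  case False
  then show ?thesis using b12 by (simp add: not_integrable_integral_eq)
 qed
 have i1: "integrable ?B (%z. Y z * \<Phi> z (SUM i:B. a i * z i))"
  by (rule PAB.integrable_const_bound[of _ "b1 * b2"]) (use Yb \<Phi>b \<Phi>1 b12 in \<open>auto simp: abs_mult intro!: mult_mono\<close>)
 have i2: "integrable ?B (%z. Y z * (LINT \<zeta>|std_normal. \<Phi> z (?\<sigma> * \<zeta>)))"
  by (rule PAB.integrable_const_bound[of _ "b1 * b2"]) (use Yb \<Phi>2b \<Phi>2 b12 in \<open>auto simp: abs_mult intro!: mult_mono\<close>)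
 define y0 where "y0 = (\<lambda>i\<in>B. 0 :: real)"
 have y0: "y0 : space (?G B)" by (simp add: y0_def space_PiM PiE_iff)
 have Yx: "Y (merge A B (x, y)) = Y (merge A B (x, y0))" "\<Phi> (merge A B (x, y)) = \<Phi> (merge A B (x, y0))" for x y
  using AB by (intro Yd \<Phi>d; auto simp: merge_def)+
 have inner: "(LINT y|?G B. Y (merge A B (x, y)) * \<Phi> (merge A B (x, y)) (SUM i:B. a i * merge A B (x, y) i)) =
  (LINT y|?G B. Y (merge A B (x, y)) * (LINT \<zeta>|std_normal. \<Phi> (merge A B (x, y)) (?\<sigma> * \<zeta>)))" if x: "x : space (?G A)" for x
 proof -
  let ?z = "merge A B (x, y0)"
  have zs: "?z : space ?B" using x y0 by (auto simp: space_PiM merge_def PiE_iff extensional_def)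
  have m: "\<Phi> ?z : borel_measurable borel" using measurable_compose[OF measurable_Pair1'[OF zs] \<Phi>m] by simp
  have s: "(SUM i:B. a i * merge A B (x, y) i) = (SUM i:B. a i * y i)" for y using AB by (intro sum.cong) (auto simp: merge_def)
  let ?A = "LINT \<zeta>|std_normal. \<Phi> ?z (?\<sigma> * \<zeta>)"
  have "(LINT y|?G B. \<Phi> ?z (SUM i:B. a i * y i)) = (LINT t|distr (?G B) borel (%y. SUM i:B. a i * y i). \<Phi> ?z t)"
   by (rule integral_distr[symmetric]) (use m in auto)
  also have "... = ?A" unfolding std_normal_linear_combination[OF B] by (rule integral_distr) (use m in auto)
  finally have E: "(LINT y|?G B. \<Phi> ?z (SUM i:B. a i * y i)) = ?A" .
  have "(LINT y|?G B. Y (merge A B (x, y)) * \<Phi> (merge A B (x, y)) (SUM i:B. a i * merge A B (x, y) i)) =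
    (LINT y|?G B. Y ?z * \<Phi> ?z (SUM i:B. a i * y i))"
  proof (rule L_integral_cong[OF refl])
   fix y
   show "Y (merge A B (x, y)) * \<Phi> (merge A B (x, y)) (SUM i:B. a i * merge A B (x, y) i) = Y ?z * \<Phi> ?z (SUM i:B. a i * y i)"
    using Yx[of x y] s[of y] by (simp only:)
  qed
  also have "... = (LINT y|?G B. Y ?z * ?A)"  using PB.prob_space by (simp add: E)
  also have "... = (LINT y|?G B. Y (merge A B (x, y)) * (LINT \<zeta>|std_normal. \<Phi> (merge A B (x, y)) (?\<sigma> * \<zeta>)))"
  proof (rule L_integral_cong[OF refl])
   fix y
   show "Y ?z * ?A = Y (merge A B (x, y)) * (LINT \<zeta>|std_normal. \<Phi> (merge A B (x, y)) (?\<sigma> * \<zeta>))"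
    using Yx[of x y] by (simp only:)
  qed
  finally show ?thesis .
 qed
 show ?thesis unfolding P.product_integral_fold[OF AB A B i1] P.product_integral_fold[OF AB A B i2] by (rule L_integral_cong[OF refl]) (rule inner)
qed

definition sd :: "(real ^ 'n => real) => 'n => real => real ^ 'n => real" where
 "sd g j h x = g (x + axis j h) + g (x - axis j h) - 2 * g x"

lemma axis_add: "axis j (a + b) = axis j a + (axis j b :: real ^ 'n)" by (simp add: axis_def vec_eq_iff)

lemma axis_diff: "axis j (a - b) = axis j a - (axis j b :: real ^ 'n)" by (simp add: axis_def vec_eq_iff)

lemma axis_zero: "axis j 0 = (0 :: real ^ 'n)" by (simp add: axis_def vec_eq_iff)

lemma norm_axis_real: "norm (axis j a :: real ^ 'n) = \<bar>a\<bar>"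
 by (simp add: norm_vec_def L2_set_def axis_def if_distrib[of "%x. x^2"] cong: if_cong)

lemma borel_measurable_vec_lambda:
 assumes "!!k. (%z. f z k) : borel_measurable M"
 shows "(%z. (\<chi> k. f z k) :: real ^ 'n) : borel_measurable M" unfolding borel_measurable_euclidean_space[of "%z. \<chi> k. f z k"]
 using assms by (auto simp: Basis_vec_def inner_axis)

lemma sd_measurable [measurable]:
 assumes [measurable]: "g : borel_measurable borel" shows "sd g j h : borel_measurable borel" unfolding sd_def by measurable

text \<open>\<open>dyadic_sewing_tail\<close> for conditional expectations of second differences.
  Freezing at \<open>s\<close> leaves a Gaussian of standard deviation at least of order ((i - s) /
  N)^H, and \<open>gaussian_second_difference\<close> yields the power - \<theta> of (i - s) / N.
  For i = s nothing is averaged, and the plain Hoelder bound is combined with \<open>hN\<close>,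
  which says that the step is not finer than the noise over one time step.\<close>

lemma sd_block_tail:
 fixes g :: "real ^ 'n => real" and b :: "nat => nat => real"
 assumes gm [measurable]: "g : borel_measurable borel" and gB: "!!x. \<bar>g x\<bar> <= B"
  and gh: "!!x y. \<bar>g x - g y\<bar> <= C * norm (x - y) powr \<alpha>" and C: "0 < C" and \<alpha>: "0 < \<alpha>" "\<alpha> <= 1"
  and \<epsilon>: "0 <= \<epsilon>" "\<epsilon> <= 1" and h: "0 < h" and H: "0 < H" and \<theta>: "\<theta> = H * (1 + \<epsilon> - \<alpha>)" "\<theta> < 1/2"
  and bz: "!!i l. i < N ==> i <= l ==> b i l = 0" and c0: "0 < c0"
  and nd: "!!i s. i < N ==> s < i ==> c0 * (real (i - s) / real N) powr (2 * H) <= (SUM l = s..<N. (b i l)^2)"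
  and hN: "h powr (- (1 + \<epsilon> - \<alpha>)) <= real N powr \<theta>"
  and blk: "p + 2 ^ r <= N" and X: "0 < X" and P: "0 < (P :: nat)" and q: "q = (1 - 2 * \<theta>) / 4"
  and U: "U = C * h powr (1 + \<epsilon>) * (2 + sd_const * c0 powr (- ((1 + \<epsilon> - \<alpha>) / 2)))"
 shows "measure (gauss ({..<N} \<times> UNIV)) {z : space (gauss ({..<N} \<times> UNIV)).
   3 * U * (2 ^ r / real N) powr (1 - \<theta>) * (1 + X / (1 - 2 powr (- q)))
   <= \<bar>(SUM i = p..<p + 2 ^ r. sd g j h (y + (\<chi> k. SUM l<N. b i l * z (l, k)))) / real N\<bar>}
  <= 2 * 8 ^ P * fact P / (1 - 2 powr (- 2 * q * P)) / X ^ (2 * P)"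
proof -
 define I where "I = {..<N} \<times> (UNIV :: 'n set)"
 let ?G = "gauss I"
 interpret G: prob_space ?G by (intro prob_space_PiM std_normal_prob)
 interpret S: prob_space std_normal by (rule std_normal_prob)
 define \<kappa> where "\<kappa> = 1 + \<epsilon> - \<alpha>"
 have \<kappa>: "0 <= \<kappa>" using \<epsilon> \<alpha> by (simp add: \<kappa>_def)
 have \<theta>0: "0 <= \<theta>" using \<theta> \<kappa> H by (simp add: \<kappa>_def)
 have finI: "finite I" by (simp add: I_def)
 have N: "0 < N" using blk by (cases N) auto
 define \<sigma> where "\<sigma> s i = sqrt (SUM l = s..<N. (b i l)^2)" for s i
 define u :: "nat => nat => (nat \<times> 'n => real) => real ^ 'n"
  where "u s i z = (\<chi> k. SUM l<N. if k = j & s <= l then 0 else b i l * z (l, k))" for s i z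
 define \<Phi> where "\<Phi> s i z x = sd g j h (y + u s i z + axis j x)" for s i z x
 define A where "A s i z = (LINT \<zeta>|std_normal. \<Phi> s i z (\<sigma> s i * \<zeta>))" for s i z
 \<comment> \<open>Only component \<open>j\<close> of the innovations from \<open>s\<close> on is
   averaged, because the second difference is in direction \<open>j\<close>. The other components
   count as known at all times.\<close>
 define As where "As s = I - {s..<N} \<times> {j}" for s
 define ad where "ad s Y \<longleftrightarrow> Y : borel_measurable ?G & (ALL z z'. (ALL i:As s. z i = z' i) --> Y z = Y z')" for s and Y :: "(nat \<times> 'n => real) => real"
 have sdh: "\<bar>sd g j h x\<bar> <= 2 * C * h powr \<alpha>" for x
  using gh[of "x + axis j h" x] gh[of "x - axis j h" x] h by (simp add: sd_def norm_axis_real norm_minus_commute)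
 have um: "u s i : borel_measurable ?G" for s i
 proof -
  have "(%z. SUM l<N. if k = j & s <= l then 0 else b i l * z (l, k)) : borel_measurable ?G" for k
   by (intro borel_measurable_sum) (auto simp: I_def)
  then show ?thesis unfolding u_def by (intro borel_measurable_vec_lambda)
 qed
 have \<Phi>m: "(%(z, x). \<Phi> s i z x) : borel_measurable (?G \<Otimes>\<^sub>M borel)" for s i
 proof -
  note [measurable] = um
  have [measurable]: "(%x. axis j x :: real ^ 'n) : borel_measurable borel"
   by (intro borel_measurable_continuous_onI linear_continuous_on linear_linear[THEN iffD2] linearI)
    (auto simp: axis_add, simp add: axis_def vec_eq_iff)
  show ?thesis unfolding \<Phi>_def by measurable
 qed
 have \<Phi>b: "\<bar>\<Phi> s i z x\<bar> <= 2 * C * h powr \<alpha>" for s i z x unfolding \<Phi>_def by (rule sdh)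
 have ud: "u s i z = u s i z'" if "!!k. k : As s ==> z k = z' k" for s i z z'
  unfolding u_def vec_eq_iff vec_lambda_beta by (intro allI sum.cong refl) (auto intro!: that simp: As_def I_def)
 have adA: "ad s (A s i)" for s i
 proof -
  have "A s i : borel_measurable ?G" unfolding A_def
  proof (rule S.borel_measurable_lebesgue_integral)
   have "(%(z, \<zeta>). (z, \<sigma> s i * \<zeta>)) : ?G \<Otimes>\<^sub>M std_normal \<rightarrow>\<^sub>M ?G \<Otimes>\<^sub>M borel" by measurable
   from measurable_compose[OF this \<Phi>m[of s i]]
   show "(%(z, \<zeta>). \<Phi> s i z (\<sigma> s i * \<zeta>)) : borel_measurable (?G \<Otimes>\<^sub>M std_normal)" by (simp add: split_beta')
  qed
  moreover have "A s i z = A s i z'" if "ALL k:As s. z k = z' k" for z z' using ud[of s z z' i] that by (simp add: A_def \<Phi>_def)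
  ultimately show ?thesis unfolding ad_def by blast
 qed
 define F where "F i z = sd g j h (y + (\<chi> k. SUM l<N. b i l * z (l, k)))" for i z
 have freeze: "(LINT z|?G. Y z * A s i z) = (LINT z|?G. Y z * F i z)" if Y: "ad s Y" "!!z. \<bar>Y z\<bar> <= B'" for s i Y B'
 proof -
  have "{s..<N} \<times> {j} = (%l. (l, j)) ` {s..<N}" by auto
  then have sline: "sum f ({s..<N} \<times> {j}) = (SUM l = s..<N. f (l, j))" for f :: "nat \<times> 'n => real"
   by (simp add: sum.reindex inj_on_def)
  have AB: "As s \<union> ({s..<N} \<times> {j}) = I" by (auto simp: As_def I_def)
  have "(LINT z|gauss (As s \<union> ({s..<N} \<times> {j})). Y z * \<Phi> s i z (SUM k:{s..<N} \<times> {j}. b i (fst k) * z k)) =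
   (LINT z|gauss (As s \<union> ({s..<N} \<times> {j})). Y z * (LINT \<zeta>|std_normal. \<Phi> s i z (sqrt (SUM k:{s..<N} \<times> {j}. (b i (fst k))^2) * \<zeta>)))"
  proof (rule gaussian_freeze)
   show "finite (As s)" by (simp add: As_def finI)
   show "As s \<inter> {s..<N} \<times> {j} = {}" by (auto simp: As_def)
   show "Y : borel_measurable (gauss (As s \<union> {s..<N} \<times> {j}))" unfolding AB using Y by (simp add: ad_def)
   show "(%(z, x). \<Phi> s i z x) : borel_measurable (gauss (As s \<union> {s..<N} \<times> {j}) \<Otimes>\<^sub>M borel)"
    unfolding AB by (rule \<Phi>m)
   show "Y z = Y z'" if "!!i. i : As s ==> z i = z' i" for z z' using Y(1) that unfolding ad_def by blast
   show "\<Phi> s i z = \<Phi> s i z'" if "!!i. i : As s ==> z i = z' i" for z z' using ud[of s z z' i] that by (auto simp: \<Phi>_def)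
  qed (use Y \<Phi>b in auto)
  moreover have "\<Phi> s i z (SUM k:{s..<N} \<times> {j}. b i (fst k) * z k) = F i z" for z
  proof -
   have 1: "(SUM k:{s..<N} \<times> {j}. b i (fst k) * z k) = (SUM l = s..<N. b i l * z (l, j))" by (simp add: sline)
   have "u s i z + axis j (SUM l = s..<N. b i l * z (l, j)) = (\<chi> k. SUM l<N. b i l * z (l, k))"
   proof (subst vec_eq_iff, intro allI)
    fix k
    have "(SUM l<N. if s <= l then 0 else b i l * z (l, j)) + (SUM l = s..<N. b i l * z (l, j)) = (SUM l<N. b i l * z (l, j))"
    proof -
     have "(SUM l = s..<N. b i l * z (l, j)) = (SUM l<N. if s <= l then b i l * z (l, j) else 0)" by (rule sum.mono_neutral_cong_left) auto
     then show ?thesis by (simp add: sum.distrib[symmetric] if_distrib cong: if_cong)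
    qed
    then show "(u s i z + axis j (SUM l = s..<N. b i l * z (l, j))) $ k = (\<chi> k. SUM l<N. b i l * z (l, k)) $ k"
     by (cases "k = j") (auto simp: u_def axis_def)
   qed
   then show ?thesis unfolding 1 \<Phi>_def F_def by (simp add: add.assoc)
  qed
  moreover have "(SUM k:{s..<N} \<times> {j}. (b i (fst k))^2) = (SUM l = s..<N. (b i l)^2)" by (simp add: sline)
  ultimately show ?thesis unfolding AB A_def \<sigma>_def by simp
 qed
 have Asm: "As s \<subseteq> As s'" if "s <= s'" for s s' using that by (auto simp: As_def)
 have ad_mono: "ad s' Y" if "s <= s'" "ad s Y" for s s' Y using Asm[OF that(1)] that(2) unfolding ad_def by blast
 have U0: "0 < U" using C h sd_const c0 by (simp add: U add_pos_nonneg)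
 have AF: "A i i z = F i z" if "i < N" for i z
 proof -
  have "(SUM l = i..<N. (b i l)^2) = 0" using bz[OF that] by (intro sum.neutral) auto
  then have "\<sigma> i i = 0" by (simp add: \<sigma>_def)
  moreover have "u i i z = (\<chi> k. SUM l<N. b i l * z (l, k))"
   unfolding u_def vec_eq_iff vec_lambda_beta using bz[OF that] by (intro allI sum.cong refl) auto
  ultimately show ?thesis by (simp add: A_def \<Phi>_def F_def axis_zero)
 qed
 have hs: "h powr \<alpha> = h powr (1 + \<epsilon>) * h powr (- \<kappa>)" by (simp add: \<kappa>_def flip: powr_add)
 have bA: "\<bar>A s i z\<bar> <= U * (real (max 1 (i - s)) / real N) powr (- \<theta>)" if "s <= i" "i < N" for s i z
 proof (cases "s = i")
  case True
  have "\<bar>A s i z\<bar> <= 2 * C * h powr \<alpha>" unfolding True AF[OF that(2)] F_def by (rule sdh)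
  also have "... <= C * h powr (1 + \<epsilon>) * 2 * real N powr \<theta>" unfolding hs using hN C by (simp add: \<kappa>_def mult_left_mono)
  also have "... <= U * real N powr \<theta>" unfolding U using C sd_const c0 by (intro mult_right_mono mult_left_mono) auto
  finally show ?thesis using True N by (simp add: powr_divide powr_minus)
 next
  case False
  then have si: "s < i" using that by simp
  define t where "t = real (i - s) / real N"
  have t: "0 < t" using si N by (simp add: t_def)
  have s2: "c0 * t powr (2 * H) <= (SUM l = s..<N. (b i l)^2)" unfolding t_def by (rule nd[OF that(2) si])
  have low: "sqrt c0 * t powr H <= \<sigma> s i"
  proof -
   have "sqrt (c0 * t powr (2 * H)) <= \<sigma> s i" unfolding \<sigma>_def by (rule real_sqrt_le_mono[OF s2])
   moreover have "sqrt (t powr (2 * H)) = t powr H" by (rule real_sqrt_unique) (simp_all add: power2_eq_square flip: powr_add)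
   ultimately show ?thesis by (simp add: real_sqrt_mult)
  qed
  have pos: "0 < sqrt c0 * t powr H" using c0 t by simp
  let ?f = "%x. g (y + u s i z + axis j x)"
  have eq: "\<Phi> s i z (\<sigma> s i * \<zeta>) = ?f (0 + \<sigma> s i * \<zeta> + h) + ?f (0 + \<sigma> s i * \<zeta> - h) - 2 * ?f (0 + \<sigma> s i * \<zeta>)" for \<zeta>
   by (simp add: \<Phi>_def sd_def axis_add axis_diff add.assoc add_diff_eq)
  have "\<bar>A s i z\<bar> <= sd_const * C * h powr (1 + \<epsilon>) * \<sigma> s i powr (\<alpha> - 1 - \<epsilon>)" unfolding A_def eq
  proof (rule gaussian_second_difference)
   have "continuous_on UNIV (%x. axis j x :: real ^ 'n)" by (intro linear_continuous_on linear_linear[THEN iffD2] linearI)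
     (auto simp: axis_add, simp add: axis_def vec_eq_iff)
   then have [measurable]: "(%x. axis j x :: real ^ 'n) : borel_measurable borel" by (rule borel_measurable_continuous_onI)
   show "?f : borel_measurable borel" by measurable
   show "\<bar>?f v - ?f w\<bar> <= C * \<bar>v - w\<bar> powr \<alpha>" for v w using gh[of "y + u s i z + axis j v" "y + u s i z + axis j w"]
    by (simp add: norm_axis_real flip: axis_diff)
  qed (use gB C \<alpha> \<epsilon> h pos low in auto)
  also have "\<alpha> - 1 - \<epsilon> = - \<kappa>" by (simp add: \<kappa>_def)
  also have "\<sigma> s i powr (- \<kappa>) <= (sqrt c0 * t powr H) powr (- \<kappa>)" using pos low \<kappa> by (intro powr_mono2') auto
  also have "(sqrt c0 * t powr H) powr (- \<kappa>) = c0 powr (- (\<kappa> / 2)) * t powr (- \<theta>)"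
   using c0 t by (simp add: powr_mult powr_powr powr_half_sqrt[symmetric] \<theta>(1) \<kappa>_def[symmetric])
  finally have "\<bar>A s i z\<bar> <= sd_const * C * h powr (1 + \<epsilon>) * (c0 powr (- (\<kappa> / 2)) * t powr (- \<theta>))"
   using sd_const C by (simp add: mult_left_mono)
  also have "... = C * h powr (1 + \<epsilon>) * (sd_const * c0 powr (- (\<kappa> / 2))) * t powr (- \<theta>)" by (simp add: mult_ac)
  also have "... <= U * t powr (- \<theta>)" unfolding U \<kappa>_def using C by (intro mult_right_mono mult_left_mono) auto
  finally have "\<bar>A s i z\<bar> <= U * t powr (- \<theta>)" .
  moreover have "max 1 (i - s) = i - s" using si by simp
  ultimately show ?thesis by (simp only: t_def)
 qed
 have "measure ?G {z : space ?G. 3 * U * (2 ^ r / real N) powr (1 - \<theta>) * (1 + X / (1 - 2 powr (- q)))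
   <= \<bar>(SUM i = p..<p + 2 ^ r. A i i z) / real N\<bar>} <= 2 * 8 ^ P * fact P / (1 - 2 powr (- 2 * q * P)) / X ^ (2 * P)"
 proof (rule dyadic_sewing_tail[where ad = ad and A = A])
  show "prob_space ?G" by (rule G.prob_space_axioms)
  show "Y : borel_measurable ?G" if "ad s Y" for s Y using that by (simp add: ad_def)
  show "ad s' Y" if "s <= s'" "ad s Y" for s s' Y by (rule ad_mono[OF that])
  show "ad s (%ww. SUM k:K. c * Y k ww)" if "finite K" "!!k :: nat. k : K ==> ad s (Y k)" for s c K Y
  proof -
   have "(%ww. SUM k:K. c * Y k ww) : borel_measurable ?G" using that(2) by (intro borel_measurable_sum borel_measurable_times) (auto simp: ad_def)
   moreover have "(SUM k:K. c * Y k z) = (SUM k:K. c * Y k z')" if "ALL i:As s. z i = z' i" for z z'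
   proof (rule sum.cong[OF refl])
    fix k assume "k : K"
    then have "ad s (Y k)" by fact
    then have "Y k z = Y k z'" using that unfolding ad_def by blast
    then show "c * Y k z = c * Y k z'" by simp
   qed
   ultimately show ?thesis unfolding ad_def by blast
  qed
  show "ad s (%ww. Y ww - Z ww)" if "ad s Y" "ad s Z" for s Y Z
  proof -
   have "Y z - Z z = Y z' - Z z'" if "ALL i:As s. z i = z' i" for z z'
    using that \<open>ad s Y\<close> \<open>ad s Z\<close> unfolding ad_def by metis
   moreover have "(%ww. Y ww - Z ww) : borel_measurable ?G"
    using \<open>ad s Y\<close> \<open>ad s Z\<close> by (intro borel_measurable_diff) (auto simp: ad_def)
   ultimately show ?thesis unfolding ad_def by blast
  qed
  show "ad s (%ww. exp (Y ww))" if "ad s Y" for s Y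
  proof -
   have "exp (Y z) = exp (Y z')" if "ALL i:As s. z i = z' i" for z z' using that \<open>ad s Y\<close> unfolding ad_def by metis
   then show ?thesis using that by (simp add: ad_def)
  qed
  show "(LINT ww|?G. Y ww * A s' i ww) = (LINT ww|?G. Y ww * A s i ww)" if "s <= s'" "i < N" "ad s Y" "!!ww. \<bar>Y ww\<bar> <= B'" for s s' i Y B'
   using freeze[OF that(3,4)] freeze[OF ad_mono[OF that(1,3)] that(4)] by simp
 qed (use adA bA \<theta>0 \<theta> U0 blk X P q in auto)
 moreover have "(SUM i = p..<p + 2 ^ r. A i i z) = (SUM i = p..<p + 2 ^ r. F i z)" for z by (intro sum.cong refl AF) (use blk in auto)
 ultimately show ?thesis unfolding F_def I_def by simp
qed

section \<open>Triangular perturbations of Gaussian vectors\<close>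

text \<open>The density of the shift by k has second moment exp (k^2).\<close>

lemma nn_integral_shift_cauchy_schwarz:
 assumes [measurable]: "F : borel_measurable borel"
 shows "(\<integral>\<^sup>+y. F (y + k) \<partial>std_normal)^2 <= ennreal (exp (k^2)) * (\<integral>\<^sup>+y. (F y)^2 \<partial>std_normal)"
proof -
 let ?A = "\<integral>\<^sup>+y. (ennreal (exp (k * y - k\<^sup>2 / 2)))^2 \<partial>std_normal"
 have "(\<integral>\<^sup>+y. F (y + k) \<partial>std_normal)^2 = (\<integral>\<^sup>+y. ennreal (exp (k * y - k\<^sup>2 / 2)) * F y \<partial>std_normal)^2"
  by (subst nn_integral_std_normal_shift) auto
 also have "... <= ?A * (\<integral>\<^sup>+y. (F y)^2 \<partial>std_normal)" by (rule Cauchy_Schwarz_nn_integral) auto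
 also have "?A = (\<integral>\<^sup>+y. ennreal (exp (- k\<^sup>2)) * ennreal (exp ((2 * k) * y)) \<partial>std_normal)"
  by (intro nn_integral_cong) (simp add: power2_eq_square ennreal_mult[symmetric] exp_add[symmetric] algebra_simps)
 also have "... = ennreal (exp (- k\<^sup>2)) * (\<integral>\<^sup>+y. ennreal (exp ((2 * k) * y)) \<partial>std_normal)"
  by (rule nn_integral_cmult) auto
 also have "(\<integral>\<^sup>+y. ennreal (exp ((2 * k) * y)) \<partial>std_normal) = ennreal (exp ((2 * k)^2 / 2))"
  using std_normal_exp[of "2 * k"] by (subst nn_integral_eq_integral) auto
 also have "ennreal (exp (- k\<^sup>2)) * ennreal (exp ((2 * k)^2 / 2)) = ennreal (exp (k^2))"
  by (simp add: ennreal_mult[symmetric] exp_add[symmetric] power_mult_distrib)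
 finally show ?thesis .
qed

text \<open>A Girsanov-type bound for triangular perturbations of a Gaussian vector. The rank \<open>r\<close> plays
 the role of time, and one coordinate of maximal rank is integrated out at a time.\<close>

lemma triangular_shift:
 fixes v :: "'i => ('i => real) => real" and r :: "'i => nat"
 assumes "finite I"
  and "!!i. i : I ==> v i : borel_measurable (gauss I)"
  and "!!i z z'. i : I ==> (!!k. k : I ==> r k < r i ==> z k = z' k) ==> v i z = v i z'"
 shows "EX T : gauss I \<rightarrow>\<^sub>M gauss I.
  (ALL z : space (gauss I). ALL i:I. T z i = z i + v i (T z)) &
  (ALL F : borel_measurable (gauss I).
   (\<integral>\<^sup>+z. F (T z) \<partial>gauss I)^2
    <= (\<integral>\<^sup>+z. (F z)^2 * ennreal (exp (SUM i:I. (v i z)^2)) \<partial>gauss I))" using assms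
proof (induction "card I" arbitrary: I)
 case 0
 have I: "I = {}" using 0(1) 0(2) by simp
 interpret P: prob_space "PiM {} (%_ :: 'i. std_normal)" by (intro prob_space_PiM std_normal_prob)
 show ?case unfolding I
 proof (intro bexI[of _ "%z. z"] conjI ballI)
  fix F :: "('i => real) => ennreal"
  show "(\<integral>\<^sup>+z. F z \<partial>PiM {} (%_. std_normal))^2 <= (\<integral>\<^sup>+z. (F z)^2 * ennreal (exp (SUM i:{}. (v i z)^2)) \<partial>PiM {} (%_. std_normal))"
  proof -
   have e: "(\<integral>\<^sup>+z. F' z \<partial>PiM {} (%_. std_normal)) = F' (%_. undefined)" for F' :: "('i => real) => ennreal"
    by (simp only: PiM_empty) (subst nn_integral_count_space_finite, simp, simp)
   show ?thesis by (simp only: e) simp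
  qed
 qed auto
next
 case (Suc n)
 let ?G = "%I. gauss I"
 interpret N: prob_space std_normal by (rule std_normal_prob)
 interpret P: product_sigma_finite "%_ :: 'i. std_normal" by (rule std_normal_product)
 note fin = Suc.prems(1)
 have ne: "I ~= {}" using Suc.hyps(2) by auto
 have "Max (r ` I) : r ` I" using fin ne by (intro Max_in) auto
 then obtain i0 where i0: "i0 : I" "r i0 = Max (r ` I)" by auto
 have mx: "r k <= r i0" if "k : I" for k using fin that i0 by simp
 define J where "J = I - {i0}"
 have J: "finite J" "i0 ~: J" "insert i0 J = I" "card J = n" using fin i0 Suc.hyps(2) by (auto simp: J_def)
 \<comment> \<open>No perturbation depends on a coordinate of maximal rank, so given the others this
   coordinate is shifted by a constant.\<close>
 have upd: "v i z = v i (z(i0 := y))" if "i : I" for i z y by (rule Suc.prems(3)[OF that]) (use mx[OF that] in auto)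
 have vJ: "v i : borel_measurable (?G J)" if "i : I" for i
 proof -
  have "(%z. z(i0 := 0)) : ?G J \<rightarrow>\<^sub>M ?G I"
  proof -
   have "(%z. z(i0 := 0)) : ?G J \<rightarrow>\<^sub>M ?G (insert i0 J)" by (rule measurable_fun_upd[of "insert i0 J" J]) auto
   then show ?thesis using J by simp
  qed
  from measurable_compose[OF this Suc.prems(2)[OF that]] have "(%z. v i (z(i0 := 0))) : borel_measurable (?G J)" .
  then show ?thesis by (simp flip: upd[OF that])
 qed
 have "EX T : ?G J \<rightarrow>\<^sub>M ?G J. (ALL z : space (?G J). ALL i:J. T z i = z i + v i (T z)) &
  (ALL F : borel_measurable (?G J). (\<integral>\<^sup>+z. F (T z) \<partial>?G J)^2 <= (\<integral>\<^sup>+z. (F z)^2 * ennreal (exp (SUM i:J. (v i z)^2)) \<partial>?G J))"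
 proof (rule Suc.hyps(1))
  show "n = card J" using J by simp
  show "v i : borel_measurable (?G J)" if "i : J" for i using vJ that by (auto simp: J_def)
  fix i and z z' :: "'i => real" assume i: "i : J" and zz: "!!k. k : J ==> r k < r i ==> z k = z' k"
  show "v i z = v i z'"
  proof (rule Suc.prems(3))
   show "i : I" using i by (simp add: J_def)
   fix k assume k: "k : I" "r k < r i"
   have "k ~= i0" using k mx[of i] i by (auto simp: J_def)
   then show "z k = z' k" using zz k by (auto simp: J_def)
  qed
 qed (use J in auto)
 then obtain T' where T'm [measurable]: "T' : ?G J \<rightarrow>\<^sub>M ?G J"
  and T'e: "!!z i. z : space (?G J) ==> i : J ==> T' z i = z i + v i (T' z)"
  and T'F: "!!F. F : borel_measurable (?G J) ==> (\<integral>\<^sup>+z. F (T' z) \<partial>?G J)^2 <= (\<integral>\<^sup>+z. (F z)^2 * ennreal (exp (SUM i:J. (v i z)^2)) \<partial>?G J)"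
  by blast
 define T where "T z = (T' (restrict z J))(i0 := z i0 + v i0 (T' (restrict z J)))" for z
 have rm [measurable]: "(%z. restrict z J) : ?G I \<rightarrow>\<^sub>M ?G J" by (rule measurable_restrict_subset) (simp add: J_def subset_iff)
 have [measurable]: "v i0 : borel_measurable (?G J)" by (rule vJ[OF i0(1)])
 have Tm: "T : ?G I \<rightarrow>\<^sub>M ?G I"
 proof -
  have "(%z. (T' (restrict z J))(i0 := z i0 + v i0 (T' (restrict z J)))) : ?G I \<rightarrow>\<^sub>M ?G (insert i0 J)"
  proof (rule measurable_fun_upd[of "insert i0 J" J])
   show "(%z. T' (restrict z J)) : ?G I \<rightarrow>\<^sub>M ?G J" by measurable
   have "(%z. z i0) : borel_measurable (?G I)" using i0 by measurable
   then show "(%z. z i0 + v i0 (T' (restrict z J))) : ?G I \<rightarrow>\<^sub>M std_normal" by simp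
  qed simp
  then show ?thesis using J by (simp add: T_def[abs_def])
 qed
 have Te: "T z i = z i + v i (T z)" if z: "z : space (?G I)" and i: "i : I" for z i
 proof -
  have zJ: "restrict z J : space (?G J)" using measurable_space[OF rm z] .
  have vT: "v i (T z) = v i (T' (restrict z J))" unfolding T_def by (rule upd[OF i, symmetric])
  show ?thesis
  proof (cases "i = i0")
   case True then show ?thesis using vT by (simp add: T_def)
  next
   case False
   then have "i : J" using i by (simp add: J_def)
   then show ?thesis using T'e[OF zJ, of i] vT False by (simp add: T_def)
  qed
 qed
 have TF: "(\<integral>\<^sup>+z. F (T z) \<partial>?G I)^2 <= (\<integral>\<^sup>+z. (F z)^2 * ennreal (exp (SUM i:I. (v i z)^2)) \<partial>?G I)"
  if F [measurable]: "F : borel_measurable (?G I)" for F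
 proof -
  have vI [measurable]: "v i : borel_measurable (?G I)" if "i : I" for i using Suc.prems(2) that .
  let ?A = "?G J \<Otimes>\<^sub>M std_normal"
  have jm: "(%(x, y). x(i0 := f x y)) : ?G J \<Otimes>\<^sub>M std_normal \<rightarrow>\<^sub>M ?G I"
   if [measurable]: "(%(x, y). f x y) : borel_measurable ?A" for f
  proof -
   have "(%p. (fst p)(i0 := f (fst p) (snd p))) : ?G J \<Otimes>\<^sub>M std_normal \<rightarrow>\<^sub>M ?G (insert i0 J)"
   proof (rule measurable_fun_upd[of "insert i0 J" J])
    show "(%p. f (fst p) (snd p)) : ?G J \<Otimes>\<^sub>M std_normal \<rightarrow>\<^sub>M std_normal" using that by (simp add: split_beta')
   qed auto
   then show ?thesis using J by (simp add: split_beta')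
  qed
  define F' where "F' a = (\<integral>\<^sup>+y. F (a(i0 := y + v i0 a)) \<partial>std_normal)" for a
  have F'm [measurable]: "F' : borel_measurable (?G J)" unfolding F'_def
  proof (rule N.borel_measurable_nn_integral)
   have "(%(a, y). y + v i0 a) : borel_measurable ?A" by measurable
   from measurable_compose[OF jm[OF this] F]
   show "(%(a, y). F (a(i0 := y + v i0 a))) : borel_measurable ?A" by (simp add: split_beta')
  qed
  have Fa: "(%y. F (a(i0 := y))) : borel_measurable borel" if a: "a : space (?G J)" for a
  proof -
   have "(%(a, y). y) : borel_measurable ?A" by measurable
   from measurable_compose[OF measurable_Pair1'[OF a] measurable_compose[OF jm[OF this] F]]
   show ?thesis by simp
  qed
  have F'2: "(F' a)^2 <= ennreal (exp ((v i0 a)^2)) * (\<integral>\<^sup>+y. (F (a(i0 := y)))^2 \<partial>std_normal)" if "a : space (?G J)" for a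
   unfolding F'_def using nn_integral_shift_cauchy_schwarz[OF Fa[OF that], of "v i0 a"] .
  have "(\<integral>\<^sup>+z. F (T z) \<partial>?G I) = (\<integral>\<^sup>+x. \<integral>\<^sup>+y. F (T (x(i0 := y))) \<partial>std_normal \<partial>?G J)"
   using P.product_nn_integral_insert[OF J(1,2), of "%z. F (T z)"] J(3) measurable_compose[OF Tm F] by simp
  also have "... = (\<integral>\<^sup>+x. F' (T' x) \<partial>?G J)"
  proof (rule nn_integral_cong)
   fix x assume x: "x : space (?G J)"
   have "restrict (x(i0 := y)) J = x" for y using x J(2) by (auto simp: fun_eq_iff space_PiM PiE_iff extensional_def)
   then show "(\<integral>\<^sup>+y. F (T (x(i0 := y))) \<partial>std_normal) = F' (T' x)" by (simp add: T_def F'_def)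
  qed
  finally have "(\<integral>\<^sup>+z. F (T z) \<partial>?G I)^2 <= (\<integral>\<^sup>+x. (F' x)^2 * ennreal (exp (SUM i:J. (v i x)^2)) \<partial>?G J)"
   using T'F[OF F'm] by simp
  also have "... <= (\<integral>\<^sup>+x. \<integral>\<^sup>+y. (F (x(i0 := y)))^2 * ennreal (exp (SUM i:I. (v i (x(i0 := y)))^2)) \<partial>std_normal \<partial>?G J)"
  proof (rule nn_integral_mono)
   fix x assume x: "x : space (?G J)"
   note [measurable] = Fa[OF x]
   have "(SUM i:I. (v i (x(i0 := y)))^2) = (v i0 x)^2 + (SUM i:J. (v i x)^2)" for y
   proof -
    have "(SUM i:I. (v i (x(i0 := y)))^2) = (SUM i:I. (v i x)^2)" using upd by (intro sum.cong) auto
    also have "... = (SUM i:insert i0 J. (v i x)^2)" unfolding J(3) ..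
    finally show ?thesis unfolding sum.insert[OF J(1,2)] .
   qed
   then have "(\<integral>\<^sup>+y. (F (x(i0 := y)))^2 * ennreal (exp (SUM i:I. (v i (x(i0 := y)))^2)) \<partial>std_normal) =
     (\<integral>\<^sup>+y. (F (x(i0 := y)))^2 \<partial>std_normal) * ennreal (exp ((v i0 x)^2 + (SUM i:J. (v i x)^2)))"
    by (simp only:) (rule nn_integral_multc, simp)
   also have "... = (ennreal (exp ((v i0 x)^2)) * (\<integral>\<^sup>+y. (F (x(i0 := y)))^2 \<partial>std_normal)) * ennreal (exp (SUM i:J. (v i x)^2))"
    by (simp add: exp_add ennreal_mult mult_ac)
   finally show "(F' x)^2 * ennreal (exp (SUM i:J. (v i x)^2)) <=
     (\<integral>\<^sup>+y. (F (x(i0 := y)))^2 * ennreal (exp (SUM i:I. (v i (x(i0 := y)))^2)) \<partial>std_normal)"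
    using mult_right_mono[OF F'2[OF x], of "ennreal (exp (SUM i:J. (v i x)^2))"] by simp
  qed
  also have "... = (\<integral>\<^sup>+z. (F z)^2 * ennreal (exp (SUM i:I. (v i z)^2)) \<partial>?G I)"
  proof -
   have "(%z. (F z)^2 * ennreal (exp (SUM i:I. (v i z)^2))) : borel_measurable (?G I)"
   proof -
    have [measurable]: "(%z. SUM i:I. (v i z)^2) : borel_measurable (?G I)" by (intro borel_measurable_sum borel_measurable_power vI)
    show ?thesis by measurable
   qed
   then show ?thesis using P.product_nn_integral_insert[OF J(1,2), of "%z. (F z)^2 * ennreal (exp (SUM i:I. (v i z)^2))"] J(3) by simp
  qed
  finally show ?thesis .
 qed
 show ?case using Tm Te TF by blast
qed

lemma triangular_unique:
 fixes v :: "'i => ('i => real) => real" and r :: "'i => nat"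
 assumes vd: "!!i z z'. i : I ==> (!!k. k : I ==> r k < r i ==> z k = z' k) ==> v i z = v i z'"
  and s: "!!i. i : I ==> s i = z i + v i s" and t: "!!i. i : I ==> t i = z i + v i t" and i: "i : I"
 shows "s i = t i" using i
proof (induction "r i" arbitrary: i rule: less_induct)
 case less
 have "v i s = v i t" by (rule vd) (use less in auto)
 then show ?case using s[OF less.prems] t[OF less.prems] by simp
qed

text \<open>The law of a triangular perturbation, on the event where the perturbation has energy at most
 \<open>m\<close>: the perturbation is switched off once its energy exceeds \<open>m\<close>.\<close>

lemma triangular_shift_measure:
 fixes v :: "'i => ('i => real) => real" and r :: "'i => nat"
 assumes I: "finite I"
  and vm: "!!i. i : I ==> v i : borel_measurable (gauss I)"
  and vd: "!!i z z'. i : I ==> (!!k. k : I ==> r k < r i ==> z k = z' k) ==> v i z = v i z'"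
  and T: "!!z i. z : space (gauss I) ==> i : I ==> T z i = z i + v i (T z)"
  and Ts: "!!z. z : space (gauss I) ==> T z : extensional I"
  and S: "S : sets (gauss I)"
 shows "EX E : sets (gauss I).
   {z : space (gauss I). T z : S & (SUM i:I. (v i (T z))^2) <= m} \<subseteq> E &
   measure (gauss I) E <= exp (m / 2) * sqrt (measure (gauss I) S)"
proof -
 let ?G = "gauss I"
 interpret G: prob_space ?G by (intro prob_space_PiM std_normal_prob)
 \<comment> \<open>The energy up to rank \<open>n\<close>. It depends on coordinates of rank below
   \<open>n\<close> only, so switching off according to \<open>e (r i)\<close> keeps the
   perturbation triangular.\<close>
 define e where "e n z = (SUM i:{i:I. r i <= n}. (v i z)^2)" for n z
 define u where "u i z = (if e (r i) z <= m then v i z else 0)" for i z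
 have em [measurable]: "e n : borel_measurable ?G" for n unfolding e_def using vm by (intro borel_measurable_sum borel_measurable_power) auto
 have um: "u i : borel_measurable ?G" if "i : I" for i
 proof -
  note [measurable] = vm[OF that]
  show ?thesis unfolding u_def by measurable
 qed
 have ed: "e n z = e n z'" if "!!k. k : I ==> r k < n ==> z k = z' k" for n z z'
  unfolding e_def by (intro sum.cong refl arg_cong[where f = "%x. x^2"] vd) (use that in auto)
 have ud: "u i z = u i z'" if "i : I" "!!k. k : I ==> r k < r i ==> z k = z' k" for i z z'
  using ed[of "r i" z z'] vd[OF that(1), of z z'] that unfolding u_def by simp
 \<comment> \<open>The energy increases with the rank, so the coordinates that stay switched on have
   total energy at most the value at their maximal rank.\<close>
 have ub: "(SUM i:I. (u i z)^2) <= max m 0" for z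
 proof -
  define K where "K = {i : I. e (r i) z <= m}"
  have fK: "finite K" using I by (simp add: K_def)
  have "(SUM i:I. (u i z)^2) = (SUM i:K. (v i z)^2)" by (rule sum.mono_neutral_cong_right) (use I in \<open>auto simp: K_def u_def\<close>)
  also have "... <= max m 0"
  proof (cases "K = {}")
   case False
   have "Max (r ` K) : r ` K" using fK False by (intro Max_in) auto
   then obtain k where k: "k : K" "r k = Max (r ` K)" by auto
   have "(SUM i:K. (v i z)^2) <= e (r k) z" unfolding e_def by (rule sum_mono2) (use I fK k in \<open>auto simp: K_def\<close>)
   moreover have "e (r k) z <= m" using k(1) by (simp add: K_def)
   ultimately show ?thesis by (intro max.coboundedI1) linarith
  qed simp
  finally show ?thesis .
 qed
 obtain U where Um [measurable]: "U : ?G \<rightarrow>\<^sub>M ?G"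
  and Ue: "!!z i. z : space ?G ==> i : I ==> U z i = z i + u i (U z)"
  and UF: "!!F. F : borel_measurable ?G ==> (\<integral>\<^sup>+z. F (U z) \<partial>?G)^2 <= (\<integral>\<^sup>+z. (F z)^2 * ennreal (exp (SUM i:I. (u i z)^2)) \<partial>?G)"
  using triangular_shift[of I u r, OF I um ud] by blast
 let ?E = "{z : space ?G. U z : S}"
 show ?thesis
 proof (cases "m < 0")
  case True
  then have "{z : space ?G. T z : S & (SUM i:I. (v i (T z))^2) <= m} = {}"
  proof -
   have "0 <= (SUM i:I. (v i (T z))^2)" for z by (intro sum_nonneg) simp
   then have "~ (SUM i:I. (v i (T z))^2) <= m" for z using True by (meson not_le order.strict_trans2)
   then show ?thesis by simp
  qed
  then show ?thesis by (intro bexI[of _ "{}"]) auto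
 next
  case False
  have E: "?E : sets ?G" using S by measurable
  have sub: "{z : space ?G. T z : S & (SUM i:I. (v i (T z))^2) <= m} \<subseteq> ?E"
  proof
   fix z assume "z : {z : space ?G. T z : S & (SUM i:I. (v i (T z))^2) <= m}"
   then have z: "z : space ?G" "T z : S" "(SUM i:I. (v i (T z))^2) <= m" by auto
   have "e n (T z) <= m" for n
   proof -
    have "e n (T z) <= (SUM i:I. (v i (T z))^2)" unfolding e_def by (rule sum_mono2) (use I in auto)
    then show ?thesis using z by simp
   qed
   \<comment> \<open>Nothing is switched off on this event, so \<open>T z\<close> and
     \<open>U z\<close> solve the same triangular system.\<close>
   then have uT: "u i (T z) = v i (T z)" for i by (simp add: u_def)
   have "T z i = U z i" if "i : I" for i
    by (rule triangular_unique[OF ud _ _ that, where r = r and s = "T z" and z = z and t = "U z"]) (use T[OF z(1)] Ue[OF z(1)] uT in auto)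
   moreover have "U z : extensional I" using measurable_space[OF Um z(1)] by (auto simp: space_PiM PiE_def)
   ultimately have "T z = U z" using Ts[OF z(1)] by (intro extensionalityI[of _ I]) auto
   then show "z : ?E" using z by simp
  qed
  have "ennreal ((measure ?G ?E)^2) = (\<integral>\<^sup>+z. indicator S (U z) \<partial>?G)^2"
  proof -
   have "(\<integral>\<^sup>+z. indicator S (U z) \<partial>?G) = (\<integral>\<^sup>+z. indicator ?E z \<partial>?G)"
    by (intro nn_integral_cong) (auto simp: indicator_def)
   also have "... = ennreal (measure ?G ?E)" using E by (simp add: G.emeasure_eq_measure)
   finally show ?thesis by (simp add: ennreal_power)
  qed
  also have "... <= (\<integral>\<^sup>+z. (indicator S z)^2 * ennreal (exp (SUM i:I. (u i z)^2)) \<partial>?G)" by (rule UF) (use S in auto)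
  also have "... <= (\<integral>\<^sup>+z. indicator S z * ennreal (exp m) \<partial>?G)"
   using ub False by (intro nn_integral_mono) (auto simp: indicator_def intro!: ennreal_leI)
  also have "... = ennreal (measure ?G S * exp m)" using S by (simp add: nn_integral_multc G.emeasure_eq_measure ennreal_mult)
  finally have "(measure ?G ?E)^2 <= measure ?G S * exp m" by (simp add: ennreal_le_iff)
  then have "measure ?G ?E <= sqrt (measure ?G S * exp m)" by (rule real_le_rsqrt)
  also have "... = exp (m / 2) * sqrt (measure ?G S)"
  proof -
   have "sqrt (exp m) = exp (m / 2)" by (rule real_sqrt_unique) (simp_all add: power2_eq_square flip: exp_add)
   then show ?thesis by (simp add: real_sqrt_mult)
  qed
  finally show ?thesis using E sub by blast
 qed
qed

section \<open>The Euler scheme\<close>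

text \<open>The drift is kept apart from the noise, because it is the perturbation in the change of
  innovations.\<close>

primrec euler_drift :: "('a::real_vector => 'a) => 'a => nat => (nat => 'a) => nat => 'a" where
 "euler_drift b x0 N w 0 = 0"
| "euler_drift b x0 N w (Suc i) = euler_drift b x0 N w i + (1 / real N) *\<^sub>R b (x0 + w i + euler_drift b x0 N w i)"

definition euler :: "('a::real_vector => 'a) => 'a => nat => (nat => 'a) => nat => 'a" where
 "euler b x0 N w i = x0 + w i + euler_drift b x0 N w i"

lemma euler_drift_sum: "euler_drift b x0 N w k = (1 / real N) *\<^sub>R (SUM i<k. b (euler b x0 N w i))"
 by (induction k) (simp_all add: euler_def scaleR_add_right)

text \<open>Here \<open>m\<close> is the level of the time grid, \<open>k\<close> and \<open>l\<close> select a dyadic block of times, and \<open>n\<close> is the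
 level of the spatial grid. Only \<open>n \<le> H m\<close> is controlled, as the noise does not resolve finer scales.\<close>

definition regular_points ::
 "(real ^ 'n => real ^ 'n) => real => nat => real => real => real => nat => (nat => real ^ 'n) => bool" where
 "regular_points b H \<rho> r q R m \<xi> \<longleftrightarrow>
  (ALL l<=m. ALL k<2 ^ l. ALL n. real n <= H * real m --> (ALL z j e. in_box \<rho> n z -->
   \<bar>(SUM i = k * 2 ^ (m - l)..<k * 2 ^ (m - l) + 2 ^ (m - l). sd (%y. b y $ e) j (1 / 2 ^ n) (grid_pt n z + \<xi> i)) / 2 ^ m\<bar>
    <= R * r ^ l * (q / 2) ^ n))"

text \<open>The length of the part of cell \<open>j\<close>, from j / N to (j + 1) / N, that lies
  before \<open>t\<close>. Weighting slopes with it gives the linear interpolation of the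
  drift.\<close>

definition clamped_time :: "nat => nat => real => real" where
 "clamped_time N j t = max 0 (min (t - real j / real N) (1 / real N))"

lemma sum_clamped_time:
 assumes N: "0 < N" and st: "0 <= s" "s <= t" "t <= 1"
 shows "(SUM j<N. clamped_time N j t - clamped_time N j s) = t - s"
proof -
 have A: "(SUM j<M. clamped_time N j t) = min t (real M / N)" if "0 <= t" for M t
 proof (induction M)
  case 0
  then show ?case using that by simp
 next
  case (Suc M)
  have e: "real (Suc M) / N = real M / N + 1 / N" by (simp add: add_divide_distrib)
  have "0 < 1 / real N" using N by simp
  then show ?case using Suc unfolding e sum.lessThan_Suc clamped_time_def min_def max_def by (smt (verit))
 qed
 have "real N / N = 1" using N by simp
 then show ?thesis using A[of t N] A[of s N] st unfolding sum_subtractf by simp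
qed

lemma clamped_time_mono: "s <= t ==> clamped_time N j s <= clamped_time N j t" by (auto simp: clamped_time_def)

lemma clamped_time_grid:
 assumes "0 < N"
 shows "clamped_time N j (real i / real N) = (if j < i then 1 / real N else 0)"
proof -
 have d: "real i / N - real j / N = (real i - real j) / N" by (simp add: diff_divide_distrib)
 show ?thesis
 proof (cases "j < i")
  case True
  then have "1 / real N <= (real i - real j) / N" using assms by (intro divide_right_mono) auto
  then show ?thesis using True unfolding clamped_time_def d by simp
 next
  case False
  then have "(real i - real j) / N <= 0" using assms by (intro divide_nonpos_pos) auto
  then show ?thesis using False unfolding clamped_time_def d by simp
 qed
qed

section \<open>Compactness and passage to the limit\<close>

lemma dyadic_floor_tendsto:
 fixes t :: real
 shows "(%l. real_of_int \<lfloor>t * 2 ^ l\<rfloor> / 2 ^ l) \<longlonglongrightarrow> t"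
proof (rule tendsto_sandwich)
 show "\<forall>\<^sub>F l in sequentially. t - (1/2) ^ l <= real_of_int \<lfloor>t * 2 ^ l\<rfloor> / 2 ^ l"
 proof (rule always_eventually, rule allI)
  fix l :: nat
  have "t * 2 ^ l - 1 <= real_of_int \<lfloor>t * 2 ^ l\<rfloor>" by linarith
  then have "(t * 2 ^ l - 1) / 2 ^ l <= real_of_int \<lfloor>t * 2 ^ l\<rfloor> / 2 ^ l" by (rule divide_right_mono) simp
  then show "t - (1/2) ^ l <= real_of_int \<lfloor>t * 2 ^ l\<rfloor> / 2 ^ l" by (simp add: diff_divide_distrib power_one_over)
 qed
 show "\<forall>\<^sub>F l in sequentially. real_of_int \<lfloor>t * 2 ^ l\<rfloor> / 2 ^ l <= t"
  by (rule always_eventually) (simp add: pos_divide_le_eq)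
 have "(%l. t - (1/2) ^ l) \<longlonglongrightarrow> t - 0" by (intro tendsto_intros LIMSEQ_realpow_zero) auto
 then show "(%l. t - (1/2) ^ l) \<longlonglongrightarrow> t" by simp
qed simp

lemma eq_on_dyadics_imp_eq:
 fixes f g :: "real => 'a::t2_space"
 assumes f: "continuous_on {0..1} f" and g: "continuous_on {0..1} g"
  and eq: "!!l p. p <= 2 ^ l ==> f (real p / 2 ^ l) = g (real p / 2 ^ l)" and t: "t : {0..1}"
 shows "f t = g t"
proof -
 define p where "p l = nat \<lfloor>t * 2 ^ l\<rfloor>" for l
 have p: "real (p l) = real_of_int \<lfloor>t * 2 ^ l\<rfloor>" for l using t by (simp add: p_def)
 have le: "p l <= 2 ^ l" for l
 proof -
  have "t * 2 ^ l <= 2 ^ l" using t by (simp add: mult_left_le_one_le)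
  then have "real (p l) <= 2 ^ l" unfolding p by linarith
  then show ?thesis by (metis of_nat_le_iff of_nat_numeral of_nat_power)
 qed
 have lim: "(%l. real (p l) / 2 ^ l) \<longlonglongrightarrow> t" unfolding p by (rule dyadic_floor_tendsto)
 have mem: "real (p l) / 2 ^ l : {0..1}" for l
 proof -
  have "real (p l) <= 2 ^ l" using le[of l] by (metis of_nat_le_iff of_nat_numeral of_nat_power)
  then show ?thesis by simp
 qed
 have "(%l. f (real (p l) / 2 ^ l)) \<longlonglongrightarrow> f t" "(%l. g (real (p l) / 2 ^ l)) \<longlonglongrightarrow> g t"
  by (rule continuous_on_tendsto_compose[OF f lim t]; use mem in simp)
   (rule continuous_on_tendsto_compose[OF g lim t]; use mem in simp)
 then show ?thesis unfolding eq[OF le] using LIMSEQ_unique by blast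
qed

text \<open>The noise is fixed, so only the interpolated drifts need compactness, and they are
  Lipschitz with the common constant \<open>B\<close>. The equation for the limit is identified at
  dyadic times, where the drift is a Riemann sum, and extends by continuity.\<close>

lemma euler_subsequence_limit:
 fixes b :: "'a::euclidean_space => 'a" and w :: "real => 'a"
 assumes w: "continuous_on {0..1} w" and bB: "!!y. norm (b y) <= B" and ub: "uniformly_continuous_on UNIV b"
  and s: "strict_mono s"
 obtains x k where "continuous_on {0..1} x" "strict_mono (k :: nat => nat)"
  "!!t. t : {0..1} ==> x t = x0 + integral {0..t} (%r. b (x r)) + w t"
  "!!e. e > 0 ==> \<forall>\<^sub>F m in sequentially. ALL i<2 ^ s (k m).
   norm (euler b x0 (2 ^ s (k m)) (%i. w (real i / 2 ^ s (k m))) i - x (real i / 2 ^ s (k m))) < e"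
proof -
 define N where "N m = (2::nat) ^ m" for m :: nat
 define W where "W m i = w (real i / 2 ^ m)" for m i
 define F where "F m t = (SUM j<N m. clamped_time (N m) j t *\<^sub>R b (euler b x0 (N m) (W m) j))" for m t
 have N0: "0 < N m" for m by (simp add: N_def)
 have B0: "0 <= B" using norm_ge_zero bB order_trans by blast
 have lip1: "norm (F m t - F m u) <= B * (t - u)" if "0 <= u" "u <= t" "t <= 1" for m t u
 proof -
  have "norm (F m t - F m u) = norm (SUM j<N m. (clamped_time (N m) j t - clamped_time (N m) j u) *\<^sub>R b (euler b x0 (N m) (W m) j))"
   by (simp add: F_def sum_subtractf scaleR_diff_left)
  also have "... <= (SUM j<N m. (clamped_time (N m) j t - clamped_time (N m) j u) * B)"
   by (rule sum_norm_le) (use clamped_time_mono[OF that(2)] bB in \<open>auto intro!: mult_left_mono\<close>)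
  also have "... = B * (t - u)" unfolding sum_distrib_right[symmetric] sum_clamped_time[OF N0 that] by (rule mult.commute)
  finally show ?thesis .
 qed
 have lip: "norm (F m t - F m u) <= B * \<bar>t - u\<bar>" if "t : {0..1}" "u : {0..1}" for m t u
 proof (cases "u <= t")
  case False
  then show ?thesis using lip1[of t u m] that norm_minus_commute[of "F m t"] by simp
 qed (use lip1[of u t m] that in simp)
 have F0: "F m 0 = 0" for m using clamped_time_grid[OF N0, of m _ 0] by (simp add: F_def)
 have grid: "F m (real i / 2 ^ m) = euler_drift b x0 (N m) (W m) i" if "i <= 2 ^ m" for m i
 proof -
  have "F m (real i / real (N m)) = (SUM j<N m. if j < i then (1 / real (N m)) *\<^sub>R b (euler b x0 (N m) (W m) j) else 0)"
   unfolding F_def clamped_time_grid[OF N0] by (intro sum.cong refl) simp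
  also have "... = (SUM j<i. (1 / real (N m)) *\<^sub>R b (euler b x0 (N m) (W m) j))"
   by (rule sum.mono_neutral_cong_right) (use that in \<open>auto simp: N_def\<close>)
  finally show ?thesis by (simp add: euler_drift_sum scaleR_sum_right N_def)
 qed
 obtain g k where g: "continuous_on {0..1} g" and k: "strict_mono (k :: nat => nat)"
  and u: "!!e. 0 < e ==> EX M. ALL n t. n >= M & t : {0..1} --> norm (F (s (k n)) t - g t) < e"
 proof (rule Arzela_Ascoli[of "{0..1::real}" "%n. F (s n)" B])
  show "norm (F (s n) t) <= B" if "t : {0..1}" for n t using lip[OF that, of 0 "s n"] F0 mult_left_mono[OF _ B0, of t 1] that by simp
  show "EX d>0. ALL n u. u : {0..1} & norm (t - u) < d --> norm (F (s n) t - F (s n) u) < e" if t: "t : {0..1}" and e: "0 < e" for t e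
  proof (intro exI[of _ "e / (B + 1)"] conjI allI impI)
   show "0 < e / (B + 1)" using e B0 by simp
   fix n u assume u: "u : {0..1} & norm (t - u) < e / (B + 1)"
   then have "norm (F (s n) t - F (s n) u) <= B * \<bar>t - u\<bar>" by (intro lip t) auto
   also have "... <= (B + 1) * \<bar>t - u\<bar>" by (rule mult_right_mono) auto
   also have "... < e" using u B0 by (simp add: pos_less_divide_eq mult.commute)
   finally show "norm (F (s n) t - F (s n) u) < e" .
  qed
 qed auto
 define x where "x t = x0 + w t + g t" for t
 have xc: "continuous_on {0..1} x" unfolding x_def by (intro continuous_intros w g)
 have X: "\<forall>\<^sub>F m in sequentially. ALL i<2 ^ s (k m). norm (euler b x0 (2 ^ s (k m)) (W (s (k m))) i - x (real i / 2 ^ s (k m))) < e"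
  if e: "e > 0" for e
 proof -
  obtain M where M: "!!n t. n >= M ==> t : {0..1} ==> norm (F (s (k n)) t - g t) < e" using u[OF e] by blast
  have "norm (euler b x0 (2 ^ s (k m)) (W (s (k m))) i - x (real i / 2 ^ s (k m))) < e" if "M <= m" "i < 2 ^ s (k m)" for m i
  proof -
   have "real i <= 2 ^ s (k m)" using that(2) by (metis less_imp_le of_nat_le_iff of_nat_numeral of_nat_power)
   then have "real i / 2 ^ s (k m) : {0..1}" by simp
   from M[OF that(1) this] show ?thesis using grid[of i "s (k m)"] that(2) by (simp add: euler_def x_def W_def N_def)
  qed
  then show ?thesis unfolding eventually_sequentially by blast
 qed
 have sk: "strict_mono (%m. s (k m))" using s k by (simp add: strict_mono_def)
 then have skt: "filterlim (%m. s (k m)) at_top sequentially" by (rule filterlim_subseq)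
 let ?A = "%r. b (x r)"
 have bx: "continuous_on {0..1} ?A" by (rule continuous_on_compose2[OF uniformly_continuous_imp_continuous[OF ub] xc]) simp
 have gi: "g t = integral {0..t} ?A" if "t : {0..1}" for t
 proof (rule eq_on_dyadics_imp_eq[OF g _ _ that])
  show "continuous_on {0..1} (%t. integral {0..t} ?A)" by (rule indefinite_integral_continuous_1) (rule integrable_continuous_interval[OF bx])
  fix l p :: nat assume p: "p <= 2 ^ l"
  have pr: "real p / 2 ^ l : {0..1}"
  proof -
   have "real p <= 2 ^ l" using p by (metis of_nat_le_iff of_nat_numeral of_nat_power)
   then show ?thesis by simp
  qed
  let ?B = "real p / 2 ^ l"
  have "(%m. (1 / 2 ^ s (k m)) *\<^sub>R (SUM i = 0 * 2 ^ (s (k m) - l)..<p * 2 ^ (s (k m) - l). b (euler b x0 (2 ^ s (k m)) (W (s (k m))) i)))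
   \<longlonglongrightarrow> integral {real 0 / 2 ^ l..real p / 2 ^ l} ?A" by (rule dyadic_riemann_limit[OF xc ub skt X]) (use p in auto)
  moreover have "\<forall>\<^sub>F m in sequentially. (1 / 2 ^ s (k m)) *\<^sub>R (SUM i = 0 * 2 ^ (s (k m) - l)..<p * 2 ^ (s (k m) - l). b (euler b x0 (2 ^ s (k m)) (W (s (k m))) i))
   = F (s (k m)) ?B" using eventually_compose_filterlim[OF eventually_ge_at_top[of l] skt]
  proof eventually_elim
   case (elim m)
   have le: "p * 2 ^ (s (k m) - l) <= 2 ^ s (k m)"
   proof -
    have "p * 2 ^ (s (k m) - l) <= 2 ^ l * 2 ^ (s (k m) - l)" using p by (rule mult_le_mono1)
    then show ?thesis using elim by (simp flip: power_add)
   qed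
   have "real (p * 2 ^ (s (k m) - l)) / 2 ^ s (k m) = real p / 2 ^ l"
   proof -
    have "(2::real) ^ s (k m) = 2 ^ l * 2 ^ (s (k m) - l)" using elim by (simp flip: power_add)
    then show ?thesis by simp
   qed
   then have "F (s (k m)) ?B = euler_drift b x0 (N (s (k m))) (W (s (k m))) (p * 2 ^ (s (k m) - l))" using grid[OF le] by simp
   then show ?case by (simp add: euler_drift_sum N_def atLeast0LessThan)
  qed
  ultimately have "(%m. F (s (k m)) ?B) \<longlonglongrightarrow> integral {0..real p / 2 ^ l} ?A" using tendsto_cong[THEN iffD1] by force
  moreover have "(%m. F (s (k m)) ?B) \<longlonglongrightarrow> g ?B"
  proof (rule LIMSEQ_I)
   fix e :: real assume "0 < e"
   from u[OF this] show "EX no. ALL n>=no. norm (F (s (k n)) ?B - g ?B) < e" using pr by blast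
  qed
  ultimately show "g ?B = integral {0..real p / 2 ^ l} ?A" using LIMSEQ_unique by blast
 qed
 show thesis
 proof (rule that[OF xc k])
  fix t :: real assume "t : {0..1}"
  then show "x t = x0 + integral {0..t} ?A + w t" using gi by (simp add: x_def)
 next
  fix e :: real assume e: "0 < e"
  from X[OF e] show "\<forall>\<^sub>F m in sequentially. ALL i<2 ^ s (k m).
   norm (euler b x0 (2 ^ s (k m)) (%i. w (real i / 2 ^ s (k m))) i - x (real i / 2 ^ s (k m))) < e" unfolding W_def .
 qed
qed

lemma sum_axis_grid_pt:
 "grid_pt n z + axis j (1 / 2 ^ n) = grid_pt n (z(j := z j + 1))"
 "grid_pt n z - axis j (1 / 2 ^ n) = grid_pt n (z(j := z j - 1))"
 by (auto simp: grid_pt_def vec_eq_iff axis_def add_divide_distrib diff_divide_distrib)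

text \<open>Both restrictions in \<open>regular_points\<close> disappear in the limit: a fixed block
  level \<open>l\<close> and a fixed spatial level \<open>n\<close> satisfy l <= m and n <= H m for
  all large m.\<close>

lemma regular_points_limit:
 fixes b :: "real ^ 'n => real ^ 'n" and x :: "real => real ^ 'n"
 assumes x: "continuous_on {0..1} x" and ub: "uniformly_continuous_on UNIV b" and H: "0 < H"
  and s: "strict_mono (s :: nat => nat)"
  and reg: "!!m. regular_points b H \<rho> r q R (s m) (X m)"
  and X: "!!e. e > 0 ==> \<forall>\<^sub>F m in sequentially. ALL i<2 ^ s m. norm (X m i - x (real i / 2 ^ s m)) < e"
  and k: "k < 2 ^ l" and z: "in_box \<rho> n z"
 shows "\<bar>integral {real k / 2 ^ l..real (Suc k) / 2 ^ l} (%t. sd (%y. b y $ e) j (1 / 2 ^ n) (grid_pt n z + x t))\<bar> <= R * r ^ l * (q / 2) ^ n"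
proof -
 let ?g = "%y. sd (%y. b y $ e) j (1 / 2 ^ n) (grid_pt n z + y)"
 have st: "filterlim s at_top sequentially" using s by (rule filterlim_subseq)
 have ube: "uniformly_continuous_on UNIV (%y. b (y + c) $ e)" for c
 proof -
  have "uniformly_continuous_on UNIV (%y. b (y + c))" unfolding uniformly_continuous_on_def
  proof (intro allI impI)
   fix e' :: real assume "0 < e'"
   from ub[unfolded uniformly_continuous_on_def, rule_format, OF this]
   obtain d where "0 < d" "ALL y:UNIV. ALL z:UNIV. dist z y < d --> dist (b z) (b y) < e'" by (elim exE conjE)
   then show "EX d>0. ALL y:UNIV. ALL z:UNIV. dist z y < d --> dist (b (z + c)) (b (y + c)) < e'" by (intro exI[of _ d]) simp
  qed
  then show ?thesis by (rule bounded_linear.uniformly_continuous_on[OF bounded_linear_vec_nth])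
 qed
 have ug: "uniformly_continuous_on UNIV ?g"
 proof -
  have "?g = (%y. b (y + (grid_pt n z + axis j (1 / 2 ^ n))) $ e + b (y + (grid_pt n z - axis j (1 / 2 ^ n))) $ e - 2 * b (y + grid_pt n z) $ e)"
   by (auto simp: sd_def fun_eq_iff algebra_simps)
  moreover have "uniformly_continuous_on UNIV ..."
   by (intro uniformly_continuous_on_add uniformly_continuous_on_diff ube bounded_linear.uniformly_continuous_on[OF bounded_linear_mult_right])
  ultimately show ?thesis by simp
 qed
 have "(%m. (1 / 2 ^ s m) *\<^sub>R (SUM i = k * 2 ^ (s m - l)..<Suc k * 2 ^ (s m - l). ?g (X m i)))
  \<longlonglongrightarrow> integral {real k / 2 ^ l..real (Suc k) / 2 ^ l} (%t. ?g (x t))"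
  by (rule dyadic_riemann_limit[OF x ug st X]) (use k in auto)
 then have "(%m. \<bar>(1 / 2 ^ s m) *\<^sub>R (SUM i = k * 2 ^ (s m - l)..<Suc k * 2 ^ (s m - l). ?g (X m i))\<bar>)
  \<longlonglongrightarrow> \<bar>integral {real k / 2 ^ l..real (Suc k) / 2 ^ l} (%t. ?g (x t))\<bar>" by (rule tendsto_rabs)
 moreover have "\<forall>\<^sub>F m in sequentially. \<bar>(1 / 2 ^ s m) *\<^sub>R (SUM i = k * 2 ^ (s m - l)..<Suc k * 2 ^ (s m - l). ?g (X m i))\<bar> <= R * r ^ l * (q / 2) ^ n"
  using eventually_compose_filterlim[OF eventually_ge_at_top[of "max l (nat \<lceil>real n / H\<rceil>)"] st]
 proof eventually_elim
  case (elim m)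
  then have "l <= s m" "real n / H <= real (s m)" by auto
  then have "real n <= H * real (s m)" using H by (simp add: pos_divide_le_eq mult.commute)
  then have "\<bar>(SUM i = k * 2 ^ (s m - l)..<k * 2 ^ (s m - l) + 2 ^ (s m - l). ?g (X m i)) / 2 ^ s m\<bar> <= R * r ^ l * (q / 2) ^ n"
   using reg[of m] \<open>l \<le> s m\<close> k z unfolding regular_points_def by blast
  then show ?case by (simp add: add.commute)
 qed
 ultimately show ?thesis by (intro tendsto_upperbound) auto
qed

text \<open>\<open>dyadic_zygmund_lipschitz\<close> is applied to each component of the average as a
  function of the translation. The box has to contain the translations of norm up to 2 B, the bound
  on the difference of two solutions. One factor \<open>CARD('n)\<close> comes from the coordinates
  of y - y', the other from the components of the integral.\<close>

lemma averaged_lipschitz: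
 fixes b :: "real ^ 'n => real ^ 'n" and x :: "real => real ^ 'n"
 assumes x: "continuous_on {0..1} x" and b: "continuous_on UNIV b" and bB: "!!y. norm (b y) <= B"
  and \<rho>: "2 * B < real \<rho>" and q: "0 < q" "q < 1" and r: "1 / 2 <= r" and R: "0 <= R"
  and lim: "!!l k n z j e. k < 2 ^ l ==> in_box \<rho> n z ==>
   \<bar>integral {real k / 2 ^ l..real (Suc k) / 2 ^ l} (%t. sd (%y. b y $ e) j (1 / 2 ^ n) (grid_pt n z + x t))\<bar> <= R * r ^ l * (q / 2) ^ n"
  and k: "k < 2 ^ l" and y: "norm y <= 2 * B" "norm y' <= 2 * B"
 shows "norm (integral {real k / 2 ^ l..real (Suc k) / 2 ^ l} (%s. b (x s + y) - b (x s + y')))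
  <= (real CARD('n) * real CARD('n) * (2 * B + (real CARD('n) + 1) * R / (1 - q))) * r ^ l * norm (y - y')"
proof -
 let ?I = "{real k / 2 ^ l..real (Suc k) / 2 ^ l}"
 have sub: "?I \<subseteq> {0..1}"
 proof -
  have "real (Suc k) <= 2 ^ l" using k by (metis Suc_leI of_nat_le_iff of_nat_numeral of_nat_power)
  then show ?thesis by (auto simp: field_simps)
 qed
 have xI: "continuous_on ?I x" by (rule continuous_on_subset[OF x sub])
 have bx: "continuous_on ?I (%s. b (x s + y))" for y by (rule continuous_on_compose2[OF b continuous_on_add[OF xI continuous_on_const]]) simp
 have bxe: "continuous_on ?I (%s. b (x s + y) $ e)" for y e using bx[of y] by (intro continuous_intros)
 have len: "real (Suc k) / 2 ^ l - real k / 2 ^ l = 1 / 2 ^ l" by (simp add: add_divide_distrib)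
 have kk: "real k / 2 ^ l <= real (Suc k) / 2 ^ l" by (rule divide_right_mono) auto
 have B0: "0 <= B" using norm_ge_zero bB order_trans by blast
 define D where "D e y = integral ?I (%s. b (x s + y) $ e)" for e y
 have Dc: "continuous_on UNIV (D e)" for e
 proof -
  have "continuous_on (UNIV \<times> cbox (real k / 2 ^ l) (real (Suc k) / 2 ^ l)) (%(y, s). b (x s + y) $ e)"
   unfolding case_prod_beta cbox_interval by (intro continuous_intros continuous_on_compose2[OF b] continuous_on_compose2[OF xI]) auto
  from integral_continuous_on_param[OF this] show ?thesis by (simp add: D_def[abs_def])
 qed
 have r0: "0 < r" using r by simp
 \<comment> \<open>Because of r >= 1/2 the trivial bound by the length of the interval is of order
   r^l as well.\<close>
 have rl: "1 / 2 ^ l <= r ^ l" using power_mono[OF r, of l] by (simp add: power_one_over)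
 have DB: "\<bar>D e y\<bar> <= B * r ^ l" for e y
 proof -
  have "norm (integral ?I (%s. b (x s + y) $ e)) <= B * (real (Suc k) / 2 ^ l - real k / 2 ^ l)"
   by (rule integral_bound[OF kk bxe]) (use bB component_le_norm_cart order_trans in \<open>auto simp only: real_norm_def, blast\<close>)
  also have "... <= B * r ^ l" unfolding len using rl B0 by (rule mult_left_mono)
  finally show ?thesis by (simp add: D_def)
 qed
 have yi: "\<bar>u $ i\<bar> < real \<rho>" if "norm u <= 2 * B" for u :: "real ^ 'n" and i
  using component_le_norm_cart[of u i] that \<rho> by linarith
 have sdD: "D e (grid_pt n (z(j := z j + 1))) + D e (grid_pt n (z(j := z j - 1))) - 2 * D e (grid_pt n z) =
  integral ?I (%t. sd (%y. b y $ e) j (1 / 2 ^ n) (grid_pt n z + x t))" for e n z j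
 proof -
  note i = integrable_continuous_interval[OF bxe]
  have "integral ?I (%t. sd (%y. b y $ e) j (1 / 2 ^ n) (grid_pt n z + x t)) =
   integral ?I (%t. b (x t + grid_pt n (z(j := z j + 1))) $ e + b (x t + grid_pt n (z(j := z j - 1))) $ e - 2 * b (x t + grid_pt n z) $ e)"
   unfolding sum_axis_grid_pt[symmetric] sd_def by (intro integral_cong) (simp add: algebra_simps)
  also have "... = D e (grid_pt n (z(j := z j + 1))) + D e (grid_pt n (z(j := z j - 1))) - 2 * D e (grid_pt n z)"
  proof -
   have "(%t. 2 * b (x t + grid_pt n z) $ e) integrable_on ?I" using integrable_cmul[OF i, of 2] by simp
   then show ?thesis unfolding D_def by (subst integral_diff[OF integrable_add[OF i i]], assumption, subst integral_add[OF i i]) simp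
  qed
  finally show ?thesis ..
 qed
 let ?B = "SUM i:UNIV. \<bar>y $ i - y' $ i\<bar>"
 have main: "\<bar>D e y - D e y'\<bar> <= (2 * (B * r ^ l) + (real CARD('n) + 1) * (R * r ^ l) / (1 - q)) * ?B" for e
  by (rule dyadic_zygmund_lipschitz[where \<rho> = \<rho>, OF Dc DB q]) (use R r0 lim[OF k] yi y in \<open>auto simp: sdD\<close>)
 have S: "?B <= real CARD('n) * norm (y - y')"
 proof -
  have "?B <= (SUM i:(UNIV :: 'n set). norm (y - y'))" by (rule sum_mono) (metis component_le_norm_cart vector_minus_component)
  then show ?thesis by simp
 qed
 let ?K = "2 * B + (real CARD('n) + 1) * R / (1 - q)"
 have K0: "0 <= ?K" using B0 R q by simp
 let ?A = "%s. b (x s + y) - b (x s + y')"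
 have "norm (integral ?I ?A) <= (SUM e:UNIV. \<bar>integral ?I ?A $ e\<bar>)" by (rule norm_le_l1_cart)
 also have "... <= (SUM e:(UNIV :: 'n set). ?K * r ^ l * (real CARD('n) * norm (y - y')))"
 proof (rule sum_mono)
  fix e :: 'n
  have "integral ?I ?A $ e = D e y - D e y'"
  proof -
   have "integral ?I ?A $ e = integral ?I (%s. (b (x s + y) - b (x s + y')) $ e)"
    by (rule integral_component_eq_cart[symmetric]) (intro integrable_continuous_interval continuous_on_diff bx)
   then show ?thesis unfolding D_def using integral_diff[OF integrable_continuous_interval[OF bxe] integrable_continuous_interval[OF bxe]] by simp
  qed
  then have "\<bar>integral ?I ?A $ e\<bar> <= (2 * (B * r ^ l) + (real CARD('n) + 1) * (R * r ^ l) / (1 - q)) * ?B" using main[of e] by simp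
  also have "2 * (B * r ^ l) + (real CARD('n) + 1) * (R * r ^ l) / (1 - q) = ?K * r ^ l" by (simp add: algebra_simps)
  also have "?K * r ^ l * ?B <= ?K * r ^ l * (real CARD('n) * norm (y - y'))" using S K0 r0 by (intro mult_left_mono) auto
  finally show "\<bar>integral ?I ?A $ e\<bar> <= ?K * r ^ l * (real CARD('n) * norm (y - y'))" .
 qed
 also have "... = (real CARD('n) * real CARD('n) * ?K) * r ^ l * norm (y - y')" by (simp add: mult_ac)
 finally show ?thesis .
qed

lemma holder_uniformly_continuous:
 fixes b :: "'a::real_normed_vector => 'b::real_normed_vector"
 assumes "!!y z. norm (b y - b z) <= C * norm (y - z) powr a" "0 < a" "0 <= C"
 shows "uniformly_continuous_on UNIV b" unfolding uniformly_continuous_on_def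
proof (intro allI impI)
 fix e :: real assume e: "0 < e"
 define d where "d = (e / (C + 1)) powr (1 / a)"
 have d: "0 < d" using e assms by (simp add: d_def)
 have "norm (b y - b z) < e" if "norm (y - z) < d" for y z
 proof -
  have "norm (y - z) powr a < d powr a" using that assms by (intro powr_less_mono2) auto
  also have "d powr a = e / (C + 1)" using e assms by (simp add: d_def powr_powr)
  finally have "(C + 1) * norm (y - z) powr a < e" using assms by (simp add: pos_less_divide_eq mult.commute)
  moreover have "C * norm (y - z) powr a <= (C + 1) * norm (y - z) powr a" by (rule mult_right_mono) auto
  ultimately show ?thesis using assms(1)[of y z] by linarith
 qed
 then show "EX d>0. ALL x:UNIV. ALL x':UNIV. dist x' x < d --> dist (b x') (b x) < e" using d by (auto simp: dist_norm)
qed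

text \<open>Pathwise conclusion, with all of the probability in \<open>inf\<close>. The regular
  levels are enumerated first and thinned out by compactness afterwards, so that the limit is at
  once a solution and a path with the averaging bounds.\<close>

theorem regular_path_unique_solution:
 fixes b :: "real ^ 'n => real ^ 'n" and w :: "real => real ^ 'n"
 assumes w: "continuous_on {0..1} w" and bB: "!!y. norm (b y) <= B"
  and hb: "!!y z. norm (b y - b z) <= C * norm (y - z) powr a" and C: "0 <= C" and a: "0 < a"
  and H: "0 < H" and \<rho>: "2 * B < real \<rho>" and q: "0 < q" "q < 1" and r: "1 / 2 <= r" "r < 1" "r * r < 1 / 2" and R: "0 <= R"
  and inf: "infinite {m. regular_points b H \<rho> r q R m (euler b x0 (2 ^ m) (%i. w (real i / 2 ^ m)))}"
 shows "EX x. continuous_on {0..1} x & (ALL t:{0..1}. x t = x0 + integral {0..t} (%s. b (x s)) + w t) &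
  (ALL x'. continuous_on {0..1} x' & (ALL t:{0..1}. x' t = x0 + integral {0..t} (%s. b (x' s)) + w t) --> (ALL t:{0..1}. x' t = x t))"
proof -
 have ub: "uniformly_continuous_on UNIV b" by (rule holder_uniformly_continuous[OF hb a C])
 then have cb: "continuous_on UNIV b" by (rule uniformly_continuous_imp_continuous)
 obtain s :: "nat => nat" where s: "strict_mono s"
  "!!m. regular_points b H \<rho> r q R (s m) (euler b x0 (2 ^ s m) (%i. w (real i / 2 ^ s m)))" using infinite_enumerate[OF inf] by auto
 obtain x k where x: "continuous_on {0..1} x" and k: "strict_mono (k :: nat => nat)"
  and sol: "!!t. t : {0..1} ==> x t = x0 + integral {0..t} (%r. b (x r)) + w t"
  and X: "!!e. e > 0 ==> \<forall>\<^sub>F m in sequentially. ALL i<2 ^ s (k m).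
   norm (euler b x0 (2 ^ s (k m)) (%i. w (real i / 2 ^ s (k m))) i - x (real i / 2 ^ s (k m))) < e"
  using euler_subsequence_limit[OF w bB ub s(1)] by blast
 have sk: "strict_mono (%m. s (k m))" using s(1) k by (simp add: strict_mono_def)
 note lim = regular_points_limit[OF x ub H sk s(2) X]
 note avg = averaged_lipschitz[OF x cb bB \<rho> q r(1) R lim]
 let ?K = "real CARD('n) * real CARD('n) * (2 * B + (real CARD('n) + 1) * R / (1 - q))"
 have B0: "0 <= B" using norm_ge_zero bB order_trans by blast
 have K: "0 <= ?K" using B0 R q by simp
 have uniq: "x' t = x t" if x': "continuous_on {0..1} x'" "!!t. t : {0..1} ==> x' t = x0 + integral {0..t} (%s. b (x' s)) + w t" and t: "t : {0..1}" for x' t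
 proof (rule dyadic_averaging_unique[OF x x'(1) cb _ bB hb C a r K avg t])
  fix t :: real assume t: "t : {0..1}"
  have "(%s. b (y s)) integrable_on {0..t}" if "continuous_on {0..1} y" for y
   by (rule integrable_continuous_interval, rule continuous_on_compose2[OF cb continuous_on_subset[OF that]]) (use t in auto)
  then show "x' t - x t = integral {0..t} (%s. b (x' s) - b (x s))" using x x' sol[OF t] x'(2)[OF t] by (simp add: integral_diff)
 qed
 show ?thesis by (intro exI[of _ x] conjI allI impI ballI x sol) (use uniq in blast)+
qed

section \<open>Regularity of the noise with large probability\<close>

lemma vec_nth_measurable:
 fixes b :: "'a => real ^ 'n"
 assumes "b : borel_measurable M"
 shows "(%x. b x $ e) : borel_measurable M"
proof -
 have "(%y :: real ^ 'n. y $ e) : borel_measurable borel" by (intro borel_measurable_continuous_onI continuous_intros)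
 then show ?thesis using assms by (rule measurable_compose[rotated])
qed

lemma std_normal_coordinate_measurable:
 assumes "i : I" shows "(%z. z i) : borel_measurable (gauss I)"
 using measurable_component_singleton[OF assms, of "%_. std_normal"] by (simp add: measurable_cong_sets[OF refl sets_distr])

lemma regular_points_measurable [measurable (raw)]:
 fixes b :: "real ^ 'n => real ^ 'n"
 assumes [measurable]: "b : borel_measurable borel" "!!i. \<xi> i : borel_measurable M"
 shows "Measurable.pred M (%w. regular_points b H \<rho> r q R m (%i. \<xi> i w))"
proof -
 have [measurable]: "(%y. b y $ e) : borel_measurable borel" for e by (rule vec_nth_measurable) fact
 have "Measurable.pred M (%w. \<bar>(SUM i = k * 2 ^ (m - l)..<k * 2 ^ (m - l) + 2 ^ (m - l). sd (%y. b y $ e) j (1 / 2 ^ n) (grid_pt n z + \<xi> i w)) / 2 ^ m\<bar>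
    <= R * r ^ l * (q / 2) ^ n)" for k l n z e j by measurable
 then show ?thesis unfolding regular_points_def by (intro pred_intros_countable pred_intros_imp') auto
qed

lemma finite_in_box: "finite {z :: 'n::finite => int. in_box \<rho> n z}"
 and card_in_box_le: "real (card {z :: 'n => int. in_box \<rho> n z}) <= ((2 * real \<rho> + 1) * 2 ^ n) ^ CARD('n)"
proof -
 let ?A = "{- (int \<rho> * 2 ^ n)..int \<rho> * 2 ^ n}"
 have eq: "{z :: 'n => int. in_box \<rho> n z} = PiE UNIV (%_. ?A)" by (auto simp: in_box_def PiE_UNIV_domain abs_le_iff minus_le_iff)
 show "finite {z :: 'n => int. in_box \<rho> n z}" unfolding eq by (rule finite_PiE) auto
 have "card {z :: 'n => int. in_box \<rho> n z} = card ?A ^ CARD('n)" unfolding eq by (simp add: card_PiE)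
 moreover have "real (card ?A) <= (2 * real \<rho> + 1) * 2 ^ n" by (simp add: algebra_simps)
 ultimately show "real (card {z :: 'n => int. in_box \<rho> n z}) <= ((2 * real \<rho> + 1) * 2 ^ n) ^ CARD('n)" by (simp add: power_mono)
qed

lemma sum_half_powers_le: "(SUM l:A. (1 / 2 :: real) ^ l) <= 2" if "finite A"
proof -
 have "(SUM l:A. (1 / 2 :: real) ^ l) <= (\<Sum>l. (1 / 2) ^ l)" by (rule sum_le_suminf) (use that in \<open>auto intro: summable_geometric\<close>)
 then show ?thesis by (simp add: suminf_geometric)
qed

text \<open>A union bound over blocks, spatial grid points, directions and components. The
  thresholds leave a factor 2^(\<eta> l) of room in time and 2^(\<epsilon> n / 2) in space, which a
  high power \<open>P\<close> turns into 4^(-l) 2^(- n (d + 1)). This beats the 2^l blocks and the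
  order of 2^(n d) grid points, and the sums converge uniformly in \<open>m\<close>.\<close>

lemma not_regular_points_measure:
 fixes b :: "real ^ 'n => real ^ 'n"
 assumes bm [measurable]: "b : borel_measurable borel" and bB: "!!y. norm (b y) <= B"
  and hb: "!!y z. norm (b y - b z) <= C * norm (y - z) powr a" and C: "0 < C" and a: "0 < a" "a <= 1"
  and H: "0 < H" and \<epsilon>: "0 < \<epsilon>" "\<epsilon> <= 1" and \<theta>: "\<theta> = H * (1 + \<epsilon> - a)" "\<theta> < 1/2" and \<gamma>: "\<gamma> < 1 - \<theta>"
  and c0: "0 < c0" and \<delta>: "0 < \<delta>"
 obtains R where "0 <= R"
  "!!m bb. (!!i l. i < 2 ^ m ==> i <= l ==> bb i l = 0) ==>
   (!!i s. i < 2 ^ m ==> s < i ==> c0 * (real (i - s) / real (2 ^ m)) powr (2 * H) <= (SUM l = s..<2 ^ m. (bb i l)^2)) ==>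
   measure (gauss ({..<2 ^ m} \<times> UNIV)) {z : space (gauss ({..<2 ^ m} \<times> UNIV)).
    ~ regular_points b H \<rho> (2 powr (- \<gamma>)) (2 powr (- \<epsilon> / 2)) R m (%i. start + (\<chi> k. SUM l<2 ^ m. bb i l * z (l, k)))} <= \<delta>"
proof -
 define \<eta> where "\<eta> = 1 - \<theta> - \<gamma>"
 have \<eta>: "0 < \<eta>" using \<gamma> by (simp add: \<eta>_def)
 define d where "d = CARD('n)"
 \<comment> \<open>Large enough for 2 P \<eta> >= 2 and P \<epsilon> >= d + 1, the exponents needed
   per level in time and in space.\<close>
 obtain P0 :: nat where P0: "1 / \<eta> + (real d + 1) / \<epsilon> + 1 <= real P0" using real_arch_simple by blast
 define P where "P = P0"
 have Pp: "0 < P" "1 / \<eta> <= real P" "(real d + 1) / \<epsilon> <= real P"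
 proof -
  have "0 <= 1 / \<eta>" "0 <= (real d + 1) / \<epsilon>" using \<eta> \<epsilon> by auto
  then have "1 <= real P" "1 / \<eta> <= real P" "(real d + 1) / \<epsilon> <= real P" using P0 unfolding P_def by linarith+
  then show "0 < P" "1 / \<eta> <= real P" "(real d + 1) / \<epsilon> <= real P" by auto
 qed
 have P\<eta>: "2 <= 2 * real P * \<eta>" using Pp(2) \<eta> by (simp add: pos_divide_le_eq)
 have P\<epsilon>: "real d + 1 <= real P * \<epsilon>" using Pp(3) \<epsilon> by (simp add: pos_divide_le_eq)
 define q0 where "q0 = (1 - 2 * \<theta>) / 4"
 have q0: "0 < q0" using \<theta> by (simp add: q0_def)
 define \<kappa> where "\<kappa> = 1 / (1 - 2 powr (- q0))"
 have \<kappa>: "0 < \<kappa>" using q0 by (simp add: \<kappa>_def powr_less_one)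
 define CU where "CU = C * (2 + sd_const * c0 powr (- ((1 + \<epsilon> - a) / 2)))"
 have CU: "0 <= CU" using C by (simp add: CU_def sd_const_def add_nonneg_nonneg mult_nonneg_nonneg)
 define cP where "cP = 2 * 8 ^ P * fact P / (1 - 2 powr (- 2 * q0 * P))"
 have "2 powr (- 2 * q0 * P) < 1" using q0 Pp(1) by (intro powr_less_one) auto
 then have cP: "0 < cP" by (simp add: cP_def)
 \<comment> \<open>The union bound totals K / Y; the 4 is the product of two geometric sums.\<close>
 define K where "K = 4 * (real d)^2 * (2 * real \<rho> + 1) ^ d * cP"
 define Y where "Y = max 1 (K / \<delta>)"
 have Y: "1 <= Y" "K / \<delta> <= Y" by (auto simp: Y_def)
 define R where "R = 3 * CU * Y * (1 + \<kappa>)"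
 have R0: "0 <= R" using CU Y \<kappa> by (simp add: R_def)
 show thesis
 proof (rule that[OF R0])
  fix m and bb :: "nat => nat => real"
  assume bz: "!!i l. i < 2 ^ m ==> i <= l ==> bb i l = 0"
   and nd: "!!i s. i < 2 ^ m ==> s < i ==> c0 * (real (i - s) / real (2 ^ m)) powr (2 * H) <= (SUM l = s..<2 ^ m. (bb i l)^2)"
  let ?N = "2 ^ m :: nat"
  let ?P = "gauss ({..<?N} \<times> (UNIV :: 'n set))"
  let ?\<xi> = "%i z. (\<chi> k. SUM l<?N. bb i l * z (l, k)) :: real ^ 'n"
  define A where "A l k n y j e z = (SUM i = k * 2 ^ (m - l)..<k * 2 ^ (m - l) + 2 ^ (m - l).
    sd (%y. b y $ e) j (1 / 2 ^ n) ((grid_pt n y + start) + ?\<xi> i z)) / real ?N" for l k n and y :: "'n => int" and j e z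
  define X where "X l n = Y * 2 powr (real l * \<eta>) * 2 powr (real n * (\<epsilon> / 2))" for l n :: nat
  define thr where "thr l n = 3 * (C * (1 / 2 ^ n) powr (1 + \<epsilon>) * (2 + sd_const * c0 powr (- ((1 + \<epsilon> - a) / 2))))
    * (2 ^ (m - l) / real ?N) powr (1 - \<theta>) * (1 + X l n / (1 - 2 powr (- q0)))" for l n :: nat
  define E where "E l k n y j e = {z : space ?P. thr l n <= \<bar>A l k n y j e z\<bar>}" for l k n y j e
  have gm [measurable]: "(%y. b y $ e) : borel_measurable borel" for e by (rule vec_nth_measurable) fact
  have X1: "1 <= X l n" for l n
  proof -
   have "1 <= 2 powr (real l * \<eta>)" "1 <= 2 powr (real n * (\<epsilon> / 2))" using \<eta> \<epsilon> by (auto intro!: ge_one_powr_ge_zero)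
   then have "1 * 1 * 1 <= X l n" unfolding X_def using Y by (intro mult_mono) auto
   then show ?thesis by simp
  qed
  have p2: "(1 / 2 ^ n) powr s = 2 powr (- (real n * s))" for n :: nat and s :: real
  proof -
   have "1 / 2 ^ n = 2 powr (- real n)" by (simp add: powr_minus powr_realpow inverse_eq_divide)
   then show ?thesis by (simp add: powr_powr)
  qed
  have thr_le: "thr l n <= R * (2 powr (- \<gamma>)) ^ l * (2 powr (- \<epsilon> / 2) / 2) ^ n" if "l <= m" for l n
  proof -
   have r1: "2 ^ (m - l) / real ?N = 1 / 2 ^ l"
   proof -
    have "(2::real) ^ m = 2 ^ l * 2 ^ (m - l)" using that by (simp flip: power_add)
    then show ?thesis by simp
   qed
   have "1 + X l n / (1 - 2 powr (- q0)) <= X l n * (1 + \<kappa>)" using X1[of l n] by (simp add: \<kappa>_def algebra_simps)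
   then have "thr l n <= 3 * (C * (1 / 2 ^ n) powr (1 + \<epsilon>) * (2 + sd_const * c0 powr (- ((1 + \<epsilon> - a) / 2))))
    * (1 / 2 ^ l) powr (1 - \<theta>) * (X l n * (1 + \<kappa>))"
    unfolding thr_def r1 using CU C by (intro mult_left_mono) (auto simp: sd_const_def)
   also have "... = (3 * CU * Y * (1 + \<kappa>)) * ((1 / 2 ^ l) powr (1 - \<theta>) * 2 powr (real l * \<eta>)) * ((1 / 2 ^ n) powr (1 + \<epsilon>) * 2 powr (real n * (\<epsilon> / 2)))"
    by (simp add: CU_def X_def mult_ac)
   also have "(1 / 2 ^ l) powr (1 - \<theta>) * 2 powr (real l * \<eta>) = (2 powr (- \<gamma>)) ^ l"
   proof -
    have "(1 / 2 ^ l) powr (1 - \<theta>) * 2 powr (real l * \<eta>) = 2 powr (- \<gamma> * real l)"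
     unfolding p2 powr_add[symmetric] by (simp add: \<eta>_def algebra_simps)
    then show ?thesis by (simp add: powr_realpow[symmetric] powr_powr)
   qed
   also have "(1 / 2 ^ n) powr (1 + \<epsilon>) * 2 powr (real n * (\<epsilon> / 2)) = (2 powr (- \<epsilon> / 2) / 2) ^ n"
   proof -
    have "(1 / 2 ^ n) powr (1 + \<epsilon>) * 2 powr (real n * (\<epsilon> / 2)) = 2 powr ((- \<epsilon> / 2 - 1) * real n)"
     unfolding p2 powr_add[symmetric] by (rule arg_cong[where f = "(powr) 2"]) (simp add: field_simps)
    also have "... = (2 powr (- \<epsilon> / 2 - 1)) ^ n" by (simp add: powr_realpow[symmetric] powr_powr)
    also have "2 powr (- \<epsilon> / 2 - 1) = 2 powr (- \<epsilon> / 2) / 2" by (simp add: powr_diff)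
    finally show ?thesis .
   qed
   finally show ?thesis unfolding R_def .
  qed
  have Em: "E l k n y j e : sets ?P" for l k n y j e
  proof -
   have \<xi>m: "?\<xi> i : borel_measurable ?P" for i
    by (intro borel_measurable_vec_lambda borel_measurable_sum borel_measurable_times borel_measurable_const std_normal_coordinate_measurable) simp
   have "A l k n y j e : borel_measurable ?P" unfolding A_def[abs_def]
    by (intro borel_measurable_divide borel_measurable_sum borel_measurable_const measurable_compose[OF _ sd_measurable] borel_measurable_add \<xi>m gm)
   then show ?thesis unfolding E_def by measurable
  qed
  have PE: "measure ?P (E l k n y j e) <= cP / Y * (1 / 4) ^ l * (1 / 2 ^ n) ^ Suc d"
   if l: "l <= m" "k < 2 ^ l" and n: "real n <= H * real m" for l k n y j e
  proof -
   have "measure ?P (E l k n y j e) <= 2 * 8 ^ P * fact P / (1 - 2 powr (- 2 * q0 * P)) / X l n ^ (2 * P)" unfolding E_def A_def thr_def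
   proof (rule sd_block_tail[where \<alpha> = a and \<epsilon> = \<epsilon> and H = H and \<theta> = \<theta> and q = q0 and B = B and C = C, OF gm _ _ C a _ \<epsilon>(2) _ H \<theta> _ c0 _ _ _ _ Pp(1) q0_def refl])
    show "\<bar>b x $ e\<bar> <= B" for x using component_le_norm_cart[of "b x" e] bB[of x] by linarith
    show "\<bar>b x $ e - b y $ e\<bar> <= C * norm (x - y) powr a" for x y using component_le_norm_cart[of "b x - b y" e] hb[of x y] by simp
    show "k * 2 ^ (m - l) + 2 ^ (m - l) <= ?N"
    proof -
     have "Suc k * 2 ^ (m - l) <= 2 ^ l * 2 ^ (m - l)" using l(2) by (intro mult_le_mono1) simp
     then show ?thesis using l(1) by (simp flip: power_add add: add.commute)
    qed
    \<comment> \<open>The restriction n <= H m enters here: the step 2^(-n) is at least 2^(- H m),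
      the size of the noise over one time step.\<close>
    show "(1 / 2 ^ n) powr (- (1 + \<epsilon> - a)) <= real ?N powr \<theta>"
    proof -
     have "real n * (1 + \<epsilon> - a) <= H * real m * (1 + \<epsilon> - a)" using n \<epsilon> a by (intro mult_right_mono) auto
     then have "(1 / 2 ^ n) powr (- (1 + \<epsilon> - a)) <= 2 powr (real m * \<theta>)"
      unfolding p2 \<theta>(1) mult_minus_right minus_minus by (intro powr_mono) (auto simp: mult.assoc mult.left_commute)
     also have "... = real ?N powr \<theta>" by (simp add: powr_realpow[symmetric] powr_powr)
     finally show ?thesis .
    qed
    show "0 < X l n" using X1[of l n] by linarith
   qed (use \<epsilon> bz nd in auto)
   also have "... = cP / X l n ^ (2 * P)" by (simp add: cP_def)
   also have "... <= cP / (Y * 4 ^ l * (2 ^ n) ^ Suc d)"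
   proof (rule divide_left_mono)
    have "Y <= Y ^ (2 * P)" using Y(1) Pp(1) by (intro self_le_power) auto
    moreover have "(4::real) ^ l <= (2 powr (real l * \<eta>)) ^ (2 * P)"
    proof -
     have "(4::real) ^ l = 2 powr (real l * 2)" by (simp add: powr_powr[symmetric] powr_realpow mult.commute[of _ 2] flip: power_mult)
     also have "... <= 2 powr (real l * (2 * real P * \<eta>))" using P\<eta> by (intro powr_mono mult_left_mono) auto
     also have "... = (2 powr (real l * \<eta>)) ^ (2 * P)" by (simp add: powr_realpow[symmetric] powr_powr mult_ac)
     finally show ?thesis .
    qed
    moreover have "((2::real) ^ n) ^ Suc d <= (2 powr (real n * (\<epsilon> / 2))) ^ (2 * P)"
    proof -
     have "((2::real) ^ n) ^ Suc d = 2 powr (real n * (real d + 1))"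
      by (simp add: powr_powr[symmetric] powr_realpow[symmetric, of _ "Suc d"] powr_realpow add.commute del: power_Suc)
     also have "... <= 2 powr (real n * (real P * \<epsilon>))" using P\<epsilon> by (intro powr_mono mult_left_mono) auto
     also have "... = (2 powr (real n * (\<epsilon> / 2))) ^ (2 * P)" by (simp add: powr_realpow[symmetric] powr_powr mult_ac)
     finally show ?thesis .
    qed
    ultimately show "Y * 4 ^ l * (2 ^ n) ^ Suc d <= X l n ^ (2 * P)" unfolding X_def power_mult_distrib using Y(1) by (intro mult_mono) auto
    show "0 < X l n ^ (2 * P) * (Y * 4 ^ l * (2 ^ n) ^ Suc d)" using X1[of l n] Y(1) by (intro mult_pos_pos zero_less_power) auto
   qed (use cP in simp)
   also have "... = cP / Y * (1 / 4) ^ l * (1 / 2 ^ n) ^ Suc d" by (simp add: power_divide)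
   finally show ?thesis .
  qed
  define Ns where "Ns = {n. real n <= H * real m}"
  have Nf: "finite Ns"
  proof (rule finite_subset)
   show "Ns \<subseteq> {..nat \<lceil>H * real m\<rceil>}" unfolding Ns_def by (auto simp: le_nat_iff) linarith
  qed simp
  let ?Box = "%n. {z :: 'n => int. in_box \<rho> n z}"
  let ?Bad = "{z : space ?P. ~ regular_points b H \<rho> (2 powr (- \<gamma>)) (2 powr (- \<epsilon> / 2)) R m (%i. start + ?\<xi> i z)}"
  let ?U = "UN l:{..m}. UN k:{..<2 ^ l}. UN n:Ns. UN y:?Box n. UN j:UNIV. UN e:UNIV. E l k n y j e"
  have sub: "?Bad \<subseteq> ?U"
  proof
   fix z assume z: "z : ?Bad"
   then obtain l k n y j e where w: "l <= m" "k < 2 ^ l" "real n <= H * real m" "in_box \<rho> n y"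
    "R * (2 powr (- \<gamma>)) ^ l * (2 powr (- \<epsilon> / 2) / 2) ^ n <
     \<bar>(SUM i = k * 2 ^ (m - l)..<k * 2 ^ (m - l) + 2 ^ (m - l). sd (%y. b y $ e) j (1 / 2 ^ n) (grid_pt n y + (start + ?\<xi> i z))) / 2 ^ m\<bar>"
    unfolding regular_points_def by (auto simp: not_le)
   have "thr l n <= \<bar>A l k n y j e z\<bar>" using thr_le[OF w(1), of n] w(5) by (simp add: A_def add.assoc)
   then have "z : E l k n y j e" using z by (simp add: E_def)
   moreover have "l : {..m}" "k : {..<2 ^ l}" "n : Ns" "y : ?Box n" using w by (auto simp: Ns_def)
   ultimately show "z : ?U" by (intro UN_I UNIV_I)
  qed
  have Ufin: "measure ?P ?U <= (SUM l:{..m}. SUM k:{..<2 ^ l :: nat}. SUM n:Ns. SUM y:?Box n. SUM j:(UNIV :: 'n set). SUM e:(UNIV :: 'n set). measure ?P (E l k n y j e))"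
   by (intro order_trans[OF measure_UNION_le] sum_mono order_refl sets.finite_UN Em Nf finite_in_box) auto
  interpret PP: prob_space ?P by (intro prob_space_PiM std_normal_prob)
  have "measure ?P ?Bad <= measure ?P ?U"
   by (rule PP.finite_measure_mono[OF sub]) (intro sets.finite_UN Em Nf finite_in_box finite_atMost finite_lessThan finite)
  also note Ufin
  also have "(SUM l:{..m}. SUM k:{..<2 ^ l :: nat}. SUM n:Ns. SUM y:?Box n. SUM j:(UNIV :: 'n set). SUM e:(UNIV :: 'n set). measure ?P (E l k n y j e)) <=
   (SUM l:{..m}. SUM k:{..<2 ^ l :: nat}. SUM n:Ns. SUM y:?Box n. SUM j:(UNIV :: 'n set). SUM e:(UNIV :: 'n set). cP / Y * (1 / 4) ^ l * (1 / 2 ^ n) ^ Suc d)"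
   by (intro sum_mono PE) (auto simp: Ns_def)
  also have "... = (SUM l:{..m}. SUM n:Ns. 2 ^ l * (real (card (?Box n)) * ((real d)^2 * (cP / Y * (1 / 4) ^ l * (1 / 2 ^ n) ^ Suc d))))"
   by (simp add: d_def power2_eq_square sum_distrib_left mult_ac)
  also have "... <= (SUM l:{..m}. SUM n:Ns. ((real d)^2 * (2 * real \<rho> + 1) ^ d * (cP / Y)) * ((1 / 2) ^ l * (1 / 2) ^ n))"
  proof (intro sum_mono)
   fix l n
   have "2 ^ l * (real (card (?Box n)) * ((real d)^2 * (cP / Y * (1 / 4) ^ l * (1 / 2 ^ n) ^ Suc d))) <=
    2 ^ l * (((2 * real \<rho> + 1) * 2 ^ n) ^ d * ((real d)^2 * (cP / Y * (1 / 4) ^ l * (1 / 2 ^ n) ^ Suc d)))"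
    using cP Y card_in_box_le[of \<rho> n, where 'n = 'n] by (intro mult_left_mono mult_right_mono) (auto simp: d_def)
   also have "... = ((real d)^2 * (2 * real \<rho> + 1) ^ d * (cP / Y)) * ((2 * (1 / 4)) ^ l * (((2 ^ n) * (1 / 2 ^ n)) ^ d * (1 / 2 ^ n)))"
    unfolding power_mult_distrib by (simp add: mult_ac)
   also have "... = ((real d)^2 * (2 * real \<rho> + 1) ^ d * (cP / Y)) * ((1 / 2) ^ l * (1 / 2) ^ n)" by (simp add: power_one_over)
   finally show "2 ^ l * (real (card (?Box n)) * ((real d)^2 * (cP / Y * (1 / 4) ^ l * (1 / 2 ^ n) ^ Suc d))) <= ..." .
  qed
  also have "... = ((real d)^2 * (2 * real \<rho> + 1) ^ d * (cP / Y)) * ((SUM l:{..m}. (1 / 2) ^ l) * (SUM n:Ns. (1 / 2) ^ n))"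
   unfolding sum_product by (simp only: sum_distrib_left)
  also have "... <= ((real d)^2 * (2 * real \<rho> + 1) ^ d * (cP / Y)) * (2 * 2)"
   using cP Y by (intro mult_left_mono mult_mono sum_half_powers_le Nf sum_nonneg) auto
  also have "... = K / Y" by (simp add: K_def)
  also have "... <= \<delta>" using Y \<delta> by (simp add: pos_divide_le_eq mult.commute)
  finally show "measure ?P ?Bad <= \<delta>" .
 qed
qed

section \<open>Transfer from the noise to the Euler polygon\<close>

lemma euler_drift_cong:
 assumes "!!j. j < i ==> w j = w' j"
 shows "euler_drift b x0 N w i = euler_drift b x0 N w' i" using assms by (induction i) auto

lemma euler_cong:
 assumes "!!j. j <= i ==> w j = w' j"
 shows "euler b x0 N w i = euler b x0 N w' i" using euler_drift_cong[of i w w' b x0 N] assms by (simp add: euler_def)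

lemma regular_points_cong:
 assumes "!!i. i < 2 ^ m ==> \<xi> i = \<xi>' i"
 shows "regular_points b H \<rho> r q R m \<xi> \<longleftrightarrow> regular_points b H \<rho> r q R m \<xi>'"
proof -
 have "(SUM i = k * 2 ^ (m - l)..<k * 2 ^ (m - l) + 2 ^ (m - l). sd (%y. b y $ e) j h (y + \<xi> i)) =
    (SUM i = k * 2 ^ (m - l)..<k * 2 ^ (m - l) + 2 ^ (m - l). sd (%y. b y $ e) j h (y + \<xi>' i))" if "l <= m" "k < 2 ^ l" for k l e j h y
 proof (intro sum.cong refl)
  fix i assume "i : {k * 2 ^ (m - l)..<k * 2 ^ (m - l) + 2 ^ (m - l)}"
  then have "i < Suc k * 2 ^ (m - l)" by simp
  also have "... <= 2 ^ l * 2 ^ (m - l)" using that(2) by (intro mult_le_mono1) simp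
  also have "... = 2 ^ m" using that(1) by (simp flip: power_add)
  finally show "sd (%y. b y $ e) j h (y + \<xi> i) = sd (%y. b y $ e) j h (y + \<xi>' i)" using assms by simp
 qed
 then show ?thesis unfolding regular_points_def by (simp cong: conj_cong)
qed

lemma euler_drift_bound:
 fixes b :: "'a::real_normed_vector => 'a"
 assumes bB: "!!y. norm (b y) <= B" and jk: "j <= k" and N: "0 < N"
 shows "norm (euler_drift b x0 N w k - euler_drift b x0 N w j) <= B * (real (k - j) / real N)" using jk
proof (induction k rule: dec_induct)
 case (step n)
 have "norm (euler_drift b x0 N w (Suc n) - euler_drift b x0 N w j) <=
  norm (euler_drift b x0 N w n - euler_drift b x0 N w j) + norm ((1 / real N) *\<^sub>R b (x0 + w n + euler_drift b x0 N w n))"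
  using norm_triangle_ineq[of "euler_drift b x0 N w n - euler_drift b x0 N w j" "(1 / real N) *\<^sub>R b (x0 + w n + euler_drift b x0 N w n)"]
  by (simp add: algebra_simps)
 also have "... <= B * (real (n - j) / real N) + (1 / real N) * B" using step(3) bB by (intro add_mono) (simp_all add: divide_right_mono)
 also have "... = B * (real (Suc n - j) / real N)" using step(1) by (simp add: Suc_diff_le add_divide_distrib distrib_left)
 finally show ?case .
qed simp

lemma fbm_coordinate:
 assumes fbm: "fractional_brownian_motion M H W" and t: "t : {0..1}"
 shows "(%w. W t w $ i) : borel_measurable M" "integrable M (%w. (W t w $ i)^2)"
  and "W t : borel_measurable M"
proof -
 have P: "prob_space M" using fbm by (simp add: fractional_brownian_motion_def)
 have G: "gaussian_var M (%w. W t w $ i)" for i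
 proof -
  have "gaussian_process M {0..1} (%t w. W t w $ i)" using fbm by (simp add: fractional_brownian_motion_def)
  from this[unfolded gaussian_process_def, rule_format, of "{t}" "%_. 1"]
  have "gaussian_var M (%w. SUM t:{t}. 1 * W t w $ i)" using t by simp
  then show ?thesis by simp
 qed
 show m: "(%w. W t w $ i) : borel_measurable M" for i using G by (simp add: gaussian_var_def)
 show "integrable M (%w. (W t w $ i)^2)" using gaussian_var_moments(2)[OF P G] .
 have "(%w. \<chi> i. W t w $ i) : borel_measurable M" by (rule borel_measurable_vec_lambda) (rule m)
 then show "W t : borel_measurable M" by simp
qed

lemma fbm_increment_moment:
 assumes fbm: "fractional_brownian_motion M H W" and st: "s : {0..1}" "t : {0..1}"
  and cov: "!!s t. s : {0..1} ==> t : {0..1} ==> prob_space.expectation M (%w. W s w $ i * W t w $ i) =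
     c * (t powr (2 * H) + s powr (2 * H) - \<bar>t - s\<bar> powr (2 * H))"
 shows "integrable M (%w. (W t w $ i - W s w $ i)^2)"
  and "prob_space.expectation M (%w. (W t w $ i - W s w $ i)^2) = 2 * c * \<bar>t - s\<bar> powr (2 * H)"
proof -
 note T = fbm_coordinate(1,2)[OF fbm st(2), of i] and S = fbm_coordinate(1,2)[OF fbm st(1), of i]
 have ts: "integrable M (%w. W s w $ i * W t w $ i)" by (rule integrable_mult_of_squares[OF S(1) T(1) S(2) T(2)])
 have eq: "(W t w $ i - W s w $ i)^2 = ((W t w $ i)^2 + (W s w $ i)^2) - 2 * (W s w $ i * W t w $ i)" for w
  by (simp add: power2_eq_square algebra_simps)
 note i1 = L_integrable_add[OF T(2) S(2)] and i2 = integrable_mult_right[OF ts, of 2]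
 let ?A = "%w. (W t w $ i - W s w $ i)^2"
 show "integrable M ?A" unfolding eq by (rule L_integrable_diff[OF i1 i2])
 have "prob_space.expectation M ?A =
  prob_space.expectation M (%w. W t w $ i * W t w $ i) + prob_space.expectation M (%w. W s w $ i * W s w $ i) - 2 * prob_space.expectation M (%w. W s w $ i * W t w $ i)"
  unfolding eq L_integral_diff[OF i1 i2] L_integral_add[OF T(2) S(2)] by (simp add: power2_eq_square)
 also have "... = 2 * c * \<bar>t - s\<bar> powr (2 * H)" unfolding cov[OF st(2) st(2)] cov[OF st(1) st(1)] cov[OF st] by (simp add: algebra_simps)
 finally show "prob_space.expectation M ?A = 2 * c * \<bar>t - s\<bar> powr (2 * H)" .
qed

text \<open>A linear majorant of a concave power, in the role of Jensen's inequality: with s the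
  typical size of x, the right-hand side has expectation of order s^a.\<close>

lemma powr_le_interpolate:
 fixes x s a :: real
 assumes "0 <= x" "0 < s" "0 < a" "a <= 1"
 shows "x powr a <= s powr a + s powr (a - 1) * x"
proof (cases "x <= s")
 case True
 then have "x powr a <= s powr a" using assms by (intro powr_mono2) auto
 moreover have "0 <= s powr (a - 1) * x" using assms by simp
 ultimately show ?thesis by linarith
next
 case False
 then have x: "0 < x" using assms by simp
 have "x powr a = x powr (a - 1) * x powr 1" by (simp only: powr_add[symmetric]) simp
 also have "... <= s powr (a - 1) * x powr 1" using assms False by (intro mult_right_mono powr_mono2') auto
 finally show ?thesis using x by (simp add: add_increasing)
qed

text \<open>Noise increments have variance of order \<Delta>^(2 H), and drift increments are at most
  B \<Delta>, which is of no larger order as \<Delta> <= 1 and H < 1. Hoelder continuity of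
  \<open>b\<close> then yields the exponent a H, the \<open>th\<close> of
  \<open>expected_drift_energy\<close>.\<close>

lemma euler_increment_moment:
 fixes b :: "real ^ 'n => real ^ 'n" and W :: "real => 'w => real ^ 'n"
 assumes fbm: "fractional_brownian_motion M H W" and H: "0 < H" "H < 1"
  and cov: "!!i s t. s : {0..1} ==> t : {0..1} ==> prob_space.expectation M (%w. W s w $ i * W t w $ i) =
     c * (t powr (2 * H) + s powr (2 * H) - \<bar>t - s\<bar> powr (2 * H))"
  and bm [measurable]: "b : borel_measurable borel" and bB: "!!y. norm (b y) <= B"
  and hb: "!!y z. norm (b y - b z) <= C * norm (y - z) powr a" and C: "0 < C" and a: "0 < a" "a <= 1" and c: "0 < c"
  and jk: "j < k" "k < N"
  and X: "!!i w. i < N ==> X i w = euler b x0 N (%i. W (real i / real N) w) i" and Xm: "!!i. i < N ==> X i : borel_measurable M"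
 shows "prob_space.expectation M (%w. (b (X k w) $ e - b (X j w) $ e)^2) <=
  C^2 * (1 + 4 * real CARD('n) * c + 2 * B^2) * (real (k - j) / real N) powr (2 * (a * H))"
proof -
 interpret prob_space M using fbm by (simp add: fractional_brownian_motion_def)
 have N: "0 < N" using jk by simp
 define \<Delta> where "\<Delta> = real (k - j) / real N"
 have \<Delta>: "0 < \<Delta>" "\<Delta> <= 1" using jk N by (auto simp: \<Delta>_def)
 define s where "s = \<Delta> powr (2 * H)"
 have s: "0 < s" using \<Delta> by (simp add: s_def)
 have B0: "0 <= B" using norm_ge_zero bB order_trans by blast
 define S where "S w = (SUM i:UNIV. (W (real k / N) w $ i - W (real j / N) w $ i)^2)" for w
 have t01: "real k / N : {0..1}" "real j / N : {0..1}" using jk by auto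
 note inc = fbm_increment_moment[OF fbm t01(2,1) cov]
 have Si: "integrable M S" unfolding S_def by (intro L_integrable_sum inc)
 have dkj: "\<bar>real k / N - real j / N\<bar> = \<Delta>" using jk by (simp add: \<Delta>_def of_nat_diff diff_divide_distrib divide_right_mono)
 have ES: "expectation S = real CARD('n) * (2 * c * s)"
 proof -
  have "expectation S = (SUM i:(UNIV::'n set). expectation (%w. (W (real k / N) w $ i - W (real j / N) w $ i)^2))"
   unfolding S_def by (rule L_integral_sum) (rule inc)
  also have "... = (SUM i:(UNIV::'n set). 2 * c * s)" by (intro sum.cong refl) (simp only: inc(2) dkj s_def)
  finally show ?thesis by simp
 qed
 have \<Delta>2: "\<Delta>^2 <= s"
 proof -
  have "\<Delta>^2 = \<Delta> powr 2" using \<Delta> by simp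
  also have "... <= \<Delta> powr (2 * H)" using \<Delta> H by (intro powr_mono') auto
  finally show ?thesis by (simp add: s_def)
 qed
 have pt: "(b (X k w) $ e - b (X j w) $ e)^2 <= C^2 * (s powr a + s powr (a - 1) * (2 * S w + 2 * B^2 * s))" for w
 proof -
  let ?w = "%i. W (real i / real N) w"
  let ?D = "euler_drift b x0 N ?w k - euler_drift b x0 N ?w j" and ?V = "?w k - ?w j"
  have nV: "(norm ?V)^2 = S w" by (simp add: S_def norm_vec_def L2_set_def sum_nonneg)
  have nD: "norm ?D <= B * \<Delta>" unfolding \<Delta>_def by (rule euler_drift_bound[OF bB _ N]) (use jk in simp)
  have d: "X k w - X j w = ?V + ?D" using jk X by (simp add: euler_def)
  let ?A = "X k w - X j w"
  have "(norm ?A)^2 <= (norm ?V + B * \<Delta>)^2" unfolding d using nD norm_triangle_ineq[of ?V ?D] by (intro power_mono) auto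
  also have "... <= 2 * (norm ?V)^2 + 2 * (B * \<Delta>)^2" using sum_squares_bound[of "norm ?V" "B * \<Delta>"] by (simp add: power2_sum)
  also have "... <= 2 * S w + 2 * B^2 * s" unfolding nV using \<Delta>2 by (simp add: power_mult_distrib mult_left_mono)
  finally have q: "(norm ?A)^2 <= 2 * S w + 2 * B^2 * s" .
  have "\<bar>b (X k w) $ e - b (X j w) $ e\<bar> <= C * norm ?A powr a"
   using component_le_norm_cart[of "b (X k w) - b (X j w)" e] hb[of "X k w" "X j w"] by simp
  then have "(b (X k w) $ e - b (X j w) $ e)^2 <= (C * norm ?A powr a)^2"
   using power_mono[of "\<bar>b (X k w) $ e - b (X j w) $ e\<bar>" _ 2] by simp
  also have "... = C^2 * ((norm ?A)^2) powr a"
  proof -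
   have "(norm ?A powr a)^2 = ((norm ?A)^2) powr a" by (simp add: power2_eq_square powr_mult)
   then show ?thesis by (simp add: power_mult_distrib)
  qed
  also have "... <= C^2 * (s powr a + s powr (a - 1) * (norm ?A)^2)" by (intro mult_left_mono powr_le_interpolate s a) auto
  also have "... <= C^2 * (s powr a + s powr (a - 1) * (2 * S w + 2 * B^2 * s))" using q by (intro mult_left_mono add_left_mono) auto
  finally show ?thesis .
 qed
 have Xk: "X k : borel_measurable M" "X j : borel_measurable M" using Xm jk by auto
 have bX: "(%w. b (X i w) $ e) : borel_measurable M" if "i < N" for i by (rule vec_nth_measurable) (rule measurable_compose[OF Xm[OF that] bm])
 let ?E = "%w. C^2 * (s powr a + s powr (a - 1) * (2 * S w + 2 * B^2 * s))"
 have iR: "integrable M ?E" using Si by (intro integrable_mult_right L_integrable_add integrable_const)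
 let ?B = "%w. (b (X k w) $ e - b (X j w) $ e)^2"
 have iL: "integrable M ?B"
 proof (rule L_integrable_bound[OF iR])
  show "?B : borel_measurable M" by (intro borel_measurable_power borel_measurable_diff bX) (use jk in auto)
  show "AE w in M. norm ((b (X k w) $ e - b (X j w) $ e)^2) <= norm (C^2 * (s powr a + s powr (a - 1) * (2 * S w + 2 * B^2 * s)))"
  proof (rule AE_I2)
   fix w
   have "norm ((b (X k w) $ e - b (X j w) $ e)^2) = (b (X k w) $ e - b (X j w) $ e)^2" by simp
   also note pt[of w]
   also have "C^2 * (s powr a + s powr (a - 1) * (2 * S w + 2 * B^2 * s)) <= norm (C^2 * (s powr a + s powr (a - 1) * (2 * S w + 2 * B^2 * s)))" by (metis abs_ge_self real_norm_def)
   finally show "norm ((b (X k w) $ e - b (X j w) $ e)^2) <= norm (C^2 * (s powr a + s powr (a - 1) * (2 * S w + 2 * B^2 * s)))" .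
  qed
 qed
 have "expectation ?B <= expectation ?E" by (rule integral_mono[OF iL iR pt])
 also have "... = C^2 * (s powr a + s powr (a - 1) * (2 * expectation S + 2 * B^2 * s))" using Si by (simp add: prob_space)
 also have "... = C^2 * (s powr a + (s powr (a - 1) * s) * (4 * real CARD('n) * c + 2 * B^2))" unfolding ES by (simp add: algebra_simps)
 also have "s powr (a - 1) * s = s powr a"
 proof -
  have "s powr (a - 1) * s = s powr (a - 1) * s powr 1" using s by simp
  then show ?thesis by (simp only: powr_add[symmetric]) simp
 qed
 also have "s powr a = \<Delta> powr (2 * (a * H))" by (simp add: s_def powr_powr mult_ac)
 also have "C^2 * (\<Delta> powr (2 * (a * H)) + \<Delta> powr (2 * (a * H)) * (4 * real CARD('n) * c + 2 * B^2)) =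
  C^2 * (1 + 4 * real CARD('n) * c + 2 * B^2) * \<Delta> powr (2 * (a * H))" by (simp add: algebra_simps)
 finally show ?thesis by (simp add: \<Delta>_def)
qed

lemma euler_measurable:
 fixes b :: "real ^ 'n => real ^ 'n" and W :: "nat => 'w => real ^ 'n"
 assumes bm: "b : borel_measurable borel" and W: "!!j. j <= i ==> W j : borel_measurable M"
 shows "(%w. euler b x0 N (%i. W i w) i) : borel_measurable M"
proof -
 have "(%w. euler_drift b x0 N (%i. W i w) i) : borel_measurable M" using W
 proof (induction i)
  case (Suc i)
  have "(%w. x0 + W i w + euler_drift b x0 N (%i. W i w) i) : borel_measurable M"
   using Suc by (intro borel_measurable_add borel_measurable_const) auto
  from measurable_compose[OF this bm] show ?case using Suc by simp
 qed simp
 then show ?thesis unfolding euler_def using W by (intro borel_measurable_add borel_measurable_const) auto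
qed

text \<open>Row i - 1 of \<open>L\<close> belongs to the time i / N, since the grid of
  \<open>fbm_innovations\<close> starts at 1 / N; index 0 is the start, where the path is 0. For
  triangular \<open>L\<close> the point \<open>i\<close> involves innovations of index below
  \<open>i\<close> only.\<close>

definition grid_path :: "(nat => nat => real) => nat => (nat \<times> 'n => real) => nat => real ^ 'n" where
 "grid_path L N z i = (\<chi> e. SUM l<N. (if i = 0 then 0 else L (i - 1) l) * z (l, e))"

text \<open>\<open>G\<close> inverts \<open>L\<close>, so shifting the innovations by the image of
  \<open>D\<close> under \<open>G\<close> shifts the path by \<open>D\<close>.\<close>

lemma grid_path_shift:
 fixes D :: "nat => real ^ 'n"
 assumes LG: "!!i j. i < N ==> j < N ==> (SUM k<N. L i k * G k j) = of_bool (i = j)" and D: "D 0 = 0" and i: "i <= N"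
  and z': "!!k e. k < N ==> z' (k, e) = z (k, e) + (SUM l<N. G k l * D (Suc l) $ e)"
 shows "grid_path L N z' i = grid_path L N z i + D i"
proof (cases i)
 case 0
 then show ?thesis using D by (simp add: grid_path_def vec_eq_iff)
next
 case (Suc k)
 then have k: "k < N" using i by simp
 have "(SUM l<N. L k l * z' (l, e)) = (SUM l<N. L k l * z (l, e)) + D (Suc k) $ e" for e
 proof -
  have "(SUM l<N. L k l * z' (l, e)) = (SUM l<N. L k l * z (l, e) + (SUM p<N. L k l * G l p * D (Suc p) $ e))"
   by (intro sum.cong refl) (simp add: z' distrib_left sum_distrib_left mult.assoc)
  also have "... = (SUM l<N. L k l * z (l, e)) + (SUM p<N. (SUM l<N. L k l * G l p) * D (Suc p) $ e)"
   unfolding sum.distrib sum_distrib_right by (subst sum.swap) (rule refl)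
  also have "(SUM p<N. (SUM l<N. L k l * G l p) * D (Suc p) $ e) = (SUM p<N. if p = k then D (Suc p) $ e else 0)"
   by (intro sum.cong refl) (simp add: LG[OF k])
  also have "... = D (Suc k) $ e" using k by simp
  finally show ?thesis .
 qed
 then show ?thesis unfolding Suc by (simp add: grid_path_def vec_eq_iff)
qed

text \<open>The polygon is a noise path with other innovations \<open>T z\<close>, namely
  \<open>z\<close> plus the image of the drift under \<open>G\<close>. The drift is a function of
  the polygon itself, so the shift is a function \<open>v\<close> of \<open>T z\<close>, and it is
  triangular because the drift up to a grid time uses earlier innovations only. On the event of
  bounded energy, \<open>triangular_shift_measure\<close> then compares the polygon with the
  noise.\<close>

lemma girsanov_euler:
 fixes b :: "real ^ 'n => real ^ 'n" and Reg :: "(nat => real ^ 'n) => bool"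
 assumes LG: "!!i j. i < N ==> j < N ==> (SUM k<N. L i k * G k j) = of_bool (i = j)"
  and L: "!!i j. i < j ==> L i j = 0" and G: "!!i j. i < j ==> G i j = 0"
  and bm: "b : borel_measurable borel"
  and S: "{z : space (gauss ({..<N} \<times> UNIV)). ~ Reg (%i. start + grid_path L N z i)} : sets (gauss ({..<N} \<times> UNIV))"
  and Reg: "!!\<xi> \<xi>'. (!!i. i < N ==> \<xi> i = \<xi>' i) ==> Reg \<xi> \<longleftrightarrow> Reg \<xi>'"
 shows "EX E : sets (gauss ({..<N} \<times> UNIV)).
  {z : space (gauss ({..<N} \<times> UNIV)). ~ Reg (euler b start N (grid_path L N z)) &
   (SUM (k, e):{..<N} \<times> UNIV. (SUM l<N. G k l * euler_drift b start N (grid_path L N z) (Suc l) $ e)^2) <= m} \<subseteq> E &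
  measure (gauss ({..<N} \<times> UNIV)) E <=
   exp (m / 2) * sqrt (measure (gauss ({..<N} \<times> UNIV))
    {z : space (gauss ({..<N} \<times> UNIV)). ~ Reg (%i. start + grid_path L N z i)})"
proof -
 let ?I = "{..<N} \<times> (UNIV :: 'n set)"
 let ?P = "gauss ?I"
 let ?S = "{z : space ?P. ~ Reg (%i. start + grid_path L N z i)}"
 define D where "D z = euler_drift b start N (grid_path L N z)" for z :: "nat \<times> 'n => real"
 \<comment> \<open>The drift as a function of the perturbed path: \<open>b\<close> is evaluated
   along \<open>start + grid_path L N z\<close>, which at \<open>T z\<close> in place of
   \<open>z\<close> is the polygon.\<close>
 define v where "v p z = (SUM l<N. G (fst p) l * ((1 / real N) *\<^sub>R (SUM j<=l. b (start + grid_path L N z j))) $ snd p)" for p and z :: "nat \<times> 'n => real"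
 define T where "T z = (\<lambda>p\<in>?I. z p + (SUM l<N. G (fst p) l * D z (Suc l) $ snd p))" for z :: "nat \<times> 'n => real"
 have gT: "grid_path L N (T z) i = grid_path L N z i + D z i" if "i <= N" for z i by (rule grid_path_shift[OF LG _ that]) (simp_all add: D_def T_def)
 have pT: "start + grid_path L N (T z) i = euler b start N (grid_path L N z) i" if "i <= N" for z i
  using gT[OF that, of z] by (simp add: euler_def D_def)
 have vT: "v p (T z) = (SUM l<N. G (fst p) l * D z (Suc l) $ snd p)" for p z
 proof -
  have "(1 / real N) *\<^sub>R (SUM j<=l. b (start + grid_path L N (T z) j)) = D z (Suc l)" if "l < N" for l
  proof -
   have "(SUM j<=l. b (start + grid_path L N (T z) j)) = (SUM j<Suc l. b (euler b start N (grid_path L N z) j))"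
    using that by (intro sum.cong) (auto simp: pT)
   then show ?thesis unfolding D_def by (simp only: euler_drift_sum)
  qed
  then show ?thesis unfolding v_def by (intro sum.cong refl) simp
 qed
 have gm: "(%z. grid_path L N z i) : borel_measurable ?P" for i unfolding grid_path_def
  by (intro borel_measurable_vec_lambda borel_measurable_sum borel_measurable_times borel_measurable_const std_normal_coordinate_measurable) simp
 have vm: "v p : borel_measurable ?P" for p
 proof -
  have "(%z. b (start + grid_path L N z j)) : borel_measurable ?P" for j
   by (rule measurable_compose[OF _ bm]) (intro borel_measurable_add borel_measurable_const gm)
  then show ?thesis unfolding v_def[abs_def]
   by (intro borel_measurable_sum borel_measurable_times borel_measurable_const vec_nth_measurable borel_measurable_scaleR)
 qed
 have vd: "v p z = v p z'" if p: "p : ?I" and eq: "!!k. k : ?I ==> fst k < fst p ==> z k = z' k" for p z z' unfolding v_def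
 proof (intro sum.cong refl)
  fix l assume l: "l : {..<N}"
  show "G (fst p) l * ((1 / real N) *\<^sub>R (SUM j<=l. b (start + grid_path L N z j))) $ snd p =
   G (fst p) l * ((1 / real N) *\<^sub>R (SUM j<=l. b (start + grid_path L N z' j))) $ snd p"
  proof (cases "l <= fst p")
   case False
   then show ?thesis using G by simp
  next
   case True
   have "grid_path L N z j = grid_path L N z' j" if j: "j <= l" for j
   proof -
    have "(if j = 0 then 0 else L (j - 1) q) * z (q, e) = (if j = 0 then 0 else L (j - 1) q) * z' (q, e)" if q: "q < N" for q and e :: 'n
    proof (cases "j = 0 \<or> j - 1 < q")
     case True
     then show ?thesis using L by auto
    next
     case False
     then have "q < fst p" using j True by linarith
     then show ?thesis using eq[of "(q, e)"] q by simp
    qed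
    then show ?thesis unfolding grid_path_def vec_eq_iff vec_lambda_beta lessThan_iff[symmetric] by (intro allI sum.cong refl)
   qed
   then show ?thesis by simp
  qed
 qed
 have "EX E : sets ?P. {z : space ?P. T z : ?S & (SUM i:?I. (v i (T z))^2) <= m} \<subseteq> E & measure ?P E <= exp (m / 2) * sqrt (measure ?P ?S)"
 proof (rule triangular_shift_measure[where r = fst])
  show "T z p = z p + v p (T z)" if "p : ?I" for z p
  proof -
   have "T z p = z p + (SUM l<N. G (fst p) l * D z (Suc l) $ snd p)" unfolding T_def using that by (rule restrict_apply')
   then show ?thesis unfolding vT .
  qed
  show "T z : extensional ?I" for z unfolding T_def by (rule restrict_extensional)
  show "finite ?I" by simp
  show "v i : borel_measurable ?P" for i by (rule vm)
  show "v p z = v p z'" if "p : ?I" "!!k. k : ?I ==> fst k < fst p ==> z k = z' k" for p z z' using that by (rule vd)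
  show "?S : sets ?P" by (rule S)
 qed
 then obtain E where E: "E : sets ?P" "{z : space ?P. T z : ?S & (SUM i:?I. (v i (T z))^2) <= m} \<subseteq> E"
  "measure ?P E <= exp (m / 2) * sqrt (measure ?P ?S)" by blast
 have "{z : space ?P. ~ Reg (euler b start N (grid_path L N z)) &
   (SUM (k, e):?I. (SUM l<N. G k l * euler_drift b start N (grid_path L N z) (Suc l) $ e)^2) <= m} \<subseteq> E"
 proof
  fix z assume z: "z : {z : space ?P. ~ Reg (euler b start N (grid_path L N z)) &
   (SUM (k, e):?I. (SUM l<N. G k l * euler_drift b start N (grid_path L N z) (Suc l) $ e)^2) <= m}"
  have "T z : space ?P" by (simp add: space_PiM T_def)
  moreover have "Reg (%i. start + grid_path L N (T z) i) \<longleftrightarrow> Reg (euler b start N (grid_path L N z))" by (rule Reg) (simp add: pT)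
  ultimately have "T z : ?S" using z by simp
  moreover have "(SUM i:?I. (v i (T z))^2) <= m" using z unfolding vT D_def by (simp add: case_prod_beta)
  ultimately show "z : E" using E(2) z by blast
 qed
 then show ?thesis using E(1,3) by blast
qed

text \<open>Either the energy of the drift is at least \<open>mm\<close>, which has probability at
  most \<delta> / 2 by Markov's inequality and \<open>expected_drift_energy\<close>, or
  \<open>girsanov_euler\<close> applies and costs exp (mm / 2) and a square root. The order of the
  choices matters: \<open>mm\<close> depends neither on the grid nor on \<open>R\<close>, which is
  chosen after it.\<close>

lemma euler_not_regular_measure:
 fixes b :: "real ^ 'n => real ^ 'n" and W :: "real => 'w => real ^ 'n"
 assumes fbm: "fractional_brownian_motion M H W" and H: "0 < H" "H < 1"
  and bm [measurable]: "b : borel_measurable borel" and bB: "!!y. norm (b y) <= B"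
  and hb: "!!y z. norm (b y - b z) <= C * norm (y - z) powr a" and C: "0 < C" and a: "0 < a" "a <= 1"
  and \<epsilon>: "0 < \<epsilon>" "\<epsilon> <= 1" and \<theta>: "\<theta> = H * (1 + \<epsilon> - a)" "\<theta> < 1/2" and \<gamma>: "\<gamma> < 1 - \<theta>"
  and \<delta>: "0 < \<delta>"
 obtains R where "0 <= R"
  "!!m. measure M {v : space M. ~ regular_points b H \<rho> (2 powr (- \<gamma>)) (2 powr (- \<epsilon> / 2)) R m
   (euler b start (2 ^ m) (%i. W (real i / 2 ^ m) v))} <= \<delta>"
proof -
 interpret prob_space M using fbm by (simp add: fractional_brownian_motion_def)
 obtain c where c: "0 < c" and cov: "!!i s t. s : {0..1} ==> t : {0..1} ==> expectation (%v. W s v $ i * W t v $ i) =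
     c * (t powr (2 * H) + s powr (2 * H) - \<bar>t - s\<bar> powr (2 * H))" using fbm unfolding fractional_brownian_motion_def by blast
 define c0 where "c0 = c / (mvn_const H * H)"
 have c0: "0 < c0" using c H mvn_const_pos[OF H] by (simp add: c0_def)
 \<comment> \<open>The mean-square Hoelder exponent of the slopes in time. It exceeds H - 1/2
   because H (1 - a) <= \<theta> < 1/2.\<close>
 define th where "th = a * H"
 have th: "0 < th" "H - 1/2 < th"
 proof -
  have "H * (1 - a) <= \<theta>" unfolding \<theta>(1) using H \<epsilon> by (intro mult_left_mono) auto
  then show "0 < th" "H - 1/2 < th" using a H \<theta>(2) by (auto simp: th_def algebra_simps)
 qed
 define Dc where "Dc = C^2 * (1 + 4 * real CARD('n) * c + 2 * B^2)"
 have Dc: "0 <= Dc" using c by (simp add: Dc_def)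
 define Q where "Q = B^2 / (1 - H) + 4 * Dc * (1 + 2 powr th * \<bar>1/2 - H\<bar> / (th + (1/2 - H)))^2 + 2 * Dc / (1 - H)"
 have Q: "0 <= Q" using H Dc by (simp add: Q_def)
 define Be where "Be = Beta (3/2 - H) (H + 1/2)"
 have Be: "0 < Be" unfolding Be_def using H by (simp add: Beta_def)
 \<comment> \<open>The constant of the Cameron--Martin inequality, divided by the square of the Beta
   factor in \<open>drift_derivative_inner\<close>.\<close>
 define \<kappa> where "\<kappa> = mvn_const H / (2 * c) / Be^2"
 have \<kappa>: "0 < \<kappa>" using mvn_const_pos[OF H] c Be by (simp add: \<kappa>_def)
 define mm where "mm = 2 * (\<kappa> * (real CARD('n) * Q)) / \<delta> + 1"
 have mm0: "0 < mm" using \<kappa> Q \<delta> by (simp add: mm_def add_nonneg_pos)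
 have mm: "\<kappa> * (real CARD('n) * Q) / mm <= \<delta> / 2"
 proof -
  have "2 * (\<kappa> * (real CARD('n) * Q)) / \<delta> <= mm" by (simp add: mm_def)
  then have "2 * (\<kappa> * (real CARD('n) * Q)) <= mm * \<delta>" using \<delta> by (simp add: pos_divide_le_eq)
  then show ?thesis using mm0 by (simp add: pos_divide_le_eq mult.commute)
 qed
 \<comment> \<open>Chosen to make exp (mm / 2) times the square root of \<delta>' equal to \<delta>
   / 2.\<close>
 define \<delta>' where "\<delta>' = (\<delta> / 2 / exp (mm / 2))^2"
 have \<delta>': "0 < \<delta>'" using \<delta> by (simp add: \<delta>'_def)
 obtain R where R: "0 <= R" and Rm: "!!m bb. (!!i l. i < 2 ^ m ==> i <= l ==> bb i l = 0) ==>
   (!!i s. i < 2 ^ m ==> s < i ==> c0 * (real (i - s) / real (2 ^ m)) powr (2 * H) <= (SUM l = s..<2 ^ m. (bb i l)^2)) ==>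
   measure (gauss ({..<2 ^ m} \<times> UNIV)) {z : space (gauss ({..<2 ^ m} \<times> UNIV)).
    ~ regular_points b H \<rho> (2 powr (- \<gamma>)) (2 powr (- \<epsilon> / 2)) R m (%i. start + (\<chi> k. SUM l<2 ^ m. bb i l * z (l, k)))} <= \<delta>'"
 proof (rule not_regular_points_measure[where \<rho> = \<rho> and start = start, OF bm bB hb C a H(1) \<epsilon> \<theta> \<gamma> c0 \<delta>'], goal_cases)
  case (1 R)
  show ?case by (rule 1(1)[OF 1(2,3)])
 qed
 show thesis
 proof (rule that[OF R])
  fix m
  define N where "N = (2::nat) ^ m"
  have N: "0 < N" by (simp add: N_def)
  have N2: "(2::real) ^ m = real N" by (simp add: N_def)
  let ?Reg = "regular_points b H \<rho> (2 powr (- \<gamma>)) (2 powr (- \<epsilon> / 2)) R m"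
  let ?I = "{..<N} \<times> (UNIV :: 'n set)"
  let ?P = "gauss ?I"
  let ?t = "%k. real (Suc k) / real N"
  obtain L G :: "nat => nat => real" where L: "!!i j. i < j ==> L i j = 0" and G: "!!i j. i < j ==> G i j = 0"
   and LG: "!!i j. i < N ==> j < N ==> (SUM k<N. L i k * G k j) = of_bool (i = j)"
   and GG: "!!i j. i < N ==> j < N ==> (SUM k<N. SUM l<N. G i k * G j l *
    (c * (?t k powr (2 * H) + ?t l powr (2 * H) - \<bar>?t k - ?t l\<bar> powr (2 * H)))) = of_bool (i = j)"
   and nd: "!!i s. i < N ==> s <= i ==> c / (mvn_const H * H) * (real (Suc i - s) / real N) powr (2 * H) <= (SUM l = s..<N. (L i l)^2)"
   and CM: "!!g. g : borel_measurable borel ==> integrable lborel (%u. (g u)^2) ==>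
    (SUM i<N. (SUM k<N. G i k * (LBINT u. mvn_kernel H (?t k) u * g u))^2) <= mvn_const H / (2 * c) * (LBINT u. (g u)^2)"
  proof (rule fbm_innovations[OF H c N], goal_cases)
   case (1 L G)
   show ?case by (rule 1(1)[OF 1(2-)])
  qed
  define w where "w v i = W (real i / real N) v" for v i
  define X where "X i v = euler b start N (w v) i" for i v
  define \<Phi> where "\<Phi> v = (\<lambda>(k, i)\<in>?I. SUM l<N. G k l * W (?t l) v $ i)" for v
  have t01: "?t k : {0..1}" if "k < N" for k using that by (simp add: field_simps)
  have i01: "real i / real N : {0..1}" if "i <= N" for i using that N by (simp add: field_simps)
  have dP: "distr M (PiM ?I (%_. borel)) \<Phi> = ?P" unfolding \<Phi>_def
  proof (rule fbm_innovations_iid[OF fbm t01 _ cov])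
   show "inj_on ?t {..<N}" using N by (auto intro!: inj_onI)
   show "(SUM k<N. SUM l<N. G i k * G j l * (c * (?t l powr (2 * H) + ?t k powr (2 * H) - \<bar>?t l - ?t k\<bar> powr (2 * H)))) = of_bool (i = j)"
    if "i < N" "j < N" for i j
   proof -
    have "?t l powr (2 * H) + ?t k powr (2 * H) - \<bar>?t l - ?t k\<bar> powr (2 * H) = ?t k powr (2 * H) + ?t l powr (2 * H) - \<bar>?t k - ?t l\<bar> powr (2 * H)" for k l
     by (simp only: abs_minus_commute[of "?t l" "?t k"] add.commute[of "?t l powr (2 * H)"])
    then show ?thesis using GG[OF that] by (simp only:)
   qed
  qed
  have \<Phi>m: "\<Phi> : M \<rightarrow>\<^sub>M PiM ?I (%_. borel)" unfolding \<Phi>_def case_prod_beta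
   by (intro measurable_restrict borel_measurable_sum borel_measurable_times borel_measurable_const fbm_coordinate(1)[OF fbm] t01) auto
  have sP: "sets ?P = sets (PiM ?I (%_. borel))" by (simp flip: dP)
  have S: "{z : space ?P. ~ ?Reg (%i. start + grid_path L N z i)} : sets ?P"
  proof -
   have "(%z. start + grid_path L N z i) : borel_measurable ?P" for i unfolding grid_path_def
    by (intro borel_measurable_add borel_measurable_vec_lambda borel_measurable_sum borel_measurable_times borel_measurable_const std_normal_coordinate_measurable) simp
   from regular_points_measurable[OF bm this, where H = H and \<rho> = \<rho> and R = R and m = m]
   show ?thesis by measurable
  qed
  have Sm: "measure ?P {z : space ?P. ~ ?Reg (%i. start + grid_path L N z i)} <= \<delta>'" unfolding grid_path_def N_def
  proof (rule Rm)
   show "(if i = 0 then 0 else L (i - 1) l) = 0" if "i <= l" for i l using that L[of "i - 1" l] by auto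
   show "c0 * (real (i - s) / real (2 ^ m)) powr (2 * H) <= (SUM l = s..<2 ^ m. (if i = 0 then 0 else L (i - 1) l)^2)"
    if "i < 2 ^ m" "s < i" for i s using nd[of "i - 1" s] that by (simp add: N_def c0_def)
  qed
  have "EX E : sets ?P. {z : space ?P. ~ ?Reg (euler b start N (grid_path L N z)) &
    (SUM (k, e):?I. (SUM l<N. G k l * euler_drift b start N (grid_path L N z) (Suc l) $ e)^2) <= mm} \<subseteq> E &
   measure ?P E <= exp (mm / 2) * sqrt (measure ?P {z : space ?P. ~ ?Reg (%i. start + grid_path L N z i)})"
   by (rule girsanov_euler[OF LG L G bm S]) (auto intro!: regular_points_cong simp: N_def)
  then obtain E where E: "E : sets ?P"
   and Esub: "{z : space ?P. ~ ?Reg (euler b start N (grid_path L N z)) &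
    (SUM (k, e):?I. (SUM l<N. G k l * euler_drift b start N (grid_path L N z) (Suc l) $ e)^2) <= mm} \<subseteq> E"
   and Em: "measure ?P E <= exp (mm / 2) * sqrt (measure ?P {z : space ?P. ~ ?Reg (%i. start + grid_path L N z i)})" by (elim bexE conjE)
  have E\<delta>: "measure ?P E <= \<delta> / 2"
  proof -
   have "exp (mm / 2) * sqrt (measure ?P {z : space ?P. ~ ?Reg (%i. start + grid_path L N z i)}) <= exp (mm / 2) * sqrt \<delta>'"
    using Sm by (intro mult_left_mono real_sqrt_le_mono) auto
   also have "... = \<delta> / 2" using \<delta> by (simp add: \<delta>'_def)
   finally show ?thesis using Em by simp
  qed
  define g where "g e v u = drift_derivative H N (%j. b (X j v) $ e) u" for e v u
  define J where "J e v = (LBINT u. (g e v u)^2)" for e v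
  have wm: "(%v. w v i) : borel_measurable M" if "i <= N" for i unfolding w_def using fbm_coordinate(3)[OF fbm i01[OF that]] by simp
  have Xm: "X i : borel_measurable M" if "i <= N" for i unfolding X_def[abs_def] using that by (intro euler_measurable bm wm) auto
  have be: "(%v. b (X j v) $ e) : borel_measurable M" if "j < N" for j e
   by (rule vec_nth_measurable, rule measurable_compose[OF Xm bm]) (use that in simp)
  have bb: "\<bar>b y $ e\<bar> <= B" for y e using component_le_norm_cart[of "b y" e] bB[of y] by linarith
  have inc: "expectation (%v. (b (X k v) $ e - b (X j v) $ e)^2) <= Dc * (real (k - j) / real N) powr (2 * th)" if "j < k" "k < N" for j k e
   unfolding Dc_def th_def
  proof (rule euler_increment_moment[OF fbm H cov bm bB hb C a c that])
   show "X i v = euler b start N (%i. W (real i / real N) v) i" for i v by (simp add: X_def w_def[abs_def])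
   show "X i : borel_measurable M" if "i < N" for i using that by (intro Xm) simp
  qed
  have Ji: "integrable M (J e)" and JE: "expectation (J e) <= Q" for e unfolding J_def g_def Q_def
   by (rule expected_drift_energy[where th = th, OF prob_space_axioms be bb H th Dc inc]; assumption)+
  define V where "V v = (SUM (k, e):?I. (SUM l<N. G k l * euler_drift b start N (w v) (Suc l) $ e)^2)" for v
  have V: "V v <= \<kappa> * (SUM e:UNIV. J e v)" for v
  proof -
   have gm: "g e v : borel_measurable borel" for e unfolding g_def drift_derivative_def by measurable
   have gi: "integrable lborel (%u. (g e v u)^2)" for e unfolding g_def drift_derivative_def
    by (rule integrable_sum_mult_sq) (use H in \<open>auto intro!: pos_part_sq_integrable\<close>)
   have "(SUM k<N. (SUM l<N. G k l * euler_drift b start N (w v) (Suc l) $ e)^2) <= \<kappa> * J e v" for e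
   proof -
    have d: "euler_drift b start N (w v) (Suc l) $ e = (LBINT u. mvn_kernel H (?t l) u * g e v u) / Be" if "l < N" for l
    proof -
     have "euler_drift b start N (w v) (Suc l) $ e = (SUM j<=l. b (X j v) $ e) / real N"
      unfolding euler_drift_sum lessThan_Suc_atMost X_def by simp
     moreover have "(LBINT u. mvn_kernel H (?t l) u * g e v u) = Be * ((SUM j<=l. b (X j v) $ e) / N)"
      unfolding g_def Be_def by (rule drift_derivative_inner[OF H that])
     ultimately show ?thesis using Be by simp
    qed
    have "(SUM k<N. (SUM l<N. G k l * euler_drift b start N (w v) (Suc l) $ e)^2) =
     (SUM k<N. ((SUM l<N. G k l * (LBINT u. mvn_kernel H (?t l) u * g e v u)) / Be)^2)" unfolding sum_divide_distrib
     by (intro sum.cong refl arg_cong[where f = "%x. x^2"]) (simp only: d lessThan_iff times_divide_eq_right)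
    also have "... = (SUM k<N. (SUM l<N. G k l * (LBINT u. mvn_kernel H (?t l) u * g e v u))^2) / Be^2"
     by (simp only: power_divide sum_divide_distrib[where r = "Be^2"])
    also have "... <= (mvn_const H / (2 * c) * (LBINT u. (g e v u)^2)) / Be^2" by (intro divide_right_mono CM gm gi) simp
    also have "... = \<kappa> * J e v" by (simp add: \<kappa>_def J_def)
    finally show ?thesis .
   qed
   then have "(SUM e:UNIV. SUM k<N. (SUM l<N. G k l * euler_drift b start N (w v) (Suc l) $ e)^2) <= (SUM e:UNIV. \<kappa> * J e v)"
    by (intro sum_mono)
   moreover have "V v = (SUM e:UNIV. SUM k<N. (SUM l<N. G k l * euler_drift b start N (w v) (Suc l) $ e)^2)"
    unfolding V_def sum.cartesian_product[symmetric] by (rule sum.swap)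
   ultimately show ?thesis by (simp add: sum_distrib_left)
  qed
  let ?JJ = "%v. \<kappa> * (SUM e:UNIV. J e v)"
  have JJi: "integrable M ?JJ" by (intro integrable_mult_right L_integrable_sum Ji)
  have J0: "0 <= J e v" for e v unfolding J_def by (rule L_integral_nonneg) simp
  have Vm: "measure M {v : space M. mm <= ?JJ v} <= \<delta> / 2"
  proof -
   have "measure M {v : space M. mm <= ?JJ v} <= expectation ?JJ / mm"
    by (rule integral_Markov_inequality_measure[OF JJi sets.top _ mm0]) (use \<kappa> J0 in \<open>auto intro!: AE_I2 mult_nonneg_nonneg sum_nonneg\<close>)
   also have "expectation ?JJ = \<kappa> * (SUM e:UNIV. expectation (J e))" using L_integral_sum[of UNIV M J, OF Ji] by simp
   also have "... <= \<kappa> * (real CARD('n) * Q)"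
   proof -
    have "(SUM e:(UNIV :: 'n set). expectation (J e)) <= (SUM e:(UNIV :: 'n set). Q)" by (intro sum_mono JE)
    then show ?thesis using \<kappa> by simp
   qed
   finally have "measure M {v : space M. mm <= ?JJ v} <= \<kappa> * (real CARD('n) * Q) / mm" using mm0 by (simp add: divide_right_mono)
   then show ?thesis using mm by linarith
  qed
  \<comment> \<open>The process starts at 0 only almost surely, through its variance, whereas
    \<open>grid_path\<close> does so exactly; hence the inclusion of events below holds almost
    everywhere.\<close>
  have W0: "AE v in M. w v 0 = 0"
  proof -
   have "AE v in M. W 0 v $ i = 0" for i
   proof -
    note F = fbm_coordinate(1,2)[OF fbm, of 0 i]
    have "expectation (%v. (W 0 v $ i)^2) = 0" using cov[of 0 0 i] by (simp add: power2_eq_square)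
    then have "AE v in M. (W 0 v $ i)^2 = 0" using F by (subst (asm) integral_nonneg_eq_0_iff_AE) auto
    then show ?thesis by simp
   qed
   then have "AE v in M. ALL i. W 0 v $ i = 0" by (subst AE_all_countable) simp
   then show ?thesis by (auto simp: w_def vec_eq_iff)
  qed
  let ?Bad = "{v : space M. ~ ?Reg (euler b start (2 ^ m) (%i. W (real i / 2 ^ m) v))}"
  let ?E' = "\<Phi> -` E \<inter> space M" and ?J' = "{v : space M. mm <= ?JJ v}"
  have E': "?E' : sets M" using E unfolding sP by (rule measurable_sets[OF \<Phi>m])
  have J': "?J' : sets M" using borel_measurable_integrable[OF JJi] by measurable
  have gp: "grid_path L N (\<Phi> v) i = w v i" if "w v 0 = 0" "i <= N" for v i
  proof -
   have "grid_path L N (\<Phi> v) i = grid_path L N (%_. 0) i + w v i"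
    by (rule grid_path_shift[where D = "w v", OF LG that]) (simp_all add: \<Phi>_def w_def)
   then show ?thesis by (simp add: grid_path_def vec_eq_iff)
  qed
  have "measure M ?Bad <= measure M (?E' \<union> ?J')"
  proof (rule finite_measure_mono_AE)
   show "AE v in M. v : ?Bad --> v : ?E' \<union> ?J'" using W0
   proof (eventually_elim, intro impI)
    fix v assume w0: "w v 0 = 0" and bad: "v : ?Bad"
    have ge: "euler b start N (grid_path L N (\<Phi> v)) i = euler b start N (w v) i" if "i <= N" for i
     by (rule euler_cong) (use gp[OF w0] that in auto)
    have gd: "euler_drift b start N (grid_path L N (\<Phi> v)) i = euler_drift b start N (w v) i" if "i <= N" for i
     by (rule euler_drift_cong) (use gp[OF w0] that in auto)
    have "?Reg (euler b start N (grid_path L N (\<Phi> v))) \<longleftrightarrow> ?Reg (euler b start N (w v))"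
     by (rule regular_points_cong) (use ge in \<open>simp add: N_def\<close>)
    then have nr: "~ ?Reg (euler b start N (grid_path L N (\<Phi> v)))" using bad by (simp add: w_def[abs_def] N_def)
    have Vg: "(SUM (k, e):?I. (SUM l<N. G k l * euler_drift b start N (grid_path L N (\<Phi> v)) (Suc l) $ e)^2) = V v"
     unfolding V_def case_prod_beta
     by (intro sum.cong refl arg_cong[where f = "%x. x^2"] arg_cong2[where f = "(*)"] arg_cong2[where f = "vec_nth"] gd) auto
    have sp: "\<Phi> v : space ?P" using measurable_space[OF \<Phi>m] bad sets_eq_imp_space_eq[OF sP] by auto
    show "v : ?E' \<union> ?J'"
    proof (cases "V v <= mm")
     case True
     then have "\<Phi> v : E" using Esub nr sp Vg by (intro subsetD[OF Esub]) simp
     then show ?thesis using bad by simp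
    next
     case False
     then have "mm <= ?JJ v" using V[of v] by linarith
     then show ?thesis using bad by simp
    qed
   qed
  qed (use E' J' in auto)
  also have "... <= measure M ?E' + measure M ?J'" by (rule measure_Un_le[OF E' J'])
  also have "measure M ?E' = measure ?P E" unfolding dP[symmetric] by (rule measure_distr[symmetric, OF \<Phi>m]) (use E sP in simp)
  also have "measure ?P E + measure M ?J' <= \<delta>" using E\<delta> Vm by simp
  finally show "measure M ?Bad <= \<delta>" by simp
 qed
qed

section \<open>Choice of the exponents and of the null set\<close>

theorem theorem1p9:
 fixes H \<alpha> :: real and b :: "real ^ 'n \<Rightarrow> real ^ 'n"
  and x\<^sub>0 :: "real ^ 'n" and \<mu> :: "(real \<Rightarrow> real ^ 'n) measure"
 assumes "0 < H" "H < 1"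
  and "\<alpha> > 0" "\<alpha> > 1 - 1 / (2 * H)"
  and "b \<in> besov_holder \<alpha>"
  and "fbm_law H \<mu>"
 shows "\<exists>N \<in> sets borel_C01. emeasure \<mu> N = 0 \<and>
  (\<forall>w \<in> mspace C01 - N. \<exists>!x. x \<in> mspace C01 \<and>
   (\<forall>t\<in>{0..1}. x t = x\<^sub>0 + integral {0..t} (\<lambda>s. b (x s)) + w t))"
proof -
 note H = assms(1,2)
 \<comment> \<open>A midpoint: a < 1 and a <= \<alpha> are needed for Hoelder continuity, and a > 1
   - 1 / (2 H) gives H (1 - a) < 1/2.\<close>
 define a where "a = (max 0 (1 - 1 / (2 * H)) + min \<alpha> 1) / 2"
 have avg: "p < s ==> 0 <= p ==> v <= p ==> s <= u ==> s <= 1 ==> 0 < (p + s) / 2 & (p + s) / 2 < 1 & (p + s) / 2 <= u & v < (p + s) / 2" for p s u v :: real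
  by auto
 have a: "0 < a" "a < 1" "a <= \<alpha>" "1 - 1 / (2 * H) < a"
 proof -
  have "max 0 (1 - 1 / (2 * H)) < min \<alpha> 1" using assms H by auto
  moreover have "0 <= max 0 (1 - 1 / (2 * H))" "1 - 1 / (2 * H) <= max 0 (1 - 1 / (2 * H))" "min \<alpha> 1 <= \<alpha>" "min \<alpha> 1 <= 1"
   by (rule max.cobounded1 max.cobounded2 min.cobounded1 min.cobounded2)+
  ultimately show "0 < a" "a < 1" "a <= \<alpha>" "1 - 1 / (2 * H) < a" unfolding a_def
   using avg[of "max 0 (1 - 1 / (2 * H))" "min \<alpha> 1" "1 - 1 / (2 * H)" \<alpha>] by blast+
 qed
 have Ha: "H * (1 - a) < 1 / 2"
 proof -
  have "H * (1 - a) < H * (1 / (2 * H))" using a(4) H by (intro mult_strict_left_mono) auto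
  then show ?thesis using H by simp
 qed
 \<comment> \<open>At most half of the slack in H (1 - a) < 1/2 is spent on the extra spatial
   regularity.\<close>
 define \<epsilon> where "\<epsilon> = min 1 ((1/2 - H * (1 - a)) / (2 * H))"
 have \<epsilon>: "0 < \<epsilon>" "\<epsilon> <= 1" using Ha H by (auto simp: \<epsilon>_def)
 define \<theta> where "\<theta> = H * (1 + \<epsilon> - a)"
 have \<theta>: "0 < \<theta>" "\<theta> < 1 / 2"
 proof -
  show "0 < \<theta>" unfolding \<theta>_def using H a \<epsilon> by (intro mult_pos_pos) auto
  have "H * \<epsilon> <= H * ((1/2 - H * (1 - a)) / (2 * H))" using H by (intro mult_left_mono) (auto simp: \<epsilon>_def)
  also have "... = (1/2 - H * (1 - a)) / 2" using H by simp
  also have "... < 1/2 - H * (1 - a)" using Ha by simp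
  finally show "\<theta> < 1 / 2" unfolding \<theta>_def by (simp add: algebra_simps)
 qed
 \<comment> \<open>Strictly between 1/2 and 1 - \<theta>: the lower bound gives r r < 1/2 for the
   sewing, the upper one leaves room in the tail estimate.\<close>
 define \<gamma> where "\<gamma> = (1/2 + (1 - \<theta>)) / 2"
 have \<gamma>: "1/2 < \<gamma>" "\<gamma> < 1 - \<theta>" "\<gamma> < 1" using \<theta> by (auto simp: \<gamma>_def)
 define r where "r = 2 powr (- \<gamma>)"
 define q where "q = 2 powr (- \<epsilon> / 2)"
 have r: "1/2 <= r" "r < 1" "r * r < 1/2"
 proof -
  have "2 powr (- 1) <= r" unfolding r_def using \<gamma> by (intro powr_mono) auto
  then show "1/2 <= r" by (simp add: powr_minus_divide)
  show "r < 1" unfolding r_def using \<gamma> by (intro powr_less_one) auto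
  have "r * r = 2 powr (- \<gamma> + - \<gamma>)" unfolding r_def by (rule powr_add[symmetric])
  also have "... < 2 powr (- 1)" using \<gamma> by (intro powr_less_mono) auto
  finally show "r * r < 1/2" by (simp add: powr_minus_divide)
 qed
 have q: "0 < q" "q < 1" unfolding q_def using \<epsilon> by (auto intro: powr_less_one)
 have cb: "continuous_on UNIV b" and bb: "bounded (range b)" using assms(5) by (auto simp: besov_holder_def)
 then have bm: "b : borel_measurable borel" by (intro borel_measurable_continuous_onI)
 obtain B where bB: "!!y. norm (b y) <= B" using bb by (auto simp: bounded_iff)
 obtain C0 where C0: "0 <= C0" "!!y z. norm (b y - b z) <= C0 * norm (y - z) powr a" using besov_holder_imp_holder[OF assms(5) a(1,2,3)] by blast
 define C where "C = C0 + 1"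
 have C: "0 < C" using C0 by (simp add: C_def)
 have hb: "norm (b y - b z) <= C * norm (y - z) powr a" for y z using C0(2)[of y z] by (simp add: C_def distrib_right add_increasing2)
 obtain \<rho> :: nat where \<rho>: "2 * B < real \<rho>" using reals_Archimedean2 by blast
 have sp: "space \<mu> = mspace C01" and se: "sets \<mu> = sets borel_C01" and fbm: "fractional_brownian_motion \<mu> H (%t w. w t)"
  using assms(6) by (auto simp: fbm_law_def space_borel_C01)
 interpret prob_space \<mu> using fbm by (simp add: fractional_brownian_motion_def)
 let ?reg = "%R m w. regular_points b H \<rho> r q R m (euler b x\<^sub>0 (2 ^ m) (%i. w (real i / 2 ^ m)))"
 have exR: "EX R>=0. ALL m. measure \<mu> {w : space \<mu>. ~ ?reg R m w} <= 1 / real (Suc n)" for n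
 proof -
  have d: "0 < 1 / real (Suc n)" by simp
  show ?thesis
  proof (rule euler_not_regular_measure[OF fbm H bm bB hb C a(1) less_imp_le[OF a(2)] \<epsilon> \<theta>_def \<theta>(2) \<gamma>(2) d, where \<rho> = \<rho> and start = x\<^sub>0], goal_cases)
   case (1 R)
   show ?case by (intro exI[of _ R] conjI allI 1(1) 1(2)[folded r_def q_def])
  qed
 qed
 have "EX R. ALL n. 0 <= R n & (ALL m. measure \<mu> {w : space \<mu>. ~ ?reg (R n) m w} <= 1 / real (Suc n))" by (rule choice) (rule allI, rule exR)
 then obtain R where R': "ALL n. 0 <= R n & (ALL m. measure \<mu> {w : space \<mu>. ~ ?reg (R n) m w} <= 1 / real (Suc n))" ..
 then have R: "!!n. 0 <= R n" and Rm: "!!n m. measure \<mu> {w : space \<mu>. ~ ?reg (R n) m w} <= 1 / real (Suc n)" by simp_all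
 have bad: "{w : space \<mu>. ~ ?reg R m w} : sets \<mu>" for R m
 proof -
  \<comment> \<open>Beyond index 2^m the time leaves the unit interval, where paths take the value
    \<open>undefined\<close>. Points with index 2^m or more are not inspected by
    \<open>regular_points\<close> and are set to 0, so that all of them are measurable.\<close>
  let ?\<xi> = "%i w. if i < 2 ^ m then euler b x\<^sub>0 (2 ^ m) (%i. w (real i / 2 ^ m)) i else 0"
  have "?\<xi> i : borel_measurable \<mu>" for i
  proof (cases "i < 2 ^ m")
   case True
   have "(%w. euler b x\<^sub>0 (2 ^ m) (%i. w (real i / 2 ^ m)) i) : borel_measurable \<mu>"
   proof (rule euler_measurable[OF bm])
    fix j assume "j <= i"
    then have "real j <= 2 ^ m" using True by (metis le_less_trans less_imp_le of_nat_le_iff of_nat_numeral of_nat_power)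
    then have "real j / 2 ^ m : {0..1}" by simp
    then show "(%w. w (real j / 2 ^ m)) : borel_measurable \<mu>" by (rule fbm_coordinate(3)[OF fbm])
   qed
   then show ?thesis using True by simp
  qed simp
  from regular_points_measurable[OF bm this, where H = H and \<rho> = \<rho> and R = R and m = m and r = r and q = q]
  have "{w : space \<mu>. ~ regular_points b H \<rho> r q R m (%i. ?\<xi> i w)} : sets \<mu>" by measurable
  moreover have "regular_points b H \<rho> r q R m (%i. ?\<xi> i w) \<longleftrightarrow> ?reg R m w" for w by (rule regular_points_cong) simp
  ultimately show ?thesis by simp
 qed
 \<comment> \<open>A path in \<open>F n M\<close> is irregular with constant \<open>R n\<close> at
   every level from \<open>M\<close> on, so its probability is at most that of a single level. The
   sets increase with \<open>M\<close>, hence their union has probability at most 1 / (n + 1); a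
   path outside \<open>N\<close> is regular at infinitely many levels for some constant
   \<open>R n\<close>.\<close>
 define F where "F n M = (INT m:{M..}. {w : space \<mu>. ~ ?reg (R n) m w})" for n M
 define N where "N = (INT n. UN M. F n M)"
 have Fs: "F n M : sets \<mu>" for n M unfolding F_def by (rule sets.countable_INT') (use bad in auto)
 have Ns: "N : sets \<mu>" unfolding N_def using Fs by auto
 have mU: "measure \<mu> (UN M. F n M) <= 1 / real (Suc n)" for n
 proof -
  have "(%M. measure \<mu> (F n M)) \<longlonglongrightarrow> measure \<mu> (UN M. F n M)"
   by (rule finite_Lim_measure_incseq) (use Fs in \<open>auto simp: incseq_def F_def\<close>)
  moreover have F1: "measure \<mu> (F n M) <= 1 / real (Suc n)" for M
  proof -
   have "measure \<mu> (F n M) <= measure \<mu> {w : space \<mu>. ~ ?reg (R n) M w}" by (rule finite_measure_mono[OF _ bad]) (auto simp: F_def)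
   then show ?thesis using Rm[of n M] by linarith
  qed
  ultimately show ?thesis by (intro LIMSEQ_le_const2[OF _ exI[of _ 0]]) auto
 qed
 have "measure \<mu> N <= 1 / real (Suc n)" for n
 proof -
  have "measure \<mu> N <= measure \<mu> (UN M. F n M)" by (rule finite_measure_mono) (use Fs in \<open>auto simp: N_def\<close>)
  then show ?thesis using mU[of n] by linarith
 qed
 then have "measure \<mu> N <= 0" by (intro LIMSEQ_le_const[OF LIMSEQ_Suc[OF lim_1_over_n]]) auto
 then have N0: "emeasure \<mu> N = 0" by (simp add: emeasure_eq_measure measure_le_0_iff)
 have "\<exists>!x. x : mspace C01 & (ALL t:{0..1}. x t = x\<^sub>0 + integral {0..t} (%s. b (x s)) + w t)" if w: "w : mspace C01 - N" for w
 proof -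
  have wc: "continuous_on {0..1} w" using w by (simp add: mspace_C01)
  obtain n where n: "!!M. w ~: F n M" using w by (auto simp: N_def)
  have "EX m>=M. ?reg (R n) m w" for M using n[of M] w by (auto simp: F_def sp)
  then have inf: "infinite {m. ?reg (R n) m w}" unfolding infinite_nat_iff_unbounded_le by simp
  obtain x where x: "continuous_on {0..1} x" "ALL t:{0..1}. x t = x\<^sub>0 + integral {0..t} (%s. b (x s)) + w t"
   and u: "ALL x'. continuous_on {0..1} x' & (ALL t:{0..1}. x' t = x\<^sub>0 + integral {0..t} (%s. b (x' s)) + w t) --> (ALL t:{0..1}. x' t = x t)"
   using regular_path_unique_solution[OF wc bB hb less_imp_le[OF C] a(1) H(1) \<rho> q r R inf] by blast
  \<comment> \<open>Elements of the path space are \<open>undefined\<close> outside the unit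
    interval, so the solution has to be restricted.\<close>
  define y where "y = restrict x {0..1}"
  have yx: "y t = x t" if "t : {0..1}" for t using that by (simp add: y_def)
  have yc: "continuous_on {0..1} y" by (rule continuous_on_cong[THEN iffD2, OF refl yx x(1)])
  show ?thesis
  proof (rule ex1I[of _ y])
   show "y : mspace C01 & (ALL t:{0..1}. y t = x\<^sub>0 + integral {0..t} (%s. b (y s)) + w t)"
   proof (intro conjI ballI)
    show "y : mspace C01" using yc by (simp add: mspace_C01 y_def)
    fix t :: real assume t: "t : {0..1}"
    have "integral {0..t} (%s. b (y s)) = integral {0..t} (%s. b (x s))" by (rule integral_cong) (use t yx in auto)
    then show "y t = x\<^sub>0 + integral {0..t} (%s. b (y s)) + w t" using x(2) t yx by simp
   qed
   fix z assume z: "z : mspace C01 & (ALL t:{0..1}. z t = x\<^sub>0 + integral {0..t} (%s. b (z s)) + w t)"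
   then have ze: "z : extensional {0..1}" "continuous_on {0..1} z" by (auto simp: mspace_C01)
   have zx: "ALL t:{0..1}. z t = x t" using u[rule_format, of z] z ze(2) by blast
   show "z = y" by (rule extensionalityI[OF ze(1)]) (use zx in \<open>auto simp: y_def\<close>)
  qed
 qed
 then show ?thesis using Ns N0 unfolding se by blast
qed

end
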